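(* Let $A$ be a unital $C^*$-algebra, $\Gamma$ a discrete group, and $\alpha:\Gamma\to\mathrm{Aut}(A)$ a group homomorphism. The following are equivalent: (1) the set $S_\Gamma(A)$ of $\Gamma$-invariant states on $A$ is nonempty; (2) the canonical homomorphism $C^*(\Gamma)\to A\rtimes\Gamma$ is an embedding (i.e. injective); (3) there exists a representation $\pi:A\rtimes\Gamma\to B(H)$ such that $H_\Gamma\neq0$, or equivalently, there exists a covariant representation $(\pi,U,H)$ of $(A,\Gamma,\alpha)$ such that $U$ contains the trivial representation of $\Gamma$.
   Context: $A\rtimes\Gamma$ is the full crossed product $C^*$-algebra of $(A,\Gamma,\alpha)$: the universal $C^*$-completion of the $*$-algebra $C_c(\Gamma,A)$ of finite sums $\sum_{s} a_su_s$ ($a_s\in A$), where the $u_s$ ($s\in\Gamma$) are unitaries with $u_su_t=u_{st}$ and $u_sau_s^*=\alpha_s(a)$. $C^*(\Gamma)$ is the full group $C^*$-algebra; the canonical homomorphism $C^*(\Gamma)\to A\rtimes\Gamma$ sends the unitary of $s\in\Gamma$ to $u_s$. A state $\varphi$ on $A$ is $\Gamma$-invariant if $\varphi(\alpha_s(a))=\varphi(a)$ for all $s\in\Gamma$, $a\in A$. A covariant representation $(\pi,U,H)$ of $(A,\Gamma,\alpha)$ consists of a (unital) representation $\pi$ of $A$ and a unitary representation $U$ of $\Gamma$ on the same Hilbert space $H$ with $\pi(\alpha_s(a))=U_s\pi(a)U_s^*$ for all $a\in A$, $s\in\Gamma$; these correspond one-to-one to (unital) representations of $A\rtimes\Gamma$.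 For a representation $\pi:A\rtimes\Gamma\to B(H)$, $H_\Gamma=\{x\in H:\pi(u_s)x=x\text{ for all }s\in\Gamma\}$. *)

theory Defs
  imports Complex_Main "HOL-Algebra.Module" "HOL-Algebra.Bij"
begin

section \<open>Unital *-algebras and C*-algebras\<close>

definition complex_ring :: "complex ring" where
  "complex_ring = \<lparr>carrier = UNIV, mult = (*), one = 1, zero = 0, add = (+)\<rparr>"

record 'a star_alg = "(complex, 'a) module" +
  star :: "'a \<Rightarrow> 'a"

record 'a cstar_alg = "'a star_alg" +
  cnorm :: "'a \<Rightarrow> real"

locale unital_star_algebra = Module.module complex_ring A + ring A
  for A :: "('a, 'm) star_alg_scheme" (structure) +
  assumes smult_mult_left:
      "\<lbrakk>x \<in> carrier A; y \<in> carrier A\<rbrakk> \<Longrightarrow> (c \<odot>\<^bsub>A\<^esub> x) \<otimes> y = c \<odot>\<^bsub>A\<^esub> (x \<otimes> y)"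
    and smult_mult_right:
      "\<lbrakk>x \<in> carrier A; y \<in> carrier A\<rbrakk> \<Longrightarrow> x \<otimes> (c \<odot>\<^bsub>A\<^esub> y) = c \<odot>\<^bsub>A\<^esub> (x \<otimes> y)"
    and star_closed: "x \<in> carrier A \<Longrightarrow> star A x \<in> carrier A"
    and star_star: "x \<in> carrier A \<Longrightarrow> star A (star A x) = x"
    and star_add:
      "\<lbrakk>x \<in> carrier A; y \<in> carrier A\<rbrakk> \<Longrightarrow> star A (x \<oplus> y) = star A x \<oplus> star A y"
    and star_smult:
      "x \<in> carrier A \<Longrightarrow> star A (c \<odot>\<^bsub>A\<^esub> x) = cnj c \<odot>\<^bsub>A\<^esub> star A x"
    and star_mult:
      "\<lbrakk>x \<in> carrier A; y \<in> carrier A\<rbrakk> \<Longrightarrow> star A (x \<otimes> y) = star A y \<otimes> star A x"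

definition cstar_seminorm :: "('a, 'm) star_alg_scheme \<Rightarrow> ('a \<Rightarrow> real) \<Rightarrow> bool" where
  "cstar_seminorm A p \<longleftrightarrow>
     (\<forall>x\<in>carrier A. 0 \<le> p x) \<and>
     (\<forall>x\<in>carrier A. \<forall>y\<in>carrier A. p (x \<oplus>\<^bsub>A\<^esub> y) \<le> p x + p y) \<and>
     (\<forall>c. \<forall>x\<in>carrier A. p (c \<odot>\<^bsub>A\<^esub> x) = cmod c * p x) \<and>
     (\<forall>x\<in>carrier A. \<forall>y\<in>carrier A. p (x \<otimes>\<^bsub>A\<^esub> y) \<le> p x * p y) \<and>
     (\<forall>x\<in>carrier A. p (star A x \<otimes>\<^bsub>A\<^esub> x) = (p x)\<^sup>2)"

definition cauchy_seqs :: "('a, 'm) ring_scheme \<Rightarrow> ('a \<Rightarrow> real) \<Rightarrow> (nat \<Rightarrow> 'a) set" where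
  "cauchy_seqs M p = {X. (\<forall>n. X n \<in> carrier M) \<and>
     (\<forall>e>0. \<exists>N. \<forall>m\<ge>N. \<forall>n\<ge>N. p (X m \<ominus>\<^bsub>M\<^esub> X n) < e)}"

definition seq_complete :: "('a, 'm) ring_scheme \<Rightarrow> ('a \<Rightarrow> real) \<Rightarrow> bool" where
  "seq_complete M p \<longleftrightarrow>
     (\<forall>X\<in>cauchy_seqs M p. \<exists>x\<in>carrier M. (\<lambda>n. p (X n \<ominus>\<^bsub>M\<^esub> x)) \<longlonglongrightarrow> 0)"

text \<open>The zero algebra, in which \<open>\<one> = \<zero>\<close>, is admitted as a unital C*-algebra.\<close>

locale unital_cstar_algebra = unital_star_algebra A
  for A :: "('a, 'm) cstar_alg_scheme" (structure) +
  assumes cnorm_cstar: "cstar_seminorm A (cnorm A)"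
    and cnorm_definite: "\<lbrakk>x \<in> carrier A; cnorm A x = 0\<rbrakk> \<Longrightarrow> x = \<zero>"
    and cnorm_complete: "seq_complete A (cnorm A)"

text \<open>Membership in \<^const>\<open>ring_hom\<close> includes preservation of the unit.\<close>

definition unital_alg_hom ::
    "(complex, 'a, 'm) module_scheme \<Rightarrow> (complex, 'b, 'n) module_scheme \<Rightarrow> ('a \<Rightarrow> 'b) set" where
  "unital_alg_hom A B =
     {h \<in> ring_hom A B. \<forall>c. \<forall>x\<in>carrier A. h (c \<odot>\<^bsub>A\<^esub> x) = c \<odot>\<^bsub>B\<^esub> h x}"

definition unital_star_hom ::
    "('a, 'm) star_alg_scheme \<Rightarrow> ('b, 'n) star_alg_scheme \<Rightarrow> ('a \<Rightarrow> 'b) set" where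
  "unital_star_hom A B =
     {h \<in> unital_alg_hom A B. \<forall>x\<in>carrier A. h (star A x) = star B (h x)}"

text \<open>The group \<open>Aut(A)\<close> of *-automorphisms under composition.\<close>

definition star_aut_group :: "('a, 'm) star_alg_scheme \<Rightarrow> ('a \<Rightarrow> 'a) monoid" where
  "star_aut_group A =
     BijGroup (carrier A) \<lparr>carrier := Bij (carrier A) \<inter> unital_star_hom A A\<rparr>"

section \<open>The universal C*-completion of a *-algebra\<close>

text \<open>
  A C*-seminorm on a *-algebra \<open>B\<close> is the same thing as the pullback of the norm along a
  *-homomorphism from \<open>B\<close> to a C*-algebra, so the largest one is the norm of the universal
  C*-completion. The supremum is finite for the algebras \<open>C_c(\<Gamma>, A)\<close> and \<open>\<complex>[\<Gamma>]\<close> below, since there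
  every C*-seminorm is bounded by the \<open>\<ell>\<^sup>1\<close>-norm; for other *-algebras it may be a junk value.
\<close>

definition univ_norm :: "('b, 'm) star_alg_scheme \<Rightarrow> 'b \<Rightarrow> real" where
  "univ_norm B x = (SUP p\<in>Collect (cstar_seminorm B). p x)"

definition completion_rel :: "('b, 'm) star_alg_scheme \<Rightarrow> ((nat \<Rightarrow> 'b) \<times> (nat \<Rightarrow> 'b)) set" where
  "completion_rel B =
     {(X, Y). X \<in> cauchy_seqs B (univ_norm B) \<and> Y \<in> cauchy_seqs B (univ_norm B) \<and>
              (\<lambda>n. univ_norm B (X n \<ominus>\<^bsub>B\<^esub> Y n)) \<longlonglongrightarrow> 0}"

definition completion_class :: "('b, 'm) star_alg_scheme \<Rightarrow> (nat \<Rightarrow> 'b) \<Rightarrow> (nat \<Rightarrow> 'b) set" where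
  "completion_class B X = completion_rel B `` {X}"

text \<open>
  The elements are classes of Cauchy sequences. As usual for quotients, the union over all
  representatives picks out the common class of the results.
\<close>

definition univ_completion :: "('b, 'm) star_alg_scheme \<Rightarrow> (nat \<Rightarrow> 'b) set cstar_alg" where
  "univ_completion B =
     \<lparr>carrier = cauchy_seqs B (univ_norm B) // completion_rel B,
      mult = (\<lambda>P Q. \<Union>X\<in>P. \<Union>Y\<in>Q. completion_class B (\<lambda>n. X n \<otimes>\<^bsub>B\<^esub> Y n)),
      one = completion_class B (\<lambda>n. \<one>\<^bsub>B\<^esub>),
      zero = completion_class B (\<lambda>n. \<zero>\<^bsub>B\<^esub>),
      add = (\<lambda>P Q. \<Union>X\<in>P. \<Union>Y\<in>Q. completion_class B (\<lambda>n. X n \<oplus>\<^bsub>B\<^esub> Y n)),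
      smult = (\<lambda>c P. \<Union>X\<in>P. completion_class B (\<lambda>n. c \<odot>\<^bsub>B\<^esub> X n)),
      star = (\<lambda>P. \<Union>X\<in>P. completion_class B (\<lambda>n. star B (X n))),
      cnorm = (\<lambda>P. lim (\<lambda>n. univ_norm B ((SOME X. X \<in> P) n)))\<rparr>"

definition completion_embed :: "('b, 'm) star_alg_scheme \<Rightarrow> 'b \<Rightarrow> (nat \<Rightarrow> 'b) set" where
  "completion_embed B x = completion_class B (\<lambda>n. x)"

section \<open>Group C*-algebra and crossed product\<close>

text \<open>
  Finite sums \<open>\<Sum>\<^sub>s a\<^sub>s u\<^sub>s\<close> are encoded as their coefficient functions \<open>s \<mapsto> a\<^sub>s\<close>, set to zero off the
  carrier of the group. The product and the involution are forced by \<open>u\<^sub>s a = \<alpha>\<^sub>s(a) u\<^sub>s\<close>,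
  \<open>u\<^sub>s u\<^sub>t = u\<^sub>s\<^sub>t\<close> and \<open>u\<^sub>s\<close> being unitary.
\<close>

definition cc_alg ::
    "('a, 'm) star_alg_scheme \<Rightarrow> ('g, 'n) monoid_scheme \<Rightarrow> ('g \<Rightarrow> 'a \<Rightarrow> 'a) \<Rightarrow> ('g \<Rightarrow> 'a) star_alg"
  where
  "cc_alg A G \<alpha> =
     \<lparr>carrier = {f. range f \<subseteq> carrier A \<and> finite {s. f s \<noteq> \<zero>\<^bsub>A\<^esub>} \<and> {s. f s \<noteq> \<zero>\<^bsub>A\<^esub>} \<subseteq> carrier G},
      mult = (\<lambda>f g t. if t \<in> carrier G
                then \<Oplus>\<^bsub>A\<^esub>s\<in>{s. f s \<noteq> \<zero>\<^bsub>A\<^esub>}. f s \<otimes>\<^bsub>A\<^esub> \<alpha> s (g (inv\<^bsub>G\<^esub> s \<otimes>\<^bsub>G\<^esub> t)) else \<zero>\<^bsub>A\<^esub>),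
      one = (\<lambda>t. if t = \<one>\<^bsub>G\<^esub> then \<one>\<^bsub>A\<^esub> else \<zero>\<^bsub>A\<^esub>),
      zero = (\<lambda>t. \<zero>\<^bsub>A\<^esub>),
      add = (\<lambda>f g t. f t \<oplus>\<^bsub>A\<^esub> g t),
      smult = (\<lambda>c f t. c \<odot>\<^bsub>A\<^esub> f t),
      star = (\<lambda>f t. if t \<in> carrier G then \<alpha> t (star A (f (inv\<^bsub>G\<^esub> t))) else \<zero>\<^bsub>A\<^esub>)\<rparr>"

definition crossed_product ::
    "('a, 'm) star_alg_scheme \<Rightarrow> ('g, 'n) monoid_scheme \<Rightarrow> ('g \<Rightarrow> 'a \<Rightarrow> 'a) \<Rightarrow>
     (nat \<Rightarrow> 'g \<Rightarrow> 'a) set cstar_alg" where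
  "crossed_product A G \<alpha> = univ_completion (cc_alg A G \<alpha>)"

definition crossed_unitary ::
    "('a, 'm) star_alg_scheme \<Rightarrow> ('g, 'n) monoid_scheme \<Rightarrow> ('g \<Rightarrow> 'a \<Rightarrow> 'a) \<Rightarrow> 'g \<Rightarrow>
     (nat \<Rightarrow> 'g \<Rightarrow> 'a) set" where
  "crossed_unitary A G \<alpha> s =
     completion_embed (cc_alg A G \<alpha>) (\<lambda>t. if t = s then \<one>\<^bsub>A\<^esub> else \<zero>\<^bsub>A\<^esub>)"

definition group_alg :: "('g, 'n) monoid_scheme \<Rightarrow> ('g \<Rightarrow> complex) star_alg" where
  "group_alg G =
     \<lparr>carrier = {f. finite {s. f s \<noteq> 0} \<and> {s. f s \<noteq> 0} \<subseteq> carrier G},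
      mult = (\<lambda>f g t. if t \<in> carrier G
                then \<Sum>s | f s \<noteq> 0. f s * g (inv\<^bsub>G\<^esub> s \<otimes>\<^bsub>G\<^esub> t) else 0),
      one = (\<lambda>t. if t = \<one>\<^bsub>G\<^esub> then 1 else 0),
      zero = (\<lambda>t. 0),
      add = (\<lambda>f g t. f t + g t),
      smult = (\<lambda>c f t. c * f t),
      star = (\<lambda>f t. if t \<in> carrier G then cnj (f (inv\<^bsub>G\<^esub> t)) else 0)\<rparr>"

definition group_cstar :: "('g, 'n) monoid_scheme \<Rightarrow> (nat \<Rightarrow> 'g \<Rightarrow> complex) set cstar_alg" where
  "group_cstar G = univ_completion (group_alg G)"

definition group_unitary :: "('g, 'n) monoid_scheme \<Rightarrow> 'g \<Rightarrow> (nat \<Rightarrow> 'g \<Rightarrow> complex) set" where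
  "group_unitary G s = completion_embed (group_alg G) (\<lambda>t. if t = s then 1 else 0)"

text \<open>
  The canonical map is the extension by continuity of
  \<open>\<Sum>\<^sub>s c\<^sub>s u\<^sub>s \<mapsto> \<Sum>\<^sub>s (c\<^sub>s \<one>) u\<^sub>s\<close>, taken termwise on Cauchy sequences.
\<close>

definition canonical_hom ::
    "('a, 'm) star_alg_scheme \<Rightarrow> ('g, 'n) monoid_scheme \<Rightarrow> ('g \<Rightarrow> 'a \<Rightarrow> 'a) \<Rightarrow>
     (nat \<Rightarrow> 'g \<Rightarrow> complex) set \<Rightarrow> (nat \<Rightarrow> 'g \<Rightarrow> 'a) set" where
  "canonical_hom A G \<alpha> P =
     (\<Union>X\<in>P. completion_class (cc_alg A G \<alpha>) (\<lambda>n t. X n t \<odot>\<^bsub>A\<^esub> \<one>\<^bsub>A\<^esub>))"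

section \<open>Invariant states\<close>

definition states :: "('a, 'm) cstar_alg_scheme \<Rightarrow> ('a \<Rightarrow> complex) set" where
  "states A = {\<phi> \<in> extensional (carrier A).
     (\<forall>x\<in>carrier A. \<forall>y\<in>carrier A. \<phi> (x \<oplus>\<^bsub>A\<^esub> y) = \<phi> x + \<phi> y) \<and>
     (\<forall>c. \<forall>x\<in>carrier A. \<phi> (c \<odot>\<^bsub>A\<^esub> x) = c * \<phi> x) \<and>
     (\<forall>x\<in>carrier A. Im (\<phi> (star A x \<otimes>\<^bsub>A\<^esub> x)) = 0 \<and> 0 \<le> Re (\<phi> (star A x \<otimes>\<^bsub>A\<^esub> x))) \<and>
     \<phi> \<one>\<^bsub>A\<^esub> = 1}"

definition invariant_states ::
    "('a, 'm) cstar_alg_scheme \<Rightarrow> ('g, 'n) monoid_scheme \<Rightarrow> ('g \<Rightarrow> 'a \<Rightarrow> 'a) \<Rightarrow>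
     ('a \<Rightarrow> complex) set" where
  "invariant_states A G \<alpha> =
     {\<phi> \<in> states A. \<forall>s\<in>carrier G. \<forall>a\<in>carrier A. \<phi> (\<alpha> s a) = \<phi> a}"

section \<open>Hilbert spaces and representations\<close>

text \<open>
  Following the convention of \<^theory>\<open>HOL-Algebra.Module\<close>, the fields \<^const>\<open>mult\<close> and \<^const>\<open>one\<close>
  inherited from rings play no role in a vector space. The inner product is linear in the
  first argument.
\<close>

record 'h inner_space = "(complex, 'h) module" +
  cinner :: "'h \<Rightarrow> 'h \<Rightarrow> complex"

definition hnorm :: "('h, 'm) inner_space_scheme \<Rightarrow> 'h \<Rightarrow> real" where
  "hnorm H x = sqrt (Re (cinner H x x))"

locale complex_hilbert_space = Module.module complex_ring H
  for H :: "('h, 'm) inner_space_scheme" (structure) +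
  assumes cinner_add_left:
      "\<lbrakk>x \<in> carrier H; y \<in> carrier H; z \<in> carrier H\<rbrakk> \<Longrightarrow>
       cinner H (x \<oplus> y) z = cinner H x z + cinner H y z"
    and cinner_smult_left:
      "\<lbrakk>x \<in> carrier H; y \<in> carrier H\<rbrakk> \<Longrightarrow> cinner H (c \<odot>\<^bsub>H\<^esub> x) y = c * cinner H x y"
    and cinner_commute:
      "\<lbrakk>x \<in> carrier H; y \<in> carrier H\<rbrakk> \<Longrightarrow> cinner H y x = cnj (cinner H x y)"
    and cinner_nonneg: "x \<in> carrier H \<Longrightarrow> 0 \<le> Re (cinner H x x)"
    and cinner_definite: "\<lbrakk>x \<in> carrier H; cinner H x x = 0\<rbrakk> \<Longrightarrow> x = \<zero>"
    and hilbert_complete: "seq_complete H (hnorm H)"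

definition linear_maps ::
    "('h, 'm) inner_space_scheme \<Rightarrow> ('k, 'n) inner_space_scheme \<Rightarrow> ('h \<Rightarrow> 'k) set" where
  "linear_maps H K = {T \<in> carrier H \<rightarrow>\<^sub>E carrier K.
     (\<forall>x\<in>carrier H. \<forall>y\<in>carrier H. T (x \<oplus>\<^bsub>H\<^esub> y) = T x \<oplus>\<^bsub>K\<^esub> T y) \<and>
     (\<forall>c. \<forall>x\<in>carrier H. T (c \<odot>\<^bsub>H\<^esub> x) = c \<odot>\<^bsub>K\<^esub> T x)}"

definition isometries ::
    "('h, 'm) inner_space_scheme \<Rightarrow> ('k, 'n) inner_space_scheme \<Rightarrow> ('h \<Rightarrow> 'k) set" where
  "isometries H K = {T \<in> linear_maps H K.
     \<forall>x\<in>carrier H. \<forall>y\<in>carrier H. cinner K (T x) (T y) = cinner H x y}"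

definition bounded_operators :: "('h, 'm) inner_space_scheme \<Rightarrow> (complex, 'h \<Rightarrow> 'h) module" where
  "bounded_operators H =
     \<lparr>carrier = {T \<in> linear_maps H H. \<exists>C. \<forall>x\<in>carrier H. hnorm H (T x) \<le> C * hnorm H x},
      mult = compose (carrier H),
      one = (\<lambda>x\<in>carrier H. x),
      zero = (\<lambda>x\<in>carrier H. \<zero>\<^bsub>H\<^esub>),
      add = (\<lambda>S T. \<lambda>x\<in>carrier H. S x \<oplus>\<^bsub>H\<^esub> T x),
      smult = (\<lambda>c T. \<lambda>x\<in>carrier H. c \<odot>\<^bsub>H\<^esub> T x)\<rparr>"

definition is_adjoint ::
    "('h, 'm) inner_space_scheme \<Rightarrow> ('h \<Rightarrow> 'h) \<Rightarrow> ('h \<Rightarrow> 'h) \<Rightarrow> bool" where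
  "is_adjoint H T S \<longleftrightarrow>
     (\<forall>x\<in>carrier H. \<forall>y\<in>carrier H. cinner H (T x) y = cinner H x (S y))"

text \<open>
  Unital *-homomorphisms to \<open>B(H)\<close>; adjoints of bounded operators are unique, so the last
  condition says \<open>\<pi>(a\<^sup>*) = \<pi>(a)\<^sup>*\<close>.
\<close>

definition representations ::
    "('a, 'm) star_alg_scheme \<Rightarrow> ('h, 'n) inner_space_scheme \<Rightarrow> ('a \<Rightarrow> 'h \<Rightarrow> 'h) set" where
  "representations A H = {\<pi> \<in> unital_alg_hom A (bounded_operators H).
     \<forall>a\<in>carrier A. is_adjoint H (\<pi> a) (\<pi> (star A a))}"

definition unitary_group :: "('h, 'm) inner_space_scheme \<Rightarrow> ('h \<Rightarrow> 'h) monoid" where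
  "unitary_group H = BijGroup (carrier H) \<lparr>carrier := Bij (carrier H) \<inter> isometries H H\<rparr>"

text \<open>The adjoint of a unitary operator is its inverse in the unitary group.\<close>

definition covariant_representation ::
    "('a, 'm) star_alg_scheme \<Rightarrow> ('g, 'n) monoid_scheme \<Rightarrow> ('g \<Rightarrow> 'a \<Rightarrow> 'a) \<Rightarrow>
     ('h, 'k) inner_space_scheme \<Rightarrow> ('a \<Rightarrow> 'h \<Rightarrow> 'h) \<Rightarrow> ('g \<Rightarrow> 'h \<Rightarrow> 'h) \<Rightarrow> bool" where
  "covariant_representation A G \<alpha> H \<pi> U \<longleftrightarrow>
     complex_hilbert_space H \<and> \<pi> \<in> representations A H \<and> U \<in> hom G (unitary_group H) \<and>
     (\<forall>s\<in>carrier G. \<forall>a\<in>carrier A.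
        \<pi> (\<alpha> s a) = U s \<otimes>\<^bsub>bounded_operators H\<^esub> \<pi> a \<otimes>\<^bsub>bounded_operators H\<^esub> inv\<^bsub>unitary_group H\<^esub> (U s))"

text \<open>A unitary representation \<open>V\<close> is contained in \<open>U\<close> if it is unitarily equivalent to a
  subrepresentation, that is, if some isometry intertwines \<open>V\<close> with \<open>U\<close>.\<close>

definition contains_rep ::
    "('g, 'n) monoid_scheme \<Rightarrow> ('h, 'm) inner_space_scheme \<Rightarrow> ('g \<Rightarrow> 'h \<Rightarrow> 'h) \<Rightarrow>
     ('k, 'l) inner_space_scheme \<Rightarrow> ('g \<Rightarrow> 'k \<Rightarrow> 'k) \<Rightarrow> bool" where
  "contains_rep G H U K V \<longleftrightarrow>
     (\<exists>W\<in>isometries K H. \<forall>s\<in>carrier G. \<forall>x\<in>carrier K. W (V s x) = U s (W x))"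

definition complex_line :: "complex inner_space" where
  "complex_line = \<lparr>carrier = UNIV, mult = (*), one = 1, zero = 0, add = (+), smult = (*),
     cinner = (\<lambda>x y. x * cnj y)\<rparr>"

definition trivial_rep :: "'g \<Rightarrow> complex \<Rightarrow> complex" where
  "trivial_rep s z = z"

text \<open>The subspace \<open>H\<^sub>\<Gamma>\<close> for a representation \<open>\<pi>\<close> of the crossed product on \<open>H\<close>.\<close>

definition fixed_vectors ::
    "('a, 'm) star_alg_scheme \<Rightarrow> ('g, 'n) monoid_scheme \<Rightarrow> ('g \<Rightarrow> 'a \<Rightarrow> 'a) \<Rightarrow>
     ('h, 'k) inner_space_scheme \<Rightarrow> ((nat \<Rightarrow> 'g \<Rightarrow> 'a) set \<Rightarrow> 'h \<Rightarrow> 'h) \<Rightarrow> 'h set" where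
  "fixed_vectors A G \<alpha> H \<pi> =
     {x \<in> carrier H. \<forall>s\<in>carrier G. \<pi> (crossed_unitary A G \<alpha> s) x = x}"

text \<open>
  A formula cannot quantify over types, so existence of a Hilbert space is stated relative to the
  type \<open>'h\<close> of its vectors, which is passed as a parameter. The type \<open>(nat \<Rightarrow> 'g \<Rightarrow> 'a) set\<close>
  underlying the crossed product is large enough for every \<open>'h\<close>: a vector of a cyclic representation
  is a limit of a sequence in the orbit of \<open>C_c(\<Gamma>, A)\<close>, so cyclic Hilbert spaces have copies there.
\<close>

definition has_rep_fixing_vector ::
    "'h itself \<Rightarrow> ('a, 'm) star_alg_scheme \<Rightarrow> ('g, 'n) monoid_scheme \<Rightarrow> ('g \<Rightarrow> 'a \<Rightarrow> 'a) \<Rightarrow> bool"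
  where
  "has_rep_fixing_vector T A G \<alpha> \<longleftrightarrow>
     (\<exists>(H :: 'h inner_space) \<pi>. complex_hilbert_space H \<and>
        \<pi> \<in> representations (crossed_product A G \<alpha>) H \<and>
        fixed_vectors A G \<alpha> H \<pi> \<noteq> {\<zero>\<^bsub>H\<^esub>})"

definition has_covariant_rep_containing_trivial ::
    "'h itself \<Rightarrow> ('a, 'm) star_alg_scheme \<Rightarrow> ('g, 'n) monoid_scheme \<Rightarrow> ('g \<Rightarrow> 'a \<Rightarrow> 'a) \<Rightarrow> bool"
  where
  "has_covariant_rep_containing_trivial T A G \<alpha> \<longleftrightarrow>
     (\<exists>(H :: 'h inner_space) \<pi> U. covariant_representation A G \<alpha> H \<pi> U \<and>
        contains_rep G H U complex_line trivial_rep)"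

end

theory Submission
  imports "HOL-Analysis.Weierstrass_Theorems" "HOL-Computational_Algebra.Polynomial" Defs
begin

text \<open>
  An invariant state \<open>\<phi>\<close> on \<open>A\<close> and a positive functional \<open>\<psi>\<close> on \<open>\<complex>[\<Gamma>]\<close> combine to the positive
  functional \<open>\<Sum>\<^sub>s a\<^sub>s u\<^sub>s \<mapsto> \<Sum>\<^sub>s \<phi>(a\<^sub>s) \<psi>(u\<^sub>s)\<close> on \<open>C_c(\<Gamma>, A)\<close>, by the Schur product theorem. With the trivial
  character as \<open>\<psi>\<close>, its GNS representation fixes the cyclic vector; with \<open>\<psi>\<close> norming a given element of
  \<open>\<complex>[\<Gamma>]\<close>, its GNS seminorm shows that the universal norm of \<open>\<complex>[\<Gamma>]\<close> is the restriction of that of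
  \<open>C_c(\<Gamma>, A)\<close>. A fixed unit vector of a covariant representation defines an invariant state.
  If the canonical homomorphism is injective, functional calculus shows that the trivial character is
  bounded by the norm of the crossed product, and a Hahn-Banach extension of it has all \<open>u\<^sub>s\<close> in its
  multiplicative domain, so that it restricts to an invariant state on \<open>A\<close>.

  The spectral theory is carried out in incomplete algebras, directly for a C*-seminorm \<open>p\<close>: the
  spectrum of a selfadjoint \<open>h\<close> is the set of points at which evaluation of real polynomials is
  bounded by \<open>P \<mapsto> p(P(h))\<close>.
\<close>

text \<open>The universal completion is never shown to be a C*-algebra, so no functional calculus is
  available in it: its norm is a supremum of seminorms on finitely supported functions. Estimates
  are therefore made for polynomials under one seminorm at a time, and elements of the completion
  appear only as Cauchy sequences. To bound a seminorm of P by the supremum of |P| on an interval, a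
  crude bound suffices whose loss grows only linearly with the degree, since applying it to P^(2^k)
  makes the loss disappear; Chebyshev coefficients supply such a bound.

  Completeness of A enters through one fact: if h is selfadjoint of norm at most 1/2, then 1 - h^2
  has a selfadjoint square root w in A commuting with h. The identity h^2 + w^2 = 1 bounds every
  C*-seminorm on A, which makes the supremum defining the universal norm finite, and it bounds left
  multiplication in every GNS space.

  The norms of the group algebra and of \<open>C_c(\<Gamma>, A)\<close> are compared one C*-seminorm
  of the group algebra at a time, each being attained by a positive functional.\<close>

section \<open>Seminorms on real polynomials\<close>

fun cheb :: "nat \<Rightarrow> real poly \<times> real poly" where
  "cheb 0 = (1, 0)"
| "cheb (Suc n) = (let (C, S) = cheb n
     in ([:0, 1:] * C - [:1, 0, -1:] * S, [:0, 1:] * S + C))"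

text \<open>These are the Chebyshev polynomials of the first and second kind, T_n and U_(n-1). With
  X = cos \<theta> the recursion is the addition theorem for cos n\<theta> and sin n\<theta> / sin
  \<theta>, where \<open>[:1, 0, -1:]\<close> = 1 - X^2 stands for the square of the sine.\<close>

definition chebC :: "nat \<Rightarrow> real poly" where "chebC n = fst (cheb n)"
definition chebS :: "nat \<Rightarrow> real poly" where "chebS n = snd (cheb n)"

lemma cheb_simps [simp]:
  "chebC 0 = 1" "chebS 0 = 0"
  "chebC (Suc n) = [:0, 1:] * chebC n - [:1, 0, -1:] * chebS n"
  "chebS (Suc n) = [:0, 1:] * chebS n + chebC n"
  by (simp_all add: chebC_def chebS_def Let_def case_prod_unfold)

text \<open>Being an identity of polynomials, it can be used under any seminorm;
  \<open>chebC_bound\<close> draws from it what |cos| \<le> 1 gives for functions.\<close>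

lemma cheb_pythagoras: "(chebC n)\<^sup>2 + [:1, 0, -1:] * (chebS n)\<^sup>2 = 1"
proof (induction n)
  case (Suc n)
  have v: "[:1, 0, -1:] = 1 - [:0, 1 :: real:]\<^sup>2"
    by (simp add: power2_eq_square one_pCons)
  have "(chebC (Suc n))\<^sup>2 + [:1, 0, -1:] * (chebS (Suc n))\<^sup>2
      = (chebC n)\<^sup>2 + [:1, 0, -1:] * (chebS n)\<^sup>2"
    unfolding cheb_simps v by Groebner_Basis.algebra
  then show ?case using Suc by simp
qed simp

lemma poly_cheb_cos:
  "poly (chebC n) (cos \<theta>) = cos (real n * \<theta>) \<and> poly (chebS n) (cos \<theta>) * sin \<theta> = sin (real n * \<theta>)"
proof (induction n)
  case (Suc n)
  have s: "1 - (cos \<theta>)\<^sup>2 = (sin \<theta>)\<^sup>2" by (simp add: sin_squared_eq)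
  have e: "real (Suc n) * \<theta> = real n * \<theta> + \<theta>" by (simp add: algebra_simps)
  have "poly (chebC (Suc n)) (cos \<theta>)
      = cos \<theta> * poly (chebC n) (cos \<theta>) - (1 - (cos \<theta>)\<^sup>2) * poly (chebS n) (cos \<theta>)"
    by (simp add: power2_eq_square algebra_simps)
  also have "\<dots> = cos \<theta> * cos (real n * \<theta>) - sin \<theta> * sin (real n * \<theta>)"
  proof -
    have "(1 - (cos \<theta>)\<^sup>2) * poly (chebS n) (cos \<theta>) = sin \<theta> * (poly (chebS n) (cos \<theta>) * sin \<theta>)"
      unfolding s by (simp only: power2_eq_square mult_ac)
    then show ?thesis using Suc by simp
  qed
  finally have 1: "poly (chebC (Suc n)) (cos \<theta>) = cos (real (Suc n) * \<theta>)"
    unfolding e cos_add by (simp add: mult.commute)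
  have "poly (chebS (Suc n)) (cos \<theta>) * sin \<theta>
      = cos \<theta> * (poly (chebS n) (cos \<theta>) * sin \<theta>) + poly (chebC n) (cos \<theta>) * sin \<theta>"
    by (simp add: algebra_simps)
  also have "\<dots> = cos \<theta> * sin (real n * \<theta>) + cos (real n * \<theta>) * sin \<theta>" using Suc by simp
  finally have "poly (chebS (Suc n)) (cos \<theta>) * sin \<theta> = sin (real (Suc n) * \<theta>)"
    unfolding e sin_add by (simp add: mult.commute)
  with 1 show ?case by simp
qed simp

text \<open>The three-term recurrence, in the form which shows that multiplication by X maps the
  span of the first Chebyshev polynomials into the next one.\<close>

lemma X_times_chebC:
  "[:0, 1:] * chebC (Suc n) = Polynomial.smult (1/2) (chebC (Suc (Suc n)) + chebC n)"
proof -
  have v: "[:1, 0, -1:] = 1 - [:0, 1 :: real:]\<^sup>2"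
    by (simp add: power2_eq_square one_pCons)
  have "chebC (Suc (Suc n)) + chebC n = [:0, 1:] * chebC (Suc n) + [:0, 1:] * chebC (Suc n)"
    unfolding cheb_simps v by Groebner_Basis.algebra
  also have "\<dots> = Polynomial.smult 2 ([:0, 1:] * chebC (Suc n))" by (simp only: one_add_one[symmetric] smult_add_left smult_1_left)
  finally show ?thesis by simp
qed

definition cheb_span :: "nat \<Rightarrow> real poly set" where
  "cheb_span n = range (\<lambda>c. \<Sum>k\<le>n. Polynomial.smult (c k) (chebC k))"

lemma cheb_span_add: "p \<in> cheb_span n \<Longrightarrow> r \<in> cheb_span n \<Longrightarrow> p + r \<in> cheb_span n"
  unfolding cheb_span_def
proof (elim rangeE)
  fix c d assume "p = (\<Sum>k\<le>n. Polynomial.smult (c k) (chebC k))" "r = (\<Sum>k\<le>n. Polynomial.smult (d k) (chebC k))"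
  then have "p + r = (\<Sum>k\<le>n. Polynomial.smult (c k + d k) (chebC k))"
    by (simp only: smult_add_left sum.distrib)
  then show "p + r \<in> range (\<lambda>c. \<Sum>k\<le>n. Polynomial.smult (c k) (chebC k))"
    by (rule range_eqI[of _ _ "\<lambda>k. c k + d k"])
qed

lemma smult_sum_right: "Polynomial.smult a (sum f A) = (\<Sum>i\<in>A. Polynomial.smult a (f i))"
  by (induction A rule: infinite_finite_induct) (auto simp: smult_add_right)

lemma cheb_span_smult: "p \<in> cheb_span n \<Longrightarrow> Polynomial.smult a p \<in> cheb_span n"
  unfolding cheb_span_def
proof (elim rangeE)
  fix c assume "p = (\<Sum>k\<le>n. Polynomial.smult (c k) (chebC k))"
  then have "Polynomial.smult a p = (\<Sum>k\<le>n. Polynomial.smult (a * c k) (chebC k))"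
    by (simp only: smult_sum_right smult_smult)
  then show "Polynomial.smult a p \<in> range (\<lambda>c. \<Sum>k\<le>n. Polynomial.smult (c k) (chebC k))"
    by (rule range_eqI[of _ _ "\<lambda>k. a * c k"])
qed

lemma cheb_span_chebC: "k \<le> n \<Longrightarrow> chebC k \<in> cheb_span n"
proof -
  assume "k \<le> n"
  then have "chebC k = (\<Sum>j\<le>n. if j = k then chebC j else 0)" by simp
  also have "\<dots> = (\<Sum>j\<le>n. Polynomial.smult (if j = k then 1 else 0) (chebC j))"
    by (rule sum.cong) simp_all
  finally show ?thesis unfolding cheb_span_def by (rule range_eqI[of _ _ "\<lambda>j. if j = k then 1 else 0"])
qed

lemma cheb_span_X:
  assumes "p \<in> cheb_span n"
  shows "[:0, 1:] * p \<in> cheb_span (Suc n)"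
proof -
  obtain c where p: "p = (\<Sum>k\<le>n. Polynomial.smult (c k) (chebC k))" using assms by (auto simp: cheb_span_def)
  have X: "[:0, 1:] * chebC k \<in> cheb_span (Suc n)" if "k \<le> n" for k
  proof (cases k)
    case 0
    have "[:0, 1:] * chebC 0 = chebC 1" by simp
    then show ?thesis unfolding 0 by (metis cheb_span_chebC le_add1 plus_1_eq_Suc)
  next
    case (Suc m)
    show ?thesis
      unfolding Suc X_times_chebC using that Suc
      by (intro cheb_span_smult cheb_span_add cheb_span_chebC) auto
  qed
  have "(\<Sum>k\<in>K. Polynomial.smult (c k) ([:0, 1:] * chebC k)) \<in> cheb_span (Suc n)" if "K \<subseteq> {..n}" for K
    using finite_subset[OF that finite_atMost] that
  proof (induction K rule: finite_induct)
    case empty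
    show ?case using cheb_span_smult[OF cheb_span_chebC, of 0 "Suc n" 0] by simp
  next
    case (insert k K)
    then show ?case
      unfolding sum.insert[OF insert(1,2)]
      by (intro cheb_span_add cheb_span_smult X) auto
  qed
  then show ?thesis unfolding p sum_distrib_left mult_smult_right by blast
qed

text \<open>Peeling off the constant coefficient, p = a + X r, reduces the claim to r and one
  multiplication by X. No formula for the coefficients is needed, since
  \<open>cheb_coeff_bound\<close> estimates any of them.\<close>

lemma cheb_expansion: "\<exists>c. p = (\<Sum>k\<le>degree p. Polynomial.smult (c k) (chebC k))"
proof -
  have "p \<in> cheb_span n" if "degree p \<le> n" for n and p :: "real poly"
    using that
  proof (induction n arbitrary: p)
    case 0
    then obtain a where "p = [:a:]" by (metis degree_0_id le_zero_eq)
    then show ?case using cheb_span_smult[OF cheb_span_chebC, of 0 0 a] by simp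
  next
    case (Suc n)
    obtain a r where p: "p = pCons a r" by (metis pCons_cases)
    have "degree r \<le> n" using Suc.prems p by (cases "r = 0") auto
    then have "[:0, 1:] * r \<in> cheb_span (Suc n)" by (intro cheb_span_X Suc.IH)
    moreover have "Polynomial.smult a (chebC 0) \<in> cheb_span (Suc n)"
      by (intro cheb_span_smult cheb_span_chebC) simp
    moreover have "p = Polynomial.smult a (chebC 0) + [:0, 1:] * r" using p by simp
    ultimately show ?case by (simp only: cheb_span_add)
  qed
  then show ?thesis by (auto simp: cheb_span_def)
qed

text \<open>The summands are the real parts of the powers of an N-th root of unity, which differs
  from 1 because 0 < m < N; the geometric sum vanishes.\<close>

lemma sum_cos_roots:
  fixes m N :: nat
  assumes "0 < m" "m < N"
  shows "(\<Sum>l<N. cos (real m * (2 * pi * real l / real N))) = 0"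
proof -
  define z where "z = cis (2 * pi * real m / real N)"
  have zN: "z ^ N = 1"
    using assms cis_multiple_2pi[of "real m"] by (simp add: z_def DeMoivre)
  have z1: "z \<noteq> 1"
  proof
    assume "z = 1"
    then have "cos (2 * pi * real m / real N) = 1" by (simp add: z_def complex_eq_iff)
    then obtain k :: int where "2 * pi * real m / real N = of_int k * 2 * pi"
      by (auto simp: cos_one_2pi_int)
    then have "(2 * pi) * (real m / real N) = (2 * pi) * of_int k" by (simp add: mult_ac)
    then have "real m / real N = of_int k" by (subst (asm) mult_cancel_left) simp
    moreover have "0 < real m / real N" "real m / real N < 1" using assms by simp_all
    ultimately show False by auto
  qed
  have "(\<Sum>l<N. z ^ l) = 0" using z1 zN by (simp add: geometric_sum)
  then have "(\<Sum>l<N. Re (z ^ l)) = 0" by (metis Re_sum zero_complex.simps(1))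
  moreover have "Re (z ^ l) = cos (real m * (2 * pi * real l / real N))" for l
    unfolding z_def DeMoivre by (simp add: mult.commute mult.left_commute)
  ultimately show ?thesis by simp
qed

text \<open>Sampling p at the points cos (2 pi l / N) and pairing with the cosine of frequency k
  isolates c k by discrete orthogonality. It appears with weight N/2, or N if k = 0, whence the
  factor 2.\<close>

lemma cheb_coeff_bound:
  fixes p :: "real poly"
  assumes p: "p = (\<Sum>k\<le>d. Polynomial.smult (c k) (chebC k))"
    and M: "\<And>t. \<bar>t\<bar> \<le> 1 \<Longrightarrow> \<bar>poly p t\<bar> \<le> M" and k: "k \<le> d"
  shows "\<bar>c k\<bar> \<le> 2 * M"
proof -
  \<comment> \<open>Products of the cosines have frequencies up to 2d; these must stay below N in
    order not to be mistaken for frequency 0.\<close>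
  define N where "N = 2 * d + 1"
  define th where "th l = 2 * pi * real l / real N" for l
  have N: "real N > 0" by (simp add: N_def)
  have cosdiff: "(\<Sum>l<N. cos (real j * th l) * cos (real k * th l))
      = (if j = k then (if k = 0 then real N else real N / 2) else 0)" if "j \<le> d" for j
  proof -
    define m where "m = (if j \<le> k then k - j else j - k)"
    have "cos (real j * th l) * cos (real k * th l)
        = (cos (real m * th l) + cos (real (j + k) * th l)) / 2" for l
    proof -
      have "cos (real m * th l) = cos (real j * th l - real k * th l)"
        by (cases "j \<le> k") (auto simp: m_def of_nat_diff left_diff_distrib cos_diff)
      then show ?thesis by (simp add: cos_times_cos distrib_right)
    qed
    then have eq: "(\<Sum>l<N. cos (real j * th l) * cos (real k * th l))
        = ((\<Sum>l<N. cos (real m * th l)) + (\<Sum>l<N. cos (real (j + k) * th l))) / 2"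
      by (simp add: sum.distrib sum_divide_distrib add_divide_distrib)
    have z: "(\<Sum>l<N. cos (real i * th l)) = (if i = 0 then real N else 0)" if "i < N" for i
      using sum_cos_roots[of i N] that by (auto simp: th_def)
    have "m < N" "j + k < N" using k that by (auto simp: m_def N_def)
    then show ?thesis unfolding eq by (auto simp: z m_def simp del: of_nat_add)
  qed
  have "(\<Sum>l<N. poly p (cos (th l)) * cos (real k * th l))
      = (\<Sum>l<N. \<Sum>j\<le>d. c j * (cos (real j * th l) * cos (real k * th l)))"
    unfolding p by (simp add: poly_sum poly_cheb_cos sum_distrib_right mult.assoc)
  also have "\<dots> = (\<Sum>j\<le>d. c j * (\<Sum>l<N. cos (real j * th l) * cos (real k * th l)))"
    by (subst sum.swap) (simp add: sum_distrib_left)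
  also have "\<dots> = (\<Sum>j\<le>d. if j = k then c k * (if k = 0 then real N else real N / 2) else 0)"
    by (intro sum.cong) (auto simp: cosdiff)
  also have "\<dots> = c k * (if k = 0 then real N else real N / 2)" using k by simp
  finally have e: "c k * (if k = 0 then real N else real N / 2)
      = (\<Sum>l<N. poly p (cos (th l)) * cos (real k * th l))" by simp
  have "\<bar>c k\<bar> * (real N / 2) \<le> \<bar>c k * (if k = 0 then real N else real N / 2)\<bar>"
    by (simp add: abs_mult mult_left_mono)
  also have "\<dots> \<le> (\<Sum>l<N. \<bar>poly p (cos (th l)) * cos (real k * th l)\<bar>)"
    unfolding e by (rule sum_abs)
  also have "\<dots> \<le> (\<Sum>l<N. M)"
  proof (rule sum_mono)
    fix l
    have "\<bar>poly p (cos (th l))\<bar> * \<bar>cos (real k * th l)\<bar> \<le> M * 1"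
      by (rule mult_mono) (auto intro!: M abs_cos_le_one order_trans[OF _ M[of 0]])
    then show "\<bar>poly p (cos (th l)) * cos (real k * th l)\<bar> \<le> M" by (simp add: abs_mult)
  qed
  finally have "\<bar>c k\<bar> * (real N / 2) \<le> real N * M" by simp
  then show ?thesis using N by (simp add: field_simps)
qed


section \<open>Polynomial approximation of continuous functions and of a square root\<close>

lemma Weierstrass_poly:
  fixes f :: "real \<Rightarrow> real"
  assumes "continuous_on {a..b} f" "0 < e"
  obtains p where "\<And>x. x \<in> {a..b} \<Longrightarrow> \<bar>f x - poly p x\<bar> < e"
proof -
  obtain g where g: "real_polynomial_function g" "\<And>x. x \<in> {a..b} \<Longrightarrow> \<bar>f x - g x\<bar> < e"
    using Stone_Weierstrass_real_polynomial_function[OF compact_Icc assms] by blast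
  obtain c n where c: "g = (\<lambda>x. \<Sum>i\<le>n. c i * x ^ i)"
    using g(1) unfolding real_polynomial_function_iff_sum by blast
  have "poly (\<Sum>i\<le>n. monom (c i) i) x = g x" for x
    by (simp add: poly_sum poly_monom c)
  with g(2) that show thesis by metis
qed

text \<open>The limit \<open>y\<close> satisfies \<open>2y = X\<^sup>2 + y\<^sup>2\<close>, so \<open>1 - y\<close> is a square root of \<open>1 - X\<^sup>2\<close>.\<close>

fun sqrt_iter :: "nat \<Rightarrow> real poly" where
  "sqrt_iter 0 = 0"
| "sqrt_iter (Suc n) = Polynomial.smult (1/2) ([:0, 1:]\<^sup>2 + (sqrt_iter n)\<^sup>2)"

text \<open>The defect of 1 - \<open>sqrt_iter n\<close> as a square root is, up to sign, twice the
  next increment of the iteration, so it is enough to estimate increments.\<close>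

lemma sqrt_iter_defect:
  "[:1, 0, -1:] - (1 - sqrt_iter n)\<^sup>2 = Polynomial.smult 2 (sqrt_iter n - sqrt_iter (Suc n))"
proof -
  have v: "[:1, 0, -1:] = 1 - [:0, 1 :: real:]\<^sup>2"
    by (simp add: power2_eq_square one_pCons)
  have "Polynomial.smult 2 (sqrt_iter n - sqrt_iter (Suc n))
      = Polynomial.smult 2 (sqrt_iter n) - ([:0, 1:]\<^sup>2 + (sqrt_iter n)\<^sup>2)"
    by (simp only: smult_diff_right sqrt_iter.simps smult_smult) simp
  also have "Polynomial.smult 2 (sqrt_iter n) = sqrt_iter n + sqrt_iter n"
    by (simp only: one_add_one[symmetric] smult_add_left smult_1_left)
  finally show ?thesis unfolding v by Groebner_Basis.algebra
qed

section \<open>Bounding a seminorm by the supremum over an interval\<close>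

text \<open>
  The last axiom is what remains on real polynomials \<open>P\<close>, \<open>Q\<close> of the C*-identity for the
  complex polynomial \<open>P + \<i>Q\<close>. It is needed: on \<open>\<real>[X]\<close> the seminorm \<open>\<bar>P(\<i>)\<bar>\<close> has all the
  other properties and even satisfies \<open>q(P\<^sup>2) = q(P)\<^sup>2\<close>.
\<close>

locale poly_seminorm =
  fixes q :: "real poly \<Rightarrow> real"
  assumes q_nonneg: "0 \<le> q P"
    and q_triangle: "q (P + Q) \<le> q P + q Q"
    and q_smult: "q (Polynomial.smult c P) = \<bar>c\<bar> * q P"
    and q_mult: "q (P * Q) \<le> q P * q Q"
    and q_sumsq: "(q P)\<^sup>2 \<le> q (P\<^sup>2 + Q\<^sup>2)"
begin

lemma q_zero [simp]: "q 0 = 0"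
  using q_smult[of 0 0] by simp

lemma q_minus [simp]: "q (- P) = q P"
  using q_smult[of "-1" P] by simp

lemma q_diff: "q (P - Q) \<le> q P + q Q"
  using q_triangle[of P "- Q"] by simp

lemma q_minus_commute: "q (P - Q) = q (Q - P)"
  using q_minus[of "P - Q"] by simp

lemma q_square: "q (P\<^sup>2) = (q P)\<^sup>2"
  using q_sumsq[of P 0] q_mult[of P P] by (simp add: power2_eq_square)

lemma q_one: "q 1 \<le> 1"
proof -
  have "q 1 = q 1 * q 1" using q_square[of 1] by (simp add: power2_eq_square)
  then show ?thesis by (cases "q 1 = 0") auto
qed

lemma q_sum: "q (sum f A) \<le> (\<Sum>i\<in>A. q (f i))"
  by (induction A rule: infinite_finite_induct) (auto intro: order_trans[OF q_triangle])

lemma q_power: "q (P ^ n) \<le> q P ^ n"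
proof (induction n)
  case (Suc n)
  then show ?case
    by (auto intro!: order_trans[OF q_mult] mult_left_mono simp: q_nonneg)
qed (simp add: q_one)

text \<open>Repeated squaring gives equality, whereas \<open>q_power\<close> is only an inequality;
  the growth argument in \<open>sup_bound_half\<close> therefore runs along the exponents
  2^k.\<close>

lemma q_power_two: "q (P ^ (2 ^ k)) = q P ^ (2 ^ k)"
  by (induction k) (simp_all add: power_mult q_square mult.commute[of 2])

text \<open>The ball of radius 1/4 is invariant under the iteration, as (1/2)((1/2)^2 + (1/4)^2) =
  5/32.\<close>

lemma sqrt_iter_bound:
  assumes "q [:0, 1:] \<le> 1/2"
  shows "q (sqrt_iter n) \<le> 1/4"
proof (induction n)
  case (Suc n)
  have "q (sqrt_iter (Suc n)) \<le> 1/2 * (q ([:0, 1:]\<^sup>2) + q ((sqrt_iter n)\<^sup>2))"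
    using q_triangle[of "[:0, 1:]\<^sup>2" "(sqrt_iter n)\<^sup>2"] by (simp add: q_smult)
  also have "\<dots> = 1/2 * ((q [:0, 1:])\<^sup>2 + (q (sqrt_iter n))\<^sup>2)" by (simp only: q_square)
  also have "\<dots> \<le> 1/2 * ((1/2)\<^sup>2 + (1/4)\<^sup>2)"
    by (intro mult_left_mono add_mono power_mono) (use assms Suc in \<open>auto simp: q_nonneg\<close>)
  finally show ?case by (simp add: power2_eq_square)
qed simp

text \<open>For consecutive iterates a and b the next increment is (a + b)(a - b) / 2. Both have
  seminorm at most 1/4, so each step contracts by the factor 1/4.\<close>

lemma sqrt_iter_step:
  assumes "q [:0, 1:] \<le> 1/2"
  shows "q (sqrt_iter (Suc n) - sqrt_iter n) \<le> (1/4) ^ n"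
proof (induction n)
  case 0
  show ?case using sqrt_iter_bound[OF assms, of 1] by simp
next
  case (Suc n)
  let ?a = "sqrt_iter (Suc n)" and ?b = "sqrt_iter n"
  have "sqrt_iter (Suc (Suc n)) - sqrt_iter (Suc n) = Polynomial.smult (1/2) (?a\<^sup>2 - ?b\<^sup>2)"
    by (simp only: sqrt_iter.simps(2)[of "Suc n"] sqrt_iter.simps(2)[of n] smult_diff_right[symmetric])
       simp
  also have "?a\<^sup>2 - ?b\<^sup>2 = (?a + ?b) * (?a - ?b)" by Groebner_Basis.algebra
  finally have "q (sqrt_iter (Suc (Suc n)) - sqrt_iter (Suc n)) \<le> 1/2 * (q (?a + ?b) * q (?a - ?b))"
    using q_mult[of "?a + ?b" "?a - ?b"] by (simp add: q_smult)
  also have "\<dots> \<le> 1/2 * ((1/4 + 1/4) * (1/4) ^ n)"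
    by (intro mult_left_mono mult_mono order_trans[OF q_triangle] add_mono sqrt_iter_bound assms Suc)
       (auto simp: q_nonneg)
  finally show ?case by simp
qed

text \<open>In \<open>cheb_pythagoras\<close> the factor 1 - X^2 is replaced by the square of W = 1
  - \<open>sqrt_iter m\<close>. This writes 1, up to an error that vanishes as m grows, as a sum of
  two squares, to which \<open>q_sumsq\<close> applies.\<close>

lemma chebC_bound:
  assumes "q [:0, 1:] \<le> 1/2"
  shows "q (chebC n) \<le> 1"
proof -
  let ?S = "chebS n"
  have "(q (chebC n))\<^sup>2 \<le> 1 + 2 * (1/4) ^ m * q (?S\<^sup>2)" for m
  proof -
    define W where "W = 1 - sqrt_iter m"
    have e: "(chebC n)\<^sup>2 + (W * ?S)\<^sup>2 = 1 - ([:1, 0, -1:] - W\<^sup>2) * ?S\<^sup>2"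
      using cheb_pythagoras[of n] by Groebner_Basis.algebra
    have "(q (chebC n))\<^sup>2 \<le> q ((chebC n)\<^sup>2 + (W * ?S)\<^sup>2)" by (rule q_sumsq)
    also have "\<dots> \<le> q 1 + q (([:1, 0, -1:] - W\<^sup>2) * ?S\<^sup>2)" unfolding e by (rule q_diff)
    also have "\<dots> \<le> 1 + q ([:1, 0, -1:] - W\<^sup>2) * q (?S\<^sup>2)" by (intro add_mono q_one q_mult)
    also have "q ([:1, 0, -1:] - W\<^sup>2) \<le> 2 * (1/4) ^ m"
      unfolding W_def sqrt_iter_defect q_smult
      using sqrt_iter_step[OF assms, of m] by (simp add: q_minus_commute del: sqrt_iter.simps)
    finally show ?thesis by (simp add: mult_right_mono q_nonneg)
  qed
  moreover have "(\<lambda>m. 1 + 2 * (1/4) ^ m * q (?S\<^sup>2)) \<longlonglongrightarrow> 1 + 2 * 0 * q (?S\<^sup>2)"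
    by (intro tendsto_intros LIMSEQ_power_zero) simp
  ultimately have "(q (chebC n))\<^sup>2 \<le> 1"
    by (intro LIMSEQ_le_const[where X = "\<lambda>m. 1 + 2 * (1/4) ^ m * q (?S\<^sup>2)"]) auto
  then show ?thesis using q_nonneg[of "chebC n"] by (simp add: power_le_one_iff)
qed

text \<open>The Chebyshev expansion has degree + 1 terms, with coefficients of size at most 2M and
  polynomials of seminorm at most 1.\<close>

lemma degree_bound:
  assumes "q [:0, 1:] \<le> 1/2" "\<And>t. \<bar>t\<bar> \<le> 1 \<Longrightarrow> \<bar>poly P t\<bar> \<le> M"
  shows "q P \<le> (real (degree P) + 1) * (2 * M)"
proof -
  obtain c where c: "P = (\<Sum>k\<le>degree P. Polynomial.smult (c k) (chebC k))" using cheb_expansion by blast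
  have "q P \<le> (\<Sum>k\<le>degree P. q (Polynomial.smult (c k) (chebC k)))" by (subst c) (rule q_sum)
  also have "\<dots> \<le> (\<Sum>k\<le>degree P. 2 * M)"
  proof (rule sum_mono)
    fix k assume k: "k \<in> {..degree P}"
    have "\<bar>c k\<bar> * q (chebC k) \<le> \<bar>c k\<bar> * 1"
      by (intro mult_left_mono chebC_bound assms) simp
    also have "\<bar>c k\<bar> \<le> 2 * M" using cheb_coeff_bound[OF c assms(2)] k by simp
    finally show "q (Polynomial.smult (c k) (chebC k)) \<le> 2 * M" by (simp add: q_smult)
  qed
  finally show ?thesis by (simp add: add.commute)
qed

text \<open>\<open>degree_bound\<close> is applied to P^n with n = 2^k, whose seminorm is exactly (q
  P)^n. The factor lost there is linear in n and cannot compensate the exponential gap between (q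
  P)^n and M'^n.\<close>

lemma sup_bound_half:
  assumes "q [:0, 1:] \<le> 1/2" and M: "\<And>t. \<bar>t\<bar> \<le> 1 \<Longrightarrow> \<bar>poly P t\<bar> \<le> M"
  shows "q P \<le> M"
proof (rule ccontr)
  assume "\<not> q P \<le> M"
  then obtain M' where M': "M < M'" "M' < q P" using dense not_le by metis
  have "0 \<le> M" using M[of 0] by simp
  define r where "r = M' / q P"
  have qP: "0 < q P" "0 < M'" using M' \<open>0 \<le> M\<close> by auto
  have r: "0 < r" "r < 1" using M' qP by (auto simp: r_def)
  define d where "d = real (degree P)"
  have le: "1 \<le> 2 * d * (real n * r ^ n) + 2 * r ^ n" if "n = 2 ^ k" for n k
  proof -
    have "q P ^ n = q (P ^ n)" using that by (simp add: q_power_two)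
    also have "\<dots> \<le> (real (degree (P ^ n)) + 1) * (2 * M' ^ n)"
    proof (rule degree_bound[OF assms(1)])
      fix t :: real assume "\<bar>t\<bar> \<le> 1"
      then have "\<bar>poly P t\<bar> ^ n \<le> M' ^ n" using M[of t] M' by (intro power_mono) auto
      then show "\<bar>poly (P ^ n) t\<bar> \<le> M' ^ n" by (simp add: power_abs)
    qed
    also have "\<dots> \<le> (d * real n + 1) * (2 * M' ^ n)"
      using degree_power_le[of P n] qP
      by (intro mult_right_mono) (auto simp: d_def simp flip: of_nat_mult)
    finally have "1 \<le> (d * real n + 1) * (2 * M' ^ n) / q P ^ n" using qP by (simp add: le_divide_eq)
    then show ?thesis by (simp add: r_def power_divide algebra_simps add_divide_distrib)
  qed
  have "(\<lambda>n. 2 * d * (real n * r ^ n) + 2 * r ^ n) \<longlonglongrightarrow> 2 * d * 0 + 2 * 0"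
    using r by (intro tendsto_intros powser_times_n_limit_0 LIMSEQ_power_zero) auto
  then have "(\<lambda>n. 2 * d * (real n * r ^ n) + 2 * r ^ n) \<longlonglongrightarrow> 0" by simp
  then have "(\<lambda>k. 2 * d * (real (2 ^ k) * r ^ (2 ^ k)) + 2 * r ^ (2 ^ k)) \<longlonglongrightarrow> 0"
    by (rule LIMSEQ_subseq_LIMSEQ[where f = "\<lambda>k. 2 ^ k", unfolded o_def]) (simp add: strict_mono_def)
  then have "(1::real) \<le> 0" using le by (intro LIMSEQ_le_const) auto
  then show False by simp
qed

end

text \<open>Substituting X / (2R) for X yields a seminorm under which X has size at most 1/2. The
  interval obtained is generous; it serves only as the compact set within which
  \<open>spec_attained\<close> locates the spectrum.\<close>

lemma (in poly_seminorm) sup_bound: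
  assumes R: "q [:0, 1:] \<le> R" "0 < R" and M: "\<And>t. \<bar>t\<bar> \<le> 2 * R \<Longrightarrow> \<bar>poly P t\<bar> \<le> M"
  shows "q P \<le> M"
proof -
  define q' where "q' Q = q (pcompose Q [:0, 1 / (2 * R):])" for Q
  interpret q': poly_seminorm q'
  proof
    fix P Q :: "real poly" and c :: real
    show "0 \<le> q' P" by (simp add: q'_def q_nonneg)
    show "q' (P + Q) \<le> q' P + q' Q" by (simp add: q'_def pcompose_add q_triangle)
    show "q' (Polynomial.smult c P) = \<bar>c\<bar> * q' P" by (simp add: q'_def pcompose_smult q_smult)
    show "q' (P * Q) \<le> q' P * q' Q" by (simp add: q'_def pcompose_mult q_mult)
    show "(q' P)\<^sup>2 \<le> q' (P\<^sup>2 + Q\<^sup>2)"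
      by (simp add: q'_def pcompose_add pcompose_mult power2_eq_square flip: q_sumsq[unfolded power2_eq_square])
         (use q_sumsq in \<open>simp add: power2_eq_square\<close>)
  qed
  have "pcompose (pcompose P [:0, 2 * R:]) [:0, 1 / (2 * R):] = P"
    using R by (simp flip: pcompose_assoc add: pcompose_pCons pcompose_idR)
  then have "q P = q' (pcompose P [:0, 2 * R:])" by (simp add: q'_def)
  also have "\<dots> \<le> M"
  proof (rule q'.sup_bound_half)
    have "q' [:0, 1:] = q (Polynomial.smult (1 / (2 * R)) [:0, 1:])" by (simp add: q'_def pcompose_pCons)
    also have "\<dots> \<le> 1 / 2" unfolding q_smult using R by (simp add: field_simps)
    finally show "q' [:0, 1:] \<le> 1/2" .
    show "\<bar>poly (pcompose P [:0, 2 * R:]) t\<bar> \<le> M" if "\<bar>t\<bar> \<le> 1" for t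
      using that R by (auto simp: poly_pcompose abs_mult intro!: M)
  qed
  finally show ?thesis .
qed

section \<open>The spectrum of a seminorm on real polynomials\<close>

context poly_seminorm
begin

definition spec :: "real set" where
  "spec = {t. \<forall>P. \<bar>poly P t\<bar> \<le> q P}"

lemma spec_le: "t \<in> spec \<Longrightarrow> \<bar>poly P t\<bar> \<le> q P"
  by (simp add: spec_def)

text \<open>
  Otherwise, by compactness, there is a sum of squares \<open>S\<close> with \<open>q S\<close> small that is large wherever \<open>\<bar>P\<bar>\<close> is close
  to \<open>q P\<close>. Then \<open>P\<^sup>2 / (1 + S)\<close> is smaller than \<open>(q P)\<^sup>2\<close>, and approximating it by a polynomial \<open>D\<close> gives
  the contradiction \<open>q (P\<^sup>2) \<le> q D (1 + q S) < (q P)\<^sup>2\<close>, up to a small error.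
\<close>

theorem spec_attained:
  assumes P: "0 < q P"
  shows "\<exists>t\<in>spec. \<bar>poly P t\<bar> = q P"
proof (rule ccontr)
  assume none: "\<not> ?thesis"
  define R where "R = q [:0, 1:] + 1"
  have R: "q [:0, 1:] \<le> R" "0 < R" using q_nonneg[of "[:0, 1:]"] by (auto simp: R_def)
  define I where "I = {- 2 * R .. 2 * R}"
  have I: "compact I" "0 \<in> I" using R by (auto simp: I_def)
  have sup: "q Q \<le> M" if "\<And>t. t \<in> I \<Longrightarrow> \<bar>poly Q t\<bar> \<le> M" for Q M
    by (rule sup_bound[OF R], rule that) (auto simp: I_def abs_le_iff)
  define K where "K = {t \<in> I. q P \<le> \<bar>poly P t\<bar>}"
  have "compact K"
  proof -
    have "closed {t. q P \<le> \<bar>poly P t\<bar>}" by (intro closed_Collect_le continuous_intros)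
    moreover have "K = I \<inter> {t. q P \<le> \<bar>poly P t\<bar>}" by (auto simp: K_def)
    ultimately show ?thesis using I by (auto intro: compact_Int_closed)
  qed
  \<comment> \<open>A point outside the spectrum has a witness Q with q Q < |Q t|. Dividing by a
    number s in between and taking a power keeps the seminorm below 1 and pushes the value beyond 2.
    The exponent is \<open>Suc n\<close>, since a zeroth power could have seminorm 1.\<close>
  have "\<exists>Q. q Q < 1 \<and> 2 < \<bar>poly Q t\<bar>" if "t \<in> K" for t
  proof -
    have "t \<notin> spec" using none that spec_le[of t P] by (auto simp: K_def)
    then obtain Q where "q Q < \<bar>poly Q t\<bar>" by (auto simp: spec_def not_le)
    then obtain s where s: "q Q < s" "s < \<bar>poly Q t\<bar>" using dense by metis
    then have "0 < s" using q_nonneg[of Q] by simp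
    define y where "y = \<bar>poly Q t\<bar> / s"
    have "1 < y" using s \<open>0 < s\<close> by (simp add: y_def)
    then obtain n where "2 < y ^ n" using real_arch_pow by blast
    moreover have "y ^ n \<le> y ^ Suc n" using \<open>1 < y\<close> by (intro power_increasing) auto
    moreover have "\<bar>poly (Polynomial.smult (1/s) Q ^ Suc n) t\<bar> = y ^ Suc n"
      using \<open>0 < s\<close> by (simp only: poly_power poly_smult power_abs y_def abs_mult) simp
    ultimately have n: "2 < \<bar>poly (Polynomial.smult (1/s) Q ^ Suc n) t\<bar>" by linarith
    have "q (Polynomial.smult (1/s) Q ^ Suc n) \<le> (q Q / s) ^ Suc n"
      using q_power[of "Polynomial.smult (1/s) Q" "Suc n"] \<open>0 < s\<close> by (simp add: q_smult)
    also have "\<dots> \<le> (q Q / s) ^ 1" using s \<open>0 < s\<close> q_nonneg[of Q] by (intro power_decreasing) auto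
    also have "\<dots> < 1" using s \<open>0 < s\<close> by simp
    finally show ?thesis using n by blast
  qed
  then obtain Q where Q: "\<And>t. t \<in> K \<Longrightarrow> q (Q t) < 1 \<and> 2 < \<bar>poly (Q t) t\<bar>" by metis
  define U where "U t = {x. 2 < \<bar>poly (Q t) x\<bar>}" for t
  have oU: "open (U t)" for t unfolding U_def by (intro open_Collect_less continuous_intros)
  have "K \<subseteq> (\<Union>t\<in>K. U t)" using Q by (auto simp: U_def)
  then obtain F where F: "F \<subseteq> K" "finite F" "K \<subseteq> (\<Union>t\<in>F. U t)"
    using compactE_image[OF \<open>compact K\<close>, of K U] oU by metis
  define V where "V = (\<Union>t\<in>F. U t)"
  have "open V" using oU by (auto simp: V_def)
  \<comment> \<open>V covers the set K where |P| reaches q P, so the maximum of |P| over the compact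
    remainder is strictly smaller.\<close>
  obtain \<rho> where \<rho>: "0 \<le> \<rho>" "\<rho> < q P" "\<And>t. t \<in> I - V \<Longrightarrow> \<bar>poly P t\<bar> \<le> \<rho>"
  proof (cases "I - V = {}")
    case True
    then show ?thesis using that[of 0] P by auto
  next
    case False
    have "compact (I - V)" using I \<open>open V\<close> by (intro compact_diff) auto
    moreover have "continuous_on (I - V) (\<lambda>t. \<bar>poly P t\<bar>)" by (intro continuous_intros)
    ultimately obtain s where s: "s \<in> I - V" "\<And>t. t \<in> I - V \<Longrightarrow> \<bar>poly P t\<bar> \<le> \<bar>poly P s\<bar>"
      using continuous_attains_sup[of "I - V"] False by blast
    have "s \<notin> K" using s F(3) by (auto simp: V_def)
    then have "\<bar>poly P s\<bar> < q P" using s by (auto simp: K_def)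
    then show ?thesis using that[of "\<bar>poly P s\<bar>"] s by auto
  qed
  have "\<rho>\<^sup>2 < (q P)\<^sup>2" using \<rho> by (intro power_strict_mono) auto
  then obtain \<tau> where \<tau>: "\<rho>\<^sup>2 < \<tau>" "\<tau> < (q P)\<^sup>2" using dense by blast
  have \<tau>0: "0 < \<tau>" using \<tau> by (meson le_less_trans zero_le_power2)
  \<comment> \<open>At every point of V one summand is at least 4^m, while the seminorm of the sum
    tends to 0 because all \<open>q (Q t)\<close> are below 1.\<close>
  define S where "S m = (\<Sum>t\<in>F. (Q t ^ m)\<^sup>2)" for m
  have S0: "0 \<le> poly (S m) x" for m x by (simp add: S_def poly_sum sum_nonneg)
  have "continuous_on I (\<lambda>t. \<bar>poly P t\<bar>)" by (intro continuous_intros)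
  then obtain B where B: "\<And>t. t \<in> I \<Longrightarrow> \<bar>poly P t\<bar> \<le> B"
    using continuous_attains_sup[of I "\<lambda>t. \<bar>poly P t\<bar>"] I by blast
  \<comment> \<open>The condition on m makes the quotient f at most \<tau> on V, where the
    denominator exceeds 4^m and the numerator is at most B^2; off V the numerator alone is below
    \<tau>.\<close>
  have key: "(q P)\<^sup>2 \<le> \<tau> * (1 + q (S m))" if m: "B\<^sup>2 < \<tau> * 4 ^ m" for m
  proof -
    define f where "f x = (poly P x)\<^sup>2 / (1 + poly (S m) x)" for x
    have pos: "1 + poly (S m) x > 0" for x using S0[of m x] by simp
    have f0: "0 \<le> f x" for x using pos[of x] by (simp add: f_def)
    have f\<tau>: "f x \<le> \<tau>" if x: "x \<in> I" for x
    proof (cases "x \<in> V")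
      case True
      then obtain t where t: "t \<in> F" "2 < \<bar>poly (Q t) x\<bar>" by (auto simp: V_def U_def)
      have "4 ^ m = ((2::real) ^ m)\<^sup>2" by (simp add: power2_eq_square flip: power_mult_distrib)
      also have "\<dots> \<le> (\<bar>poly (Q t) x\<bar> ^ m)\<^sup>2" using t by (intro power_mono) auto
      also have "\<dots> = poly ((Q t ^ m)\<^sup>2) x" by (simp flip: power_abs)
      also have "\<dots> \<le> poly (S m) x"
        unfolding S_def poly_sum using t F by (intro member_le_sum) auto
      finally have "4 ^ m \<le> 1 + poly (S m) x" by simp
      then have "\<tau> * 4 ^ m \<le> \<tau> * (1 + poly (S m) x)" using \<tau>0 by (intro mult_left_mono) auto
      moreover have "(poly P x)\<^sup>2 \<le> B\<^sup>2" using B[OF x] by (simp add: abs_le_square_iff[symmetric])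
      ultimately show ?thesis using m pos[of x] by (simp add: f_def divide_le_eq)
    next
      case False
      then have "(poly P x)\<^sup>2 \<le> \<rho>\<^sup>2" using \<rho> x by (simp add: abs_le_square_iff[symmetric])
      moreover have "\<tau> * 1 \<le> \<tau> * (1 + poly (S m) x)" using \<tau>0 S0[of m x] by (intro mult_left_mono) auto
      ultimately show ?thesis using \<tau> pos[of x] by (simp add: f_def divide_le_eq)
    qed
    have contf: "continuous_on {- 2 * R .. 2 * R} f"
      unfolding f_def using pos by (intro continuous_intros) (metis less_irrefl)
    have "continuous_on I (\<lambda>t. 1 + poly (S m) t)" by (intro continuous_intros)
    then obtain C where C: "\<And>t. t \<in> I \<Longrightarrow> 1 + poly (S m) t \<le> C"
      using continuous_attains_sup[of I "\<lambda>t. 1 + poly (S m) t"] I by blast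
    \<comment> \<open>D approximates f, so P^2 is close to D (1 + S m) on I. Both approximations are
      statements about suprema and become seminorm bounds through \<open>sup\<close>; the error is
      removed afterwards by letting n tend to infinity.\<close>
    have "(q P)\<^sup>2 \<le> (\<tau> + inverse (real (Suc n))) * (1 + q (S m)) + inverse (real (Suc n)) * C" for n
    proof -
      let ?e = "inverse (real (Suc n))"
      obtain D where D: "\<And>x. x \<in> I \<Longrightarrow> \<bar>f x - poly D x\<bar> < ?e"
        using Weierstrass_poly[OF contf, of ?e] by (auto simp: I_def)
      have q1: "q D \<le> \<tau> + ?e"
      proof (rule sup)
        fix t assume "t \<in> I"
        then show "\<bar>poly D t\<bar> \<le> \<tau> + ?e" using D[of t] f0[of t] f\<tau>[of t] by linarith
      qed
      have q2: "q (P\<^sup>2 - D * (1 + S m)) \<le> ?e * C"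
      proof (rule sup)
        fix t assume t: "t \<in> I"
        have "poly (P\<^sup>2 - D * (1 + S m)) t = (f t - poly D t) * (1 + poly (S m) t)"
          using pos[of t] by (simp add: f_def left_diff_distrib)
        then have "\<bar>poly (P\<^sup>2 - D * (1 + S m)) t\<bar> = \<bar>f t - poly D t\<bar> * (1 + poly (S m) t)"
          using pos[of t] by (simp add: abs_mult)
        also have "\<dots> \<le> ?e * C"
          using D[OF t] C[OF t] pos[of t] by (intro mult_mono) auto
        finally show "\<bar>poly (P\<^sup>2 - D * (1 + S m)) t\<bar> \<le> ?e * C" .
      qed
      have "(q P)\<^sup>2 = q (D * (1 + S m) + (P\<^sup>2 - D * (1 + S m)))" by (simp add: q_square)
      also have "\<dots> \<le> q D * q (1 + S m) + q (P\<^sup>2 - D * (1 + S m))"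
        by (intro order_trans[OF q_triangle] add_right_mono q_mult)
      also have "\<dots> \<le> (\<tau> + ?e) * (1 + q (S m)) + ?e * C"
        using q1 q2 order_trans[OF q_triangle add_right_mono[OF q_one]] \<tau>0
        by (intro add_mono mult_mono) (auto simp: q_nonneg)
      finally show ?thesis .
    qed
    note le = this
    have "(\<lambda>n. (\<tau> + inverse (real (Suc n))) * (1 + q (S m)) + inverse (real (Suc n)) * C)
        \<longlonglongrightarrow> (\<tau> + 0) * (1 + q (S m)) + 0 * C"
      by (intro tendsto_intros LIMSEQ_inverse_real_of_nat)
    from LIMSEQ_le_const[OF this, of "(q P)\<^sup>2"] le show ?thesis by auto
  qed
  have "eventually (\<lambda>m. (q P)\<^sup>2 \<le> \<tau> * (1 + (\<Sum>t\<in>F. (q (Q t) ^ 2) ^ m))) sequentially"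
  proof -
    obtain m0 where m0: "B\<^sup>2 / \<tau> < 4 ^ m0" using real_arch_pow[of 4] by auto
    have "(q P)\<^sup>2 \<le> \<tau> * (1 + (\<Sum>t\<in>F. (q (Q t) ^ 2) ^ m))" if "m0 \<le> m" for m
    proof -
      have "B\<^sup>2 / \<tau> < 4 ^ m" using less_le_trans[OF m0 power_increasing[OF that]] by simp
      then have "(q P)\<^sup>2 \<le> \<tau> * (1 + q (S m))" using \<tau>0 by (intro key) (simp add: divide_less_eq mult.commute)
      also have "q (S m) \<le> (\<Sum>t\<in>F. (q (Q t) ^ 2) ^ m)"
        unfolding S_def
        by (intro order_trans[OF q_sum] sum_mono)
           (metis q_power power_mult mult.commute)
      finally show ?thesis using \<tau>0 by (simp add: mult_left_mono)
    qed
    then show ?thesis by (auto simp: eventually_sequentially)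
  qed
  moreover have "(\<lambda>m. \<tau> * (1 + (\<Sum>t\<in>F. (q (Q t) ^ 2) ^ m))) \<longlonglongrightarrow> \<tau> * (1 + (\<Sum>t\<in>F. 0))"
  proof (intro tendsto_intros LIMSEQ_power_zero)
    fix t assume "t \<in> F"
    then have "q (Q t) < 1" using F Q by auto
    then show "norm ((q (Q t))\<^sup>2) < 1"
      using q_nonneg[of "Q t"] by (simp add: power_less_one_iff)
  qed
  ultimately have "(q P)\<^sup>2 \<le> \<tau> * (1 + (\<Sum>t\<in>F. 0))"
    by (intro tendsto_lowerbound) auto
  then show False using \<tau> by simp
qed

lemma spec_bound:
  assumes "\<And>t. t \<in> spec \<Longrightarrow> \<bar>poly P t\<bar> \<le> M" "0 \<le> M"
  shows "q P \<le> M"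
  using assms spec_attained[of P] q_nonneg[of P] by (cases "q P = 0") force+

end

section \<open>The Hahn-Banach theorem\<close>

text \<open>Carrier and operations are explicit parameters, so that the carrier of a complex algebra
  with scalars restricted to the reals is an instance.\<close>

locale real_space =
  fixes V :: "'v set" and add :: "'v \<Rightarrow> 'v \<Rightarrow> 'v" and sc :: "real \<Rightarrow> 'v \<Rightarrow> 'v" and z :: 'v
  assumes z: "z \<in> V" and add: "x \<in> V \<Longrightarrow> y \<in> V \<Longrightarrow> add x y \<in> V" and sc: "x \<in> V \<Longrightarrow> sc r x \<in> V"
    and add_assoc: "\<lbrakk>x \<in> V; y \<in> V; w \<in> V\<rbrakk> \<Longrightarrow> add (add x y) w = add x (add y w)"
    and add_comm: "\<lbrakk>x \<in> V; y \<in> V\<rbrakk> \<Longrightarrow> add x y = add y x"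
    and add_z: "x \<in> V \<Longrightarrow> add x z = x"
    and sc_add: "\<lbrakk>x \<in> V; y \<in> V\<rbrakk> \<Longrightarrow> sc r (add x y) = add (sc r x) (sc r y)"
    and sc_plus: "x \<in> V \<Longrightarrow> sc (r + s) x = add (sc r x) (sc s x)"
    and sc_sc: "x \<in> V \<Longrightarrow> sc r (sc s x) = sc (r * s) x"
    and sc_one: "x \<in> V \<Longrightarrow> sc 1 x = x"
    and sc_0: "x \<in> V \<Longrightarrow> sc 0 x = z"
begin

definition sublinear :: "('v \<Rightarrow> real) \<Rightarrow> bool" where
  "sublinear q \<longleftrightarrow> (\<forall>x\<in>V. \<forall>y\<in>V. q (add x y) \<le> q x + q y) \<and> (\<forall>x\<in>V. \<forall>r\<ge>0. q (sc r x) = r * q x)"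

definition linear_on :: "'v set \<Rightarrow> ('v \<Rightarrow> real) \<Rightarrow> bool" where
  "linear_on E f \<longleftrightarrow> (\<forall>x\<in>E. \<forall>y\<in>E. f (add x y) = f x + f y) \<and> (\<forall>x\<in>E. \<forall>r. f (sc r x) = r * f x)"

lemma add_neg: "x \<in> V \<Longrightarrow> add x (sc (-1) x) = z"
  using sc_plus[of x 1 "-1"] by (simp add: sc_one sc_0)

lemma add_4: "\<lbrakk>x \<in> V; y \<in> V; u \<in> V; w \<in> V\<rbrakk> \<Longrightarrow> add (add x y) (add u w) = add (add x u) (add y w)"
  by (metis add add_assoc add_comm)

text \<open>Subadditivity applied to y = (x + y) - x. The estimate keeps the infima formed below
  from being minus infinity.\<close>

lemma sublinear_lower:
  assumes "sublinear q" "x \<in> V" "y \<in> V"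
  shows "q y \<le> q (add x y) + q (sc (-1) x)"
proof -
  have "add (add x y) (sc (-1) x) = y"
    using assms add sc add_assoc add_comm add_z add_neg by metis
  then show ?thesis using assms add sc unfolding sublinear_def by metis
qed

lemma sublinear_z: "sublinear q \<Longrightarrow> q z = 0"
  using z sc_0[of z] unfolding sublinear_def by (metis order_refl mult_zero_left)

lemma sublinear_ge: "sublinear q \<Longrightarrow> x \<in> V \<Longrightarrow> - q (sc (-1) x) \<le> q x"
  using sublinear_lower[of q x z] z add_z sublinear_z by fastforce

text \<open>
  \<open>E\<close> is only required to be a convex cone, as the lemma is applied both to subspaces and to the ray
  spanned by a vector.
\<close>

lemma sublinear_Inf:
  assumes q: "sublinear q" and E: "E \<subseteq> V" "z \<in> E"
    and Ea: "\<And>x y. x \<in> E \<Longrightarrow> y \<in> E \<Longrightarrow> add x y \<in> E"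
    and Es: "\<And>x r. x \<in> E \<Longrightarrow> 0 \<le> r \<Longrightarrow> sc r x \<in> E"
    and ga: "\<And>x y. x \<in> E \<Longrightarrow> y \<in> E \<Longrightarrow> g (add x y) = g x + g y"
    and gs: "\<And>x r. x \<in> E \<Longrightarrow> 0 \<le> r \<Longrightarrow> g (sc r x) = r * g x"
    and gq: "\<And>x. x \<in> E \<Longrightarrow> g x \<le> q x"
  defines "u \<equiv> \<lambda>x. INF e\<in>E. q (add x e) - g e"
  shows "sublinear u" "\<And>x e. x \<in> V \<Longrightarrow> e \<in> E \<Longrightarrow> u x \<le> q (add x e) - g e" "\<And>x. x \<in> V \<Longrightarrow> u x \<le> q x"
proof -
  have low: "- q (sc (-1) x) \<le> q (add x e) - g e" if "x \<in> V" "e \<in> E" for x e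
    using sublinear_lower[OF q, of x e] gq[of e] that E by force
  then have bdd: "bdd_below ((\<lambda>e. q (add x e) - g e) ` E)" if "x \<in> V" for x
    using that by (intro bdd_belowI2[where m = "- q (sc (-1) x)"]) auto
  show ue: "u x \<le> q (add x e) - g e" if "x \<in> V" "e \<in> E" for x e
    unfolding u_def by (rule cINF_lower[OF bdd]) (use that in auto)
  have g0: "g z = 0" using gs[of z 0] E z sc_0[of z] by simp
  show uq: "u x \<le> q x" if "x \<in> V" for x
    using ue[OF that E(2)] add_z[OF that] g0 by simp
  have ug: "c \<le> u x" if "\<And>e. e \<in> E \<Longrightarrow> c \<le> q (add x e) - g e" for c x
    unfolding u_def using E that by (intro cINF_greatest) auto
  show "sublinear u"
    unfolding sublinear_def
  proof (intro conjI ballI allI impI)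
    fix x y assume xy: "x \<in> V" "y \<in> V"
    have "u (add x y) - u x \<le> u y"
    proof (rule ug)
      fix e assume e: "e \<in> E"
      have "u (add x y) - (q (add y e) - g e) \<le> u x"
      proof (rule ug)
        fix d assume d: "d \<in> E"
        have "u (add x y) \<le> q (add (add x y) (add d e)) - g (add d e)"
          using xy add d e Ea by (intro ue) auto
        also have "add (add x y) (add d e) = add (add x d) (add y e)"
          using xy d e E by (intro add_4) auto
        also have "q \<dots> \<le> q (add x d) + q (add y e)"
          using q xy d e E add unfolding sublinear_def by blast
        finally show "u (add x y) - (q (add y e) - g e) \<le> q (add x d) - g d"
          using ga[OF d e] by simp
      qed
      then show "u (add x y) - u x \<le> q (add y e) - g e" by simp
    qed
    then show "u (add x y) \<le> u x + u y" by simp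
  next
    fix x and r :: real assume x: "x \<in> V" and r: "0 \<le> r"
    \<comment> \<open>The infimum yields this inequality directly; the converse follows from it by
      scaling back with 1/r.\<close>
    have le: "u (sc r x) \<le> r * u x" if "0 < r" "x \<in> V" for r x
    proof -
      have "u (sc r x) / r \<le> u x"
      proof (rule ug)
        fix e assume e: "e \<in> E"
        have "u (sc r x) \<le> q (add (sc r x) (sc r e)) - g (sc r e)"
          using that sc e Es by (intro ue) auto
        also have "add (sc r x) (sc r e) = sc r (add x e)" using that e E sc_add by auto
        also have "q \<dots> - g (sc r e) = r * (q (add x e) - g e)"
          using q that e E add gs[OF e, of r] unfolding sublinear_def by (auto simp: right_diff_distrib)
        finally show "u (sc r x) / r \<le> q (add x e) - g e"
          using that by (simp add: divide_le_eq mult.commute)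
      qed
      then show ?thesis using that by (simp add: divide_le_eq mult.commute)
    qed
    show "u (sc r x) = r * u x"
    proof (cases "r = 0")
      case True
      have "u z \<le> 0" using uq[OF z] sublinear_z[OF q] by simp
      moreover have "0 \<le> u z"
        by (rule ug) (use gq E z add_comm add_z in fastforce)
      ultimately show ?thesis using True sc_0[OF x] by simp
    next
      case False
      then have r: "0 < r" using r by simp
      have "u (sc (1/r) (sc r x)) \<le> (1/r) * u (sc r x)" using r x sc by (intro le) auto
      then have "r * u x \<le> u (sc r x)" using r x by (simp add: sc_sc sc_one field_simps)
      then show ?thesis using le[OF r x] by simp
    qed
  qed
qed

text \<open>The infimum construction for the ray of w, with g = q. The last property is the term at
  e = w: it forces a minimal sublinear function to be additive and a functional below u to take the
  value q w at w.\<close>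

lemma sublinear_ray:
  assumes q: "sublinear q" and w: "w \<in> V"
  obtains u where "sublinear u" "\<And>x. x \<in> V \<Longrightarrow> u x \<le> q x" "\<And>x. x \<in> V \<Longrightarrow> u x \<le> q (add x w) - q w"
proof -
  define E where "E = (\<lambda>t. sc t w) ` {0..}"
  have qs: "q (sc r x) = r * q x" if "x \<in> V" "0 \<le> r" for r x
    using q that unfolding sublinear_def by blast
  have E: "E \<subseteq> V" "z \<in> E" using w sc sc_0[of w] by (auto simp: E_def)
  have Ea: "add e d \<in> E \<and> q (add e d) = q e + q d" if ed: "e \<in> E" "d \<in> E" for e d
  proof -
    obtain s where s: "e = sc s w" "0 \<le> s" using \<open>e \<in> E\<close> unfolding E_def by auto
    obtain t where t: "d = sc t w" "0 \<le> t" using \<open>d \<in> E\<close> unfolding E_def by auto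
    have "add e d = sc (s + t) w" using sc_plus w s t by simp
    then show ?thesis using s t w qs by (auto simp: E_def distrib_right)
  qed
  have p0: "add e d \<in> E" if "e \<in> E" "d \<in> E" for e d using Ea that by blast
  have p1: "sc r e \<in> E" if "e \<in> E" "0 \<le> r" for e r using that w by (auto simp: E_def sc_sc)
  have p2: "q (add e d) = q e + q d" if "e \<in> E" "d \<in> E" for e d using Ea that by blast
  have p3: "q (sc r e) = r * q e" if "e \<in> E" "0 \<le> r" for e r using qs that E by blast
  have "w \<in> E" using w sc_one by (auto simp: E_def intro!: image_eqI[of _ _ 1])
  note L = sublinear_Inf[OF q E p0 p1 p2 p3 order_refl]
  define u where "u = (\<lambda>x. INF e\<in>E. q (add x e) - q e)"
  have u: "sublinear u" "\<And>x e. x \<in> V \<Longrightarrow> e \<in> E \<Longrightarrow> u x \<le> q (add x e) - q e"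
    "\<And>x. x \<in> V \<Longrightarrow> u x \<le> q x"
    unfolding u_def using L by blast+
  show thesis by (rule that[OF u(1,3) u(2)[OF _ \<open>w \<in> E\<close>]])
qed

text \<open>By minimality the function u of \<open>sublinear_ray\<close> equals q, so q x \<le> q (x
  + y) - q y. Together with subadditivity q is additive, hence odd, hence homogeneous for negative
  scalars too.\<close>

lemma minimal_sublinear_linear:
  assumes q: "sublinear q"
    and min: "\<And>u. sublinear u \<Longrightarrow> (\<forall>x\<in>V. u x \<le> q x) \<Longrightarrow> (\<forall>x\<in>V. u x = q x)"
  shows "linear_on V q"
proof -
  have qs: "q (sc r x) = r * q x" if "x \<in> V" "0 \<le> r" for r x
    using q that unfolding sublinear_def by blast
  have add_ge: "q x + q y \<le> q (add x y)" if xy: "x \<in> V" "y \<in> V" for x y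
  proof -
    obtain u where u: "sublinear u" "\<And>x. x \<in> V \<Longrightarrow> u x \<le> q x" "\<And>x. x \<in> V \<Longrightarrow> u x \<le> q (add x y) - q y"
      using sublinear_ray[OF q xy(2)] by blast
    have "u x = q x" using min[OF u(1)] u(2) xy by blast
    then show ?thesis using u(3)[OF xy(1)] by simp
  qed
  have qa: "q (add x y) = q x + q y" if "x \<in> V" "y \<in> V" for x y
    using add_ge[OF that] q that unfolding sublinear_def by (simp add: antisym)
  have qn: "q (sc (-1) x) = - q x" if "x \<in> V" for x
    using qa[OF that sc[OF that, of "-1"]] add_neg[OF that] sublinear_z[OF q] by simp
  show ?thesis
    unfolding linear_on_def
  proof (intro conjI ballI allI)
    fix x and r :: real assume x: "x \<in> V"
    show "q (sc r x) = r * q x"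
    proof (cases "0 \<le> r")
      case False
      then have "q (sc (-1) (sc (- r) x)) = r * q x" using qn[OF sc[OF x]] qs[OF x, of "- r"] by simp
      then show ?thesis using x by (simp add: sc_sc)
    qed (use qs x in auto)
  qed (use qa in auto)
qed

text \<open>Zorn's lemma on the sublinear functions below p. The pointwise infimum of a chain is
  finite because every member f satisfies f x \<ge> -f (-x) \<ge> -p (-x).\<close>

lemma minimal_sublinear_exists:
  assumes p: "sublinear p"
  shows "\<exists>q. sublinear q \<and> (\<forall>x\<in>V. q x \<le> p x) \<and>
     (\<forall>u. sublinear u \<longrightarrow> (\<forall>x\<in>V. u x \<le> q x) \<longrightarrow> (\<forall>x\<in>V. u x = q x))"
proof -
  \<comment> \<open>The functions are set to 0 off V; otherwise distinct functions could agree on V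
    and the order would not be antisymmetric.\<close>
  define A where "A = {q. sublinear q \<and> (\<forall>x\<in>V. q x \<le> p x) \<and> (\<forall>x. x \<notin> V \<longrightarrow> q x = 0)}"
  \<comment> \<open>The order is reversed, so that maximal elements in Zorn's lemma are minimal
    sublinear functions.\<close>
  define P where "P f g \<longleftrightarrow> (\<forall>x\<in>V. g x \<le> f x)" for f g :: "'v \<Rightarrow> real"
  define cut where "cut q x = (if x \<in> V then q x else 0)" for q :: "'v \<Rightarrow> real" and x
  have cut: "sublinear (cut q) = sublinear q" for q
    unfolding sublinear_def cut_def using add sc by auto
  have "\<exists>m\<in>A. \<forall>a\<in>A. P m a \<longrightarrow> a = m"
  proof (rule predicate_Zorn)
    show "partial_order_on A (relation_of P A)"
      unfolding partial_order_on_def preorder_on_def refl_on_def trans_def antisym_def relation_of_def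
    proof (intro conjI allI impI ballI; (clarsimp simp: P_def)?)
      fix f g assume fg: "f \<in> A" "g \<in> A" "\<forall>x\<in>V. g x \<le> f x" "\<forall>x\<in>V. f x \<le> g x"
      show "f = g"
      proof
        fix x show "f x = g x" using fg by (cases "x \<in> V") (auto simp: A_def intro: antisym)
      qed
    next
      fix f g h :: "'v \<Rightarrow> real" and x assume "\<forall>x\<in>V. g x \<le> f x" "\<forall>x\<in>V. h x \<le> g x" "x \<in> V"
      then show "h x \<le> f x" by (meson order_trans)
    qed
  next
    fix C assume C: "C \<in> Chains (relation_of P A)"
    then have CA: "C \<subseteq> A" and ch: "\<And>f g. f \<in> C \<Longrightarrow> g \<in> C \<Longrightarrow> P f g \<or> P g f"
      unfolding Chains_def relation_of_def by blast+
    show "\<exists>u\<in>A. \<forall>a\<in>C. P a u"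
    proof (cases "C = {}")
      case True
      have "cut p \<in> A" using p cut unfolding A_def by (auto simp: cut_def)
      then show ?thesis using True by blast
    next
      case False
      define u where "u x = (if x \<in> V then INF f\<in>C. f x else 0)" for x
      have bdd: "bdd_below ((\<lambda>f. f x) ` C)" if "x \<in> V" for x
      proof (intro bdd_belowI2[where m = "- p (sc (-1) x)"])
        fix f assume "f \<in> C"
        then have "sublinear f" "f (sc (-1) x) \<le> p (sc (-1) x)" using CA sc[OF that] by (auto simp: A_def)
        then show "- p (sc (-1) x) \<le> f x" using sublinear_ge[of f x] that by simp
      qed
      have ul: "u x \<le> f x" if "f \<in> C" "x \<in> V" for f x
        using cINF_lower[OF bdd[OF that(2)] that(1)] that by (simp add: u_def)
      have ug: "c \<le> u x" if "x \<in> V" "\<And>f. f \<in> C \<Longrightarrow> c \<le> f x" for c x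
        using False that by (auto simp: u_def intro!: cINF_greatest)
      have "sublinear u"
        unfolding sublinear_def
      proof (intro conjI ballI allI impI)
        fix x y assume xy: "x \<in> V" "y \<in> V"
        have "u (add x y) - u x \<le> u y"
        proof (rule ug[OF xy(2)])
          fix f assume f: "f \<in> C"
          have "u (add x y) - f y \<le> u x"
          proof (rule ug[OF xy(1)])
            fix g assume g: "g \<in> C"
            \<comment> \<open>One of the chain members f and g lies below the other on all of V and
              serves at both points.\<close>
            obtain h where h: "h \<in> C" "h x \<le> g x" "h y \<le> f y"
              using ch[OF f g] f g xy unfolding P_def by blast
            have "u (add x y) \<le> h (add x y)" using ul h xy add by blast
            also have "\<dots> \<le> h x + h y" using h CA xy by (auto simp: A_def sublinear_def)
            finally show "u (add x y) - f y \<le> g x" using h by simp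
          qed
          then show "u (add x y) - u x \<le> f y" by simp
        qed
        then show "u (add x y) \<le> u x + u y" by simp
      next
        fix x and r :: real assume x: "x \<in> V" and r: "0 \<le> r"
        have fs: "f (sc r x) = r * f x" if "f \<in> C" for f
          using that CA x r by (auto simp: A_def sublinear_def)
        show "u (sc r x) = r * u x"
        proof (cases "r = 0")
          case True
          then have "(INF f\<in>C. f (sc r x)) = (INF f\<in>C. 0)" using fs by (intro INF_cong) auto
          then show ?thesis using True \<open>C \<noteq> {}\<close> sc[OF x] by (simp add: u_def)
        next
          case False
          then have r: "0 < r" using r by simp
          have "u (sc r x) / r \<le> u x"
          proof (rule ug[OF x])
            fix f assume "f \<in> C"
            then show "u (sc r x) / r \<le> f x" using ul[of f "sc r x"] fs sc[OF x] r by (simp add: divide_le_eq mult.commute)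
          qed
          moreover have "r * u x \<le> u (sc r x)"
          proof (rule ug[OF sc[OF x]])
            fix f assume f: "f \<in> C"
            show "r * u x \<le> f (sc r x)"
              unfolding fs[OF f] using ul[OF f x] r by (intro mult_left_mono) auto
          qed
          ultimately show ?thesis using r by (simp add: divide_le_eq mult.commute)
        qed
      qed
      moreover have "u x \<le> p x" if "x \<in> V" for x
        using False ul[OF _ that] CA that by (force simp: A_def)
      ultimately have "u \<in> A" by (auto simp: A_def u_def)
      then show ?thesis using ul by (auto simp: P_def)
    qed
  qed
  then obtain m where m: "m \<in> A" "\<And>a. a \<in> A \<Longrightarrow> P m a \<Longrightarrow> a = m" by blast
  have "\<forall>x\<in>V. u x = m x" if u: "sublinear u" "\<forall>x\<in>V. u x \<le> m x" for u
  proof -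
    have "cut u \<in> A" using u m(1) unfolding A_def mem_Collect_eq cut by (force simp: cut_def)
    moreover have "P m (cut u)" using u by (auto simp: P_def cut_def)
    ultimately have "cut u = m" using m(2) by blast
    then show ?thesis by (metis cut_def)
  qed
  then show ?thesis using m(1) by (auto simp: A_def)
qed

theorem Hahn_Banach_sublinear:
  assumes "sublinear p"
  shows "\<exists>f. linear_on V f \<and> (\<forall>x\<in>V. f x \<le> p x)"
  using minimal_sublinear_exists[OF assms] minimal_sublinear_linear by metis

text \<open>A functional below the function u of \<open>sublinear_ray\<close> satisfies f (-w) \<le>
  p 0 - p w, which is the missing inequality p w \<le> f w.\<close>

theorem Hahn_Banach_norming:
  assumes p: "sublinear p" and w: "w \<in> V"
  shows "\<exists>f. linear_on V f \<and> (\<forall>x\<in>V. f x \<le> p x) \<and> f w = p w"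
proof -
  obtain u where u: "sublinear u" "\<And>x. x \<in> V \<Longrightarrow> u x \<le> p x" "\<And>x. x \<in> V \<Longrightarrow> u x \<le> p (add x w) - p w"
    using sublinear_ray[OF p w] by blast
  obtain f where f: "linear_on V f" "\<And>x. x \<in> V \<Longrightarrow> f x \<le> u x"
    using Hahn_Banach_sublinear[OF u(1)] by blast
  have fp: "f x \<le> p x" if "x \<in> V" for x using f(2) u(2) that by (meson order_trans)
  have "f (sc (-1) w) \<le> p (add (sc (-1) w) w) - p w"
    using f(2) u(3)[of "sc (-1) w"] w sc by (meson order_trans)
  also have "add (sc (-1) w) w = z" using add_comm add_neg w sc by metis
  finally have "p w \<le> f w" using f(1) w sublinear_z[OF p] unfolding linear_on_def by auto
  then show ?thesis using f(1) fp w by (meson antisym)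
qed

text \<open>At x in E the infimum u is at most its term for e = -x, which is g x. So a linear
  functional below u lies below g on E, and passing to -x turns this into equality.\<close>

theorem Hahn_Banach_extension:
  assumes p: "sublinear p" and E: "E \<subseteq> V" "z \<in> E"
    and Ea: "\<And>x y. x \<in> E \<Longrightarrow> y \<in> E \<Longrightarrow> add x y \<in> E" and Es: "\<And>x r. x \<in> E \<Longrightarrow> sc r x \<in> E"
    and g: "linear_on E g" and gp: "\<And>x. x \<in> E \<Longrightarrow> g x \<le> p x"
  shows "\<exists>f. linear_on V f \<and> (\<forall>x\<in>V. f x \<le> p x) \<and> (\<forall>x\<in>E. f x = g x)"
proof -
  define u where "u x = (INF e\<in>E. p (add x e) - g e)" for x
  have u: "sublinear u" "\<And>x e. x \<in> V \<Longrightarrow> e \<in> E \<Longrightarrow> u x \<le> p (add x e) - g e"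
    "\<And>x. x \<in> V \<Longrightarrow> u x \<le> p x"
    using sublinear_Inf[OF p E, of g] Ea Es g gp unfolding u_def linear_on_def by auto
  obtain f where f: "linear_on V f" "\<And>x. x \<in> V \<Longrightarrow> f x \<le> u x"
    using Hahn_Banach_sublinear[OF u(1)] by blast
  have fE: "f x \<le> g x" if "x \<in> E" for x
  proof -
    have "f x \<le> p (add x (sc (-1) x)) - g (sc (-1) x)"
      using f(2) u(2)[of x "sc (-1) x"] that E Es by (meson order_trans subsetD)
    also have "\<dots> = g x"
      using that E add_neg sublinear_z[OF p] g unfolding linear_on_def by auto
    finally show ?thesis .
  qed
  have "f x = g x" if "x \<in> E" for x
    using fE[OF that] fE[OF Es[OF that, of "-1"]] f(1) g that E unfolding linear_on_def
    by (auto intro!: antisym)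
  then show ?thesis using f u(3) by (meson order_trans)
qed

end

section \<open>Schur products of positive semidefinite kernels\<close>

text \<open>Hermitian symmetry is a separate condition because nonnegativity is asked of the real
  part of the form only.\<close>

definition psd_kernel :: "'i set \<Rightarrow> ('i \<Rightarrow> 'i \<Rightarrow> complex) \<Rightarrow> bool" where
  "psd_kernel S M \<longleftrightarrow> (\<forall>s\<in>S. \<forall>t\<in>S. M t s = cnj (M s t)) \<and>
     (\<forall>c. 0 \<le> Re (\<Sum>s\<in>S. \<Sum>t\<in>S. cnj (c s) * c t * M s t))"

lemma psd_kernel_nonneg:
  "psd_kernel S M \<Longrightarrow> 0 \<le> Re (\<Sum>s\<in>S. \<Sum>t\<in>S. cnj (c s) * c t * M s t)"
  unfolding psd_kernel_def by blast

lemma psd_kernel_herm: "psd_kernel S M \<Longrightarrow> s \<in> S \<Longrightarrow> t \<in> S \<Longrightarrow> M t s = cnj (M s t)"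
  unfolding psd_kernel_def by blast

lemma psd_kernel_subset:
  assumes "psd_kernel S M" "T \<subseteq> S" "finite S"
  shows "psd_kernel T M"
  unfolding psd_kernel_def
proof (intro conjI allI)
  show "\<forall>s\<in>T. \<forall>t\<in>T. M t s = cnj (M s t)" using assms unfolding psd_kernel_def by blast
  fix c :: "'a \<Rightarrow> complex"
  define d where "d s = (if s \<in> T then c s else 0)" for s
  have "(\<Sum>s\<in>S. \<Sum>t\<in>S. cnj (d s) * d t * M s t) = (\<Sum>s\<in>T. \<Sum>t\<in>S. cnj (d s) * d t * M s t)"
    using assms by (intro sum.mono_neutral_right) (auto simp: d_def)
  also have "\<dots> = (\<Sum>s\<in>T. \<Sum>t\<in>T. cnj (c s) * c t * M s t)"
    using assms by (intro sum.cong refl sum.mono_neutral_cong_right) (auto simp: d_def)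
  finally have e: "(\<Sum>s\<in>S. \<Sum>t\<in>S. cnj (d s) * d t * M s t) = (\<Sum>s\<in>T. \<Sum>t\<in>T. cnj (c s) * c t * M s t)" .
  have "0 \<le> Re (\<Sum>s\<in>S. \<Sum>t\<in>S. cnj (d s) * d t * M s t)"
    by (rule psd_kernel_nonneg[OF assms(1)])
  then show "0 \<le> Re (\<Sum>s\<in>T. \<Sum>t\<in>T. cnj (c s) * c t * M s t)" unfolding e .
qed

text \<open>On the points s and t the test vector with entries -k M s t and 1 gives the value M t t
  - 2k |M s t|^2, which would become negative for large k.\<close>

lemma psd_diag_zero:
  assumes M: "psd_kernel S M" and S: "finite S" "s \<in> S" "t \<in> S" and 0: "Re (M s s) = 0"
  shows "M s t = 0"
proof (cases "s = t")
  case True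
  have "M s s = cnj (M s s)" using M S unfolding psd_kernel_def by blast
  then have "Im (M s s) = - Im (M s s)" by (metis cnj.simps(2))
  then have "Im (M s s) = 0" by simp
  then show ?thesis using 0 True by (simp add: complex_eq_iff)
next
  case False
  have p2: "psd_kernel {s, t} M" by (rule psd_kernel_subset[OF M]) (use S in auto)
  have c: "M t s = cnj (M s t)" using M S unfolding psd_kernel_def by blast
  define a where "a = (cmod (M s t))\<^sup>2"
  have a: "a = Re (M s t) * Re (M s t) + Im (M s t) * Im (M s t)"
    by (simp add: a_def cmod_power2) (simp add: power2_eq_square)
  have "0 \<le> Re (M t t) - 2 * k * a" for k :: real
  proof -
    define l where "l = - (complex_of_real k * M s t)"
    have "0 \<le> Re (\<Sum>x\<in>{s,t}. \<Sum>y\<in>{s,t}. cnj (if x = s then l else 1) * (if y = s then l else 1) * M x y)"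
      by (rule psd_kernel_nonneg[OF p2])
    also have "\<dots> = Re (cnj l * l * M s s) + Re (cnj l * M s t) + Re (l * M t s) + Re (M t t)"
      using False by (simp add: add_ac)
    also have "Re (cnj l * l * M s s) = 0" using 0 by (simp add: complex_mult_cnj mult.commute[of "cnj l"])
    also have "Re (cnj l * M s t) = - k * a"
      by (simp add: l_def a algebra_simps)
    also have "Re (l * M t s) = - k * a"
      unfolding c by (simp add: l_def a algebra_simps)
    finally show ?thesis by (simp add: mult_ac)
  qed
  from this[of 0] this[of "(Re (M t t) + 1) / a"] have "a = 0" by (cases "a = 0") auto
  then show ?thesis by (simp add: a_def)
qed

lemma sum_insert2:
  fixes f :: "'i \<Rightarrow> 'i \<Rightarrow> complex"
  assumes "finite S" "x \<notin> S"
  shows "(\<Sum>s\<in>insert x S. \<Sum>t\<in>insert x S. f s t)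
     = f x x + (\<Sum>t\<in>S. f x t) + (\<Sum>s\<in>S. f s x) + (\<Sum>s\<in>S. \<Sum>t\<in>S. f s t)"
  using assms by (simp add: sum.distrib add_ac)

text \<open>Induction by Schur complements. If the pivot m = M x x is nonzero, M is the sum of a
  kernel M' with vanishing row and column at x and of a rank-one kernel. Summed against L, the
  rank-one part is the quadratic form of L at the vector M x, divided by m > 0, and M' is left to
  the induction hypothesis. If the pivot is 0, its row and column vanish already.\<close>

lemma Schur_product_nonneg:
  assumes "finite S" "psd_kernel S M" "psd_kernel S L"
  shows "0 \<le> Re (\<Sum>s\<in>S. \<Sum>t\<in>S. M s t * L s t)"
  using assms
proof (induction S arbitrary: M rule: finite_induct)
  case (insert x S)
  have LS: "psd_kernel S L" and MS: "psd_kernel S M"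
    using insert psd_kernel_subset by (metis finite_insert subset_insertI)+
  have herm: "M t s = cnj (M s t)" if "s \<in> insert x S" "t \<in> insert x S" for s t
    using insert.prems that unfolding psd_kernel_def by blast
  have diag: "0 \<le> Re (M x x)"
  proof -
    have "psd_kernel {x} M" using psd_kernel_subset[OF insert.prems(1), of "{x}"] insert.hyps by blast
    from psd_kernel_nonneg[OF this, of "\<lambda>_. 1"] show ?thesis by simp
  qed
  have "Im (M x x) = - Im (M x x)" using herm[of x x] by (metis cnj.simps(2) insertI1)
  then have im: "M x x = complex_of_real (Re (M x x))"
    by (simp add: complex_eq_iff)
  show ?case
  proof (cases "Re (M x x) = 0")
    case True
    have "M x t = 0" "M t x = 0" if "t \<in> insert x S" for t
      using psd_diag_zero[OF insert.prems(1) _ _ that True] herm[of x t] that insert.hyps by (metis complex_cnj_zero finite_insert insertI1)+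
    then show ?thesis
      unfolding sum_insert2[OF insert.hyps] using insert.IH[OF MS LS] by simp
  next
    case False
    define m where "m = complex_of_real (Re (M x x))"
    have m: "m \<noteq> 0" "0 < Re m" "cnj m = m" "Im m = 0" using False diag by (auto simp: m_def)
    have Mm: "M x x = m" unfolding m_def by (rule im)
    define M' where "M' s t = M s t - M s x * M x t / m" for s t
    have 0: "M' x t = 0" "M' t x = 0" for t using m by (auto simp: M'_def Mm)
    have "psd_kernel S M'"
      unfolding psd_kernel_def
    proof (intro conjI ballI allI)
      fix s t assume "s \<in> S" "t \<in> S"
      then have h: "M t s = cnj (M s t)" "M x s = cnj (M s x)" "M t x = cnj (M x t)"
        by (auto intro: herm)
      show "M' t s = cnj (M' s t)" unfolding M'_def h by (simp add: m mult.commute)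
    next
      fix c :: "'a \<Rightarrow> complex"
      define b where "b = (\<Sum>t\<in>S. c t * M x t)"
      \<comment> \<open>The coefficient -b/m at x completes the square: the form of M at d equals
        the form of M' at c.\<close>
      define d where "d s = (if s = x then - b / m else c s)" for s
      have "cnj b = (\<Sum>s\<in>S. cnj (c s) * cnj (M x s))" by (simp add: b_def)
      also have "\<dots> = (\<Sum>s\<in>S. cnj (c s) * M s x)"
        by (rule sum.cong[OF refl]) (metis herm insertI1 insertI2)
      finally have b: "cnj b = (\<Sum>s\<in>S. cnj (c s) * M s x)" .
      have dS: "d s = c s" if "s \<in> S" for s using that insert.hyps by (auto simp: d_def)
      have "(\<Sum>s\<in>insert x S. \<Sum>t\<in>insert x S. cnj (d s) * d t * M s t)
        = cnj (d x) * d x * m + cnj (d x) * b + d x * cnj b + (\<Sum>s\<in>S. \<Sum>t\<in>S. cnj (c s) * c t * M s t)"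
        unfolding sum_insert2[OF insert.hyps] b Mm unfolding b_def sum_distrib_left
        by (intro arg_cong2[where f = "(+)"] refl sum.cong) (auto simp: dS mult_ac)
      also have "cnj (d x) * d x * m + cnj (d x) * b + d x * cnj b = - (cnj b * b / m)"
        using m by (simp add: d_def field_simps)
      also have "cnj b * b / m = (\<Sum>s\<in>S. \<Sum>t\<in>S. cnj (c s) * c t * (M s x * M x t / m))"
        unfolding b unfolding b_def sum_product sum_divide_distrib by (intro sum.cong refl) simp
      also have "- \<dots> + (\<Sum>s\<in>S. \<Sum>t\<in>S. cnj (c s) * c t * M s t)
          = (\<Sum>s\<in>S. \<Sum>t\<in>S. cnj (c s) * c t * M' s t)"
        by (simp add: M'_def right_diff_distrib sum_subtractf)
      finally have e: "(\<Sum>s\<in>insert x S. \<Sum>t\<in>insert x S. cnj (d s) * d t * M s t)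
        = (\<Sum>s\<in>S. \<Sum>t\<in>S. cnj (c s) * c t * M' s t)" .
      have "0 \<le> Re (\<Sum>s\<in>insert x S. \<Sum>t\<in>insert x S. cnj (d s) * d t * M s t)"
        by (rule psd_kernel_nonneg[OF insert.prems(1)])
      then show "0 \<le> Re (\<Sum>s\<in>S. \<Sum>t\<in>S. cnj (c s) * c t * M' s t)" unfolding e .
    qed
    then have 1: "0 \<le> Re (\<Sum>s\<in>S. \<Sum>t\<in>S. M' s t * L s t)" using insert.IH LS by blast
    have "(\<Sum>s\<in>insert x S. \<Sum>t\<in>insert x S. M s t * L s t)
      = (\<Sum>s\<in>insert x S. \<Sum>t\<in>insert x S. M' s t * L s t)
        + (\<Sum>s\<in>insert x S. \<Sum>t\<in>insert x S. M s x * M x t * L s t) / m"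
      unfolding sum.distrib[symmetric] sum_divide_distrib
      by (intro sum.cong refl) (simp add: M'_def left_diff_distrib)
    also have "(\<Sum>s\<in>insert x S. \<Sum>t\<in>insert x S. M' s t * L s t) = (\<Sum>s\<in>S. \<Sum>t\<in>S. M' s t * L s t)"
      unfolding sum_insert2[OF insert.hyps] by (simp add: 0)
    also have "(\<Sum>s\<in>insert x S. \<Sum>t\<in>insert x S. M s x * M x t * L s t)
        = (\<Sum>s\<in>insert x S. \<Sum>t\<in>insert x S. cnj (M x s) * M x t * L s t)"
      by (rule sum.cong[OF refl], rule sum.cong[OF refl]) (metis herm insertI1)
    finally have "Re (\<Sum>s\<in>insert x S. \<Sum>t\<in>insert x S. M s t * L s t)
      = Re (\<Sum>s\<in>S. \<Sum>t\<in>S. M' s t * L s t)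
        + Re (\<Sum>s\<in>insert x S. \<Sum>t\<in>insert x S. cnj (M x s) * M x t * L s t) / Re m"
      by (simp add: m_def Re_divide_of_real del: sum.insert)
    moreover have "0 \<le> Re (\<Sum>s\<in>insert x S. \<Sum>t\<in>insert x S. cnj (M x s) * M x t * L s t)"
      by (rule psd_kernel_nonneg[OF insert.prems(2)])
    ultimately show ?thesis using 1 m by simp
  qed
qed simp

section \<open>C*-seminorms on unital *-algebras\<close>

lemma complex_ring_simps [simp]:
  "carrier complex_ring = UNIV" "x \<otimes>\<^bsub>complex_ring\<^esub> y = x * y" "\<one>\<^bsub>complex_ring\<^esub> = 1"
  "\<zero>\<^bsub>complex_ring\<^esub> = 0" "x \<oplus>\<^bsub>complex_ring\<^esub> y = x + y"
  by (simp_all add: complex_ring_def)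

lemma complex_ring_cring: "cring complex_ring"
  by (intro cringI abelian_groupI comm_monoidI)
     (auto simp: algebra_simps intro: exI[of _ "- _"] add.left_inverse)

lemma complex_ring_minus [simp]: "\<ominus>\<^bsub>complex_ring\<^esub> x = - x"
proof -
  interpret cring complex_ring by (rule complex_ring_cring)
  show ?thesis using minus_equality[of "- x" x] by simp
qed

context unital_star_algebra
begin

lemma s_closed [simp]: "x \<in> carrier A \<Longrightarrow> c \<odot> x \<in> carrier A"
  by (rule smult_closed) simp_all

lemma s_plus: "x \<in> carrier A \<Longrightarrow> (c + d) \<odot> x = c \<odot> x \<oplus> d \<odot> x"
  using smult_l_distr[of c d x] by simp

lemma s_add: "x \<in> carrier A \<Longrightarrow> y \<in> carrier A \<Longrightarrow> c \<odot> (x \<oplus> y) = c \<odot> x \<oplus> c \<odot> y"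
  using smult_r_distr[of c x y] by simp

lemma s_assoc [simp]: "x \<in> carrier A \<Longrightarrow> c \<odot> (d \<odot> x) = (c * d) \<odot> x"
  using smult_assoc1[of c d x] by simp

lemma s_one [simp]: "x \<in> carrier A \<Longrightarrow> 1 \<odot> x = x"
  using smult_one[of x] by simp

lemma s_zero_left [simp]: "x \<in> carrier A \<Longrightarrow> 0 \<odot> x = \<zero>"
  using smult_l_null[of x] by simp

lemma s_zero_right [simp]: "c \<odot> \<zero> = \<zero>"
  using smult_r_null[of c] by simp

lemma neg_s: "x \<in> carrier A \<Longrightarrow> \<ominus> x = (-1) \<odot> x"
  using smult_l_minus[of 1 x] by simp

lemma diff_s: "x \<in> carrier A \<Longrightarrow> y \<in> carrier A \<Longrightarrow> x \<ominus> y = x \<oplus> (-1) \<odot> y"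
  by (simp add: a_minus_def neg_s)

declare star_closed [simp] star_star [simp]

lemma star_one [simp]: "star A \<one> = \<one>"
  by (metis one_closed r_one star_closed star_mult star_star)

lemma star_zero [simp]: "star A \<zero> = \<zero>"
  using star_smult[of \<zero> 0] by simp

lemma star_diff: "x \<in> carrier A \<Longrightarrow> y \<in> carrier A \<Longrightarrow> star A (x \<ominus> y) = star A x \<ominus> star A y"
  by (simp add: diff_s star_add star_smult)

lemmas smult_mult = smult_mult_left smult_mult_right

lemma a_4: "\<lbrakk>x \<in> carrier A; y \<in> carrier A; u \<in> carrier A; v \<in> carrier A\<rbrakk>
   \<Longrightarrow> (x \<oplus> y) \<oplus> (u \<oplus> v) = (x \<oplus> u) \<oplus> (y \<oplus> v)"
  by (simp add: a_ac)

subsection \<open>Evaluation of polynomials\<close>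

definition peval :: "'a \<Rightarrow> complex poly \<Rightarrow> 'a" where
  "peval h F = fold_coeffs (\<lambda>a y. a \<odot> \<one> \<oplus> h \<otimes> y) F \<zero>"

lemma peval_0 [simp]: "peval h 0 = \<zero>"
  by (simp add: peval_def)

lemma peval_pCons: "h \<in> carrier A \<Longrightarrow> peval h (pCons a F) = a \<odot> \<one> \<oplus> h \<otimes> peval h F"
  by (cases "a = 0 \<and> F = 0") (auto simp: peval_def)

lemma peval_closed [simp]: "h \<in> carrier A \<Longrightarrow> peval h F \<in> carrier A"
  by (induction F) (auto simp: peval_pCons)

lemma peval_const: "h \<in> carrier A \<Longrightarrow> peval h [:c:] = c \<odot> \<one>"
  by (simp add: peval_pCons)

lemma peval_one [simp]: "h \<in> carrier A \<Longrightarrow> peval h 1 = \<one>"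
  using peval_const[of h 1] by (simp add: one_pCons)

lemma peval_X [simp]: "h \<in> carrier A \<Longrightarrow> peval h [:0, 1:] = h"
  by (simp add: peval_pCons)

lemma peval_add: "h \<in> carrier A \<Longrightarrow> peval h (F + G) = peval h F \<oplus> peval h G"
proof (induction F G rule: poly_induct2)
  case (pCons a F b G)
  then show ?case by (simp add: peval_pCons s_plus r_distr a_4)
qed simp

lemma peval_smult: "h \<in> carrier A \<Longrightarrow> peval h (Polynomial.smult c F) = c \<odot> peval h F"
  by (induction F) (simp_all add: peval_pCons s_add smult_mult)

lemma peval_mult: "h \<in> carrier A \<Longrightarrow> peval h (F * G) = peval h F \<otimes> peval h G"
proof (induction F)
  case (pCons a F)
  then show ?case
    by (simp add: peval_pCons peval_add peval_smult smult_mult l_distr m_assoc)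
qed simp

lemma peval_diff: "h \<in> carrier A \<Longrightarrow> peval h (F - G) = peval h F \<ominus> peval h G"
  using peval_add[of h F "Polynomial.smult (-1) G"] peval_smult[of h "-1" G] by (simp add: diff_s)

lemma peval_commute: "h \<in> carrier A \<Longrightarrow> peval h F \<otimes> peval h G = peval h G \<otimes> peval h F"
  by (metis mult.commute peval_mult)

text \<open>Intended for a = x*x and b = xx*, which are intertwined by x; it transfers polynomials
  between the two in \<open>pos_star_mult\<close>.\<close>

lemma peval_intertwine:
  assumes "a \<in> carrier A" "b \<in> carrier A" "x \<in> carrier A" "x \<otimes> a = b \<otimes> x"
  shows "x \<otimes> peval a F = peval b F \<otimes> x"
proof (induction F)
  case (pCons c F)
  have "x \<otimes> (a \<otimes> peval a F) = b \<otimes> (x \<otimes> peval a F)"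
    using assms by (simp flip: m_assoc)
  then show ?case using assms pCons
    by (simp add: peval_pCons r_distr l_distr smult_mult m_assoc)
qed (use assms in simp)

lemma star_peval:
  "h \<in> carrier A \<Longrightarrow> star A h = h \<Longrightarrow> star A (peval h F) = peval h (map_poly cnj F)"
proof (induction F)
  case (pCons a F)
  have "peval h (map_poly cnj F) \<otimes> h = h \<otimes> peval h (map_poly cnj F)"
    using peval_commute[of h "[:0,1:]" "map_poly cnj F"] pCons by simp
  then show ?case using pCons
    by (simp add: peval_pCons map_poly_pCons star_add star_smult star_mult)
qed simp

definition cpx :: "real poly \<Rightarrow> complex poly" where
  "cpx P = map_poly complex_of_real P"

end

lemma (in unital_star_algebra) cpx_simps:
  "cpx (P + Q) = cpx P + cpx Q" "cpx (P - Q) = cpx P - cpx Q" "cpx (Polynomial.smult r P) = Polynomial.smult (complex_of_real r) (cpx P)"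
  "cpx (P * Q) = cpx P * cpx Q" "cpx 1 = 1" "cpx 0 = 0" "cpx [:0, 1:] = [:0, 1:]" "cpx [:r:] = [:complex_of_real r:]"
  "map_poly cnj (cpx P) = cpx P"
  by (simp_all add: cpx_def poly_eq_iff coeff_map_poly coeff_mult map_poly_pCons)

context unital_star_algebra
begin

definition rpeval :: "'a \<Rightarrow> real poly \<Rightarrow> 'a" where
  "rpeval h P = peval h (cpx P)"

lemma rpeval_simps:
  assumes "h \<in> carrier A"
  shows "rpeval h P \<in> carrier A" "rpeval h (P + Q) = rpeval h P \<oplus> rpeval h Q" "rpeval h (P - Q) = rpeval h P \<ominus> rpeval h Q"
    "rpeval h (Polynomial.smult r P) = complex_of_real r \<odot> rpeval h P" "rpeval h (P * Q) = rpeval h P \<otimes> rpeval h Q"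
    "rpeval h 1 = \<one>" "rpeval h 0 = \<zero>" "rpeval h [:0, 1:] = h" "rpeval h [:r:] = complex_of_real r \<odot> \<one>"
    "rpeval h (P\<^sup>2) = rpeval h P \<otimes> rpeval h P"
  using assms by (simp_all add: rpeval_def cpx_simps peval_add peval_mult peval_smult peval_diff peval_const power2_eq_square)

lemma star_rpeval: "h \<in> carrier A \<Longrightarrow> star A h = h \<Longrightarrow> star A (rpeval h P) = rpeval h P"
  by (simp add: rpeval_def star_peval cpx_simps)

lemma rpeval_intertwine:
  "\<lbrakk>a \<in> carrier A; b \<in> carrier A; x \<in> carrier A; x \<otimes> a = b \<otimes> x\<rbrakk> \<Longrightarrow> x \<otimes> rpeval a P = rpeval b P \<otimes> x"
  unfolding rpeval_def by (rule peval_intertwine)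

end

locale cstar_seminormed = unital_star_algebra A
  for A :: "('a, 'm) star_alg_scheme" (structure) +
  fixes p :: "'a \<Rightarrow> real"
  assumes seminorm: "cstar_seminorm A p"
begin

lemma p_nonneg: "x \<in> carrier A \<Longrightarrow> 0 \<le> p x"
  and p_triangle: "x \<in> carrier A \<Longrightarrow> y \<in> carrier A \<Longrightarrow> p (x \<oplus> y) \<le> p x + p y"
  and p_smult: "x \<in> carrier A \<Longrightarrow> p (c \<odot> x) = cmod c * p x"
  and p_mult: "x \<in> carrier A \<Longrightarrow> y \<in> carrier A \<Longrightarrow> p (x \<otimes> y) \<le> p x * p y"
  and p_cstar: "x \<in> carrier A \<Longrightarrow> p (star A x \<otimes> x) = (p x)\<^sup>2"
  using seminorm unfolding cstar_seminorm_def by blast+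

lemma p_zero [simp]: "p \<zero> = 0"
  using p_smult[of \<zero> 0] by simp

lemma p_neg: "x \<in> carrier A \<Longrightarrow> p (\<ominus> x) = p x"
  by (simp add: neg_s p_smult)

lemma p_diff: "x \<in> carrier A \<Longrightarrow> y \<in> carrier A \<Longrightarrow> p (x \<ominus> y) \<le> p x + p y"
  using p_triangle[of x "\<ominus> y"] by (simp add: a_minus_def p_neg)

lemma p_one_cases: "p \<one> = 0 \<or> p \<one> = 1"
  using p_cstar[of \<one>] by (simp add: power2_eq_square)

lemma p_one_le: "p \<one> \<le> 1"
  using p_one_cases by auto

lemma p_star: "x \<in> carrier A \<Longrightarrow> p (star A x) = p x"
proof -
  have le: "p x \<le> p (star A x)" if x: "x \<in> carrier A" for x
  proof -
    have "p x * p x \<le> p (star A x) * p x"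
      using p_cstar[OF x] p_mult[of "star A x" x] x by (simp add: power2_eq_square)
    then show ?thesis using p_nonneg[of x] p_nonneg[of "star A x"] x
      by (cases "p x = 0") auto
  qed
  assume "x \<in> carrier A"
  then show ?thesis using le[of x] le[of "star A x"] by simp
qed

text \<open>For the last axiom put u = P(h) + i Q(h). Then \<open>star A u\<close> times u is (P^2 +
  Q^2)(h), so the C*-identity computes p u, and P(h) is the mean of u and its adjoint, which have
  the same seminorm.\<close>

lemma p_poly_seminorm:
  assumes h: "h \<in> carrier A" "star A h = h"
  shows "poly_seminorm (\<lambda>P. p (rpeval h P))"
proof
  fix P Q :: "real poly" and c :: real
  show "0 \<le> p (rpeval h P)" "p (rpeval h (P + Q)) \<le> p (rpeval h P) + p (rpeval h Q)"
    "p (rpeval h (Polynomial.smult c P)) = \<bar>c\<bar> * p (rpeval h P)" "p (rpeval h (P * Q)) \<le> p (rpeval h P) * p (rpeval h Q)"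
    using h by (auto simp: rpeval_simps p_nonneg p_triangle p_smult p_mult)
  define u where "u = peval h (cpx P + Polynomial.smult \<i> (cpx Q))"
  define v where "v = peval h (cpx P + Polynomial.smult (- \<i>) (cpx Q))"
  have uv: "u \<in> carrier A" "v \<in> carrier A" using h by (auto simp: u_def v_def)
  have "map_poly cnj (cpx P + Polynomial.smult \<i> (cpx Q)) = cpx P + Polynomial.smult (- \<i>) (cpx Q)"
    using cpx_simps(9)[of P] cpx_simps(9)[of Q] by (simp add: poly_eq_iff coeff_map_poly)
  then have su: "star A u = v" using h by (simp add: u_def v_def star_peval)
  have "(cpx P + Polynomial.smult (- \<i>) (cpx Q)) * (cpx P + Polynomial.smult \<i> (cpx Q)) = cpx (P\<^sup>2 + Q\<^sup>2)"
    by (simp add: cpx_simps power2_eq_square algebra_simps)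
  then have vu: "v \<otimes> u = rpeval h (P\<^sup>2 + Q\<^sup>2)" using h by (simp add: u_def v_def rpeval_def flip: peval_mult)
  have "Polynomial.smult (1/2) ((cpx P + Polynomial.smult \<i> (cpx Q)) + (cpx P + Polynomial.smult (- \<i>) (cpx Q))) = cpx P"
    by (intro poly_eqI, simp only: coeff_smult coeff_add) (simp add: algebra_simps)
  then have "rpeval h P = (1/2) \<odot> (u \<oplus> v)"
    using h by (simp add: u_def v_def rpeval_def flip: peval_add peval_smult)
  then have "p (rpeval h P) = 1/2 * p (u \<oplus> v)" using uv by (simp add: p_smult)
  also have "\<dots> \<le> 1/2 * (p u + p v)" using uv by (intro mult_left_mono p_triangle) auto
  also have "p v = p u" using su uv p_star by metis
  finally have "p (rpeval h P) \<le> p u" by simp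
  then have "(p (rpeval h P))\<^sup>2 \<le> (p u)\<^sup>2" using h by (intro power_mono) (auto simp: p_nonneg rpeval_simps)
  also have "\<dots> = p (rpeval h (P\<^sup>2 + Q\<^sup>2))" using p_cstar[of u] uv su vu by simp
  finally show "(p (rpeval h P))\<^sup>2 \<le> p (rpeval h (P\<^sup>2 + Q\<^sup>2))" .
qed

definition sp :: "'a \<Rightarrow> real set" where
  "sp h = poly_seminorm.spec (\<lambda>P. p (rpeval h P))"

lemma sp_le: "h \<in> carrier A \<Longrightarrow> star A h = h \<Longrightarrow> t \<in> sp h \<Longrightarrow> \<bar>poly P t\<bar> \<le> p (rpeval h P)"
  unfolding sp_def using poly_seminorm.spec_le[OF p_poly_seminorm] by blast

lemma sp_abs_le: "h \<in> carrier A \<Longrightarrow> star A h = h \<Longrightarrow> t \<in> sp h \<Longrightarrow> \<bar>t\<bar> \<le> p h"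
  using sp_le[of h t "[:0, 1:]"] by (simp add: rpeval_simps)

lemma sp_attained:
  "h \<in> carrier A \<Longrightarrow> star A h = h \<Longrightarrow> 0 < p (rpeval h P) \<Longrightarrow> \<exists>t\<in>sp h. \<bar>poly P t\<bar> = p (rpeval h P)"
  unfolding sp_def using poly_seminorm.spec_attained[OF p_poly_seminorm] by blast

lemma sp_bound:
  "h \<in> carrier A \<Longrightarrow> star A h = h \<Longrightarrow> (\<And>t. t \<in> sp h \<Longrightarrow> \<bar>poly P t\<bar> \<le> M) \<Longrightarrow> 0 \<le> M \<Longrightarrow> p (rpeval h P) \<le> M"
  unfolding sp_def using poly_seminorm.spec_bound[OF p_poly_seminorm] by blast

subsection \<open>Positive elements\<close>

text \<open>The norm condition expresses a nonnegative spectrum, as \<open>pos_sp\<close> and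
  \<open>sp_pos\<close> show. In this form sums of positive elements are a matter of the triangle
  inequality, and no square root has to exist.\<close>

definition pos :: "'a \<Rightarrow> bool" where
  "pos h \<longleftrightarrow> h \<in> carrier A \<and> star A h = h \<and> (\<exists>c\<ge>0. p (complex_of_real c \<odot> \<one> \<ominus> h) \<le> c)"

lemma pos_rpeval_sp:
  assumes h: "h \<in> carrier A" "star A h = h" and P: "pos (rpeval h P)" and t: "t \<in> sp h"
  shows "0 \<le> poly P t"
proof -
  obtain c where c: "p (complex_of_real c \<odot> \<one> \<ominus> rpeval h P) \<le> c" using P by (auto simp: pos_def)
  have "\<bar>poly ([:c:] - P) t\<bar> \<le> p (rpeval h ([:c:] - P))" using h t by (rule sp_le)
  also have "\<dots> \<le> c" using c h by (simp add: rpeval_simps)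
  finally show ?thesis by simp
qed

text \<open>With c = p (P(h)) the values of P on the spectrum lie in [0, c], so c - P is bounded by
  c there.\<close>

lemma sp_pos_rpeval:
  assumes h: "h \<in> carrier A" "star A h = h" and P: "\<And>t. t \<in> sp h \<Longrightarrow> 0 \<le> poly P t"
  shows "pos (rpeval h P)"
proof -
  define c where "c = p (rpeval h P)"
  have c: "0 \<le> c" using h by (simp add: c_def p_nonneg rpeval_simps)
  have "p (rpeval h ([:c:] - P)) \<le> c"
  proof (rule sp_bound[OF h])
    fix t assume t: "t \<in> sp h"
    show "\<bar>poly ([:c:] - P) t\<bar> \<le> c" using P[OF t] sp_le[OF h t, of P] by (simp add: c_def)
  qed (rule c)
  then show ?thesis unfolding pos_def using c h by (auto simp: rpeval_simps star_rpeval)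
qed

lemma pos_sp: "pos h \<Longrightarrow> t \<in> sp h \<Longrightarrow> 0 \<le> t"
  using pos_rpeval_sp[of h "[:0, 1:]" t] by (auto simp: pos_def rpeval_simps)

lemma sp_pos: "h \<in> carrier A \<Longrightarrow> star A h = h \<Longrightarrow> (\<And>t. t \<in> sp h \<Longrightarrow> 0 \<le> t) \<Longrightarrow> pos h"
  using sp_pos_rpeval[of h "[:0, 1:]"] by (simp add: rpeval_simps)

lemma pos_square: "h \<in> carrier A \<Longrightarrow> star A h = h \<Longrightarrow> pos (h \<otimes> h)"
  using sp_pos_rpeval[of h "[:0, 1:]\<^sup>2"] by (simp add: rpeval_simps)

lemma pos_add:
  assumes "pos h" "pos k"
  shows "pos (h \<oplus> k)"
proof -
  obtain c d where cd: "0 \<le> c" "0 \<le> d" "p (complex_of_real c \<odot> \<one> \<ominus> h) \<le> c"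
    "p (complex_of_real d \<odot> \<one> \<ominus> k) \<le> d" using assms by (auto simp: pos_def)
  have hk: "h \<in> carrier A" "k \<in> carrier A" "star A h = h" "star A k = k" using assms by (auto simp: pos_def)
  have "complex_of_real (c + d) \<odot> \<one> \<ominus> (h \<oplus> k)
      = (complex_of_real c \<odot> \<one> \<ominus> h) \<oplus> (complex_of_real d \<odot> \<one> \<ominus> k)"
    using hk by (simp add: diff_s s_plus s_add a_4)
  then have "p (complex_of_real (c + d) \<odot> \<one> \<ominus> (h \<oplus> k)) \<le> c + d"
    using p_triangle[of "complex_of_real c \<odot> \<one> \<ominus> h" "complex_of_real d \<odot> \<one> \<ominus> k"] hk cd
    by simp
  then show ?thesis unfolding pos_def using hk cd by (auto simp: star_add intro!: exI[of _ "c + d"])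
qed

lemma pos_scale:
  assumes "pos h" "0 \<le> r"
  shows "pos (complex_of_real r \<odot> h)"
proof -
  have h: "h \<in> carrier A" "star A h = h" using assms by (auto simp: pos_def)
  have "pos (rpeval h (Polynomial.smult r [:0, 1:]))"
    by (rule sp_pos_rpeval[OF h]) (use pos_sp[OF assms(1)] assms(2) in auto)
  then show ?thesis using h by (simp only: rpeval_simps)
qed

text \<open>
  Kaplansky's theorem. With \<open>a = x\<^sup>*x\<close>, \<open>b = xx\<^sup>*\<close>, \<open>R = p a = p b\<close> and \<open>y = x(R - a)\<^sup>n\<close>, the sum
  \<open>y\<^sup>*y + yy\<^sup>* = F(a) + F(b)\<close>, where \<open>F(t) = t(R - t)\<^sup>2\<^sup>n\<close>, is a sum of squares of selfadjoint elements.
  As \<open>F \<le> R\<^sup>2\<^sup>n\<^sup>+\<^sup>1\<close> on the spectrum of \<open>b\<close>, it follows that \<open>F \<ge> -R\<^sup>2\<^sup>n\<^sup>+\<^sup>1\<close> on the spectrum of \<open>a\<close>, for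
  all \<open>n\<close>, which excludes negative points.
\<close>

theorem pos_star_mult:
  assumes x: "x \<in> carrier A"
  shows "pos (star A x \<otimes> x)"
proof -
  define a where "a = star A x \<otimes> x"
  define b where "b = x \<otimes> star A x"
  have ab: "a \<in> carrier A" "star A a = a" "b \<in> carrier A" "star A b = b"
    using x by (auto simp: a_def b_def star_mult)
  define R where "R = p a"
  have R0: "0 \<le> R" using ab p_nonneg by (simp add: R_def)
  have pb: "p b = R"
    using p_cstar[of "star A x"] p_cstar[of x] p_star[of x] x by (simp add: R_def a_def b_def)
  \<comment> \<open>This relation carries polynomials in a across x to polynomials in b, and so
    identifies y times its adjoint as a polynomial in b.\<close>
  have xa: "x \<otimes> a = b \<otimes> x" using x by (simp add: a_def b_def m_assoc)
  have bound: "t * (R - t) ^ (2 * n) \<ge> - (R ^ (2 * n + 1))" if t: "t \<in> sp a" for t n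
  proof -
    define g where "g = [:R, -1:] ^ n"
    define F where "F = [:0, 1:] * g\<^sup>2"
    define C where "C = R ^ (2 * n + 1)"
    have F: "poly F s = s * (R - s) ^ (2 * n)" for s
      by (simp add: F_def g_def flip: power_mult) (simp add: mult.commute)
    define y where "y = x \<otimes> rpeval a g"
    have y: "y \<in> carrier A" using x ab by (simp add: y_def rpeval_simps)
    have sy: "star A y = rpeval a g \<otimes> star A x" using x ab by (simp add: y_def star_mult star_rpeval rpeval_simps)
    have "star A y \<otimes> y = rpeval a g \<otimes> (a \<otimes> rpeval a g)"
    proof -
      define G where "G = rpeval a g"
      have G: "G \<in> carrier A" using ab by (simp add: G_def rpeval_simps)
      show ?thesis
        unfolding sy unfolding y_def G_def[symmetric] using x G by (simp add: a_def m_assoc)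
    qed
    also have "\<dots> = rpeval a (g * ([:0,1:] * g))" using ab by (simp only: rpeval_simps)
    also have "g * ([:0,1:] * g) = F" by (simp only: F_def power2_eq_square mult_ac)
    finally have yy1: "star A y \<otimes> y = rpeval a F" .
    have "y \<otimes> star A y = (x \<otimes> rpeval a (g * g)) \<otimes> star A x"
      unfolding sy unfolding y_def using x ab by (simp add: m_assoc rpeval_simps)
    also have "\<dots> = rpeval b (g * g) \<otimes> b"
      unfolding rpeval_intertwine[OF ab(1,3) x xa] using x ab by (simp add: m_assoc rpeval_simps b_def)
    also have "\<dots> = rpeval b ((g * g) * [:0,1:])" using ab by (simp only: rpeval_simps)
    also have "(g * g) * [:0,1:] = F" by (simp only: F_def power2_eq_square mult_ac)
    finally have yy2: "y \<otimes> star A y = rpeval b F" .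
    define u where "u = y \<oplus> star A y"
    \<comment> \<open>Up to factors of modulus 2, u and v are the real and imaginary parts of y. In
      u^2 + v^2 the squares of y and of its adjoint cancel, leaving twice the two mixed
      products.\<close>
    define v where "v = \<i> \<odot> (y \<oplus> (-1) \<odot> star A y)"
    have uv: "u \<in> carrier A" "v \<in> carrier A" using y by (auto simp: u_def v_def)
    have "star A u = u" using y by (simp add: u_def star_add a_comm)
    moreover have "star A v = v" using y by (simp add: v_def star_add star_smult s_add a_comm)
    ultimately have "pos (u \<otimes> u \<oplus> v \<otimes> v)" using uv by (intro pos_add pos_square)
    then have 1: "pos (complex_of_real (1/2) \<odot> (u \<otimes> u \<oplus> v \<otimes> v))" by (rule pos_scale) simp
    have "complex_of_real (1/2) \<odot> (u \<otimes> u \<oplus> v \<otimes> v) = star A y \<otimes> y \<oplus> y \<otimes> star A y"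
    proof -
      let ?s = "star A y"
      let ?a = "y \<otimes> y" and ?b = "y \<otimes> ?s" and ?c = "?s \<otimes> y" and ?d = "?s \<otimes> ?s"
      have delta: "u \<otimes> u = (?a \<oplus> ?d) \<oplus> (?b \<oplus> ?c)"
        using y by (simp add: u_def l_distr r_distr a_ac)
      have vv: "v \<otimes> v = (-1) \<odot> (?a \<oplus> ?d) \<oplus> (?b \<oplus> ?c)"
        using y by (simp add: v_def l_distr r_distr smult_mult s_add a_ac)
      have "u \<otimes> u \<oplus> v \<otimes> v = ((?a \<oplus> ?d) \<oplus> (-1) \<odot> (?a \<oplus> ?d)) \<oplus> ((?b \<oplus> ?c) \<oplus> (?b \<oplus> ?c))"
        unfolding delta vv by (rule a_4) (use y in simp_all)
      also have "(?a \<oplus> ?d) \<oplus> (-1) \<odot> (?a \<oplus> ?d) = \<zero>"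
        using y by (simp only: neg_s[symmetric] a_closed m_closed star_closed r_neg)
      also have "(?b \<oplus> ?c) \<oplus> (?b \<oplus> ?c) = 2 \<odot> (?b \<oplus> ?c)"
        using y s_plus[of "?b \<oplus> ?c" 1 1] by simp
      finally show ?thesis using y by (simp add: a_comm)
    qed
    then have 2: "pos (rpeval a F \<oplus> rpeval b F)" using 1 yy1 yy2 by simp
    have 3: "pos (rpeval b ([:C:] - F))"
    proof (rule sp_pos_rpeval[OF ab(3,4)])
      fix s assume "s \<in> sp b"
      then have s: "\<bar>s\<bar> \<le> R" using sp_abs_le[OF ab(3,4)] pb by simp
      have "s * (R - s) ^ (2 * n) \<le> C"
      proof (cases "0 \<le> s")
        case True
        have "s * (R - s) ^ (2 * n) \<le> R * R ^ (2 * n)"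
          using s True by (intro mult_mono power_mono) auto
        then show ?thesis by (simp add: C_def)
      next
        case False
        then have "s * (R - s) ^ (2 * n) \<le> 0" using s by (intro mult_nonpos_nonneg) auto
        also have "0 \<le> C" using R0 by (simp add: C_def)
        finally show ?thesis .
      qed
      then show "0 \<le> poly ([:C:] - F) s" by (simp add: F)
    qed
    \<comment> \<open>Adding the positive element C - F(b) eliminates b altogether.\<close>
    have "(rpeval a F \<oplus> rpeval b F) \<oplus> rpeval b ([:C:] - F) = rpeval a F \<oplus> rpeval b (F + ([:C:] - F))"
      using ab by (simp only: rpeval_simps(1,2) a_assoc a_closed)
    also have "rpeval b (F + ([:C:] - F)) = rpeval a [:C:]" using ab by (simp add: rpeval_simps)
    also have "rpeval a F \<oplus> rpeval a [:C:] = rpeval a (F + [:C:])" using ab by (simp only: rpeval_simps)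
    finally have "pos (rpeval a (F + [:C:]))" using pos_add[OF 2 3] by simp
    from pos_rpeval_sp[OF ab(1,2) this t] show ?thesis by (simp add: F C_def)
  qed
  have "0 \<le> t" if t: "t \<in> sp a" for t
  proof (rule ccontr)
    assume neg: "\<not> 0 \<le> t"
    have tR: "\<bar>t\<bar> \<le> R" using sp_abs_le[OF ab(1,2) t] by (simp add: R_def)
    then have R: "0 < R" using neg by auto
    \<comment> \<open>For t < 0 the bound reads |t| (R + |t|)^(2n) \<le> R^(2n+1), that is r^(2n)
      \<le> R / |t|, which fails for large n because r > 1.\<close>
    define r where "r = (R + \<bar>t\<bar>) / R"
    have r: "1 < r" using R neg by (simp add: r_def)
    obtain n where n: "R / \<bar>t\<bar> < r ^ n" using real_arch_pow[OF r] by blast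
    have "r ^ n \<le> r ^ (2 * n)" using r by (intro power_increasing) auto
    then have "R / \<bar>t\<bar> < r ^ (2 * n)" using n by simp
    then have "R * R ^ (2 * n) < \<bar>t\<bar> * (R + \<bar>t\<bar>) ^ (2 * n)"
      using neg R by (simp add: r_def power_divide field_simps)
    moreover have "\<bar>t\<bar> * (R + \<bar>t\<bar>) ^ (2 * n) = - (t * (R - t) ^ (2 * n))" using neg by simp
    ultimately show False using bound[OF t, of n] by simp
  qed
  then show ?thesis using sp_pos[OF ab(1,2)] by (simp add: a_def)
qed

end

section \<open>Positive functionals\<close>

text \<open>Hermitian symmetry is derived by polarization. Boundedness of the left multiplications
  is not automatic in an incomplete algebra; it is expressed by \<open>lbounded\<close> and proved
  separately.\<close>

locale positive_functional = unital_star_algebra A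
  for A :: "('a, 'm) star_alg_scheme" (structure) +
  fixes \<psi> :: "'a \<Rightarrow> complex"
  assumes psi_add: "x \<in> carrier A \<Longrightarrow> y \<in> carrier A \<Longrightarrow> \<psi> (x \<oplus> y) = \<psi> x + \<psi> y"
    and psi_smult: "x \<in> carrier A \<Longrightarrow> \<psi> (c \<odot> x) = c * \<psi> x"
    and psi_im: "x \<in> carrier A \<Longrightarrow> Im (\<psi> (star A x \<otimes> x)) = 0"
    and psi_nonneg: "x \<in> carrier A \<Longrightarrow> 0 \<le> Re (\<psi> (star A x \<otimes> x))"
begin

lemma psi_zero [simp]: "\<psi> \<zero> = 0"
  using psi_smult[of \<zero> 0] by simp

lemma psi_expand:
  assumes "x \<in> carrier A" "y \<in> carrier A"
  shows "\<psi> (star A (x \<oplus> c \<odot> y) \<otimes> (x \<oplus> c \<odot> y))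
    = \<psi> (star A x \<otimes> x) + c * \<psi> (star A x \<otimes> y) + cnj c * \<psi> (star A y \<otimes> x)
      + cnj c * c * \<psi> (star A y \<otimes> y)"
  using assms
  by (simp add: star_add star_smult l_distr r_distr smult_mult psi_add psi_smult algebra_simps)

text \<open>The form is real at x + y and at x + i y; the vanishing of the two imaginary parts gives
  the two components of the identity.\<close>

lemma psi_herm:
  assumes "x \<in> carrier A" "y \<in> carrier A"
  shows "\<psi> (star A y \<otimes> x) = cnj (\<psi> (star A x \<otimes> y))"
proof -
  have "Im (\<psi> (star A x \<otimes> y)) + Im (\<psi> (star A y \<otimes> x)) = 0"
    using psi_im[of "x \<oplus> 1 \<odot> y"] psi_im[of x] psi_im[of y] psi_expand[OF assms, of 1] assms
    by simp
  moreover have "Re (\<psi> (star A x \<otimes> y)) - Re (\<psi> (star A y \<otimes> x)) = 0"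
    using psi_im[of "x \<oplus> \<i> \<odot> y"] psi_im[of x] psi_im[of y] psi_expand[OF assms, of \<i>] assms
    by simp
  ultimately show ?thesis by (simp add: complex_eq_iff)
qed

lemma psi_star: "x \<in> carrier A \<Longrightarrow> \<psi> (star A x) = cnj (\<psi> x)"
  using psi_herm[of \<one> x] by simp

lemma Cauchy_Schwarz:
  assumes x: "x \<in> carrier A" and y: "y \<in> carrier A"
  shows "(cmod (\<psi> (star A y \<otimes> x)))\<^sup>2 \<le> Re (\<psi> (star A x \<otimes> x)) * Re (\<psi> (star A y \<otimes> y))"
proof -
  define X Y w where "X = Re (\<psi> (star A x \<otimes> x))" and "Y = Re (\<psi> (star A y \<otimes> y))"
    and "w = \<psi> (star A y \<otimes> x)"
  define a where "a = (cmod w)\<^sup>2"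
  have a: "a = Re w * Re w + Im w * Im w" by (simp add: a_def cmod_power2) (simp add: power2_eq_square)
  have w: "\<psi> (star A x \<otimes> y) = cnj w" using psi_herm[OF x y] by (simp add: w_def)
  have key: "0 \<le> X - 2 * t * a + t * t * a * Y" for t :: real
  proof -
    \<comment> \<open>The phase of c turns both cross terms into -t |w|^2, which leaves a real
      quadratic polynomial in t.\<close>
    define c where "c = - (complex_of_real t * w)"
    have c: "Re (c * cnj w) = - t * a" "Re (cnj c * w) = - t * a" "cnj c * c = complex_of_real (t * t * a)"
      by (simp_all add: c_def a algebra_simps complex_eq_iff)
    have "0 \<le> Re (\<psi> (star A (x \<oplus> c \<odot> y) \<otimes> (x \<oplus> c \<odot> y)))"
      using x y by (intro psi_nonneg) simp
    also have "\<dots> = X + Re (c * cnj w) + Re (cnj c * w) + Re (cnj c * c * \<psi> (star A y \<otimes> y))"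
      using psi_expand[OF x y, of c] by (simp add: X_def w flip: w_def)
    also have "\<dots> = X - t * a - t * a + t * t * a * Y"
      unfolding c by (simp add: Y_def)
    finally show ?thesis by (simp add: algebra_simps)
  qed
  have "0 \<le> Y" using psi_nonneg[OF y] by (simp add: Y_def)
  show ?thesis
  proof (cases "Y = 0")
    case True
    \<comment> \<open>If a were nonzero, the second choice of t would give X - 2ta = -1.\<close>
    have "a = 0"
      using key[of 0] key[of "(X + 1) / (2 * a)"] True by (cases "a = 0") (auto simp: field_simps)
    then show ?thesis using True by (simp add: a_def w_def Y_def)
  next
    case False
    then have "0 < Y" using \<open>0 \<le> Y\<close> by simp
    then have "a \<le> X * Y" using key[of "1 / Y"] by (simp add: field_simps)
    then show ?thesis by (simp add: a_def w_def X_def Y_def)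
  qed
qed

text \<open>The seminorm of the GNS space of \<psi>.\<close>

definition sn :: "'a \<Rightarrow> real" where
  "sn x = sqrt (Re (\<psi> (star A x \<otimes> x)))"

lemma sn_nonneg [simp]: "x \<in> carrier A \<Longrightarrow> 0 \<le> sn x"
  by (simp add: sn_def psi_nonneg)

lemma sn_square: "x \<in> carrier A \<Longrightarrow> \<psi> (star A x \<otimes> x) = complex_of_real ((sn x)\<^sup>2)"
  by (simp add: sn_def psi_nonneg complex_eq_iff psi_im)

lemma psi_bound: "x \<in> carrier A \<Longrightarrow> y \<in> carrier A \<Longrightarrow> cmod (\<psi> (star A y \<otimes> x)) \<le> sn x * sn y"
  by (rule power2_le_imp_le) (use Cauchy_Schwarz[of x y] in \<open>simp_all add: sn_square power_mult_distrib\<close>)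

lemma sn_smult: "x \<in> carrier A \<Longrightarrow> sn (c \<odot> x) = cmod c * sn x"
proof -
  assume x: "x \<in> carrier A"
  have "\<psi> (star A (c \<odot> x) \<otimes> (c \<odot> x)) = cnj c * c * \<psi> (star A x \<otimes> x)"
    using x by (simp add: star_smult smult_mult psi_smult)
  also have "cnj c * c = complex_of_real ((cmod c)\<^sup>2)" by (metis complex_norm_square mult.commute)
  finally show ?thesis using x by (simp add: sn_def real_sqrt_mult)
qed

lemma sn_triangle:
  assumes x: "x \<in> carrier A" and y: "y \<in> carrier A"
  shows "sn (x \<oplus> y) \<le> sn x + sn y"
proof (rule power2_le_imp_le)
  have "complex_of_real ((sn (x \<oplus> y))\<^sup>2) = \<psi> (star A x \<otimes> x) + \<psi> (star A x \<otimes> y) + \<psi> (star A y \<otimes> x) + \<psi> (star A y \<otimes> y)"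
    using psi_expand[OF x y, of 1] x y by (simp add: sn_square flip: sn_square[OF a_closed[OF x y]])
  then have "(sn (x \<oplus> y))\<^sup>2 = (sn x)\<^sup>2 + Re (\<psi> (star A x \<otimes> y)) + Re (\<psi> (star A y \<otimes> x)) + (sn y)\<^sup>2"
    using x y by (simp add: sn_square complex_eq_iff)
  also have "\<dots> \<le> (sn x)\<^sup>2 + sn y * sn x + sn x * sn y + (sn y)\<^sup>2"
    using psi_bound[OF x y] psi_bound[OF y x] complex_Re_le_cmod order_trans
    by (intro add_mono order_refl) blast+
  also have "\<dots> = (sn x + sn y)\<^sup>2" by (simp add: power2_eq_square algebra_simps)
  finally show "(sn (x \<oplus> y))\<^sup>2 \<le> (sn x + sn y)\<^sup>2" .
qed (use x y in simp)

lemma psi_psd_kernel: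
  assumes S: "finite S" and b: "\<And>s. s \<in> S \<Longrightarrow> b s \<in> carrier A"
  shows "psd_kernel S (\<lambda>s t. \<psi> (star A (b s) \<otimes> b t))"
  unfolding psd_kernel_def
proof (intro conjI ballI allI)
  fix s t assume "s \<in> S" "t \<in> S"
  then show "\<psi> (star A (b t) \<otimes> b s) = cnj (\<psi> (star A (b s) \<otimes> b t))" using b by (intro psi_herm) auto
next
  fix c :: "'b \<Rightarrow> complex"
  \<comment> \<open>Q T x says that, under \<psi>, x pairs with all elements like the linear
    combination of the b t over T with coefficients c t. Such an x is built by induction on T, and
    the form of the kernel at c is \<psi> of its adjoint times x.\<close>
  define Q where "Q T x \<longleftrightarrow> x \<in> carrier A \<and>
      (\<forall>y\<in>carrier A. \<psi> (star A y \<otimes> x) = (\<Sum>t\<in>T. c t * \<psi> (star A y \<otimes> b t))) \<and>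
      (\<forall>y\<in>carrier A. \<psi> (star A x \<otimes> y) = (\<Sum>s\<in>T. cnj (c s) * \<psi> (star A (b s) \<otimes> y)))" for T x
  have "finite T \<Longrightarrow> T \<subseteq> S \<Longrightarrow> \<exists>x. Q T x" for T
  proof (induction T rule: finite_induct)
    case empty
    have "Q {} \<zero>" by (simp add: Q_def)
    then show ?case by blast
  next
    case (insert t T)
    then obtain x where x: "Q T x" by auto
    have bt: "b t \<in> carrier A" using insert b by auto
    have "Q (insert t T) (c t \<odot> b t \<oplus> x)"
      using x bt insert(1,2)
      by (simp add: Q_def r_distr l_distr smult_mult psi_add psi_smult star_add star_smult)
    then show ?case by blast
  qed
  then obtain x where "Q S x" using S by blast
  then have x: "x \<in> carrier A"
      "\<And>y. y \<in> carrier A \<Longrightarrow> \<psi> (star A y \<otimes> x) = (\<Sum>t\<in>S. c t * \<psi> (star A y \<otimes> b t))"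
      "\<And>y. y \<in> carrier A \<Longrightarrow> \<psi> (star A x \<otimes> y) = (\<Sum>s\<in>S. cnj (c s) * \<psi> (star A (b s) \<otimes> y))" by (auto simp: Q_def)
  have "(\<Sum>s\<in>S. \<Sum>t\<in>S. cnj (c s) * c t * \<psi> (star A (b s) \<otimes> b t))
      = (\<Sum>s\<in>S. cnj (c s) * \<psi> (star A (b s) \<otimes> x))"
    using x(2) b by (intro sum.cong) (auto simp: sum_distrib_left mult.assoc)
  also have "\<dots> = \<psi> (star A x \<otimes> x)" using x(3)[OF x(1)] by simp
  finally show "0 \<le> Re (\<Sum>s\<in>S. \<Sum>t\<in>S. cnj (c s) * c t * \<psi> (star A (b s) \<otimes> b t))"
    using psi_nonneg[OF x(1)] by simp
qed

subsection \<open>The operator seminorm of the GNS representation\<close>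

definition lbounded :: "'a \<Rightarrow> bool" where
  "lbounded b \<longleftrightarrow> (\<exists>C\<ge>0. \<forall>x\<in>carrier A. sn (b \<otimes> x) \<le> C * sn x)"

lemma lbounded_add:
  assumes "b \<in> carrier A" "c \<in> carrier A" "lbounded b" "lbounded c"
  shows "lbounded (b \<oplus> c)"
proof -
  obtain C D where "0 \<le> C" "0 \<le> D" and CD: "\<And>x. x \<in> carrier A \<Longrightarrow> sn (b \<otimes> x) \<le> C * sn x"
    "\<And>x. x \<in> carrier A \<Longrightarrow> sn (c \<otimes> x) \<le> D * sn x" using assms unfolding lbounded_def by blast
  have "sn ((b \<oplus> c) \<otimes> x) \<le> (C + D) * sn x" if x: "x \<in> carrier A" for x
    using sn_triangle[of "b \<otimes> x" "c \<otimes> x"] CD[OF x] x assms by (simp add: l_distr distrib_right)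
  then show ?thesis using \<open>0 \<le> C\<close> \<open>0 \<le> D\<close> unfolding lbounded_def by (intro exI[of _ "C + D"]) auto
qed

lemma lbounded_smult:
  assumes "b \<in> carrier A" "lbounded b"
  shows "lbounded (k \<odot> b)"
proof -
  obtain C where "0 \<le> C" and C: "\<And>x. x \<in> carrier A \<Longrightarrow> sn (b \<otimes> x) \<le> C * sn x"
    using assms unfolding lbounded_def by blast
  have "sn ((k \<odot> b) \<otimes> x) \<le> (cmod k * C) * sn x" if x: "x \<in> carrier A" for x
    using C[OF x] x assms by (simp add: smult_mult sn_smult mult.assoc mult_left_mono)
  then show ?thesis using \<open>0 \<le> C\<close> unfolding lbounded_def by (intro exI[of _ "cmod k * C"]) auto
qed

lemma lbounded_mult:
  assumes "b \<in> carrier A" "c \<in> carrier A" "lbounded b" "lbounded c"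
  shows "lbounded (b \<otimes> c)"
proof -
  obtain C D where "0 \<le> C" "0 \<le> D" and CD: "\<And>x. x \<in> carrier A \<Longrightarrow> sn (b \<otimes> x) \<le> C * sn x"
    "\<And>x. x \<in> carrier A \<Longrightarrow> sn (c \<otimes> x) \<le> D * sn x" using assms unfolding lbounded_def by blast
  have "sn ((b \<otimes> c) \<otimes> x) \<le> (C * D) * sn x" if x: "x \<in> carrier A" for x
  proof -
    have "sn ((b \<otimes> c) \<otimes> x) \<le> C * sn (c \<otimes> x)" using CD(1)[of "c \<otimes> x"] x assms by (simp add: m_assoc)
    also have "\<dots> \<le> C * (D * sn x)" using CD(2)[OF x] \<open>0 \<le> C\<close> by (intro mult_left_mono) auto
    finally show ?thesis by (simp add: mult.assoc)
  qed
  then show ?thesis using \<open>0 \<le> C\<close> \<open>0 \<le> D\<close> unfolding lbounded_def by (intro exI[of _ "C * D"]) auto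
qed

text \<open>In the GNS seminorm |bx|^2 + |wx|^2 = |x|^2, so b acts as a contraction. For small
  selfadjoint elements of A the complement w will be a square root, for group elements it will be
  0.\<close>

lemma lbounded_complement:
  assumes b: "b \<in> carrier A" and w: "w \<in> carrier A" "star A b \<otimes> b \<oplus> star A w \<otimes> w = \<one>"
  shows "lbounded b"
proof -
  have "sn (b \<otimes> x) \<le> 1 * sn x" if x: "x \<in> carrier A" for x
  proof -
    have e: "star A (c \<otimes> x) \<otimes> (c \<otimes> x) = star A x \<otimes> ((star A c \<otimes> c) \<otimes> x)" if "c \<in> carrier A" for c
      using x that by (simp add: star_mult m_assoc)
    have "star A (b \<otimes> x) \<otimes> (b \<otimes> x) \<oplus> star A (w \<otimes> x) \<otimes> (w \<otimes> x)
        = star A x \<otimes> ((star A b \<otimes> b \<oplus> star A w \<otimes> w) \<otimes> x)"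
      unfolding e[OF b] e[OF w(1)] using x b w(1) by (simp add: l_distr r_distr)
    also have "\<dots> = star A x \<otimes> x" unfolding w(2) using x by simp
    finally have "star A (b \<otimes> x) \<otimes> (b \<otimes> x) \<oplus> star A (w \<otimes> x) \<otimes> (w \<otimes> x) = star A x \<otimes> x" .
    then have "\<psi> (star A (b \<otimes> x) \<otimes> (b \<otimes> x)) + \<psi> (star A (w \<otimes> x) \<otimes> (w \<otimes> x)) = \<psi> (star A x \<otimes> x)"
      using x b w(1) by (simp flip: psi_add)
    then have "Re (\<psi> (star A (b \<otimes> x) \<otimes> (b \<otimes> x))) + Re (\<psi> (star A (w \<otimes> x) \<otimes> (w \<otimes> x))) = Re (\<psi> (star A x \<otimes> x))"
      by (metis plus_complex.simps(1))
    then show ?thesis unfolding sn_def using psi_nonneg[of "w \<otimes> x"] w(1) x by simp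
  qed
  then show ?thesis unfolding lbounded_def by (intro exI[of _ 1]) auto
qed

text \<open>The norm of left multiplication on the GNS space. The set under the infimum is nonempty
  exactly for \<open>lbounded\<close> elements.\<close>

definition op_norm :: "'a \<Rightarrow> real" where
  "op_norm b = Inf {C. 0 \<le> C \<and> (\<forall>x\<in>carrier A. sn (b \<otimes> x) \<le> C * sn x)}"

lemma op_norm_le: "0 \<le> C \<Longrightarrow> (\<And>x. x \<in> carrier A \<Longrightarrow> sn (b \<otimes> x) \<le> C * sn x) \<Longrightarrow> op_norm b \<le> C"
  unfolding op_norm_def by (rule cInf_lower) (auto intro: bdd_belowI[of _ 0])

lemma op_norm_bound:
  assumes b: "b \<in> carrier A" "lbounded b" and x: "x \<in> carrier A"
  shows "sn (b \<otimes> x) \<le> op_norm b * sn x"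
proof (cases "sn x = 0")
  case True
  then show ?thesis using b x unfolding lbounded_def by auto
next
  case False
  then have "0 < sn x" using sn_nonneg[OF x] by linarith
  have "sn (b \<otimes> x) / sn x \<le> op_norm b"
    unfolding op_norm_def using b x \<open>0 < sn x\<close>
    by (intro cInf_greatest) (auto simp: lbounded_def divide_le_eq)
  then show ?thesis using \<open>0 < sn x\<close> by (simp add: divide_le_eq)
qed

lemma op_norm_nonneg: "b \<in> carrier A \<Longrightarrow> lbounded b \<Longrightarrow> 0 \<le> op_norm b"
  unfolding op_norm_def by (intro cInf_greatest) (auto simp: lbounded_def)

text \<open>This places the operator norm of every GNS space with bounded left multiplications among
  the seminorms whose supremum is \<open>univ_norm\<close>.\<close>

theorem op_norm_cstar_seminorm:
  assumes bd: "\<And>b. b \<in> carrier A \<Longrightarrow> lbounded b"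
  shows "cstar_seminorm A op_norm"
proof -
  have add: "op_norm (x \<oplus> y) \<le> op_norm x + op_norm y" if "x \<in> carrier A" "y \<in> carrier A" for x y
  proof (rule op_norm_le)
    fix z assume z: "z \<in> carrier A"
    show "sn ((x \<oplus> y) \<otimes> z) \<le> (op_norm x + op_norm y) * sn z"
      using sn_triangle[of "x \<otimes> z" "y \<otimes> z"] op_norm_bound[OF that(1) bd z] op_norm_bound[OF that(2) bd z] that z
      by (simp add: l_distr distrib_right)
  qed (use that bd op_norm_nonneg in simp)
  have mult: "op_norm (x \<otimes> y) \<le> op_norm x * op_norm y" if "x \<in> carrier A" "y \<in> carrier A" for x y
  proof (rule op_norm_le)
    fix z assume z: "z \<in> carrier A"
    have "sn ((x \<otimes> y) \<otimes> z) \<le> op_norm x * sn (y \<otimes> z)"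
      using op_norm_bound[OF that(1) bd, of "y \<otimes> z"] that z by (simp add: m_assoc)
    also have "\<dots> \<le> op_norm x * (op_norm y * sn z)"
      using op_norm_bound[OF that(2) bd z] op_norm_nonneg[OF that(1) bd] that by (intro mult_left_mono) auto
    finally show "sn ((x \<otimes> y) \<otimes> z) \<le> (op_norm x * op_norm y) * sn z" by (simp add: mult.assoc)
  qed (use that bd op_norm_nonneg in simp)
  have sm: "op_norm (c \<odot> x) \<le> cmod c * op_norm x" if x: "x \<in> carrier A" for c x
  proof (rule op_norm_le)
    fix z assume z: "z \<in> carrier A"
    show "sn ((c \<odot> x) \<otimes> z) \<le> (cmod c * op_norm x) * sn z"
      using op_norm_bound[OF x bd z] x z by (simp add: smult_mult sn_smult mult.assoc mult_left_mono)
  qed (use x bd op_norm_nonneg in simp)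
  have smult: "op_norm (c \<odot> x) = cmod c * op_norm x" if x: "x \<in> carrier A" for c x
  proof (cases "c = 0")
    case True
    then show ?thesis using sm[OF x, of 0] op_norm_nonneg[OF zero_closed bd] x by simp
  next
    case False
    have "op_norm x \<le> cmod (1 / c) * op_norm (c \<odot> x)"
      using sm[of "c \<odot> x" "1 / c"] x False by simp
    then have "cmod c * op_norm x \<le> op_norm (c \<odot> x)"
      using False by (simp add: norm_divide le_divide_eq mult.commute)
    then show ?thesis using sm[OF x, of c] by simp
  qed
  \<comment> \<open>By Cauchy-Schwarz |xz|^2 is at most |x*x z| |z|. With submultiplicativity this
    inequality yields both the invariance under the adjoint and the C*-identity.\<close>
  have sq: "(op_norm x)\<^sup>2 \<le> op_norm (star A x \<otimes> x)" if x: "x \<in> carrier A" for x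
  proof -
    have n: "0 \<le> op_norm (star A x \<otimes> x)" using x by (intro op_norm_nonneg bd) auto
    have "op_norm x \<le> sqrt (op_norm (star A x \<otimes> x))"
    proof (rule op_norm_le)
      fix z assume z: "z \<in> carrier A"
      have "complex_of_real ((sn (x \<otimes> z))\<^sup>2) = \<psi> (star A z \<otimes> ((star A x \<otimes> x) \<otimes> z))"
      proof -
        have "star A z \<otimes> ((star A x \<otimes> x) \<otimes> z) = star A (x \<otimes> z) \<otimes> (x \<otimes> z)"
          using x z by (simp add: star_mult m_assoc)
        then show ?thesis using x z by (simp add: sn_square)
      qed
      then have "(sn (x \<otimes> z))\<^sup>2 = cmod (\<psi> (star A z \<otimes> ((star A x \<otimes> x) \<otimes> z)))"
        by (metis abs_of_nonneg norm_of_real zero_le_power2)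
      also have "\<dots> \<le> sn ((star A x \<otimes> x) \<otimes> z) * sn z" using x z by (intro psi_bound) auto
      also have "\<dots> \<le> (op_norm (star A x \<otimes> x) * sn z) * sn z"
        using x z by (intro mult_right_mono op_norm_bound bd) auto
      also have "\<dots> = (sqrt (op_norm (star A x \<otimes> x)) * sn z)\<^sup>2"
        using n by (simp add: power_mult_distrib power2_eq_square)
      finally show "sn (x \<otimes> z) \<le> sqrt (op_norm (star A x \<otimes> x)) * sn z"
        by (rule power2_le_imp_le) (use n z in simp)
    qed (use n in simp)
    then have "(op_norm x)\<^sup>2 \<le> (sqrt (op_norm (star A x \<otimes> x)))\<^sup>2" using x op_norm_nonneg bd by (intro power_mono) auto
    then show ?thesis using n by simp
  qed
  have st: "op_norm x \<le> op_norm (star A x)" if x: "x \<in> carrier A" for x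
  proof -
    have "op_norm x * op_norm x \<le> op_norm (star A x) * op_norm x"
      using sq[OF x] mult[of "star A x" x] x by (simp add: power2_eq_square)
    then show ?thesis using op_norm_nonneg[of x] op_norm_nonneg[of "star A x"] x bd
      by (cases "op_norm x = 0") auto
  qed
  have cs: "op_norm (star A x \<otimes> x) = (op_norm x)\<^sup>2" if x: "x \<in> carrier A" for x
  proof (rule antisym[OF _ sq[OF x]])
    have "op_norm (star A x) = op_norm x" using st[of x] st[of "star A x"] x by simp
    then show "op_norm (star A x \<otimes> x) \<le> (op_norm x)\<^sup>2" using mult[of "star A x" x] x by (simp add: power2_eq_square)
  qed
  show ?thesis
    unfolding cstar_seminorm_def by (intro conjI ballI allI add mult smult cs op_norm_nonneg bd)
qed

end

section \<open>Norming functionals\<close>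

context cstar_seminormed
begin

lemma real_space_A: "real_space (carrier A) (\<oplus>) (\<lambda>r x. complex_of_real r \<odot> x) \<zero>"
  by unfold_locales (auto simp: a_ac s_add s_plus)

sublocale RS: real_space "carrier A" "(\<oplus>)" "\<lambda>r x. complex_of_real r \<odot> x" \<zero>
  by (rule real_space_A)

lemma p_sublinear: "RS.sublinear p"
  unfolding RS.sublinear_def by (auto simp: p_triangle p_smult)

text \<open>If p (c - h) \<le> c, then c - \<rho> h = \<rho> (c - h) \<le> c because \<rho> is 1 at
  the unit; hence \<rho> is nonnegative on positive elements, and on all x*x by
  \<open>pos_star_mult\<close>.\<close>

lemma positive_functional_of_real:
  assumes \<rho>: "RS.linear_on (carrier A) \<rho>" "\<And>x. x \<in> carrier A \<Longrightarrow> \<rho> x \<le> p x" and one: "\<rho> \<one> = 1"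
  obtains \<psi> where "positive_functional A \<psi>"
    "\<And>h. h \<in> carrier A \<Longrightarrow> star A h = h \<Longrightarrow> \<psi> h = complex_of_real (\<rho> h)"
proof -
  define re where "re x = (1/2) \<odot> (x \<oplus> star A x)" for x
  \<comment> \<open>The complex linear functional whose real part is \<rho> after \<open>re\<close>.
    It agrees with \<rho> on selfadjoint elements and discards the values of \<rho> on skew-adjoint
    ones, where \<rho> need not vanish.\<close>
  define \<psi> where "\<psi> x = complex_of_real (\<rho> (re x)) - \<i> * complex_of_real (\<rho> (re (\<i> \<odot> x)))" for x
  have \<rho>a: "\<rho> (x \<oplus> y) = \<rho> x + \<rho> y" if "x \<in> carrier A" "y \<in> carrier A" for x y
    using \<rho>(1) that unfolding RS.linear_on_def by blast
  have \<rho>s: "\<rho> (complex_of_real r \<odot> x) = r * \<rho> x" if "x \<in> carrier A" for x r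
    using \<rho>(1) that unfolding RS.linear_on_def by blast
  have re_closed: "re x \<in> carrier A" if "x \<in> carrier A" for x using that by (simp add: re_def)
  have re_add: "re (x \<oplus> y) = re x \<oplus> re y" if "x \<in> carrier A" "y \<in> carrier A" for x y
    using that by (simp add: re_def star_add a_4 flip: s_add)
  have re_s: "re (complex_of_real r \<odot> x) = complex_of_real r \<odot> re x" if "x \<in> carrier A" for x r
    using that by (simp add: re_def star_smult s_add mult.commute)
  have \<psi>a: "\<psi> (x \<oplus> y) = \<psi> x + \<psi> y" if "x \<in> carrier A" "y \<in> carrier A" for x y
    using that by (simp add: \<psi>_def s_add re_add \<rho>a re_closed algebra_simps)
  have \<psi>r: "\<psi> (complex_of_real r \<odot> x) = complex_of_real r * \<psi> x" if x: "x \<in> carrier A" for x r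
  proof -
    have "\<i> \<odot> (complex_of_real r \<odot> x) = complex_of_real r \<odot> (\<i> \<odot> x)"
      using x by (simp add: mult.commute)
    then show ?thesis using x by (simp only: \<psi>_def re_s \<rho>s re_closed s_closed of_real_mult right_diff_distrib mult.left_commute[of \<i>])
  qed
  have \<psi>i: "\<psi> (\<i> \<odot> x) = \<i> * \<psi> x" if x: "x \<in> carrier A" for x
  proof -
    have "\<i> \<odot> (\<i> \<odot> x) = complex_of_real (-1) \<odot> x" using x by simp
    then have "\<rho> (re (\<i> \<odot> (\<i> \<odot> x))) = - \<rho> (re x)" using x by (simp only: re_s \<rho>s re_closed)
    then show ?thesis by (simp add: \<psi>_def algebra_simps)
  qed
  have \<psi>s: "\<psi> (c \<odot> x) = c * \<psi> x" if x: "x \<in> carrier A" for x c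
  proof -
    have "c \<odot> x = complex_of_real (Re c) \<odot> x \<oplus> complex_of_real (Im c) \<odot> (\<i> \<odot> x)"
      using x by (simp add: mult.commute flip: s_plus) (simp flip: complex_eq)
    then have "\<psi> (c \<odot> x) = complex_of_real (Re c) * \<psi> x + complex_of_real (Im c) * (\<i> * \<psi> x)"
      using x by (simp only: \<psi>a \<psi>r \<psi>i s_closed)
    also have "\<dots> = (complex_of_real (Re c) + \<i> * complex_of_real (Im c)) * \<psi> x"
      by (simp add: algebra_simps)
    finally show ?thesis by (simp flip: complex_eq)
  qed
  have \<psi>h: "\<psi> h = complex_of_real (\<rho> h)" if h: "h \<in> carrier A" "star A h = h" for h
  proof -
    have "re h = h" using h s_plus[of h "1/2" "1/2"] by (simp add: re_def s_add)
    moreover have "\<i> \<odot> h \<oplus> (- \<i>) \<odot> h = \<zero>" using h s_plus[of h \<i> "-\<i>", symmetric] by simp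
    then have "re (\<i> \<odot> h) = \<zero>" using h by (simp add: re_def star_smult)
    with calculation show ?thesis using \<rho>s[of \<zero> 0] by (simp add: \<psi>_def)
  qed
  have pos\<rho>: "0 \<le> \<rho> h" if h: "pos h" for h
  proof -
    obtain c where c: "p (complex_of_real c \<odot> \<one> \<ominus> h) \<le> c" "h \<in> carrier A" using h by (auto simp: pos_def)
    have "\<rho> (complex_of_real c \<odot> \<one> \<ominus> h) = c - \<rho> h"
      using \<rho>a[of "complex_of_real c \<odot> \<one>" "(-1) \<odot> h"] \<rho>s[of \<one> c] \<rho>s[of h "-1"] c one
      by (simp add: diff_s)
    then show ?thesis using \<rho>(2)[of "complex_of_real c \<odot> \<one> \<ominus> h"] c by simp
  qed
  have "positive_functional A \<psi>"
    by unfold_locales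
       (use \<psi>a \<psi>s \<psi>h pos\<rho>[OF pos_star_mult] in \<open>auto simp: star_mult\<close>)
  with \<psi>h that show thesis by blast
qed

text \<open>The Hahn-Banach functional norms 1 + a instead of a = x*x. Since \<rho> 1 \<le> 1 and
  \<rho> a \<le> p a, while p (1 + a) is at least 1 + p a, both inequalities must be equalities. So
  one functional attains p a and is normalized, which makes it positive.\<close>

theorem norming_functional:
  assumes x: "x \<in> carrier A" and 1: "p \<one> = 1"
  obtains \<psi> where "positive_functional A \<psi>" "\<psi> \<one> = 1" "\<psi> (star A x \<otimes> x) = complex_of_real ((p x)\<^sup>2)"
proof -
  define a where "a = star A x \<otimes> x"
  have a: "a \<in> carrier A" "star A a = a" "pos a" using x pos_star_mult by (auto simp: a_def star_mult)
  \<comment> \<open>The value p a is attained in modulus at a spectral point t, and t \<ge> 0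
    because a is positive; evaluating 1 + X at t gives the bound.\<close>
  have pa: "1 + p a \<le> p (\<one> \<oplus> a)"
  proof (cases "p a = 0")
    case True
    have "p \<one> \<le> p (\<one> \<oplus> a) + p a" using p_diff[of "\<one> \<oplus> a" a] a
      by (simp add: a_minus_def a_assoc r_neg)
    then show ?thesis using True 1 by simp
  next
    case False
    then have "0 < p (rpeval a [:0, 1:])" using p_nonneg[OF a(1)] a by (simp add: rpeval_simps)
    from sp_attained[OF a(1,2) this] obtain t where t: "t \<in> sp a" "\<bar>t\<bar> = p a" using a by (auto simp: rpeval_simps)
    then have "p a = t" using pos_sp[OF a(3)] by fastforce
    moreover have "\<bar>poly (1 + [:0, 1:]) t\<bar> \<le> p (rpeval a (1 + [:0, 1:]))" using a t by (intro sp_le) auto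
    moreover have "rpeval a (1 + [:0, 1:]) = \<one> \<oplus> a" using a by (simp only: rpeval_simps)
    ultimately show ?thesis by simp
  qed
  obtain \<rho> where \<rho>: "RS.linear_on (carrier A) \<rho>" "\<And>x. x \<in> carrier A \<Longrightarrow> \<rho> x \<le> p x" "\<rho> (\<one> \<oplus> a) = p (\<one> \<oplus> a)"
    using RS.Hahn_Banach_norming[OF p_sublinear, of "\<one> \<oplus> a"] a by auto
  have "\<rho> (\<one> \<oplus> a) = \<rho> \<one> + \<rho> a" using \<rho>(1) a unfolding RS.linear_on_def by simp
  then have r: "\<rho> \<one> = 1" "\<rho> a = p a" using \<rho>(2)[of \<one>] \<rho>(2)[of a] \<rho>(3) pa 1 a by auto
  obtain \<psi> where "positive_functional A \<psi>"
    "\<And>h. h \<in> carrier A \<Longrightarrow> star A h = h \<Longrightarrow> \<psi> h = complex_of_real (\<rho> h)"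
    using positive_functional_of_real[OF \<rho>(1,2) r(1)] by blast
  with r a that show thesis using p_cstar[OF x] by (simp add: a_def)
qed

end

section \<open>Square roots in C*-algebras\<close>

context cstar_seminormed
begin

text \<open>For a seminorm, limits are determined only up to elements of seminorm 0, as in
  \<open>tends_unique\<close>; for the norm of a C*-algebra \<open>cnorm_eqI\<close> turns this into
  equality.\<close>

definition tends :: "(nat \<Rightarrow> 'a) \<Rightarrow> 'a \<Rightarrow> bool" where
  "tends X x \<longleftrightarrow> (\<forall>n. X n \<in> carrier A) \<and> x \<in> carrier A \<and> (\<lambda>n. p (X n \<ominus> x)) \<longlonglongrightarrow> 0"

lemma p_diff_commute: "x \<in> carrier A \<Longrightarrow> y \<in> carrier A \<Longrightarrow> p (x \<ominus> y) = p (y \<ominus> x)"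
  using p_smult[of "y \<ominus> x" "-1"] by (simp add: diff_s s_add a_comm)

lemma p_diff_triangle:
  assumes "x \<in> carrier A" "y \<in> carrier A" "z \<in> carrier A"
  shows "p (x \<ominus> z) \<le> p (x \<ominus> y) + p (y \<ominus> z)"
proof -
  have "x \<ominus> z = (x \<ominus> y) \<oplus> (y \<ominus> z)"
    using assms by (simp add: a_minus_def a_assoc) (simp add: l_neg flip: a_assoc)
  then show ?thesis using p_triangle[of "x \<ominus> y" "y \<ominus> z"] assms by simp
qed

lemma tends_unique: "tends X x \<Longrightarrow> tends X y \<Longrightarrow> p (x \<ominus> y) = 0"
proof -
  assume X: "tends X x" "tends X y"
  then have c: "X n \<in> carrier A" "x \<in> carrier A" "y \<in> carrier A" for n by (auto simp: tends_def)
  have "(\<lambda>n. p (X n \<ominus> x) + p (X n \<ominus> y)) \<longlonglongrightarrow> 0 + 0"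
    using X unfolding tends_def by (intro tendsto_add) auto
  moreover have "p (x \<ominus> y) \<le> p (X n \<ominus> x) + p (X n \<ominus> y)" for n
    using p_diff_triangle[of x "X n" y] p_diff_commute[of x "X n"] c by simp
  ultimately have "p (x \<ominus> y) \<le> 0 + 0" by (intro LIMSEQ_le_const) auto
  then show ?thesis using p_nonneg[of "x \<ominus> y"] c by simp
qed

lemma tends_star: "tends X x \<Longrightarrow> tends (\<lambda>n. star A (X n)) (star A x)"
proof -
  assume X: "tends X x"
  then have "p (star A (X n) \<ominus> star A x) = p (X n \<ominus> x)" for n
    using p_star[of "X n \<ominus> x"] by (simp add: tends_def star_diff)
  then show ?thesis using X by (simp add: tends_def)
qed

lemma tends_const: "x \<in> carrier A \<Longrightarrow> tends (\<lambda>n. x) x"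
  by (simp add: tends_def a_minus_def r_neg)

lemma tends_mult:
  assumes X: "tends X x" and Y: "tends Y y"
  shows "tends (\<lambda>n. X n \<otimes> Y n) (x \<otimes> y)"
proof -
  have c: "X n \<in> carrier A" "x \<in> carrier A" "Y n \<in> carrier A" "y \<in> carrier A" for n
    using X Y by (auto simp: tends_def)
  have le: "p (X n \<otimes> Y n \<ominus> x \<otimes> y) \<le> p (X n \<ominus> x) * (p (Y n \<ominus> y) + p y) + p x * p (Y n \<ominus> y)" for n
  proof -
    have "p (X n \<otimes> Y n \<ominus> x \<otimes> y) \<le> p (X n \<otimes> Y n \<ominus> x \<otimes> Y n) + p (x \<otimes> Y n \<ominus> x \<otimes> y)"
      using c by (intro p_diff_triangle) auto
    also have "X n \<otimes> Y n \<ominus> x \<otimes> Y n = (X n \<ominus> x) \<otimes> Y n" using c by (simp add: diff_s l_distr smult_mult)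
    also have "x \<otimes> Y n \<ominus> x \<otimes> y = x \<otimes> (Y n \<ominus> y)" using c by (simp add: diff_s r_distr smult_mult)
    also have "p ((X n \<ominus> x) \<otimes> Y n) + p (x \<otimes> (Y n \<ominus> y)) \<le> p (X n \<ominus> x) * p (Y n) + p x * p (Y n \<ominus> y)"
      using c by (intro add_mono p_mult) auto
    also have "p (Y n) \<le> p (Y n \<ominus> y) + p y"
      using p_triangle[of "Y n \<ominus> y" y] c by (simp add: a_minus_def a_assoc l_neg)
    finally show ?thesis using c by (simp add: mult_left_mono p_nonneg)
  qed
  have "(\<lambda>n. p (X n \<ominus> x) * (p (Y n \<ominus> y) + p y) + p x * p (Y n \<ominus> y)) \<longlonglongrightarrow> 0 * (0 + p y) + p x * 0"
    using X Y unfolding tends_def by (intro tendsto_intros) auto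
  then have lim: "(\<lambda>n. p (X n \<ominus> x) * (p (Y n \<ominus> y) + p y) + p x * p (Y n \<ominus> y)) \<longlonglongrightarrow> 0" by simp
  have "(\<lambda>n. p (X n \<otimes> Y n \<ominus> x \<otimes> y)) \<longlonglongrightarrow> 0"
  proof (rule tendsto_sandwich[OF _ _ tendsto_const lim]; rule always_eventually, rule allI)
    fix n
    show "0 \<le> p (X n \<otimes> Y n \<ominus> x \<otimes> y)" by (rule p_nonneg) (use c in simp)
    show "p (X n \<otimes> Y n \<ominus> x \<otimes> y) \<le> p (X n \<ominus> x) * (p (Y n \<ominus> y) + p y) + p x * p (Y n \<ominus> y)"
      by (rule le)
  qed
  then show ?thesis using c by (simp add: tends_def)
qed

end

text \<open>The increments are dominated by a geometric series with ratio 1/4, whose sum is 4/3; the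
  induction keeps the remaining tail as a negative term.\<close>

lemma (in poly_seminorm) sqrt_iter_Cauchy:
  assumes "q [:0, 1:] \<le> 1/2"
  shows "q (sqrt_iter (n + k) - sqrt_iter n) \<le> 4/3 * (1/4) ^ n"
proof -
  have "q (sqrt_iter (n + k) - sqrt_iter n) \<le> 4/3 * ((1/4) ^ n - (1/4) ^ (n + k))"
  proof (induction k)
    case (Suc k)
    have "q (sqrt_iter (n + Suc k) - sqrt_iter n)
        \<le> q (sqrt_iter (Suc (n + k)) - sqrt_iter (n + k)) + q (sqrt_iter (n + k) - sqrt_iter n)"
      using q_triangle[of "sqrt_iter (Suc (n + k)) - sqrt_iter (n + k)" "sqrt_iter (n + k) - sqrt_iter n"]
      by (simp del: sqrt_iter.simps)
    also have "\<dots> \<le> (1/4) ^ (n + k) + 4/3 * ((1/4) ^ n - (1/4) ^ (n + k))"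
      by (intro add_mono sqrt_iter_step assms Suc)
    finally show ?case by (simp del: sqrt_iter.simps add: algebra_simps)
  qed simp
  also have "\<dots> \<le> 4/3 * (1/4) ^ n" by simp
  finally show ?thesis .
qed

context unital_cstar_algebra
begin

sublocale CN: cstar_seminormed A "cnorm A"
  by unfold_locales (rule cnorm_cstar)

lemma cnorm_eqI: "x \<in> carrier A \<Longrightarrow> y \<in> carrier A \<Longrightarrow> cnorm A (x \<ominus> y) = 0 \<Longrightarrow> x = y"
proof -
  assume xy: "x \<in> carrier A" "y \<in> carrier A" "cnorm A (x \<ominus> y) = 0"
  have "x = (x \<ominus> y) \<oplus> y" using xy by (simp add: a_minus_def a_assoc l_neg)
  then show ?thesis using cnorm_definite[of "x \<ominus> y"] xy by simp
qed

text \<open>w is the limit of the polynomials 1 - \<open>sqrt_iter n\<close> evaluated at h.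
  Selfadjointness, commutation with h and the value of the square all pass to the limit.\<close>

lemma sqrt_one_minus_square:
  assumes h: "h \<in> carrier A" "star A h = h" "cnorm A h \<le> 1/2"
  obtains w where "w \<in> carrier A" "star A w = w" "w \<otimes> h = h \<otimes> w" "h \<otimes> h \<oplus> w \<otimes> w = \<one>"
proof -
  interpret q: poly_seminorm "\<lambda>P. cnorm A (rpeval h P)" using CN.p_poly_seminorm h by blast
  have qX: "cnorm A (rpeval h [:0, 1:]) \<le> 1/2" using h by (simp add: rpeval_simps)
  define X where "X n = rpeval h (1 - sqrt_iter n)" for n
  have X: "X n \<in> carrier A" "star A (X n) = X n" for n
    unfolding X_def by (rule rpeval_simps(1) star_rpeval; rule h)+
  have dX: "cnorm A (X m \<ominus> X n) \<le> 4/3 * (1/4) ^ min m n" for m n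
  proof -
    have "X m \<ominus> X n = rpeval h ((1 - sqrt_iter m) - (1 - sqrt_iter n))" using h by (simp only: X_def rpeval_simps)
    also have "(1 - sqrt_iter m) - (1 - sqrt_iter n) = sqrt_iter n - sqrt_iter m" by simp
    finally have e: "cnorm A (X m \<ominus> X n) = cnorm A (rpeval h (sqrt_iter n - sqrt_iter m))" by simp
    show ?thesis
    proof (cases "m \<le> n")
      case True
      then show ?thesis using q.sqrt_iter_Cauchy[OF qX, of m "n - m"] by (simp add: e min_def)
    next
      case False
      then show ?thesis
        using q.sqrt_iter_Cauchy[OF qX, of n "m - n"] q.q_minus_commute[of "sqrt_iter n" "sqrt_iter m"]
        by (simp add: e min_def)
    qed
  qed
  have "X \<in> cauchy_seqs A (cnorm A)"
    unfolding cauchy_seqs_def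
  proof (intro CollectI conjI allI impI)
    fix e :: real assume "0 < e"
    have "(\<lambda>n. 4/3 * (1/4) ^ n :: real) \<longlonglongrightarrow> 4/3 * 0" by (intro tendsto_intros LIMSEQ_power_zero) simp
    then have "(\<lambda>n. 4/3 * (1/4) ^ n :: real) \<longlonglongrightarrow> 0" by simp
    from order_tendstoD(2)[OF this \<open>0 < e\<close>] obtain N where N: "\<And>n. N \<le> n \<Longrightarrow> 4/3 * (1/4) ^ n < e"
      by (auto simp: eventually_sequentially)
    show "\<exists>N. \<forall>m\<ge>N. \<forall>n\<ge>N. cnorm A (X m \<ominus> X n) < e"
    proof (intro exI[of _ N] allI impI)
      fix m n assume mn: "N \<le> m" "N \<le> n"
      show "cnorm A (X m \<ominus> X n) < e" using le_less_trans[OF dX N[of "min m n"]] mn by simp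
    qed
  qed (rule X)
  then obtain w where "w \<in> carrier A" "(\<lambda>n. cnorm A (X n \<ominus> w)) \<longlonglongrightarrow> 0"
    using cnorm_complete unfolding seq_complete_def by blast
  then have w: "CN.tends X w" "w \<in> carrier A" using X by (auto simp: CN.tends_def)
  have "CN.tends X (star A w)" using CN.tends_star[OF w(1)] X by simp
  then have 1: "star A w = w" using CN.tends_unique[OF _ w(1)] w(2) by (intro cnorm_eqI) auto
  have "X n \<otimes> h = h \<otimes> X n" for n
    using peval_commute[of h "cpx (1 - sqrt_iter n)" "[:0, 1:]"] h by (simp add: X_def rpeval_def)
  then have "CN.tends (\<lambda>n. X n \<otimes> h) (h \<otimes> w)" "CN.tends (\<lambda>n. X n \<otimes> h) (w \<otimes> h)"
    using CN.tends_mult[OF w(1) CN.tends_const[OF h(1)]] CN.tends_mult[OF CN.tends_const[OF h(1)] w(1)] by auto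
  then have 2: "w \<otimes> h = h \<otimes> w" using CN.tends_unique w(2) h by (intro cnorm_eqI) auto
  have "CN.tends (\<lambda>n. X n \<otimes> X n) (\<one> \<ominus> h \<otimes> h)"
    unfolding CN.tends_def
  proof (intro conjI allI)
    have le: "cnorm A (X n \<otimes> X n \<ominus> (\<one> \<ominus> h \<otimes> h)) \<le> 2 * (1/4) ^ n" for n
    proof -
      have v: "[:1, 0, -1:] = 1 - [:0, 1 :: real:]\<^sup>2" by (simp add: power2_eq_square one_pCons)
      have "X n \<otimes> X n \<ominus> (\<one> \<ominus> h \<otimes> h) = rpeval h ((1 - sqrt_iter n)\<^sup>2 - [:1, 0, -1:])"
        unfolding v using h by (simp only: X_def rpeval_simps)
      also have "(1 - sqrt_iter n)\<^sup>2 - [:1, 0, -1:] = Polynomial.smult 2 (sqrt_iter (Suc n) - sqrt_iter n)"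
      proof -
        have "(1 - sqrt_iter n)\<^sup>2 - [:1, 0, -1:] = - Polynomial.smult 2 (sqrt_iter n - sqrt_iter (Suc n))"
          unfolding sqrt_iter_defect[symmetric] by simp
        then show ?thesis by (simp only: smult_minus_right[symmetric] minus_diff_eq)
      qed
      finally have "cnorm A (X n \<otimes> X n \<ominus> (\<one> \<ominus> h \<otimes> h)) = 2 * cnorm A (rpeval h (sqrt_iter (Suc n) - sqrt_iter n))"
        by (simp only: q.q_smult)
      then show ?thesis using q.sqrt_iter_step[OF qX, of n] by linarith
    qed
    have "(\<lambda>n. 2 * (1/4) ^ n :: real) \<longlonglongrightarrow> 2 * 0" by (intro tendsto_intros LIMSEQ_power_zero) simp
    then have lim: "(\<lambda>n. 2 * (1/4) ^ n :: real) \<longlonglongrightarrow> 0" by simp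
    show "(\<lambda>n. cnorm A (X n \<otimes> X n \<ominus> (\<one> \<ominus> h \<otimes> h))) \<longlonglongrightarrow> 0"
    proof (rule tendsto_sandwich[OF _ _ tendsto_const lim]; rule always_eventually, rule allI)
      fix n
      show "0 \<le> cnorm A (X n \<otimes> X n \<ominus> (\<one> \<ominus> h \<otimes> h))" by (rule CN.p_nonneg) (use X h in simp)
    qed (rule le)
  qed (use X h in auto)
  then have "w \<otimes> w = \<one> \<ominus> h \<otimes> h"
    using CN.tends_unique CN.tends_mult[OF w(1) w(1)] w(2) h by (intro cnorm_eqI) auto
  then have 3: "h \<otimes> h \<oplus> w \<otimes> w = \<one>" using h by (simp add: a_minus_def a_ac r_neg)
  show thesis by (rule that[OF w(2) 1 2 3])
qed

text \<open>A selfadjoint h of norm at most 1/2 is the real part of the unitary u = h + i w, and the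
  C*-identity gives r u \<le> 1. Scaling produces the factor 2 for selfadjoint elements, and the
  C*-identities of r and of the norm extend it to all x.\<close>

lemma cstar_seminorm_le_cnorm:
  assumes "cstar_seminorm A r" "x \<in> carrier A"
  shows "r x \<le> 2 * cnorm A x"
proof -
  interpret R: cstar_seminormed A r by unfold_locales (rule assms)
  have half: "r h \<le> 1" if h: "h \<in> carrier A" "star A h = h" "cnorm A h \<le> 1/2" for h
  proof -
    obtain w where w: "w \<in> carrier A" "star A w = w" "w \<otimes> h = h \<otimes> w" "h \<otimes> h \<oplus> w \<otimes> w = \<one>"
      using sqrt_one_minus_square[OF h] .
    define u where "u = h \<oplus> \<i> \<odot> w"
    have u: "u \<in> carrier A" "star A u = h \<oplus> (- \<i>) \<odot> w"
      using w h by (simp_all add: u_def star_add star_smult)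
    have "star A u \<otimes> u = (h \<otimes> h \<oplus> w \<otimes> w) \<oplus> (\<i> \<odot> (h \<otimes> w) \<oplus> (- \<i>) \<odot> (h \<otimes> w))"
      unfolding u(2) unfolding u_def using h w(1-3) by (simp add: l_distr r_distr smult_mult s_add a_ac)
    also have "\<i> \<odot> (h \<otimes> w) \<oplus> (- \<i>) \<odot> (h \<otimes> w) = \<zero>"
      using h w s_plus[of "h \<otimes> w" \<i> "- \<i>", symmetric] by simp
    finally have "star A u \<otimes> u = \<one>" using w(4) by simp
    then have "(r u)\<^sup>2 = r \<one>" using R.p_cstar[OF u(1)] by simp
    then have ru: "r u \<le> 1" using R.p_one_le by (metis power2_le_imp_le one_power2 zero_le_one)
    have "h = (1/2) \<odot> (u \<oplus> star A u)"
    proof -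
      have "u \<oplus> star A u = (h \<oplus> h) \<oplus> (\<i> \<odot> w \<oplus> (- \<i>) \<odot> w)"
        unfolding u(2) unfolding u_def using h w by (intro a_4) auto
      also have "\<i> \<odot> w \<oplus> (- \<i>) \<odot> w = \<zero>"
        using w s_plus[of w \<i> "- \<i>", symmetric] by simp
      finally have "u \<oplus> star A u = 2 \<odot> h" using h s_plus[of h 1 1] by simp
      then show ?thesis using h by simp
    qed
    then have "r h = 1/2 * r (u \<oplus> star A u)" using R.p_smult[of "u \<oplus> star A u" "1/2"] u(1) by simp
    also have "\<dots> \<le> 1/2 * (r u + r (star A u))" using u(1) by (intro mult_left_mono R.p_triangle) auto
    also have "\<dots> \<le> 1" using ru R.p_star[OF u(1)] by simp
    finally show ?thesis .
  qed
  have sa: "r h \<le> 2 * cnorm A h" if h: "h \<in> carrier A" "star A h = h" for h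
  proof (cases "cnorm A h = 0")
    case True
    then have "h = \<zero>" using cnorm_definite h by blast
    then show ?thesis using R.p_zero by (simp add: CN.p_zero)
  next
    case False
    then have n: "0 < cnorm A h" using CN.p_nonneg[OF h(1)] by simp
    define c where "c = complex_of_real (1 / (2 * cnorm A h))"
    have cm: "cmod c = 1 / (2 * cnorm A h)" using n by (simp add: c_def norm_divide)
    have "r (c \<odot> h) \<le> 1"
    proof (rule half)
      show "star A (c \<odot> h) = c \<odot> h" using h by (simp add: star_smult c_def)
      show "cnorm A (c \<odot> h) \<le> 1/2" using h n by (simp add: CN.p_smult cm)
    qed (use h in simp)
    then show ?thesis using h n by (simp add: R.p_smult cm divide_le_eq mult.commute)
  qed
  have "(r x)\<^sup>2 = r (star A x \<otimes> x)" using R.p_cstar assms(2) by simp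
  also have "\<dots> \<le> 2 * cnorm A (star A x \<otimes> x)" using assms(2) by (intro sa) (auto simp: star_mult)
  also have "\<dots> = 2 * (cnorm A x)\<^sup>2" using CN.p_cstar assms(2) by simp
  also have "\<dots> \<le> (2 * cnorm A x)\<^sup>2" by (simp add: power2_eq_square)
  finally show ?thesis by (rule power2_le_imp_le) (use assms(2) CN.p_nonneg in simp)
qed

end

section \<open>The algebra of finitely supported functions\<close>

text \<open>The axioms of an action, spelled out over a mere *-algebra. The trivial action on the
  complex numbers is a second instance, which yields the group algebra.\<close>

locale star_system = unital_star_algebra A + G: group G
  for A :: "('a, 'm) star_alg_scheme" (structure) and G :: "('g, 'n) monoid_scheme" and \<alpha> :: "'g \<Rightarrow> 'a \<Rightarrow> 'a" +
  assumes al_closed [simp]: "s \<in> carrier G \<Longrightarrow> a \<in> carrier A \<Longrightarrow> \<alpha> s a \<in> carrier A"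
    and al_add: "\<lbrakk>s \<in> carrier G; a \<in> carrier A; b \<in> carrier A\<rbrakk> \<Longrightarrow> \<alpha> s (a \<oplus> b) = \<alpha> s a \<oplus> \<alpha> s b"
    and al_smult: "\<lbrakk>s \<in> carrier G; a \<in> carrier A\<rbrakk> \<Longrightarrow> \<alpha> s (c \<odot> a) = c \<odot> \<alpha> s a"
    and al_mult: "\<lbrakk>s \<in> carrier G; a \<in> carrier A; b \<in> carrier A\<rbrakk> \<Longrightarrow> \<alpha> s (a \<otimes> b) = \<alpha> s a \<otimes> \<alpha> s b"
    and al_unit [simp]: "s \<in> carrier G \<Longrightarrow> \<alpha> s \<one> = \<one>"
    and al_star: "\<lbrakk>s \<in> carrier G; a \<in> carrier A\<rbrakk> \<Longrightarrow> \<alpha> s (star A a) = star A (\<alpha> s a)"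
    and al_al: "\<lbrakk>s \<in> carrier G; t \<in> carrier G; a \<in> carrier A\<rbrakk> \<Longrightarrow> \<alpha> s (\<alpha> t a) = \<alpha> (s \<otimes>\<^bsub>G\<^esub> t) a"
    and al_one [simp]: "a \<in> carrier A \<Longrightarrow> \<alpha> \<one>\<^bsub>G\<^esub> a = a"
begin

lemma al_zero [simp]: "s \<in> carrier G \<Longrightarrow> \<alpha> s \<zero> = \<zero>"
  using al_smult[of s \<zero> 0] by simp

abbreviation B :: "('g \<Rightarrow> 'a) star_alg" where "B \<equiv> cc_alg A G \<alpha>"

definition single :: "'a \<Rightarrow> 'g \<Rightarrow> 'g \<Rightarrow> 'a" where
  "single a s t = (if t = s then a else \<zero>)"

definition supp :: "('g \<Rightarrow> 'a) \<Rightarrow> 'g set" where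
  "supp f = {s. f s \<noteq> \<zero>}"

lemma B_carrier: "f \<in> carrier B \<longleftrightarrow> (\<forall>s. f s \<in> carrier A) \<and> finite (supp f) \<and> supp f \<subseteq> carrier G"
  by (auto simp: cc_alg_def supp_def)

lemma B_val [simp]: "f \<in> carrier B \<Longrightarrow> f s \<in> carrier A"
  by (simp add: B_carrier)

lemma B_off: "f \<in> carrier B \<Longrightarrow> s \<notin> carrier G \<Longrightarrow> f s = \<zero>"
  by (auto simp: B_carrier supp_def)

lemma B_ops:
  "\<one>\<^bsub>B\<^esub> = single \<one> \<one>\<^bsub>G\<^esub>" "\<zero>\<^bsub>B\<^esub> = (\<lambda>t. \<zero>)" "f \<oplus>\<^bsub>B\<^esub> g = (\<lambda>t. f t \<oplus> g t)"
  "c \<odot>\<^bsub>B\<^esub> f = (\<lambda>t. c \<odot> f t)"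
  "star B f = (\<lambda>t. if t \<in> carrier G then \<alpha> t (star A (f (inv\<^bsub>G\<^esub> t))) else \<zero>)"
  by (auto simp: cc_alg_def single_def)

lemma B_mult_def: "f \<otimes>\<^bsub>B\<^esub> g = (\<lambda>t. if t \<in> carrier G
    then \<Oplus>s\<in>supp f. f s \<otimes> \<alpha> s (g (inv\<^bsub>G\<^esub> s \<otimes>\<^bsub>G\<^esub> t)) else \<zero>)"
  unfolding cc_alg_def supp_def by simp

lemma B_mult:
  assumes f: "f \<in> carrier B" and g: "g \<in> carrier B" and t: "t \<in> carrier G"
    and S: "finite S" "supp f \<subseteq> S" "S \<subseteq> carrier G"
  shows "(f \<otimes>\<^bsub>B\<^esub> g) t = (\<Oplus>s\<in>S. f s \<otimes> \<alpha> s (g (inv\<^bsub>G\<^esub> s \<otimes>\<^bsub>G\<^esub> t)))"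
proof -
  have "(\<Oplus>s\<in>supp f. f s \<otimes> \<alpha> s (g (inv\<^bsub>G\<^esub> s \<otimes>\<^bsub>G\<^esub> t))) = (\<Oplus>s\<in>S. f s \<otimes> \<alpha> s (g (inv\<^bsub>G\<^esub> s \<otimes>\<^bsub>G\<^esub> t)))"
    by (rule add.finprod_mono_neutral_cong_left) (use S f g t in \<open>auto simp: supp_def\<close>)
  then show ?thesis using t by (simp add: B_mult_def)
qed

lemma single_in [simp]: "a \<in> carrier A \<Longrightarrow> s \<in> carrier G \<Longrightarrow> single a s \<in> carrier B"
  by (auto simp: B_carrier single_def supp_def intro: finite_subset[of _ "{s}"])

lemma single_zero: "single \<zero> s = \<zero>\<^bsub>B\<^esub>"
  by (auto simp: single_def B_ops)

lemma single_add: "single a s \<oplus>\<^bsub>B\<^esub> single b s = single (a \<oplus> b) s" if "a \<in> carrier A" "b \<in> carrier A"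
  using that by (auto simp: single_def B_ops)

lemma single_smult: "c \<odot>\<^bsub>B\<^esub> single a s = single (c \<odot> a) s"
  by (auto simp: single_def B_ops)

lemma B_add_closed [simp]: "f \<in> carrier B \<Longrightarrow> g \<in> carrier B \<Longrightarrow> f \<oplus>\<^bsub>B\<^esub> g \<in> carrier B"
proof -
  assume fg: "f \<in> carrier B" "g \<in> carrier B"
  have "supp (f \<oplus>\<^bsub>B\<^esub> g) \<subseteq> supp f \<union> supp g" by (auto simp: supp_def B_ops)
  then have "finite (supp (f \<oplus>\<^bsub>B\<^esub> g))" "supp (f \<oplus>\<^bsub>B\<^esub> g) \<subseteq> carrier G"
    using fg by (auto simp: B_carrier intro: finite_subset)
  then show ?thesis using fg by (auto simp: B_carrier) (simp add: B_ops)
qed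

lemma B_smult_closed [simp]: "f \<in> carrier B \<Longrightarrow> c \<odot>\<^bsub>B\<^esub> f \<in> carrier B"
proof -
  assume f: "f \<in> carrier B"
  have "supp (c \<odot>\<^bsub>B\<^esub> f) \<subseteq> supp f" by (auto simp: supp_def B_ops)
  then have "finite (supp (c \<odot>\<^bsub>B\<^esub> f))" "supp (c \<odot>\<^bsub>B\<^esub> f) \<subseteq> carrier G"
    using f by (auto simp: B_carrier intro: finite_subset)
  then show ?thesis using f by (auto simp: B_carrier) (simp add: B_ops)
qed

lemma B_zero_closed [simp]: "\<zero>\<^bsub>B\<^esub> \<in> carrier B"
  by (simp add: B_carrier B_ops supp_def)

lemma B_one_closed [simp]: "\<one>\<^bsub>B\<^esub> \<in> carrier B"
  by (simp add: B_ops)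

lemma B_mult_closed [simp]: "f \<in> carrier B \<Longrightarrow> g \<in> carrier B \<Longrightarrow> f \<otimes>\<^bsub>B\<^esub> g \<in> carrier B"
proof -
  assume fg: "f \<in> carrier B" "g \<in> carrier B"
  have "supp (f \<otimes>\<^bsub>B\<^esub> g) \<subseteq> (\<lambda>(s, t). s \<otimes>\<^bsub>G\<^esub> t) ` (supp f \<times> supp g)"
  proof
    fix t assume "t \<in> supp (f \<otimes>\<^bsub>B\<^esub> g)"
    then have t: "t \<in> carrier G" and nz: "(\<Oplus>s\<in>supp f. f s \<otimes> \<alpha> s (g (inv\<^bsub>G\<^esub> s \<otimes>\<^bsub>G\<^esub> t))) \<noteq> \<zero>"
      by (auto simp: supp_def B_mult_def split: if_splits)
    have "\<exists>s\<in>supp f. g (inv\<^bsub>G\<^esub> s \<otimes>\<^bsub>G\<^esub> t) \<noteq> \<zero>"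
    proof (rule ccontr)
      assume "\<not> ?thesis"
      then have "(\<Oplus>s\<in>supp f. f s \<otimes> \<alpha> s (g (inv\<^bsub>G\<^esub> s \<otimes>\<^bsub>G\<^esub> t))) = (\<Oplus>s\<in>supp f. \<zero>)"
        using fg t by (intro add.finprod_cong') (auto simp: B_carrier)
      then show False using nz by simp
    qed
    then obtain s where s: "s \<in> supp f" "inv\<^bsub>G\<^esub> s \<otimes>\<^bsub>G\<^esub> t \<in> supp g" by (auto simp: supp_def)
    moreover have "s \<in> carrier G" using s fg by (auto simp: B_carrier)
    then have "t = s \<otimes>\<^bsub>G\<^esub> (inv\<^bsub>G\<^esub> s \<otimes>\<^bsub>G\<^esub> t)" using t by (simp flip: G.m_assoc)
    ultimately show "t \<in> (\<lambda>(s, t). s \<otimes>\<^bsub>G\<^esub> t) ` (supp f \<times> supp g)" by force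
  qed
  moreover have "finite ((\<lambda>(s, t). s \<otimes>\<^bsub>G\<^esub> t) ` (supp f \<times> supp g))" using fg by (simp add: B_carrier)
  moreover have "(\<lambda>(s, t). s \<otimes>\<^bsub>G\<^esub> t) ` (supp f \<times> supp g) \<subseteq> carrier G" using fg by (auto simp: B_carrier)
  moreover have "(f \<otimes>\<^bsub>B\<^esub> g) t \<in> carrier A" for t
    using fg by (auto simp: B_mult_def B_carrier intro!: add.finprod_closed)
  ultimately show ?thesis unfolding B_carrier by (meson finite_subset order_trans)
qed

lemma B_star_closed [simp]: "f \<in> carrier B \<Longrightarrow> star B f \<in> carrier B"
proof -
  assume f: "f \<in> carrier B"
  have "supp (star B f) \<subseteq> (\<lambda>s. inv\<^bsub>G\<^esub> s) ` supp f"
  proof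
    fix t assume t: "t \<in> supp (star B f)"
    then have "t \<in> carrier G" "f (inv\<^bsub>G\<^esub> t) \<noteq> \<zero>" by (auto simp: supp_def B_ops split: if_splits)
    then show "t \<in> (\<lambda>s. inv\<^bsub>G\<^esub> s) ` supp f" by (intro image_eqI[of _ _ "inv\<^bsub>G\<^esub> t"]) (auto simp: supp_def)
  qed
  moreover have "finite ((\<lambda>s. inv\<^bsub>G\<^esub> s) ` supp f)" "(\<lambda>s. inv\<^bsub>G\<^esub> s) ` supp f \<subseteq> carrier G"
    using f by (auto simp: B_carrier)
  moreover have "star B f t \<in> carrier A" for t using f by (simp add: B_ops)
  ultimately show ?thesis unfolding B_carrier by (meson finite_subset order_trans)
qed

text \<open>Every element is a finite sum of monomials a u_s, here \<open>single a s\<close>;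
  identities that are additive in each argument need to be checked on these only.\<close>

lemma B_induct [consumes 1, case_names zero single add]:
  assumes f: "f \<in> carrier B" and zero: "P \<zero>\<^bsub>B\<^esub>"
    and single: "\<And>a s. a \<in> carrier A \<Longrightarrow> s \<in> carrier G \<Longrightarrow> P (single a s)"
    and add: "\<And>f g. f \<in> carrier B \<Longrightarrow> g \<in> carrier B \<Longrightarrow> P f \<Longrightarrow> P g \<Longrightarrow> P (f \<oplus>\<^bsub>B\<^esub> g)"
  shows "P f"
proof -
  have "finite S \<Longrightarrow> f \<in> carrier B \<Longrightarrow> supp f \<subseteq> S \<Longrightarrow> P f" for S f
  proof (induction S arbitrary: f rule: finite_induct)
    case empty
    then have "f = \<zero>\<^bsub>B\<^esub>" by (auto simp: supp_def B_ops)
    then show ?case using zero by simp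
  next
    case (insert s S)
    define g where "g = f(s := \<zero>)"
    have "supp g \<subseteq> supp f" by (auto simp: g_def supp_def)
    then have g: "g \<in> carrier B"
      using insert.prems(1) unfolding B_carrier by (auto simp: g_def intro: finite_subset)
    have Pg: "P g" by (rule insert.IH[OF g]) (use insert.prems(2) in \<open>auto simp: g_def supp_def\<close>)
    show ?case
    proof (cases "s \<in> carrier G")
      case True
      have "f = single (f s) s \<oplus>\<^bsub>B\<^esub> g" using insert.prems(1) by (auto simp: B_ops single_def g_def)
      then show ?thesis using add[OF single_in[OF _ True] g single[OF _ True] Pg, of "f s"] insert.prems(1) by simp
    next
      case False
      then have "f = g" using B_off[OF insert.prems(1)] by (auto simp: g_def)
      then show ?thesis using Pg by simp
    qed
  qed
  then show ?thesis using f by (auto simp: B_carrier)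
qed

section \<open>The *-algebra laws of twisted convolution\<close>

lemma B_mult_add_left:
  assumes "f \<in> carrier B" "g \<in> carrier B" "h \<in> carrier B"
  shows "(f \<oplus>\<^bsub>B\<^esub> g) \<otimes>\<^bsub>B\<^esub> h = f \<otimes>\<^bsub>B\<^esub> h \<oplus>\<^bsub>B\<^esub> g \<otimes>\<^bsub>B\<^esub> h"
proof
  fix t
  define S where "S = supp f \<union> supp g"
  have S: "finite S" "S \<subseteq> carrier G" "supp f \<subseteq> S" "supp g \<subseteq> S" "supp (f \<oplus>\<^bsub>B\<^esub> g) \<subseteq> S"
    using assms by (auto simp: S_def B_carrier) (auto simp: supp_def B_ops)
  show "((f \<oplus>\<^bsub>B\<^esub> g) \<otimes>\<^bsub>B\<^esub> h) t = (f \<otimes>\<^bsub>B\<^esub> h \<oplus>\<^bsub>B\<^esub> g \<otimes>\<^bsub>B\<^esub> h) t"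
  proof (cases "t \<in> carrier G")
    case True
    have c: "s \<in> S \<Longrightarrow> s \<in> carrier G" for s using S by auto
    have "((f \<oplus>\<^bsub>B\<^esub> g) \<otimes>\<^bsub>B\<^esub> h) t = (\<Oplus>s\<in>S. (f \<oplus>\<^bsub>B\<^esub> g) s \<otimes> \<alpha> s (h (inv\<^bsub>G\<^esub> s \<otimes>\<^bsub>G\<^esub> t)))"
      by (rule B_mult) (use assms True S in auto)
    also have "\<dots> = (\<Oplus>s\<in>S. f s \<otimes> \<alpha> s (h (inv\<^bsub>G\<^esub> s \<otimes>\<^bsub>G\<^esub> t)) \<oplus> g s \<otimes> \<alpha> s (h (inv\<^bsub>G\<^esub> s \<otimes>\<^bsub>G\<^esub> t)))"
      by (rule add.finprod_cong') (use assms c in \<open>auto simp: B_ops l_distr\<close>)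
    also have "\<dots> = (f \<otimes>\<^bsub>B\<^esub> h) t \<oplus> (g \<otimes>\<^bsub>B\<^esub> h) t"
      unfolding B_mult[OF assms(1,3) True S(1,3,2)] B_mult[OF assms(2,3) True S(1,4,2)]
      by (rule add.finprod_multf) (use assms c in auto)
    finally show ?thesis by (simp add: B_ops)
  qed (simp add: B_ops B_mult_def)
qed

lemma B_mult_add_right:
  assumes "f \<in> carrier B" "g \<in> carrier B" "h \<in> carrier B"
  shows "h \<otimes>\<^bsub>B\<^esub> (f \<oplus>\<^bsub>B\<^esub> g) = h \<otimes>\<^bsub>B\<^esub> f \<oplus>\<^bsub>B\<^esub> h \<otimes>\<^bsub>B\<^esub> g"
proof
  fix t
  show "(h \<otimes>\<^bsub>B\<^esub> (f \<oplus>\<^bsub>B\<^esub> g)) t = (h \<otimes>\<^bsub>B\<^esub> f \<oplus>\<^bsub>B\<^esub> h \<otimes>\<^bsub>B\<^esub> g) t"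
  proof (cases "t \<in> carrier G")
    case True
    have c: "s \<in> supp h \<Longrightarrow> s \<in> carrier G" for s using assms by (auto simp: B_carrier)
    have "(h \<otimes>\<^bsub>B\<^esub> (f \<oplus>\<^bsub>B\<^esub> g)) t
        = (\<Oplus>s\<in>supp h. h s \<otimes> \<alpha> s (f (inv\<^bsub>G\<^esub> s \<otimes>\<^bsub>G\<^esub> t)) \<oplus> h s \<otimes> \<alpha> s (g (inv\<^bsub>G\<^esub> s \<otimes>\<^bsub>G\<^esub> t)))"
      unfolding B_mult_def using True
      by (simp, intro add.finprod_cong') (use assms c in \<open>auto simp: B_ops al_add r_distr\<close>)
    also have "\<dots> = (h \<otimes>\<^bsub>B\<^esub> f) t \<oplus> (h \<otimes>\<^bsub>B\<^esub> g) t"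
      unfolding B_mult_def using True
      by (simp, intro add.finprod_multf) (use assms c in auto)
    finally show ?thesis by (simp add: B_ops)
  qed (simp add: B_ops B_mult_def)
qed

lemma B_single_mult:
  assumes "a \<in> carrier A" "s \<in> carrier G" "g \<in> carrier B"
  shows "single a s \<otimes>\<^bsub>B\<^esub> g = (\<lambda>t. if t \<in> carrier G then a \<otimes> \<alpha> s (g (inv\<^bsub>G\<^esub> s \<otimes>\<^bsub>G\<^esub> t)) else \<zero>)"
proof
  fix t
  show "(single a s \<otimes>\<^bsub>B\<^esub> g) t = (if t \<in> carrier G then a \<otimes> \<alpha> s (g (inv\<^bsub>G\<^esub> s \<otimes>\<^bsub>G\<^esub> t)) else \<zero>)"
  proof (cases "t \<in> carrier G")
    case True
    have "(single a s \<otimes>\<^bsub>B\<^esub> g) t = (\<Oplus>r\<in>{s}. single a s r \<otimes> \<alpha> r (g (inv\<^bsub>G\<^esub> r \<otimes>\<^bsub>G\<^esub> t)))"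
      by (rule B_mult) (use assms True in \<open>auto simp: supp_def single_def split: if_splits\<close>)
    then show ?thesis using assms True by (simp add: add.finprod_insert) (simp add: single_def)
  qed (simp add: B_mult_def)
qed

lemma single_mult:
  assumes "a \<in> carrier A" "s \<in> carrier G" "b \<in> carrier A" "t \<in> carrier G"
  shows "single a s \<otimes>\<^bsub>B\<^esub> single b t = single (a \<otimes> \<alpha> s b) (s \<otimes>\<^bsub>G\<^esub> t)"
proof
  fix r
  show "(single a s \<otimes>\<^bsub>B\<^esub> single b t) r = single (a \<otimes> \<alpha> s b) (s \<otimes>\<^bsub>G\<^esub> t) r"
  proof (cases "r \<in> carrier G")
    case True
    have "inv\<^bsub>G\<^esub> s \<otimes>\<^bsub>G\<^esub> r = t \<longleftrightarrow> r = s \<otimes>\<^bsub>G\<^esub> t"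
      using assms True by (metis G.inv_solve_left)
    then show ?thesis using assms True by (simp add: B_single_mult single_def)
  next
    case False
    then have "r \<noteq> s \<otimes>\<^bsub>G\<^esub> t" using assms by auto
    then show ?thesis using assms False by (simp add: B_single_mult) (simp add: single_def)
  qed
qed

lemma B_mult_zero [simp]: "f \<in> carrier B \<Longrightarrow> f \<otimes>\<^bsub>B\<^esub> \<zero>\<^bsub>B\<^esub> = \<zero>\<^bsub>B\<^esub>"
  "f \<in> carrier B \<Longrightarrow> \<zero>\<^bsub>B\<^esub> \<otimes>\<^bsub>B\<^esub> f = \<zero>\<^bsub>B\<^esub>"
proof -
  assume f: "f \<in> carrier B"
  have "(\<Oplus>s\<in>supp f. f s \<otimes> \<alpha> s \<zero>) = (\<Oplus>s\<in>supp f. \<zero>)"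
    by (rule add.finprod_cong') (use f in \<open>auto simp: B_carrier\<close>)
  then show "f \<otimes>\<^bsub>B\<^esub> \<zero>\<^bsub>B\<^esub> = \<zero>\<^bsub>B\<^esub>" by (auto simp: B_mult_def B_ops)
  show "\<zero>\<^bsub>B\<^esub> \<otimes>\<^bsub>B\<^esub> f = \<zero>\<^bsub>B\<^esub>" by (auto simp: B_mult_def B_ops supp_def)
qed

lemma B_assoc_single:
  assumes "a \<in> carrier A" "s \<in> carrier G" "b \<in> carrier A" "t \<in> carrier G" "h \<in> carrier B"
  shows "(single a s \<otimes>\<^bsub>B\<^esub> single b t) \<otimes>\<^bsub>B\<^esub> h = single a s \<otimes>\<^bsub>B\<^esub> (single b t \<otimes>\<^bsub>B\<^esub> h)"
  using assms(5)
proof (induction h rule: B_induct)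
  case (single c r)
  then show ?case using assms
    by (simp add: single_mult al_mult al_al m_assoc G.m_assoc)
qed (use assms in \<open>simp_all add: B_mult_add_right\<close>)

lemma B_assoc:
  assumes "f \<in> carrier B" "g \<in> carrier B" "h \<in> carrier B"
  shows "(f \<otimes>\<^bsub>B\<^esub> g) \<otimes>\<^bsub>B\<^esub> h = f \<otimes>\<^bsub>B\<^esub> (g \<otimes>\<^bsub>B\<^esub> h)"
  using assms(1)
proof (induction f rule: B_induct)
  case (single a s)
  show ?case using assms(2)
  proof (induction g rule: B_induct)
    case (single b t)
    then show ?case using B_assoc_single \<open>a \<in> carrier A\<close> \<open>s \<in> carrier G\<close> assms by blast
  qed (use single assms in \<open>simp_all add: B_mult_add_right B_mult_add_left\<close>)
qed (use assms in \<open>simp_all add: B_mult_add_left\<close>)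

lemma B_one_left: "f \<in> carrier B \<Longrightarrow> \<one>\<^bsub>B\<^esub> \<otimes>\<^bsub>B\<^esub> f = f"
  unfolding B_ops(1) by (subst B_single_mult) (auto simp: B_off)

lemma B_one_right: "f \<in> carrier B \<Longrightarrow> f \<otimes>\<^bsub>B\<^esub> \<one>\<^bsub>B\<^esub> = f"
proof (induction f rule: B_induct)
  case (single a s)
  then show ?case unfolding B_ops(1) by (simp add: single_mult)
qed (simp_all add: B_mult_add_left)

lemma star_single:
  assumes "a \<in> carrier A" "s \<in> carrier G"
  shows "star B (single a s) = single (\<alpha> (inv\<^bsub>G\<^esub> s) (star A a)) (inv\<^bsub>G\<^esub> s)"
proof
  fix t
  have "inv\<^bsub>G\<^esub> t = s \<longleftrightarrow> t = inv\<^bsub>G\<^esub> s" if "t \<in> carrier G" using that assms by auto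
  then show "star B (single a s) t = single (\<alpha> (inv\<^bsub>G\<^esub> s) (star A a)) (inv\<^bsub>G\<^esub> s) t"
    using assms by (auto simp: B_ops single_def)
qed

lemma B_star_add:
  "f \<in> carrier B \<Longrightarrow> g \<in> carrier B \<Longrightarrow> star B (f \<oplus>\<^bsub>B\<^esub> g) = star B f \<oplus>\<^bsub>B\<^esub> star B g"
  by (auto simp: B_ops star_add al_add)

lemma B_star_zero [simp]: "star B \<zero>\<^bsub>B\<^esub> = \<zero>\<^bsub>B\<^esub>"
  by (auto simp: B_ops)

lemma B_star_mult:
  assumes "f \<in> carrier B" "g \<in> carrier B"
  shows "star B (f \<otimes>\<^bsub>B\<^esub> g) = star B g \<otimes>\<^bsub>B\<^esub> star B f"
  using assms(1)
proof (induction f rule: B_induct)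
  case (single a s)
  note as = this
  show ?case using assms(2)
  proof (induction g rule: B_induct)
    case (single b t)
    show ?case using as single
      by (simp add: single_mult star_single star_mult al_star al_mult al_al G.inv_mult_group G.m_assoc)
  qed (use as assms in \<open>simp_all add: B_mult_add_right B_mult_add_left B_star_add\<close>)
qed (use assms in \<open>simp_all add: B_mult_add_right B_mult_add_left B_star_add\<close>)

lemma B_star_algebra: "unital_star_algebra B"
proof -
  have ag: "abelian_group B"
  proof (rule abelian_groupI)
    fix f assume f: "f \<in> carrier B"
    show "\<exists>g\<in>carrier B. g \<oplus>\<^bsub>B\<^esub> f = \<zero>\<^bsub>B\<^esub>"
    proof (rule bexI)
      show "(-1) \<odot>\<^bsub>B\<^esub> f \<oplus>\<^bsub>B\<^esub> f = \<zero>\<^bsub>B\<^esub>"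
        using f by (auto simp: B_ops fun_eq_iff l_neg simp flip: neg_s)
      show "(-1) \<odot>\<^bsub>B\<^esub> f \<in> carrier B" using f by simp
    qed
  qed (auto simp: B_ops(2,3) a_ac B_ops fun_eq_iff intro!: a_ac
        intro: B_add_closed[unfolded B_ops(3)] B_zero_closed[unfolded B_ops(2)])
  have "Module.module complex_ring B"
    by (rule moduleI[OF complex_ring_cring ag]) (auto simp: B_ops(3,4) s_plus s_add intro: B_smult_closed[unfolded B_ops(4)])
  moreover have "monoid B"
    by (rule monoidI) (auto simp: B_assoc B_one_left B_one_right)
  then have "ring B"
    by (rule ringI[OF ag]) (auto simp: B_mult_add_left B_mult_add_right)
  moreover have "unital_star_algebra_axioms B"
  proof
    fix f g c assume fg: "f \<in> carrier B" "g \<in> carrier B"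
    show "(c \<odot>\<^bsub>B\<^esub> f) \<otimes>\<^bsub>B\<^esub> g = c \<odot>\<^bsub>B\<^esub> (f \<otimes>\<^bsub>B\<^esub> g)" using fg(1)
    proof (induction f rule: B_induct)
      case (single a s)
      then show ?case using fg(2)
        by (simp add: single_smult B_single_mult smult_mult) (auto simp: B_ops(4) B_single_mult smult_mult)
    next
      case (add f f')
      have "c \<odot>\<^bsub>B\<^esub> (u \<oplus>\<^bsub>B\<^esub> v) = c \<odot>\<^bsub>B\<^esub> u \<oplus>\<^bsub>B\<^esub> c \<odot>\<^bsub>B\<^esub> v" if "u \<in> carrier B" "v \<in> carrier B" for u v
        using that by (auto simp: B_ops s_add)
      then show ?case using add fg(2) by (simp add: B_mult_add_left)
    next
      case zero
      have "c \<odot>\<^bsub>B\<^esub> \<zero>\<^bsub>B\<^esub> = \<zero>\<^bsub>B\<^esub>" by (auto simp: B_ops)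
      then show ?case using fg(2) by simp
    qed
    show "f \<otimes>\<^bsub>B\<^esub> (c \<odot>\<^bsub>B\<^esub> g) = c \<odot>\<^bsub>B\<^esub> (f \<otimes>\<^bsub>B\<^esub> g)" using fg(1)
    proof (induction f rule: B_induct)
      case (single a s)
      then show ?case using fg(2) B_smult_closed[OF fg(2), of c]
        by (auto simp: B_single_mult) (auto simp: B_ops(4) B_single_mult smult_mult al_smult)
    next
      case (add f f')
      have "c \<odot>\<^bsub>B\<^esub> (u \<oplus>\<^bsub>B\<^esub> v) = c \<odot>\<^bsub>B\<^esub> u \<oplus>\<^bsub>B\<^esub> c \<odot>\<^bsub>B\<^esub> v" if "u \<in> carrier B" "v \<in> carrier B" for u v
        using that by (auto simp: B_ops s_add)
      then show ?case using add fg(2) by (simp add: B_mult_add_left)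
    next
      case zero
      have "c \<odot>\<^bsub>B\<^esub> \<zero>\<^bsub>B\<^esub> = \<zero>\<^bsub>B\<^esub>" by (auto simp: B_ops)
      then show ?case using fg(2) by simp
    qed
    show "star B (f \<otimes>\<^bsub>B\<^esub> g) = star B g \<otimes>\<^bsub>B\<^esub> star B f" by (rule B_star_mult[OF fg])
    show "star B (f \<oplus>\<^bsub>B\<^esub> g) = star B f \<oplus>\<^bsub>B\<^esub> star B g" by (rule B_star_add[OF fg])
    show "star B f \<in> carrier B" using fg by simp
    show "star B (star B f) = f"
      using fg(1) by (auto simp: B_ops fun_eq_iff al_star[symmetric] al_al B_off)
    show "star B (c \<odot>\<^bsub>B\<^esub> f) = cnj c \<odot>\<^bsub>B\<^esub> star B f"
      using fg(1) by (auto simp: B_ops fun_eq_iff star_smult al_smult)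
  qed
  ultimately show ?thesis by (simp add: unital_star_algebra_def)
qed

sublocale B: unital_star_algebra B
  by (rule B_star_algebra)

end

section \<open>Completions by Cauchy sequences\<close>

text \<open>The seminorm is tied to the vector space structure only, because the construction is
  used twice: with the universal norm for the completion, and with the GNS seminorm
  \<open>sn\<close>, which is not submultiplicative in general, for the Hilbert space.\<close>

locale seminormed_space = unital_star_algebra A
  for A :: "('a, 'm) star_alg_scheme" (structure) +
  fixes q :: "'a \<Rightarrow> real"
  assumes q_nonneg: "x \<in> carrier A \<Longrightarrow> 0 \<le> q x"
    and q_triangle: "x \<in> carrier A \<Longrightarrow> y \<in> carrier A \<Longrightarrow> q (x \<oplus> y) \<le> q x + q y"
    and q_smult: "x \<in> carrier A \<Longrightarrow> q (c \<odot> x) = cmod c * q x"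
begin

lemma q_zero [simp]: "q \<zero> = 0"
  using q_smult[of \<zero> 0] by simp

lemma diff_closed [simp]: "x \<in> carrier A \<Longrightarrow> y \<in> carrier A \<Longrightarrow> x \<ominus> y \<in> carrier A"
  by (simp add: a_minus_def)

lemma diff_self [simp]: "x \<in> carrier A \<Longrightarrow> x \<ominus> x = \<zero>"
  by (simp add: a_minus_def r_neg)

lemma diff_zero: "x \<in> carrier A \<Longrightarrow> x \<ominus> \<zero> = x"
  by (simp add: diff_s)

lemma q_diff_commute: "x \<in> carrier A \<Longrightarrow> y \<in> carrier A \<Longrightarrow> q (x \<ominus> y) = q (y \<ominus> x)"
  using q_smult[of "y \<ominus> x" "-1"] by (simp add: diff_s s_add a_comm)

lemma q_diff_triangle:
  assumes "x \<in> carrier A" "y \<in> carrier A" "z \<in> carrier A"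
  shows "q (x \<ominus> z) \<le> q (x \<ominus> y) + q (y \<ominus> z)"
proof -
  have "x \<ominus> z = (x \<ominus> y) \<oplus> (y \<ominus> z)"
    using assms by (simp add: a_minus_def a_assoc) (simp add: l_neg flip: a_assoc)
  then show ?thesis using q_triangle[of "x \<ominus> y" "y \<ominus> z"] assms by simp
qed

lemma diff_add_cancel: "x \<in> carrier A \<Longrightarrow> y \<in> carrier A \<Longrightarrow> (x \<ominus> y) \<oplus> y = x"
  by (simp add: a_minus_def a_assoc l_neg)

lemma q_abs_diff: "x \<in> carrier A \<Longrightarrow> y \<in> carrier A \<Longrightarrow> \<bar>q x - q y\<bar> \<le> q (x \<ominus> y)"
  using q_triangle[of "x \<ominus> y" y] q_triangle[of "y \<ominus> x" x] q_diff_commute[of x y]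
  by (simp add: diff_add_cancel)

lemma add_diff_add:
  "\<lbrakk>x \<in> carrier A; y \<in> carrier A; x' \<in> carrier A; y' \<in> carrier A\<rbrakk> \<Longrightarrow> (x \<oplus> y) \<ominus> (x' \<oplus> y') = (x \<ominus> x') \<oplus> (y \<ominus> y')"
  by (simp add: diff_s s_add a_4)

section \<open>Cauchy sequences modulo null sequences\<close>

abbreviation CS :: "(nat \<Rightarrow> 'a) set" where "CS \<equiv> cauchy_seqs A q"

definition rel :: "((nat \<Rightarrow> 'a) \<times> (nat \<Rightarrow> 'a)) set" where
  "rel = {(X, Y). X \<in> CS \<and> Y \<in> CS \<and> (\<lambda>n. q (X n \<ominus> Y n)) \<longlonglongrightarrow> 0}"

definition cls :: "(nat \<Rightarrow> 'a) \<Rightarrow> (nat \<Rightarrow> 'a) set" where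
  "cls X = rel `` {X}"

lemma CS_closed [simp]: "X \<in> CS \<Longrightarrow> X n \<in> carrier A"
  by (simp add: cauchy_seqs_def)

lemma CS_D: "X \<in> CS \<Longrightarrow> 0 < e \<Longrightarrow> \<exists>N. \<forall>m\<ge>N. \<forall>n\<ge>N. q (X m \<ominus> X n) < e"
  unfolding cauchy_seqs_def by blast

lemma CS_I:
  "(\<And>n. X n \<in> carrier A) \<Longrightarrow> (\<And>e. 0 < e \<Longrightarrow> \<exists>N. \<forall>m\<ge>N. \<forall>n\<ge>N. q (X m \<ominus> X n) < e) \<Longrightarrow> X \<in> CS"
  unfolding cauchy_seqs_def by blast

lemma CS_const [simp]: "x \<in> carrier A \<Longrightarrow> (\<lambda>n. x) \<in> CS"
  by (rule CS_I) auto

lemma CS_dominated: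
  assumes X: "X \<in> CS" and Z: "\<And>n. Z n \<in> carrier A" and C: "0 \<le> C"
    and le: "\<And>m n. q (Z m \<ominus> Z n) \<le> C * q (X m \<ominus> X n)"
  shows "Z \<in> CS"
proof (rule CS_I[OF Z])
  fix e :: real assume "0 < e"
  \<comment> \<open>C may be 0, so C + 1 is used as the divisor.\<close>
  then have "0 < e / (C + 1)" using C by simp
  from CS_D[OF X this] obtain N where N: "\<And>m n. N \<le> m \<Longrightarrow> N \<le> n \<Longrightarrow> q (X m \<ominus> X n) < e / (C + 1)" by blast
  have "q (Z m \<ominus> Z n) < e" if "N \<le> m" "N \<le> n" for m n
  proof -
    have "q (Z m \<ominus> Z n) \<le> (C + 1) * q (X m \<ominus> X n)"
      using le[of m n] q_nonneg[of "X m \<ominus> X n"] X by (simp add: distrib_right)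
    also have "\<dots> < (C + 1) * (e / (C + 1))" using N[OF that] C by (intro mult_strict_left_mono) auto
    finally show ?thesis using C by simp
  qed
  then show "\<exists>N. \<forall>m\<ge>N. \<forall>n\<ge>N. q (Z m \<ominus> Z n) < e" by blast
qed

lemma CS_dominated2:
  assumes X: "X \<in> CS" and Y: "Y \<in> CS" and Z: "\<And>n. Z n \<in> carrier A" and C: "0 \<le> C"
    and le: "\<And>m n. q (Z m \<ominus> Z n) \<le> C * (q (X m \<ominus> X n) + q (Y m \<ominus> Y n))"
  shows "Z \<in> CS"
proof (rule CS_I[OF Z])
  fix e :: real assume "0 < e"
  then have "0 < e / (2 * (C + 1))" using C by simp
  from CS_D[OF X this] CS_D[OF Y this] obtain N M
    where N: "\<And>m n. N \<le> m \<Longrightarrow> N \<le> n \<Longrightarrow> q (X m \<ominus> X n) < e / (2 * (C + 1))"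
      and M: "\<And>m n. M \<le> m \<Longrightarrow> M \<le> n \<Longrightarrow> q (Y m \<ominus> Y n) < e / (2 * (C + 1))" by blast
  have "q (Z m \<ominus> Z n) < e" if "max N M \<le> m" "max N M \<le> n" for m n
  proof -
    have "q (Z m \<ominus> Z n) \<le> (C + 1) * (q (X m \<ominus> X n) + q (Y m \<ominus> Y n))"
      using le[of m n] q_nonneg[of "X m \<ominus> X n"] q_nonneg[of "Y m \<ominus> Y n"] X Y by (simp add: distrib_right)
    also have "\<dots> < (C + 1) * (e / (2 * (C + 1)) + e / (2 * (C + 1)))"
      using N[of m n] M[of m n] C that by (intro mult_strict_left_mono add_strict_mono) auto
    also have "\<dots> = e"
    proof -
      define K where "K = C + 1"
      have "K \<noteq> 0" using C by (simp add: K_def)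
      then have "K * (e / (2 * K) + e / (2 * K)) = e" by (simp add: field_simps)
      then show ?thesis by (simp only: K_def)
    qed
    finally show ?thesis .
  qed
  then show "\<exists>N. \<forall>m\<ge>N. \<forall>n\<ge>N. q (Z m \<ominus> Z n) < e" by blast
qed

lemma CS_add [simp]:
  assumes "X \<in> CS" "Y \<in> CS"
  shows "(\<lambda>n. X n \<oplus> Y n) \<in> CS"
proof (rule CS_dominated2[OF assms, of _ 1])
  fix m n
  show "q ((X m \<oplus> Y m) \<ominus> (X n \<oplus> Y n)) \<le> 1 * (q (X m \<ominus> X n) + q (Y m \<ominus> Y n))"
    using q_triangle[of "X m \<ominus> X n" "Y m \<ominus> Y n"] assms by (simp add: add_diff_add)
qed (use assms in auto)

lemma CS_smult [simp]:
  assumes "X \<in> CS"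
  shows "(\<lambda>n. c \<odot> X n) \<in> CS"
proof (rule CS_dominated[OF assms, of _ "cmod c"])
  fix m n
  have "c \<odot> X m \<ominus> c \<odot> X n = c \<odot> (X m \<ominus> X n)"
    using assms by (simp add: diff_s s_add mult.commute)
  then show "q (c \<odot> X m \<ominus> c \<odot> X n) \<le> cmod c * q (X m \<ominus> X n)" using assms by (simp add: q_smult)
qed (use assms in auto)

lemma CS_diff [simp]: "X \<in> CS \<Longrightarrow> Y \<in> CS \<Longrightarrow> (\<lambda>n. X n \<ominus> Y n) \<in> CS"
  using CS_add[of X "\<lambda>n. (-1) \<odot> Y n"] by (simp add: diff_s)

lemma CS_convergent:
  assumes "X \<in> CS"
  shows "convergent (\<lambda>n. q (X n))"
proof -
  have "Cauchy (\<lambda>n. q (X n))"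
    unfolding Cauchy_def
  proof (intro allI impI)
    fix e :: real assume "0 < e"
    from CS_D[OF assms this] obtain N where N: "\<And>m n. N \<le> m \<Longrightarrow> N \<le> n \<Longrightarrow> q (X m \<ominus> X n) < e" by blast
    show "\<exists>M. \<forall>m\<ge>M. \<forall>n\<ge>M. dist (q (X m)) (q (X n)) < e"
    proof (intro exI[of _ N] allI impI)
      fix m n assume "N \<le> m" "N \<le> n"
      then show "dist (q (X m)) (q (X n)) < e"
        using le_less_trans[OF q_abs_diff N[of m n]] assms by (simp add: dist_real_def)
    qed
  qed
  then show ?thesis by (simp add: Cauchy_convergent)
qed

lemma CS_lim: "X \<in> CS \<Longrightarrow> (\<lambda>n. q (X n)) \<longlonglongrightarrow> lim (\<lambda>n. q (X n))"
  using CS_convergent convergent_LIMSEQ_iff by blast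

lemma CS_bounded:
  assumes "X \<in> CS"
  obtains M where "0 < M" "\<And>n. q (X n) \<le> M"
proof -
  have "Bseq (\<lambda>n. q (X n))" using CS_convergent[OF assms] by (rule convergent_imp_Bseq)
  then obtain M where "0 < M" "\<And>n. norm (q (X n)) \<le> M" by (auto simp: Bseq_def)
  then show thesis using that by (metis abs_le_D1 real_norm_def)
qed

lemma rel_refl: "X \<in> CS \<Longrightarrow> (X, X) \<in> rel"
  by (simp add: rel_def)

lemma rel_sym: "(X, Y) \<in> rel \<Longrightarrow> (Y, X) \<in> rel"
proof -
  assume r: "(X, Y) \<in> rel"
  then have "q (Y n \<ominus> X n) = q (X n \<ominus> Y n)" for n by (intro q_diff_commute) (auto simp: rel_def)
  then show ?thesis using r by (simp add: rel_def)
qed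

lemma rel_trans: "(X, Y) \<in> rel \<Longrightarrow> (Y, Z) \<in> rel \<Longrightarrow> (X, Z) \<in> rel"
proof -
  assume r: "(X, Y) \<in> rel" "(Y, Z) \<in> rel"
  then have c: "X \<in> CS" "Y \<in> CS" "Z \<in> CS" by (auto simp: rel_def)
  have "(\<lambda>n. q (X n \<ominus> Y n) + q (Y n \<ominus> Z n)) \<longlonglongrightarrow> 0 + 0"
    using r unfolding rel_def by (intro tendsto_add) auto
  then have lim: "(\<lambda>n. q (X n \<ominus> Y n) + q (Y n \<ominus> Z n)) \<longlonglongrightarrow> 0" by simp
  have "(\<lambda>n. q (X n \<ominus> Z n)) \<longlonglongrightarrow> 0"
  proof (rule tendsto_sandwich[OF _ _ tendsto_const lim]; rule always_eventually, rule allI)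
    fix n
    show "0 \<le> q (X n \<ominus> Z n)" using c by (intro q_nonneg) simp
    show "q (X n \<ominus> Z n) \<le> q (X n \<ominus> Y n) + q (Y n \<ominus> Z n)" using c by (intro q_diff_triangle) auto
  qed
  then show ?thesis using c by (simp add: rel_def)
qed

lemma cls_mem: "Y \<in> cls X \<longleftrightarrow> (X, Y) \<in> rel"
  by (simp add: cls_def)

lemma cls_self [simp]: "X \<in> CS \<Longrightarrow> X \<in> cls X"
  by (simp add: cls_mem rel_refl)

lemma cls_cong: "(X, Y) \<in> rel \<Longrightarrow> cls X = cls Y"
  unfolding set_eq_iff cls_mem by (meson rel_sym rel_trans)

lemma cls_eq: "X \<in> CS \<Longrightarrow> cls X = cls Y \<longleftrightarrow> (X, Y) \<in> rel"
  using cls_cong cls_self rel_sym by (metis cls_mem)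

lemma quotient_cls: "P \<in> CS // rel \<longleftrightarrow> (\<exists>X\<in>CS. P = cls X)"
  by (auto simp: quotient_def cls_def)

lemma UN_cls:
  assumes "X \<in> CS" "\<And>X'. (X, X') \<in> rel \<Longrightarrow> F X' = F X"
  shows "(\<Union>X'\<in>cls X. F X') = F X"
proof -
  have "F X' = F X" if "X' \<in> cls X" for X' using assms(2) that by (simp add: cls_mem)
  then have "(\<Union>X'\<in>cls X. F X') = (\<Union>X'\<in>cls X. F X)" by simp
  then show ?thesis using cls_self[OF assms(1)] by auto
qed

lemma some_cls: "X \<in> CS \<Longrightarrow> (X, SOME Y. Y \<in> cls X) \<in> rel"
  using someI_ex[of "\<lambda>Y. Y \<in> cls X"] cls_self cls_mem by blast

lemma rel_add:
  assumes "(X, X') \<in> rel" "(Y, Y') \<in> rel"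
  shows "((\<lambda>n. X n \<oplus> Y n), (\<lambda>n. X' n \<oplus> Y' n)) \<in> rel"
proof -
  have c: "X \<in> CS" "X' \<in> CS" "Y \<in> CS" "Y' \<in> CS" using assms by (auto simp: rel_def)
  have "(\<lambda>n. q (X n \<ominus> X' n) + q (Y n \<ominus> Y' n)) \<longlonglongrightarrow> 0 + 0"
    using assms unfolding rel_def by (intro tendsto_add) auto
  then have lim: "(\<lambda>n. q (X n \<ominus> X' n) + q (Y n \<ominus> Y' n)) \<longlonglongrightarrow> 0" by simp
  have "(\<lambda>n. q ((X n \<oplus> Y n) \<ominus> (X' n \<oplus> Y' n))) \<longlonglongrightarrow> 0"
  proof (rule tendsto_sandwich[OF _ _ tendsto_const lim]; rule always_eventually, rule allI)
    fix n
    show "0 \<le> q ((X n \<oplus> Y n) \<ominus> (X' n \<oplus> Y' n))" using c by (intro q_nonneg) simp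
    show "q ((X n \<oplus> Y n) \<ominus> (X' n \<oplus> Y' n)) \<le> q (X n \<ominus> X' n) + q (Y n \<ominus> Y' n)"
      using q_triangle[of "X n \<ominus> X' n" "Y n \<ominus> Y' n"] c by (simp add: add_diff_add)
  qed
  then show ?thesis using c by (simp add: rel_def)
qed

lemma rel_smult:
  assumes "(X, X') \<in> rel"
  shows "((\<lambda>n. c \<odot> X n), (\<lambda>n. c \<odot> X' n)) \<in> rel"
proof -
  have CSx: "X \<in> CS" "X' \<in> CS" using assms by (auto simp: rel_def)
  have "q (c \<odot> X n \<ominus> c \<odot> X' n) = cmod c * q (X n \<ominus> X' n)" for n
  proof -
    have "c \<odot> X n \<ominus> c \<odot> X' n = c \<odot> (X n \<ominus> X' n)"
      using CSx by (simp add: diff_s s_add mult.commute)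
    then show ?thesis using CSx by (simp add: q_smult)
  qed
  moreover have "(\<lambda>n. cmod c * q (X n \<ominus> X' n)) \<longlonglongrightarrow> cmod c * 0"
    using assms unfolding rel_def by (intro tendsto_mult_left) auto
  ultimately show ?thesis using CSx by (simp add: rel_def)
qed

theorem complete:
  assumes X: "\<And>k. X k \<in> CS"
    and Cau: "\<And>e. 0 < e \<Longrightarrow> \<exists>N. \<forall>k\<ge>N. \<forall>l\<ge>N. lim (\<lambda>n. q (X k n \<ominus> X l n)) < e"
  shows "\<exists>D\<in>CS. (\<lambda>k. lim (\<lambda>n. q (X k n \<ominus> D n))) \<longlonglongrightarrow> 0"
proof -
  define r where "r k = inverse (real (Suc k))" for k
  have r: "0 < r k" for k by (simp add: r_def)
  have rl: "r \<longlonglongrightarrow> 0" unfolding r_def by (rule LIMSEQ_inverse_real_of_nat)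
  have "\<exists>j. \<forall>m\<ge>j. \<forall>n\<ge>j. q (X k m \<ominus> X k n) < r k" for k using CS_D[OF X r] .
  then obtain j where j: "\<And>k m n. j k \<le> m \<Longrightarrow> j k \<le> n \<Longrightarrow> q (X k m \<ominus> X k n) < r k" by metis
  \<comment> \<open>A diagonal sequence: from index j k on, X k varies by less than r k, so its term
    at j k represents the whole sequence up to r k.\<close>
  define D where "D k = X k (j k)" for k
  have Dc: "D k \<in> carrier A" for k using X by (simp add: D_def)
  have D: "q (D k \<ominus> X k n) < r k" if "j k \<le> n" for k n using j[of k "j k" n] that by (simp add: D_def)
  have Dkl: "q (D k \<ominus> D l) \<le> r k + r l + lim (\<lambda>n. q (X k n \<ominus> X l n))" for k l
  proof (rule LIMSEQ_le_const)
    have "(\<lambda>n. q (X k n \<ominus> X l n)) \<longlonglongrightarrow> lim (\<lambda>n. q (X k n \<ominus> X l n))" using X by (intro CS_lim) auto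
    then show "(\<lambda>n. r k + r l + q (X k n \<ominus> X l n)) \<longlonglongrightarrow> r k + r l + lim (\<lambda>n. q (X k n \<ominus> X l n))"
      by (intro tendsto_intros)
    have "q (D k \<ominus> D l) \<le> r k + r l + q (X k n \<ominus> X l n)" if n: "max (j k) (j l) \<le> n" for n
    proof -
      have "q (D k \<ominus> D l) \<le> q (D k \<ominus> X k n) + q (X k n \<ominus> D l)" using X Dc by (intro q_diff_triangle) auto
      also have "q (X k n \<ominus> D l) \<le> q (X k n \<ominus> X l n) + q (X l n \<ominus> D l)" using X Dc by (intro q_diff_triangle) auto
      also have "q (X l n \<ominus> D l) = q (D l \<ominus> X l n)" using X Dc by (intro q_diff_commute) auto
      finally show ?thesis using D[of k n] D[of l n] n by simp
    qed
    then show "\<exists>N. \<forall>n\<ge>N. q (D k \<ominus> D l) \<le> r k + r l + q (X k n \<ominus> X l n)" by blast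
  qed
  have small: "\<exists>N. \<forall>k\<ge>N. r k < e" if "0 < e" for e
    using order_tendstoD(2)[OF rl that] by (simp add: eventually_sequentially)
  have DCS: "D \<in> CS"
  proof (rule CS_I[OF Dc])
    fix e :: real assume e: "0 < e"
    obtain N where N: "\<And>k. N \<le> k \<Longrightarrow> r k < e / 3" using small[of "e/3"] e by auto
    obtain M where M: "\<And>k l. M \<le> k \<Longrightarrow> M \<le> l \<Longrightarrow> lim (\<lambda>n. q (X k n \<ominus> X l n)) < e / 3" using Cau[of "e/3"] e by auto
    have "q (D k \<ominus> D l) < e" if "max N M \<le> k" "max N M \<le> l" for k l
      using Dkl[of k l] N[of k] N[of l] M[of k l] that by simp
    then show "\<exists>N. \<forall>m\<ge>N. \<forall>n\<ge>N. q (D m \<ominus> D n) < e" by blast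
  qed
  have "(\<lambda>k. lim (\<lambda>n. q (X k n \<ominus> D n))) \<longlonglongrightarrow> 0"
  proof (rule LIMSEQ_I)
    fix e :: real assume e: "0 < e"
    obtain N where N: "\<And>k. N \<le> k \<Longrightarrow> r k < e / 3" using small[of "e/3"] e by auto
    obtain M where M: "\<And>k l. M \<le> k \<Longrightarrow> M \<le> l \<Longrightarrow> q (D k \<ominus> D l) < e / 3" using CS_D[OF DCS, of "e/3"] e by auto
    have "norm (lim (\<lambda>n. q (X k n \<ominus> D n)) - 0) < e" if k: "max N M \<le> k" for k
    proof -
      have c: "(\<lambda>n. q (X k n \<ominus> D n)) \<longlonglongrightarrow> lim (\<lambda>n. q (X k n \<ominus> D n))" using X DCS by (intro CS_lim) auto
      have "q (X k n \<ominus> D n) \<le> 2 * (e / 3)" if n: "max (j k) (max N M) \<le> n" for n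
      proof -
        have "q (X k n \<ominus> D n) \<le> q (X k n \<ominus> D k) + q (D k \<ominus> D n)" using X Dc by (intro q_diff_triangle) auto
        also have "q (X k n \<ominus> D k) = q (D k \<ominus> X k n)" using X Dc by (intro q_diff_commute) auto
        finally show ?thesis using D[of k n] N[of k] M[of k n] n k by simp
      qed
      then have "lim (\<lambda>n. q (X k n \<ominus> D n)) \<le> 2 * (e / 3)"
        by (intro LIMSEQ_le_const2[OF c]) blast
      moreover have "0 \<le> lim (\<lambda>n. q (X k n \<ominus> D n))"
        by (rule LIMSEQ_le_const[OF c]) (use X Dc q_nonneg in auto)
      ultimately show ?thesis using e by simp
    qed
    then show "\<exists>N. \<forall>k\<ge>N. norm (lim (\<lambda>n. q (X k n \<ominus> D n)) - 0) < e" by blast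
  qed
  then show ?thesis using DCS by blast
qed

end

section \<open>The universal completion\<close>

locale bounded_star_algebra = unital_star_algebra A
  for A :: "('a, 'm) star_alg_scheme" (structure) +
  assumes seminorms_bounded: "x \<in> carrier A \<Longrightarrow> \<exists>C. \<forall>p. cstar_seminorm A p \<longrightarrow> p x \<le> C"
begin

lemma le_univ_norm: "cstar_seminorm A p \<Longrightarrow> x \<in> carrier A \<Longrightarrow> p x \<le> univ_norm A x"
  unfolding univ_norm_def using seminorms_bounded[of x]
  by (intro cSUP_upper) (auto intro: bdd_aboveI2)

lemma zero_seminorm: "cstar_seminorm A (\<lambda>_. 0)"
  by (simp add: cstar_seminorm_def)

lemma univ_norm_least: "(\<And>p. cstar_seminorm A p \<Longrightarrow> p x \<le> C) \<Longrightarrow> univ_norm A x \<le> C"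
  unfolding univ_norm_def using zero_seminorm by (intro cSUP_least) auto

lemma univ_norm_nonneg: "x \<in> carrier A \<Longrightarrow> 0 \<le> univ_norm A x"
  using le_univ_norm[OF zero_seminorm] .

text \<open>Each property passes from the single seminorms to the supremum. For the lower half of
  the C*-identity, p x is at most the square root of the universal norm of x*x for every p.\<close>

lemma univ_norm_seminorm: "cstar_seminorm A (univ_norm A)"
  unfolding cstar_seminorm_def
proof (intro conjI ballI allI)
  fix x y assume xy: "x \<in> carrier A" "y \<in> carrier A"
  show "univ_norm A (x \<oplus> y) \<le> univ_norm A x + univ_norm A y"
  proof (rule univ_norm_least)
    fix p assume p: "cstar_seminorm A p"
    interpret p: cstar_seminormed A p by unfold_locales (rule p)
    show "p (x \<oplus> y) \<le> univ_norm A x + univ_norm A y"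
      using p.p_triangle[OF xy] le_univ_norm[OF p xy(1)] le_univ_norm[OF p xy(2)] by linarith
  qed
  show "univ_norm A (x \<otimes> y) \<le> univ_norm A x * univ_norm A y"
  proof (rule univ_norm_least)
    fix p assume p: "cstar_seminorm A p"
    interpret p: cstar_seminormed A p by unfold_locales (rule p)
    have "p (x \<otimes> y) \<le> p x * p y" by (rule p.p_mult[OF xy])
    also have "\<dots> \<le> univ_norm A x * univ_norm A y"
      using p xy by (intro mult_mono le_univ_norm univ_norm_nonneg p.p_nonneg)
    finally show "p (x \<otimes> y) \<le> univ_norm A x * univ_norm A y" .
  qed
next
  fix x assume x: "x \<in> carrier A"
  show "0 \<le> univ_norm A x" by (rule univ_norm_nonneg[OF x])
  show "univ_norm A (star A x \<otimes> x) = (univ_norm A x)\<^sup>2"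
  proof (rule antisym)
    show "univ_norm A (star A x \<otimes> x) \<le> (univ_norm A x)\<^sup>2"
    proof (rule univ_norm_least)
      fix p assume p: "cstar_seminorm A p"
      interpret p: cstar_seminormed A p by unfold_locales (rule p)
      show "p (star A x \<otimes> x) \<le> (univ_norm A x)\<^sup>2"
        unfolding p.p_cstar[OF x] using p x by (intro power_mono le_univ_norm p.p_nonneg)
    qed
    have "univ_norm A x \<le> sqrt (univ_norm A (star A x \<otimes> x))"
    proof (rule univ_norm_least)
      fix p assume p: "cstar_seminorm A p"
      interpret p: cstar_seminormed A p by unfold_locales (rule p)
      have "(p x)\<^sup>2 \<le> univ_norm A (star A x \<otimes> x)"
        unfolding p.p_cstar[OF x, symmetric] using p x by (intro le_univ_norm) auto
      then show "p x \<le> sqrt (univ_norm A (star A x \<otimes> x))" by (rule real_le_rsqrt)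
    qed
    then show "(univ_norm A x)\<^sup>2 \<le> univ_norm A (star A x \<otimes> x)"
      using univ_norm_nonneg[OF x] univ_norm_nonneg[of "star A x \<otimes> x"] x
      by (metis m_closed power_mono real_sqrt_pow2 star_closed)
  qed
next
  fix c x assume x: "x \<in> carrier A"
  have le: "univ_norm A (c \<odot> x) \<le> cmod c * univ_norm A x" if x: "x \<in> carrier A" for c x
  proof (rule univ_norm_least)
    fix p assume p: "cstar_seminorm A p"
    interpret p: cstar_seminormed A p by unfold_locales (rule p)
    show "p (c \<odot> x) \<le> cmod c * univ_norm A x"
      unfolding p.p_smult[OF x] using p x by (intro mult_left_mono le_univ_norm) auto
  qed
  show "univ_norm A (c \<odot> x) = cmod c * univ_norm A x"
  proof (cases "c = 0")
    case True
    then show ?thesis using le[OF x, of 0] univ_norm_nonneg[of \<zero>] x by simp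
  next
    case False
    have "univ_norm A x \<le> cmod (1 / c) * univ_norm A (c \<odot> x)"
      using le[of "c \<odot> x" "1 / c"] x False by simp
    then have "cmod c * univ_norm A x \<le> univ_norm A (c \<odot> x)"
      using False by (simp add: norm_divide le_divide_eq mult.commute)
    then show ?thesis using le[OF x, of c] by simp
  qed
qed

sublocale U: cstar_seminormed A "univ_norm A"
  by unfold_locales (rule univ_norm_seminorm)

sublocale S: seminormed_space A "univ_norm A"
  by unfold_locales (auto simp: U.p_nonneg U.p_triangle U.p_smult)

lemma completion_class_cls: "completion_class A X = S.cls X"
  by (simp add: completion_class_def S.cls_def completion_rel_def S.rel_def)

lemma completion_carrier: "P \<in> carrier (univ_completion A) \<longleftrightarrow> (\<exists>X\<in>S.CS. P = S.cls X)"
proof -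
  have "carrier (univ_completion A) = S.CS // S.rel"
    by (simp add: univ_completion_def completion_rel_def S.rel_def)
  then show ?thesis using S.quotient_cls by blast
qed

lemma mult_diff_le:
  assumes "x \<in> carrier A" "y \<in> carrier A" "x' \<in> carrier A" "y' \<in> carrier A"
  shows "univ_norm A (x \<otimes> y \<ominus> x' \<otimes> y')
    \<le> univ_norm A (x \<ominus> x') * univ_norm A y + univ_norm A x' * univ_norm A (y \<ominus> y')"
proof -
  have "x \<otimes> y \<ominus> x' \<otimes> y' = (x \<ominus> x') \<otimes> y \<oplus> x' \<otimes> (y \<ominus> y')"
  proof -
    have "(x \<ominus> x') \<otimes> y \<oplus> x' \<otimes> (y \<ominus> y')
      = (x \<otimes> y \<oplus> (-1) \<odot> (x' \<otimes> y)) \<oplus> (x' \<otimes> y \<oplus> (-1) \<odot> (x' \<otimes> y'))"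
      using assms by (simp add: diff_s l_distr r_distr smult_mult)
    also have "\<dots> = x \<otimes> y \<oplus> (-1) \<odot> (x' \<otimes> y')"
      using assms by (simp add: a_assoc flip: neg_s) (simp add: l_neg flip: a_assoc)
    finally show ?thesis using assms by (simp add: diff_s)
  qed
  then have "univ_norm A (x \<otimes> y \<ominus> x' \<otimes> y')
    \<le> univ_norm A ((x \<ominus> x') \<otimes> y) + univ_norm A (x' \<otimes> (y \<ominus> y'))"
    using U.p_triangle[of "(x \<ominus> x') \<otimes> y" "x' \<otimes> (y \<ominus> y')"] assms by simp
  also have "\<dots> \<le> univ_norm A (x \<ominus> x') * univ_norm A y + univ_norm A x' * univ_norm A (y \<ominus> y')"
    using assms by (intro add_mono U.p_mult) auto
  finally show ?thesis .
qed

lemma CS_mult [simp]: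
  assumes X: "X \<in> S.CS" and Y: "Y \<in> S.CS"
  shows "(\<lambda>n. X n \<otimes> Y n) \<in> S.CS"
proof -
  obtain M where M: "0 < M" "\<And>n. univ_norm A (X n) \<le> M" using S.CS_bounded[OF X] by blast
  obtain K where K: "0 < K" "\<And>n. univ_norm A (Y n) \<le> K" using S.CS_bounded[OF Y] by blast
  show ?thesis
  proof (rule S.CS_dominated2[OF X Y, of _ "max M K"])
    fix m n
    have "univ_norm A (X m \<otimes> Y m \<ominus> X n \<otimes> Y n)
      \<le> univ_norm A (X m \<ominus> X n) * univ_norm A (Y m) + univ_norm A (X n) * univ_norm A (Y m \<ominus> Y n)"
      using X Y by (intro mult_diff_le) auto
    also have "\<dots> \<le> univ_norm A (X m \<ominus> X n) * max M K + max M K * univ_norm A (Y m \<ominus> Y n)"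
      using M(2)[of n] K(2)[of m] X Y
      by (intro add_mono mult_left_mono mult_right_mono) (auto simp: univ_norm_nonneg)
    finally show "univ_norm A (X m \<otimes> Y m \<ominus> X n \<otimes> Y n)
      \<le> max M K * (univ_norm A (X m \<ominus> X n) + univ_norm A (Y m \<ominus> Y n))" by (simp add: algebra_simps)
  qed (use X Y M in auto)
qed

lemma rel_mult:
  assumes r: "(X, X') \<in> S.rel" "(Y, Y') \<in> S.rel"
  shows "((\<lambda>n. X n \<otimes> Y n), (\<lambda>n. X' n \<otimes> Y' n)) \<in> S.rel"
proof -
  have c: "X \<in> S.CS" "X' \<in> S.CS" "Y \<in> S.CS" "Y' \<in> S.CS" using r by (auto simp: S.rel_def)
  obtain M where M: "0 < M" "\<And>n. univ_norm A (X' n) \<le> M" using S.CS_bounded[OF c(2)] by blast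
  obtain K where K: "0 < K" "\<And>n. univ_norm A (Y n) \<le> K" using S.CS_bounded[OF c(3)] by blast
  have "(\<lambda>n. univ_norm A (X n \<ominus> X' n) * K + M * univ_norm A (Y n \<ominus> Y' n)) \<longlonglongrightarrow> 0 * K + M * 0"
    using r unfolding S.rel_def by (intro tendsto_intros) auto
  then have lim: "(\<lambda>n. univ_norm A (X n \<ominus> X' n) * K + M * univ_norm A (Y n \<ominus> Y' n)) \<longlonglongrightarrow> 0" by simp
  have "(\<lambda>n. univ_norm A (X n \<otimes> Y n \<ominus> X' n \<otimes> Y' n)) \<longlonglongrightarrow> 0"
  proof (rule tendsto_sandwich[OF _ _ tendsto_const lim]; rule always_eventually, rule allI)
    fix n
    show "0 \<le> univ_norm A (X n \<otimes> Y n \<ominus> X' n \<otimes> Y' n)" using c by (intro univ_norm_nonneg) simp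
    have "univ_norm A (X n \<otimes> Y n \<ominus> X' n \<otimes> Y' n)
      \<le> univ_norm A (X n \<ominus> X' n) * univ_norm A (Y n) + univ_norm A (X' n) * univ_norm A (Y n \<ominus> Y' n)"
      using c by (intro mult_diff_le) auto
    also have "\<dots> \<le> univ_norm A (X n \<ominus> X' n) * K + M * univ_norm A (Y n \<ominus> Y' n)"
      using M(2)[of n] K(2)[of n] c
      by (intro add_mono mult_left_mono mult_right_mono) (auto simp: univ_norm_nonneg)
    finally show "univ_norm A (X n \<otimes> Y n \<ominus> X' n \<otimes> Y' n) \<le> \<dots>" .
  qed
  then show ?thesis using c by (simp add: S.rel_def)
qed

lemma star_diff_norm:
  "x \<in> carrier A \<Longrightarrow> y \<in> carrier A \<Longrightarrow> univ_norm A (star A x \<ominus> star A y) = univ_norm A (x \<ominus> y)"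
  using U.p_star[of "x \<ominus> y"] by (simp add: star_diff)

lemma CS_star [simp]:
  assumes X: "X \<in> S.CS"
  shows "(\<lambda>n. star A (X n)) \<in> S.CS"
  by (rule S.CS_dominated[OF X, of _ 1]) (use X in \<open>auto simp: star_diff_norm\<close>)

lemma rel_star: "(X, X') \<in> S.rel \<Longrightarrow> ((\<lambda>n. star A (X n)), (\<lambda>n. star A (X' n))) \<in> S.rel"
  by (auto simp: S.rel_def star_diff_norm)

lemma completion_ops:
  assumes X: "X \<in> S.CS" and Y: "Y \<in> S.CS"
  shows "S.cls X \<otimes>\<^bsub>univ_completion A\<^esub> S.cls Y = S.cls (\<lambda>n. X n \<otimes> Y n)"
    "S.cls X \<oplus>\<^bsub>univ_completion A\<^esub> S.cls Y = S.cls (\<lambda>n. X n \<oplus> Y n)"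
    "c \<odot>\<^bsub>univ_completion A\<^esub> S.cls X = S.cls (\<lambda>n. c \<odot> X n)"
    "star (univ_completion A) (S.cls X) = S.cls (\<lambda>n. star A (X n))"
    "\<one>\<^bsub>univ_completion A\<^esub> = S.cls (\<lambda>n. \<one>)"
proof -
  \<comment> \<open>When F respects the relation, all pairs of representatives give the same class,
    and the double union reduces to it.\<close>
  have lift2: "(\<Union>X'\<in>S.cls X. \<Union>Y'\<in>S.cls Y. S.cls (F X' Y')) = S.cls (F X Y)"
    if F: "\<And>X' Y'. (X, X') \<in> S.rel \<Longrightarrow> (Y, Y') \<in> S.rel \<Longrightarrow> (F X Y, F X' Y') \<in> S.rel" for F
  proof -
    have "(\<Union>Y'\<in>S.cls Y. S.cls (F X' Y')) = S.cls (F X Y)" if X': "(X, X') \<in> S.rel" for X'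
    proof -
      have e: "S.cls (F X' Y') = S.cls (F X Y)" if "(Y, Y') \<in> S.rel" for Y'
        using S.cls_cong[OF F[OF X' that]] by simp
      have "(\<Union>Y'\<in>S.cls Y. S.cls (F X' Y')) = S.cls (F X' Y)"
        by (rule S.UN_cls[OF Y]) (use e S.rel_refl[OF Y] in metis)
      then show ?thesis using e S.rel_refl[OF Y] by metis
    qed
    then show ?thesis
      by (intro S.UN_cls[OF X, where F = "\<lambda>X'. \<Union>Y'\<in>S.cls Y. S.cls (F X' Y')", THEN trans])
         (use S.rel_refl[OF X] in metis)+
  qed
  have lift1: "(\<Union>X'\<in>S.cls X. S.cls (F X')) = S.cls (F X)"
    if F: "\<And>X'. (X, X') \<in> S.rel \<Longrightarrow> (F X, F X') \<in> S.rel" for F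
    by (rule S.UN_cls[OF X]) (use S.cls_cong F in metis)
  show "S.cls X \<otimes>\<^bsub>univ_completion A\<^esub> S.cls Y = S.cls (\<lambda>n. X n \<otimes> Y n)"
    using lift2[of "\<lambda>X Y n. X n \<otimes> Y n"] rel_mult by (simp add: univ_completion_def completion_class_cls)
  show "S.cls X \<oplus>\<^bsub>univ_completion A\<^esub> S.cls Y = S.cls (\<lambda>n. X n \<oplus> Y n)"
    using lift2[of "\<lambda>X Y n. X n \<oplus> Y n"] S.rel_add by (simp add: univ_completion_def completion_class_cls)
  show "c \<odot>\<^bsub>univ_completion A\<^esub> S.cls X = S.cls (\<lambda>n. c \<odot> X n)"
    using lift1[of "\<lambda>X n. c \<odot> X n"] S.rel_smult by (simp add: univ_completion_def completion_class_cls)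
  show "star (univ_completion A) (S.cls X) = S.cls (\<lambda>n. star A (X n))"
    using lift1[of "\<lambda>X n. star A (X n)"] rel_star by (simp add: univ_completion_def completion_class_cls)
  show "\<one>\<^bsub>univ_completion A\<^esub> = S.cls (\<lambda>n. \<one>)"
    by (simp add: univ_completion_def completion_class_cls)
qed

lemmas completion_mult = completion_ops(1) and completion_add = completion_ops(2)

lemma completion_smult: "X \<in> S.CS \<Longrightarrow> c \<odot>\<^bsub>univ_completion A\<^esub> S.cls X = S.cls (\<lambda>n. c \<odot> X n)"
  by (rule completion_ops(3))

lemma completion_star: "X \<in> S.CS \<Longrightarrow> star (univ_completion A) (S.cls X) = S.cls (\<lambda>n. star A (X n))"
  by (rule completion_ops(4))

lemma completion_one: "\<one>\<^bsub>univ_completion A\<^esub> = S.cls (\<lambda>n. \<one>)"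
  by (rule completion_ops(5)[of "\<lambda>n. \<one>" "\<lambda>n. \<one>"]) auto

lemma embed_cls: "completion_embed A x = S.cls (\<lambda>n. x)"
  by (simp add: completion_embed_def completion_class_cls)

lemma embed_closed: "x \<in> carrier A \<Longrightarrow> completion_embed A x \<in> carrier (univ_completion A)"
  unfolding completion_carrier embed_cls by (rule bexI[of _ "\<lambda>n. x"]) auto

lemma embed_hom: "completion_embed A \<in> unital_star_hom A (univ_completion A)"
  unfolding unital_star_hom_def unital_alg_hom_def ring_hom_def
  by (simp add: embed_closed) (simp add: embed_cls completion_mult completion_add completion_smult completion_star completion_one)

end

section \<open>The GNS representation of the universal completion\<close>

sublocale positive_functional \<subseteq> HS: seminormed_space A sn
  by unfold_locales (auto simp: sn_triangle sn_smult)

context positive_functional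
begin

lemma form_diff:
  assumes "x \<in> carrier A" "y \<in> carrier A" "x' \<in> carrier A" "y' \<in> carrier A"
  shows "cmod (\<psi> (star A y \<otimes> x) - \<psi> (star A y' \<otimes> x')) \<le> sn (x \<ominus> x') * sn y + sn x' * sn (y \<ominus> y')"
proof -
  have "\<psi> (star A y \<otimes> x) - \<psi> (star A y' \<otimes> x')
      = \<psi> (star A y \<otimes> (x \<ominus> x')) + \<psi> (star A (y \<ominus> y') \<otimes> x')"
    using assms by (simp add: diff_s r_distr l_distr star_add star_smult smult_mult psi_add psi_smult)
  also have "cmod \<dots> \<le> cmod (\<psi> (star A y \<otimes> (x \<ominus> x'))) + cmod (\<psi> (star A (y \<ominus> y') \<otimes> x'))"
    by (rule norm_triangle_ineq)
  also have "\<dots> \<le> sn (x \<ominus> x') * sn y + sn x' * sn (y \<ominus> y')"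
    using assms by (intro add_mono psi_bound) auto
  finally show ?thesis .
qed

definition form :: "(nat \<Rightarrow> 'a) \<Rightarrow> (nat \<Rightarrow> 'a) \<Rightarrow> nat \<Rightarrow> complex" where
  "form X Y n = \<psi> (star A (Y n) \<otimes> X n)"

lemma form_convergent:
  assumes X: "X \<in> HS.CS" and Y: "Y \<in> HS.CS"
  shows "convergent (form X Y)"
proof -
  obtain M where M: "0 < M" "\<And>n. sn (X n) \<le> M" using HS.CS_bounded[OF X] by blast
  obtain K where K: "0 < K" "\<And>n. sn (Y n) \<le> K" using HS.CS_bounded[OF Y] by blast
  have "Cauchy (form X Y)"
    unfolding Cauchy_def
  proof (intro allI impI)
    fix e :: real assume e: "0 < e"
    have "0 < e / (2 * K)" "0 < e / (2 * M)" using e M K by auto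
    then obtain N1 N2 where N1: "\<And>m n. N1 \<le> m \<Longrightarrow> N1 \<le> n \<Longrightarrow> sn (X m \<ominus> X n) < e / (2 * K)"
      and N2: "\<And>m n. N2 \<le> m \<Longrightarrow> N2 \<le> n \<Longrightarrow> sn (Y m \<ominus> Y n) < e / (2 * M)"
      using HS.CS_D[OF X] HS.CS_D[OF Y] by meson
    have "dist (form X Y m) (form X Y n) < e" if "max N1 N2 \<le> m" "max N1 N2 \<le> n" for m n
    proof -
      have "dist (form X Y m) (form X Y n) \<le> sn (X m \<ominus> X n) * sn (Y m) + sn (X n) * sn (Y m \<ominus> Y n)"
        unfolding dist_norm form_def using X Y by (intro form_diff) auto
      also have "\<dots> \<le> sn (X m \<ominus> X n) * K + M * sn (Y m \<ominus> Y n)"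
        using M(2)[of n] K(2)[of m] X Y by (intro add_mono mult_left_mono mult_right_mono) auto
      also have "\<dots> < e / (2 * K) * K + M * (e / (2 * M))"
        using N1[of m n] N2[of m n] M(1) K(1) that
        by (intro add_strict_mono mult_strict_left_mono mult_strict_right_mono) auto
      also have "\<dots> = e" using M(1) K(1) by simp
      finally show ?thesis .
    qed
    then show "\<exists>N. \<forall>m\<ge>N. \<forall>n\<ge>N. dist (form X Y m) (form X Y n) < e" by blast
  qed
  then show ?thesis by (rule Cauchy_convergent)
qed

lemma form_lim: "X \<in> HS.CS \<Longrightarrow> Y \<in> HS.CS \<Longrightarrow> form X Y \<longlonglongrightarrow> lim (form X Y)"
  using form_convergent convergent_LIMSEQ_iff by blast

lemma form_rel:
  assumes r: "(X, X') \<in> HS.rel" "(Y, Y') \<in> HS.rel"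
  shows "lim (form X Y) = lim (form X' Y')"
proof -
  have c: "X \<in> HS.CS" "X' \<in> HS.CS" "Y \<in> HS.CS" "Y' \<in> HS.CS" using r by (auto simp: HS.rel_def)
  obtain M where M: "0 < M" "\<And>n. sn (X' n) \<le> M" using HS.CS_bounded[OF c(2)] by blast
  obtain K where K: "0 < K" "\<And>n. sn (Y n) \<le> K" using HS.CS_bounded[OF c(3)] by blast
  have "(\<lambda>n. sn (X n \<ominus> X' n) * K + M * sn (Y n \<ominus> Y' n)) \<longlonglongrightarrow> 0 * K + M * 0"
    using r unfolding HS.rel_def by (intro tendsto_intros) auto
  then have lim: "(\<lambda>n. sn (X n \<ominus> X' n) * K + M * sn (Y n \<ominus> Y' n)) \<longlonglongrightarrow> 0" by simp
  have d: "(\<lambda>n. form X Y n - form X' Y' n) \<longlonglongrightarrow> 0"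
  proof (rule Lim_null_comparison[OF _ lim]; rule always_eventually, rule allI)
    fix n
    have "norm (form X Y n - form X' Y' n) \<le> sn (X n \<ominus> X' n) * sn (Y n) + sn (X' n) * sn (Y n \<ominus> Y' n)"
      unfolding form_def using c by (intro form_diff) auto
    also have "\<dots> \<le> sn (X n \<ominus> X' n) * K + M * sn (Y n \<ominus> Y' n)"
      using M(2)[of n] K(2)[of n] c by (intro add_mono mult_left_mono mult_right_mono) auto
    finally show "norm (form X Y n - form X' Y' n) \<le> \<dots>" .
  qed
  have "form X Y \<longlonglongrightarrow> lim (form X' Y')"
    using tendsto_add[OF d form_lim[OF c(2,4)]] by simp
  then show ?thesis by (rule limI)
qed

text \<open>A chosen representative rather than a union over all of them, as the inner product of
  two classes is a number. The lemmas \<open>H_add\<close>, \<open>H_smult\<close> and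
  \<open>H_inner\<close> remove the choice.\<close>

definition rp :: "'c set \<Rightarrow> 'c" where
  "rp P = (SOME X. X \<in> P)"

definition Hsp :: "(nat \<Rightarrow> 'a) set inner_space" where
  "Hsp = \<lparr>carrier = HS.CS // HS.rel,
     mult = (\<lambda>P Q. HS.cls (\<lambda>n. \<zero>)), one = HS.cls (\<lambda>n. \<zero>), zero = HS.cls (\<lambda>n. \<zero>),
     add = (\<lambda>P Q. HS.cls (\<lambda>n. rp P n \<oplus> rp Q n)),
     smult = (\<lambda>c P. HS.cls (\<lambda>n. c \<odot> rp P n)),
     cinner = (\<lambda>P Q. lim (form (rp P) (rp Q)))\<rparr>"

lemma rp_rel: "X \<in> HS.CS \<Longrightarrow> (X, rp (HS.cls X)) \<in> HS.rel"
  unfolding rp_def by (rule HS.some_cls)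

lemma H_carrier: "P \<in> carrier Hsp \<longleftrightarrow> (\<exists>X\<in>HS.CS. P = HS.cls X)"
  by (simp add: Hsp_def HS.quotient_cls)

lemma H_cls [simp]: "X \<in> HS.CS \<Longrightarrow> HS.cls X \<in> carrier Hsp"
  unfolding H_carrier by blast

lemma H_zero: "\<zero>\<^bsub>Hsp\<^esub> = HS.cls (\<lambda>n. \<zero>)"
  by (simp add: Hsp_def)

lemma H_add: "X \<in> HS.CS \<Longrightarrow> Y \<in> HS.CS \<Longrightarrow> HS.cls X \<oplus>\<^bsub>Hsp\<^esub> HS.cls Y = HS.cls (\<lambda>n. X n \<oplus> Y n)"
  using HS.cls_cong[OF HS.rel_add[OF rp_rel rp_rel]] by (simp add: Hsp_def)

lemma H_smult: "X \<in> HS.CS \<Longrightarrow> c \<odot>\<^bsub>Hsp\<^esub> HS.cls X = HS.cls (\<lambda>n. c \<odot> X n)"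
  using HS.cls_cong[OF HS.rel_smult[OF rp_rel]] by (simp add: Hsp_def)

lemma H_inner: "X \<in> HS.CS \<Longrightarrow> Y \<in> HS.CS \<Longrightarrow> cinner Hsp (HS.cls X) (HS.cls Y) = lim (form X Y)"
  using form_rel[OF rp_rel rp_rel] by (simp add: Hsp_def)

lemma H_norm: "X \<in> HS.CS \<Longrightarrow> hnorm Hsp (HS.cls X) = lim (\<lambda>n. sn (X n))"
  and H_inner_self: "X \<in> HS.CS \<Longrightarrow> cinner Hsp (HS.cls X) (HS.cls X) = complex_of_real ((lim (\<lambda>n. sn (X n)))\<^sup>2)"
proof -
  assume X: "X \<in> HS.CS"
  have "form X X = (\<lambda>n. complex_of_real ((sn (X n))\<^sup>2))"
    using X by (auto simp: form_def sn_square)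
  moreover have "(\<lambda>n. complex_of_real ((sn (X n))\<^sup>2)) \<longlonglongrightarrow> complex_of_real ((lim (\<lambda>n. sn (X n)))\<^sup>2)"
    by (intro tendsto_intros HS.CS_lim X)
  ultimately show e: "cinner Hsp (HS.cls X) (HS.cls X) = complex_of_real ((lim (\<lambda>n. sn (X n)))\<^sup>2)"
    using X by (simp add: H_inner limI)
  have "0 \<le> lim (\<lambda>n. sn (X n))"
    by (rule LIMSEQ_le_const[OF HS.CS_lim[OF X]]) (use X in auto)
  then show "hnorm Hsp (HS.cls X) = lim (\<lambda>n. sn (X n))" unfolding hnorm_def e by simp
qed

lemma H_module: "Module.module complex_ring Hsp"
proof (rule moduleI[OF complex_ring_cring])
  show "abelian_group Hsp"
  proof (rule abelian_groupI)
    fix P Q assume "P \<in> carrier Hsp" "Q \<in> carrier Hsp"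
    then obtain X Y where X: "X \<in> HS.CS" "P = HS.cls X" and Y: "Y \<in> HS.CS" "Q = HS.cls Y"
      by (auto simp: H_carrier)
    show "P \<oplus>\<^bsub>Hsp\<^esub> Q \<in> carrier Hsp" using X Y by (simp add: H_add)
    have "(\<lambda>n. X n \<oplus> Y n) = (\<lambda>n. Y n \<oplus> X n)" using X Y by (intro ext a_comm) auto
    then show "P \<oplus>\<^bsub>Hsp\<^esub> Q = Q \<oplus>\<^bsub>Hsp\<^esub> P" using X Y by (simp add: H_add)
    fix R assume "R \<in> carrier Hsp"
    then obtain Z where Z: "Z \<in> HS.CS" "R = HS.cls Z" by (auto simp: H_carrier)
    have "(\<lambda>n. X n \<oplus> Y n \<oplus> Z n) = (\<lambda>n. X n \<oplus> (Y n \<oplus> Z n))" using X Y Z by (intro ext a_assoc) auto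
    then show "P \<oplus>\<^bsub>Hsp\<^esub> Q \<oplus>\<^bsub>Hsp\<^esub> R = P \<oplus>\<^bsub>Hsp\<^esub> (Q \<oplus>\<^bsub>Hsp\<^esub> R)" using X Y Z by (simp add: H_add)
  next
    fix P assume "P \<in> carrier Hsp"
    then obtain X where X: "X \<in> HS.CS" "P = HS.cls X" by (auto simp: H_carrier)
    have "(\<lambda>n. \<zero> \<oplus> X n) = X" using X by auto
    then show "\<zero>\<^bsub>Hsp\<^esub> \<oplus>\<^bsub>Hsp\<^esub> P = P" using X by (simp add: H_add H_zero)
    have "(\<lambda>n. (-1) \<odot> X n \<oplus> X n) = (\<lambda>n. \<zero>)" using X by (auto simp: l_neg simp flip: neg_s)
    then have "HS.cls (\<lambda>n. (-1) \<odot> X n) \<oplus>\<^bsub>Hsp\<^esub> P = \<zero>\<^bsub>Hsp\<^esub>" using X by (simp add: H_add H_zero)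
    moreover have "HS.cls (\<lambda>n. (-1) \<odot> X n) \<in> carrier Hsp" using X by simp
    ultimately show "\<exists>Q\<in>carrier Hsp. Q \<oplus>\<^bsub>Hsp\<^esub> P = \<zero>\<^bsub>Hsp\<^esub>" by blast
  qed (simp add: H_zero)
next
  fix c d P assume "P \<in> carrier Hsp"
  then obtain X where X: "X \<in> HS.CS" "P = HS.cls X" by (auto simp: H_carrier)
  show "c \<odot>\<^bsub>Hsp\<^esub> P \<in> carrier Hsp" using X by (simp add: H_smult)
  have "(\<lambda>n. (c + d) \<odot> X n) = (\<lambda>n. c \<odot> X n \<oplus> d \<odot> X n)" using X by (auto simp: s_plus)
  then show "(c \<oplus>\<^bsub>complex_ring\<^esub> d) \<odot>\<^bsub>Hsp\<^esub> P = c \<odot>\<^bsub>Hsp\<^esub> P \<oplus>\<^bsub>Hsp\<^esub> d \<odot>\<^bsub>Hsp\<^esub> P"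
    using X by (simp add: H_smult H_add)
  have "(\<lambda>n. c \<odot> (d \<odot> X n)) = (\<lambda>n. (c * d) \<odot> X n)" using X by auto
  then show "(c \<otimes>\<^bsub>complex_ring\<^esub> d) \<odot>\<^bsub>Hsp\<^esub> P = c \<odot>\<^bsub>Hsp\<^esub> (d \<odot>\<^bsub>Hsp\<^esub> P)"
    using X by (simp add: H_smult)
  have "(\<lambda>n. 1 \<odot> X n) = X" using X by auto
  then show "\<one>\<^bsub>complex_ring\<^esub> \<odot>\<^bsub>Hsp\<^esub> P = P" using X by (simp add: H_smult)
  fix Q assume "Q \<in> carrier Hsp"
  then obtain Y where Y: "Y \<in> HS.CS" "Q = HS.cls Y" by (auto simp: H_carrier)
  have "(\<lambda>n. c \<odot> (X n \<oplus> Y n)) = (\<lambda>n. c \<odot> X n \<oplus> c \<odot> Y n)" using X Y by (auto simp: s_add)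
  then show "c \<odot>\<^bsub>Hsp\<^esub> (P \<oplus>\<^bsub>Hsp\<^esub> Q) = c \<odot>\<^bsub>Hsp\<^esub> P \<oplus>\<^bsub>Hsp\<^esub> c \<odot>\<^bsub>Hsp\<^esub> Q"
    using X Y by (simp add: H_smult H_add)
qed

lemma H_diff:
  assumes "X \<in> HS.CS" "Y \<in> HS.CS"
  shows "HS.cls X \<ominus>\<^bsub>Hsp\<^esub> HS.cls Y = HS.cls (\<lambda>n. X n \<ominus> Y n)"
proof -
  interpret H: Module.module complex_ring Hsp by (rule H_module)
  have "\<ominus>\<^bsub>Hsp\<^esub> HS.cls Y = HS.cls (\<lambda>n. (-1) \<odot> Y n)"
    using H.smult_l_minus[of 1 "HS.cls Y"] H.smult_one[of "HS.cls Y"] assms by (simp add: H_smult)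
  moreover have "(\<lambda>n. X n \<ominus> Y n) = (\<lambda>n. X n \<oplus> (-1) \<odot> Y n)" using assms by (auto simp: diff_s)
  ultimately show ?thesis using assms by (simp add: a_minus_def H_add)
qed

lemma H_inner_smult:
  assumes "P \<in> carrier Hsp" "Q \<in> carrier Hsp"
  shows "cinner Hsp (c \<odot>\<^bsub>Hsp\<^esub> P) Q = c * cinner Hsp P Q"
proof -
  obtain X Y where X: "X \<in> HS.CS" "P = HS.cls X" and Y: "Y \<in> HS.CS" "Q = HS.cls Y"
    using assms unfolding H_carrier by blast
  have "form (\<lambda>n. c \<odot> X n) Y = (\<lambda>n. c * form X Y n)"
    using X Y by (auto simp: form_def smult_mult psi_smult)
  moreover have "(\<lambda>n. c * form X Y n) \<longlonglongrightarrow> c * lim (form X Y)"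
    by (intro tendsto_intros form_lim X Y)
  ultimately show ?thesis using X Y by (simp add: H_smult H_inner limI)
qed

lemma H_inner_commute:
  assumes "P \<in> carrier Hsp" "Q \<in> carrier Hsp"
  shows "cinner Hsp Q P = cnj (cinner Hsp P Q)"
proof -
  obtain X Y where X: "X \<in> HS.CS" "P = HS.cls X" and Y: "Y \<in> HS.CS" "Q = HS.cls Y"
    using assms unfolding H_carrier by blast
  have "form Y X = (\<lambda>n. cnj (form X Y n))"
  proof
    fix n show "form Y X n = cnj (form X Y n)" unfolding form_def using X Y by (intro psi_herm) auto
  qed
  moreover have "(\<lambda>n. cnj (form X Y n)) \<longlonglongrightarrow> cnj (lim (form X Y))"
    by (intro tendsto_intros form_lim X Y)
  ultimately show ?thesis using X Y by (simp add: H_inner limI)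
qed

lemma H_inner_add:
  assumes "P \<in> carrier Hsp" "Q \<in> carrier Hsp" "R \<in> carrier Hsp"
  shows "cinner Hsp (P \<oplus>\<^bsub>Hsp\<^esub> Q) R = cinner Hsp P R + cinner Hsp Q R"
proof -
  obtain X Y Z where X: "X \<in> HS.CS" "P = HS.cls X" and Y: "Y \<in> HS.CS" "Q = HS.cls Y"
    and Z: "Z \<in> HS.CS" "R = HS.cls Z"
    using assms unfolding H_carrier by blast
  have "form (\<lambda>n. X n \<oplus> Y n) Z = (\<lambda>n. form X Z n + form Y Z n)"
    using X Y Z by (auto simp: form_def r_distr psi_add)
  moreover have "(\<lambda>n. form X Z n + form Y Z n) \<longlonglongrightarrow> lim (form X Z) + lim (form Y Z)"
    by (intro tendsto_intros form_lim X Y Z)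
  ultimately show ?thesis using X Y Z by (simp add: H_add H_inner limI)
qed

lemma H_inner_nonneg: "P \<in> carrier Hsp \<Longrightarrow> 0 \<le> Re (cinner Hsp P P)"
  unfolding H_carrier using H_inner_self by force

lemma H_inner_definite:
  assumes "P \<in> carrier Hsp" "cinner Hsp P P = 0"
  shows "P = \<zero>\<^bsub>Hsp\<^esub>"
proof -
  obtain X where X: "X \<in> HS.CS" "P = HS.cls X" using assms(1) unfolding H_carrier by blast
  then have "lim (\<lambda>n. sn (X n)) = 0" using H_inner_self[OF X(1)] assms(2) by simp
  then have l: "(\<lambda>n. sn (X n)) \<longlonglongrightarrow> 0" using HS.CS_lim[OF X(1)] by metis
  have e: "sn (X n \<ominus> \<zero>) = sn (X n)" for n by (rule arg_cong[where f = sn], rule HS.diff_zero) (rule HS.CS_closed[OF X(1)])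
  have z: "(\<lambda>n. \<zero>) \<in> HS.CS" by (rule HS.CS_const) (rule zero_closed)
  have r: "(X, \<lambda>n. \<zero>) \<in> HS.rel"
    unfolding HS.rel_def mem_Collect_eq prod.case e by (intro conjI X(1) z l)
  show ?thesis unfolding X(2) H_zero by (rule HS.cls_cong[OF r])
qed

lemma cauchy_seqsD:
  "X \<in> cauchy_seqs M p \<Longrightarrow> X n \<in> carrier M"
  "X \<in> cauchy_seqs M p \<Longrightarrow> 0 < e \<Longrightarrow> \<exists>N. \<forall>m\<ge>N. \<forall>n\<ge>N. p (X m \<ominus>\<^bsub>M\<^esub> X n) < e"
  unfolding cauchy_seqs_def by blast+

lemma H_complete: "seq_complete Hsp (hnorm Hsp)"
  unfolding seq_complete_def
proof
  fix Ps assume Ps: "Ps \<in> cauchy_seqs Hsp (hnorm Hsp)"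
  have "\<exists>X. X \<in> HS.CS \<and> Ps k = HS.cls X" for k
    using cauchy_seqsD(1)[OF Ps, of k] unfolding H_carrier by (elim bexE) (intro exI conjI)
  then obtain X where X: "\<And>k. X k \<in> HS.CS" "\<And>k. Ps k = HS.cls (X k)" by metis
  have nd: "hnorm Hsp (HS.cls (X k) \<ominus>\<^bsub>Hsp\<^esub> HS.cls D) = lim (\<lambda>n. sn (X k n \<ominus> D n))" if "D \<in> HS.CS" for k D
    unfolding H_diff[OF X(1) that] by (rule H_norm, rule HS.CS_diff) (rule X(1) that)+
  have "\<exists>N. \<forall>k\<ge>N. \<forall>l\<ge>N. lim (\<lambda>n. sn (X k n \<ominus> X l n)) < e" if "0 < e" for e
  proof -
    have "\<exists>N. \<forall>k\<ge>N. \<forall>l\<ge>N. hnorm Hsp (Ps k \<ominus>\<^bsub>Hsp\<^esub> Ps l) < e"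
      by (rule cauchy_seqsD(2)[OF Ps that])
    then show ?thesis unfolding X(2) nd[OF X(1)] .
  qed
  from HS.complete[OF X(1) this] obtain D where D: "D \<in> HS.CS" "(\<lambda>k. lim (\<lambda>n. sn (X k n \<ominus> D n))) \<longlonglongrightarrow> 0"
    by blast
  then have "(\<lambda>k. hnorm Hsp (Ps k \<ominus>\<^bsub>Hsp\<^esub> HS.cls D)) \<longlonglongrightarrow> 0" unfolding X(2) nd[OF D(1)] by blast
  then show "\<exists>x\<in>carrier Hsp. (\<lambda>k. hnorm Hsp (Ps k \<ominus>\<^bsub>Hsp\<^esub> x)) \<longlonglongrightarrow> 0"
    using H_cls[OF D(1)] by blast
qed

theorem H_hilbert: "complex_hilbert_space Hsp"
  by (intro complex_hilbert_space.intro complex_hilbert_space_axioms.intro H_module H_inner_add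
    H_inner_smult H_inner_commute H_inner_nonneg H_inner_definite H_complete)

end

locale gns = bounded_star_algebra A + positive_functional A \<psi>
  for A :: "('a, 'm) star_alg_scheme" (structure) and \<psi> +
  assumes all_lbounded: "b \<in> carrier A \<Longrightarrow> lbounded b"
begin

text \<open>\<open>op_norm\<close> is one of the seminorms below \<open>univ_norm\<close>. This is
  what lets the completion act: a Cauchy sequence for the universal norm times one for
  \<open>sn\<close> is again Cauchy for \<open>sn\<close>.\<close>

lemma sn_mult_le:
  assumes "b \<in> carrier A" "x \<in> carrier A"
  shows "sn (b \<otimes> x) \<le> univ_norm A b * sn x"
proof -
  have "sn (b \<otimes> x) \<le> op_norm b * sn x" using assms all_lbounded by (intro op_norm_bound)
  also have "\<dots> \<le> univ_norm A b * sn x"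
    using assms by (intro mult_right_mono le_univ_norm op_norm_cstar_seminorm all_lbounded) auto
  finally show ?thesis .
qed

lemma sn_mult_diff_le:
  assumes "x \<in> carrier A" "y \<in> carrier A" "x' \<in> carrier A" "y' \<in> carrier A"
  shows "sn (x \<otimes> y \<ominus> x' \<otimes> y') \<le> univ_norm A (x \<ominus> x') * sn y + univ_norm A x' * sn (y \<ominus> y')"
proof -
  have "sn (x \<otimes> y \<ominus> x' \<otimes> y') \<le> sn (x \<otimes> y \<ominus> x' \<otimes> y) + sn (x' \<otimes> y \<ominus> x' \<otimes> y')"
    using assms by (intro HS.q_diff_triangle) auto
  also have "x \<otimes> y \<ominus> x' \<otimes> y = (x \<ominus> x') \<otimes> y" using assms by (simp add: diff_s l_distr smult_mult)
  also have "x' \<otimes> y \<ominus> x' \<otimes> y' = x' \<otimes> (y \<ominus> y')" using assms by (simp add: diff_s r_distr smult_mult)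
  also have "sn ((x \<ominus> x') \<otimes> y) + sn (x' \<otimes> (y \<ominus> y'))
      \<le> univ_norm A (x \<ominus> x') * sn y + univ_norm A x' * sn (y \<ominus> y')"
    using assms by (intro add_mono sn_mult_le) auto
  finally show ?thesis .
qed

lemma CS_act [simp]:
  assumes X: "X \<in> S.CS" and Y: "Y \<in> HS.CS"
  shows "(\<lambda>n. X n \<otimes> Y n) \<in> HS.CS"
proof (rule HS.CS_I)
  show "X n \<otimes> Y n \<in> carrier A" for n using X Y by simp
  obtain M where M: "0 < M" "\<And>n. univ_norm A (X n) \<le> M" using S.CS_bounded[OF X] by blast
  obtain K where K: "0 < K" "\<And>n. sn (Y n) \<le> K" using HS.CS_bounded[OF Y] by blast
  fix e :: real assume e: "0 < e"
  have "0 < e / (2 * K)" "0 < e / (2 * M)" using e M K by auto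
  then obtain N1 N2 where N1: "\<And>m n. N1 \<le> m \<Longrightarrow> N1 \<le> n \<Longrightarrow> univ_norm A (X m \<ominus> X n) < e / (2 * K)"
    and N2: "\<And>m n. N2 \<le> m \<Longrightarrow> N2 \<le> n \<Longrightarrow> sn (Y m \<ominus> Y n) < e / (2 * M)"
    using S.CS_D[OF X] HS.CS_D[OF Y] by meson
  have "sn (X m \<otimes> Y m \<ominus> X n \<otimes> Y n) < e" if "max N1 N2 \<le> m" "max N1 N2 \<le> n" for m n
  proof -
    have "sn (X m \<otimes> Y m \<ominus> X n \<otimes> Y n)
        \<le> univ_norm A (X m \<ominus> X n) * sn (Y m) + univ_norm A (X n) * sn (Y m \<ominus> Y n)"
      using X Y by (intro sn_mult_diff_le) auto
    also have "\<dots> \<le> univ_norm A (X m \<ominus> X n) * K + M * sn (Y m \<ominus> Y n)"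
      using M(2)[of n] K(2)[of m] X Y by (intro add_mono mult_left_mono mult_right_mono univ_norm_nonneg) auto
    also have "\<dots> < e / (2 * K) * K + M * (e / (2 * M))"
      using N1[of m n] N2[of m n] M(1) K(1) that
      by (intro add_strict_mono mult_strict_left_mono mult_strict_right_mono) auto
    also have "\<dots> = e" using M(1) K(1) by simp
    finally show ?thesis .
  qed
  then show "\<exists>N. \<forall>m\<ge>N. \<forall>n\<ge>N. sn (X m \<otimes> Y m \<ominus> X n \<otimes> Y n) < e" by blast
qed

lemma rel_act:
  assumes r: "(X, X') \<in> S.rel" "(Y, Y') \<in> HS.rel"
  shows "((\<lambda>n. X n \<otimes> Y n), (\<lambda>n. X' n \<otimes> Y' n)) \<in> HS.rel"
proof -
  have c: "X \<in> S.CS" "X' \<in> S.CS" "Y \<in> HS.CS" "Y' \<in> HS.CS" using r by (auto simp: S.rel_def HS.rel_def)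
  obtain M where M: "0 < M" "\<And>n. univ_norm A (X' n) \<le> M" using S.CS_bounded[OF c(2)] by blast
  obtain K where K: "0 < K" "\<And>n. sn (Y n) \<le> K" using HS.CS_bounded[OF c(3)] by blast
  have "(\<lambda>n. univ_norm A (X n \<ominus> X' n) * K + M * sn (Y n \<ominus> Y' n)) \<longlonglongrightarrow> 0 * K + M * 0"
    using r unfolding S.rel_def HS.rel_def by (intro tendsto_intros) auto
  then have lim: "(\<lambda>n. univ_norm A (X n \<ominus> X' n) * K + M * sn (Y n \<ominus> Y' n)) \<longlonglongrightarrow> 0" by simp
  have "(\<lambda>n. sn (X n \<otimes> Y n \<ominus> X' n \<otimes> Y' n)) \<longlonglongrightarrow> 0"
  proof (rule tendsto_sandwich[OF _ _ tendsto_const lim]; rule always_eventually, rule allI)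
    fix n
    show "0 \<le> sn (X n \<otimes> Y n \<ominus> X' n \<otimes> Y' n)" using c by (intro sn_nonneg) simp
    have "sn (X n \<otimes> Y n \<ominus> X' n \<otimes> Y' n)
      \<le> univ_norm A (X n \<ominus> X' n) * sn (Y n) + univ_norm A (X' n) * sn (Y n \<ominus> Y' n)"
      using c by (intro sn_mult_diff_le) auto
    also have "\<dots> \<le> univ_norm A (X n \<ominus> X' n) * K + M * sn (Y n \<ominus> Y' n)"
      using M(2)[of n] K(2)[of n] c
      by (intro add_mono mult_left_mono mult_right_mono univ_norm_nonneg) auto
    finally show "sn (X n \<otimes> Y n \<ominus> X' n \<otimes> Y' n) \<le> \<dots>" .
  qed
  then show ?thesis using c by (simp add: HS.rel_def)
qed

definition rep :: "(nat \<Rightarrow> 'a) set \<Rightarrow> (nat \<Rightarrow> 'a) set \<Rightarrow> (nat \<Rightarrow> 'a) set" where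
  "rep P = (\<lambda>Q\<in>carrier Hsp. HS.cls (\<lambda>n. rp P n \<otimes> rp Q n))"

lemma rep_cls:
  assumes "X \<in> S.CS" "Y \<in> HS.CS"
  shows "rep (S.cls X) (HS.cls Y) = HS.cls (\<lambda>n. X n \<otimes> Y n)"
proof -
  have "(X, rp (S.cls X)) \<in> S.rel" unfolding rp_def by (rule S.some_cls[OF assms(1)])
  then show ?thesis
    using HS.cls_cong[OF rel_act[OF _ rp_rel[OF assms(2)]]] assms by (simp add: rep_def)
qed

lemma rep_bounded_operator:
  assumes X: "X \<in> S.CS"
  shows "rep (S.cls X) \<in> carrier (bounded_operators Hsp)"
proof -
  have "rep (S.cls X) \<in> carrier Hsp \<rightarrow>\<^sub>E carrier Hsp"
  proof (rule PiE_I)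
    fix P assume "P \<in> carrier Hsp"
    then obtain Y where "Y \<in> HS.CS" "P = HS.cls Y" by (auto simp: H_carrier)
    then show "rep (S.cls X) P \<in> carrier Hsp" using X by (simp add: rep_cls)
  qed (simp add: rep_def)
  moreover have "rep (S.cls X) (P \<oplus>\<^bsub>Hsp\<^esub> Q) = rep (S.cls X) P \<oplus>\<^bsub>Hsp\<^esub> rep (S.cls X) Q"
    if "P \<in> carrier Hsp" "Q \<in> carrier Hsp" for P Q
  proof -
    obtain Y Z where YZ: "Y \<in> HS.CS" "P = HS.cls Y" "Z \<in> HS.CS" "Q = HS.cls Z"
      using \<open>P \<in> carrier Hsp\<close> \<open>Q \<in> carrier Hsp\<close> unfolding H_carrier by blast
    have "(\<lambda>n. X n \<otimes> (Y n \<oplus> Z n)) = (\<lambda>n. X n \<otimes> Y n \<oplus> X n \<otimes> Z n)" using X YZ by (auto simp: r_distr)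
    then show ?thesis using X YZ by (simp add: H_add rep_cls)
  qed
  moreover have "rep (S.cls X) (c \<odot>\<^bsub>Hsp\<^esub> P) = c \<odot>\<^bsub>Hsp\<^esub> rep (S.cls X) P" if "P \<in> carrier Hsp" for c P
  proof -
    obtain Y where Y: "Y \<in> HS.CS" "P = HS.cls Y"
      using \<open>P \<in> carrier Hsp\<close> unfolding H_carrier by blast
    have "(\<lambda>n. X n \<otimes> (c \<odot> Y n)) = (\<lambda>n. c \<odot> (X n \<otimes> Y n))" using X Y by (auto simp: smult_mult)
    then show ?thesis using X Y by (simp add: H_smult rep_cls)
  qed
  moreover
  obtain M where M: "0 < M" "\<And>n. univ_norm A (X n) \<le> M" using S.CS_bounded[OF X] by blast
  have "hnorm Hsp (rep (S.cls X) P) \<le> M * hnorm Hsp P" if "P \<in> carrier Hsp" for P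
  proof -
    obtain Y where Y: "Y \<in> HS.CS" "P = HS.cls Y"
      using \<open>P \<in> carrier Hsp\<close> unfolding H_carrier by blast
    have "lim (\<lambda>n. sn (X n \<otimes> Y n)) \<le> M * lim (\<lambda>n. sn (Y n))"
    proof (rule LIMSEQ_le)
      show "(\<lambda>n. sn (X n \<otimes> Y n)) \<longlonglongrightarrow> lim (\<lambda>n. sn (X n \<otimes> Y n))" using X Y by (intro HS.CS_lim) auto
      show "(\<lambda>n. M * sn (Y n)) \<longlonglongrightarrow> M * lim (\<lambda>n. sn (Y n))" using Y by (intro tendsto_intros HS.CS_lim)
      have "sn (X n \<otimes> Y n) \<le> M * sn (Y n)" for n
      proof -
        have "sn (X n \<otimes> Y n) \<le> univ_norm A (X n) * sn (Y n)" using X Y by (intro sn_mult_le) auto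
        also have "\<dots> \<le> M * sn (Y n)" using M(2)[of n] Y by (intro mult_right_mono) auto
        finally show ?thesis .
      qed
      then show "\<exists>N. \<forall>n\<ge>N. sn (X n \<otimes> Y n) \<le> M * sn (Y n)" by blast
    qed
    then show ?thesis using X Y by (simp add: rep_cls H_norm)
  qed
  then have bd: "\<exists>C. \<forall>P\<in>carrier Hsp. hnorm Hsp (rep (S.cls X) P) \<le> C * hnorm Hsp P" by blast
  ultimately have "rep (S.cls X) \<in> linear_maps Hsp Hsp" unfolding linear_maps_def by blast
  then show ?thesis using bd by (simp add: bounded_operators_def)
qed

theorem rep_representation: "rep \<in> representations (univ_completion A) Hsp"
proof -
  have closed: "rep P \<in> carrier (bounded_operators Hsp)" if "P \<in> carrier (univ_completion A)" for P
    using that rep_bounded_operator unfolding completion_carrier by blast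
  \<comment> \<open>Operators are extensional functions on the carrier. Equations between them are
    thereby reduced to classes of Cauchy sequences, off the carrier both sides being
    \<open>undefined\<close>.\<close>
  have rep_ext: "rep P = (\<lambda>R\<in>carrier Hsp. F R)" if "\<And>Z. Z \<in> HS.CS \<Longrightarrow> rep P (HS.cls Z) = F (HS.cls Z)" for P F
  proof
    fix R show "rep P R = (\<lambda>R\<in>carrier Hsp. F R) R"
    proof (cases "R \<in> carrier Hsp")
      case True
      then show ?thesis using that by (auto simp: H_carrier)
    next
      case False
      then show ?thesis by (simp add: rep_def)
    qed
  qed
  have add: "rep (P \<oplus>\<^bsub>univ_completion A\<^esub> Q) = rep P \<oplus>\<^bsub>bounded_operators Hsp\<^esub> rep Q"
    and mult: "rep (P \<otimes>\<^bsub>univ_completion A\<^esub> Q) = rep P \<otimes>\<^bsub>bounded_operators Hsp\<^esub> rep Q"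
    if PQ: "P \<in> carrier (univ_completion A)" "Q \<in> carrier (univ_completion A)" for P Q
  proof -
    obtain X Y where XY: "X \<in> S.CS" "P = S.cls X" "Y \<in> S.CS" "Q = S.cls Y"
      using PQ unfolding completion_carrier by blast
    have "rep (P \<oplus>\<^bsub>univ_completion A\<^esub> Q) = (\<lambda>R\<in>carrier Hsp. rep P R \<oplus>\<^bsub>Hsp\<^esub> rep Q R)"
    proof (rule rep_ext)
      fix Z assume Z: "Z \<in> HS.CS"
      have "(\<lambda>n. (X n \<oplus> Y n) \<otimes> Z n) = (\<lambda>n. X n \<otimes> Z n \<oplus> Y n \<otimes> Z n)" using XY Z by (auto simp: l_distr)
      then show "rep (P \<oplus>\<^bsub>univ_completion A\<^esub> Q) (HS.cls Z) = rep P (HS.cls Z) \<oplus>\<^bsub>Hsp\<^esub> rep Q (HS.cls Z)"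
        using XY Z by (simp add: completion_add rep_cls H_add)
    qed
    then show "rep (P \<oplus>\<^bsub>univ_completion A\<^esub> Q) = rep P \<oplus>\<^bsub>bounded_operators Hsp\<^esub> rep Q" by (simp add: bounded_operators_def)
    have "rep (P \<otimes>\<^bsub>univ_completion A\<^esub> Q) = (\<lambda>R\<in>carrier Hsp. rep P (rep Q R))"
    proof (rule rep_ext)
      fix Z assume Z: "Z \<in> HS.CS"
      have "(\<lambda>n. (X n \<otimes> Y n) \<otimes> Z n) = (\<lambda>n. X n \<otimes> (Y n \<otimes> Z n))" using XY Z by (auto simp: m_assoc)
      then show "rep (P \<otimes>\<^bsub>univ_completion A\<^esub> Q) (HS.cls Z) = rep P (rep Q (HS.cls Z))"
        using XY Z by (simp add: completion_mult rep_cls)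
    qed
    then show "rep (P \<otimes>\<^bsub>univ_completion A\<^esub> Q) = rep P \<otimes>\<^bsub>bounded_operators Hsp\<^esub> rep Q" by (simp add: bounded_operators_def compose_def)
  qed
  have "rep \<one>\<^bsub>univ_completion A\<^esub> = (\<lambda>R\<in>carrier Hsp. R)"
  proof (rule rep_ext)
    fix Z assume Z: "Z \<in> HS.CS"
    have "(\<lambda>n. \<one> \<otimes> Z n) = Z" using Z by auto
    then show "rep \<one>\<^bsub>univ_completion A\<^esub> (HS.cls Z) = HS.cls Z"
      using Z by (simp add: completion_one rep_cls)
  qed
  then have one: "rep \<one>\<^bsub>univ_completion A\<^esub> = \<one>\<^bsub>bounded_operators Hsp\<^esub>" by (simp add: bounded_operators_def)
  have smult: "rep (c \<odot>\<^bsub>univ_completion A\<^esub> P) = c \<odot>\<^bsub>bounded_operators Hsp\<^esub> rep P"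
    and adj: "is_adjoint Hsp (rep P) (rep (star (univ_completion A) P))"
    if P: "P \<in> carrier (univ_completion A)" for c P
  proof -
    obtain X where X: "X \<in> S.CS" "P = S.cls X" using P unfolding completion_carrier by blast
    have "rep (c \<odot>\<^bsub>univ_completion A\<^esub> P) = (\<lambda>R\<in>carrier Hsp. c \<odot>\<^bsub>Hsp\<^esub> rep P R)"
    proof (rule rep_ext)
      fix Z assume Z: "Z \<in> HS.CS"
      have "(\<lambda>n. (c \<odot> X n) \<otimes> Z n) = (\<lambda>n. c \<odot> (X n \<otimes> Z n))" using X Z by (auto simp: smult_mult)
      then show "rep (c \<odot>\<^bsub>univ_completion A\<^esub> P) (HS.cls Z) = c \<odot>\<^bsub>Hsp\<^esub> rep P (HS.cls Z)"
        using X Z by (simp add: completion_smult rep_cls H_smult)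
    qed
    then show "rep (c \<odot>\<^bsub>univ_completion A\<^esub> P) = c \<odot>\<^bsub>bounded_operators Hsp\<^esub> rep P" by (simp add: bounded_operators_def)
    show "is_adjoint Hsp (rep P) (rep (star (univ_completion A) P))"
      unfolding is_adjoint_def
    proof (intro ballI)
      fix Q R assume "Q \<in> carrier Hsp" "R \<in> carrier Hsp"
      then obtain Y Z where YZ: "Y \<in> HS.CS" "Q = HS.cls Y" "Z \<in> HS.CS" "R = HS.cls Z" by (auto simp: H_carrier)
      have "form (\<lambda>n. X n \<otimes> Y n) Z = form Y (\<lambda>n. star A (X n) \<otimes> Z n)"
        using X YZ by (auto simp: form_def star_mult m_assoc)
      then show "cinner Hsp (rep P Q) R = cinner Hsp Q (rep (star (univ_completion A) P) R)"
        using X YZ by (simp add: completion_star rep_cls H_inner)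
    qed
  qed
  have hom: "rep \<in> ring_hom (univ_completion A) (bounded_operators Hsp)"
    by (rule ring_hom_memI) (fact closed mult add one)+
  have "rep \<in> unital_alg_hom (univ_completion A) (bounded_operators Hsp)"
    unfolding unital_alg_hom_def by (intro CollectI conjI allI ballI hom smult)
  then show ?thesis unfolding representations_def by (intro CollectI conjI ballI adj)
qed

definition cyc :: "(nat \<Rightarrow> 'a) set" where
  "cyc = HS.cls (\<lambda>n. \<one>)"

lemma cyc_in: "cyc \<in> carrier Hsp"
  by (simp add: cyc_def)

text \<open>The constant sequences u and 1 differ by an element of GNS seminorm 0 and so represent
  the same vector.\<close>

lemma rep_fixes_cyc:
  assumes u: "u \<in> carrier A" "sn (u \<ominus> \<one>) = 0"
  shows "rep (completion_embed A u) cyc = cyc"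
proof -
  have "((\<lambda>n. u), (\<lambda>n. \<one>)) \<in> HS.rel" using u by (simp add: HS.rel_def)
  then have "HS.cls (\<lambda>n. u) = HS.cls (\<lambda>n. \<one>)" by (rule HS.cls_cong)
  then show ?thesis using u by (simp add: embed_cls cyc_def rep_cls)
qed

lemma cyc_nonzero:
  assumes "\<psi> \<one> \<noteq> 0"
  shows "cyc \<noteq> \<zero>\<^bsub>Hsp\<^esub>"
proof
  assume "cyc = \<zero>\<^bsub>Hsp\<^esub>"
  then have "((\<lambda>n. \<one>), (\<lambda>n. \<zero>)) \<in> HS.rel"
    unfolding cyc_def H_zero by (subst (asm) HS.cls_eq) auto
  then have "sn \<one> = 0" by (simp add: HS.rel_def HS.diff_zero LIMSEQ_const_iff)
  then show False using sn_square[of \<one>] assms by simp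
qed

end

section \<open>Functionals and seminorms on the algebra of finitely supported functions\<close>

context star_system
begin

definition fsum :: "('g \<Rightarrow> 'a \<Rightarrow> complex) \<Rightarrow> ('g \<Rightarrow> 'a) \<Rightarrow> complex" where
  "fsum F f = (\<Sum>s\<in>supp f. F s (f s))"

lemma fsum_superset:
  assumes "\<And>s. F s \<zero> = 0" "finite S" "supp f \<subseteq> S"
  shows "fsum F f = (\<Sum>s\<in>S. F s (f s))"
  unfolding fsum_def using assms by (intro sum.mono_neutral_left) (auto simp: supp_def)

lemma fsum_add:
  assumes F: "\<And>s. F s \<zero> = 0" "\<And>s a b. a \<in> carrier A \<Longrightarrow> b \<in> carrier A \<Longrightarrow> F s (a \<oplus> b) = F s a + F s b"
    and fg: "f \<in> carrier B" "g \<in> carrier B"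
  shows "fsum F (f \<oplus>\<^bsub>B\<^esub> g) = fsum F f + fsum F g"
proof -
  define S where "S = supp f \<union> supp g"
  have S: "finite S" "supp f \<subseteq> S" "supp g \<subseteq> S" "supp (f \<oplus>\<^bsub>B\<^esub> g) \<subseteq> S"
    using fg by (auto simp: S_def B_carrier) (auto simp: supp_def B_ops)
  show ?thesis
    unfolding fsum_superset[of F, OF F(1) S(1,4)] fsum_superset[of F, OF F(1) S(1,2)]
      fsum_superset[of F, OF F(1) S(1,3)] sum.distrib[symmetric]
    using fg by (intro sum.cong) (auto simp: B_ops F(2))
qed

lemma fsum_smult:
  assumes F: "\<And>s. F s \<zero> = 0" "\<And>s a. a \<in> carrier A \<Longrightarrow> F s (c \<odot> a) = c * F s a"
    and f: "f \<in> carrier B"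
  shows "fsum F (c \<odot>\<^bsub>B\<^esub> f) = c * fsum F f"
proof -
  have S: "finite (supp f)" "supp (c \<odot>\<^bsub>B\<^esub> f) \<subseteq> supp f"
    using f by (auto simp: B_carrier) (auto simp: supp_def B_ops)
  show ?thesis
    unfolding fsum_superset[of F, OF F(1) S] unfolding fsum_def sum_distrib_left
    using f by (intro sum.cong) (auto simp: B_ops F(2))
qed

lemma fsum_single:
  assumes "F s \<zero> = 0"
  shows "fsum F (single a s) = F s a"
proof (cases "a = \<zero>")
  case True
  then have "supp (single a s) = {}" by (auto simp: supp_def single_def)
  then show ?thesis using True assms by (simp add: fsum_def)
next
  case False
  then have "supp (single a s) = {s}" by (auto simp: supp_def single_def)
  then show ?thesis by (simp add: fsum_def single_def)
qed

text \<open>Only additivity of L is assumed, since it is also applied in the first argument of the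
  GNS form, where L is conjugate linear.\<close>

lemma additive_sum:
  fixes L :: "('g \<Rightarrow> 'a) \<Rightarrow> complex"
  assumes L: "\<And>f g. f \<in> carrier B \<Longrightarrow> g \<in> carrier B \<Longrightarrow> L (f \<oplus>\<^bsub>B\<^esub> g) = L f + L g"
    and S: "finite S" "S \<subseteq> carrier G" and f: "f \<in> carrier B" "supp f \<subseteq> S"
  shows "L f = (\<Sum>s\<in>S. L (single (f s) s))"
  using S f
proof (induction S arbitrary: f rule: finite_induct)
  case empty
  then have "f = \<zero>\<^bsub>B\<^esub>" by (auto simp: supp_def B_ops)
  moreover have "L \<zero>\<^bsub>B\<^esub> = 0" using L[of "\<zero>\<^bsub>B\<^esub>" "\<zero>\<^bsub>B\<^esub>"] by simp
  ultimately show ?case by simp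
next
  case (insert s S)
  define g where "g = f(s := \<zero>)"
  have "supp g \<subseteq> supp f" by (auto simp: g_def supp_def)
  then have g: "g \<in> carrier B"
    using insert.prems(2) unfolding B_carrier by (auto simp: g_def intro: finite_subset)
  have gs: "supp g \<subseteq> S" using insert.prems(3) by (auto simp: g_def supp_def)
  have s: "s \<in> carrier G" "S \<subseteq> carrier G" "f s \<in> carrier A" using insert.prems by auto
  have "f = single (f s) s \<oplus>\<^bsub>B\<^esub> g" using insert.prems(2) by (auto simp: B_ops single_def g_def)
  then have "L f = L (single (f s) s) + L g" using L[OF single_in[OF s(3,1)] g] by simp
  also have "L g = (\<Sum>t\<in>S. L (single (g t) t))" by (rule insert.IH[OF s(2) g gs])
  also have "\<dots> = (\<Sum>t\<in>S. L (single (f t) t))"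
    using insert.hyps by (intro sum.cong) (auto simp: g_def)
  finally show ?case using insert.hyps by simp
qed

section \<open>Coefficients and group elements inside the algebra\<close>

definition emb :: "'a \<Rightarrow> 'g \<Rightarrow> 'a" where
  "emb a = single a \<one>\<^bsub>G\<^esub>"

definition delta :: "'g \<Rightarrow> 'g \<Rightarrow> 'a" where
  "delta s = single \<one> s"

lemma emb_in [simp]: "a \<in> carrier A \<Longrightarrow> emb a \<in> carrier B"
  by (simp add: emb_def)

lemma delta_in [simp]: "s \<in> carrier G \<Longrightarrow> delta s \<in> carrier B"
  by (simp add: delta_def)

lemma emb_simps:
  "a \<in> carrier A \<Longrightarrow> b \<in> carrier A \<Longrightarrow> emb (a \<oplus> b) = emb a \<oplus>\<^bsub>B\<^esub> emb b"
  "a \<in> carrier A \<Longrightarrow> b \<in> carrier A \<Longrightarrow> emb (a \<otimes> b) = emb a \<otimes>\<^bsub>B\<^esub> emb b"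
  "emb (c \<odot> a) = c \<odot>\<^bsub>B\<^esub> emb a"
  "a \<in> carrier A \<Longrightarrow> emb (star A a) = star B (emb a)"
  "emb \<one> = \<one>\<^bsub>B\<^esub>" "emb \<zero> = \<zero>\<^bsub>B\<^esub>"
  by (simp_all add: emb_def single_add single_mult single_smult star_single B_ops(1) single_zero)

lemma delta_simps:
  "s \<in> carrier G \<Longrightarrow> t \<in> carrier G \<Longrightarrow> delta s \<otimes>\<^bsub>B\<^esub> delta t = delta (s \<otimes>\<^bsub>G\<^esub> t)"
  "s \<in> carrier G \<Longrightarrow> star B (delta s) = delta (inv\<^bsub>G\<^esub> s)"
  "delta \<one>\<^bsub>G\<^esub> = \<one>\<^bsub>B\<^esub>"
  by (simp_all add: delta_def single_mult star_single B_ops(1))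

lemma single_emb_delta: "a \<in> carrier A \<Longrightarrow> s \<in> carrier G \<Longrightarrow> single a s = emb a \<otimes>\<^bsub>B\<^esub> delta s"
  by (simp add: emb_def delta_def single_mult)

lemma delta_star_delta: "s \<in> carrier G \<Longrightarrow> star B (delta s) \<otimes>\<^bsub>B\<^esub> delta s = \<one>\<^bsub>B\<^esub>"
  by (simp add: delta_simps)

lemma delta_emb_delta:
  "a \<in> carrier A \<Longrightarrow> s \<in> carrier G \<Longrightarrow> delta s \<otimes>\<^bsub>B\<^esub> emb a \<otimes>\<^bsub>B\<^esub> delta (inv\<^bsub>G\<^esub> s) = emb (\<alpha> s a)"
  by (simp add: emb_def delta_def single_mult)

end

locale cstar_system = star_system A G \<alpha> + unital_cstar_algebra A
  for A :: "('a, 'm) cstar_alg_scheme" (structure) and G :: "('g, 'n) monoid_scheme" and \<alpha>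
begin

text \<open>Restricted to A, r is a C*-seminorm and hence at most twice the norm of A; the group
  elements are unitary, so r is at most 1 on them.\<close>

lemma seminorm_single:
  assumes r: "cstar_seminorm B r" and a: "a \<in> carrier A" and s: "s \<in> carrier G"
  shows "r (single a s) \<le> 2 * cnorm A a"
proof -
  interpret R: cstar_seminormed B r by unfold_locales (rule r)
  have "cstar_seminorm A (\<lambda>a. r (emb a))"
    unfolding cstar_seminorm_def
    by (auto simp: emb_simps R.p_nonneg R.p_triangle R.p_smult R.p_mult R.p_cstar)
  from cstar_seminorm_le_cnorm[OF this a] have e: "r (emb a) \<le> 2 * cnorm A a" .
  have "(r (delta s))\<^sup>2 = r \<one>\<^bsub>B\<^esub>" using R.p_cstar[of "delta s"] s by (simp add: delta_star_delta)
  then have "(r (delta s))\<^sup>2 \<le> 1\<^sup>2" using R.p_one_le by simp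
  then have u: "r (delta s) \<le> 1" by (rule power2_le_imp_le) simp
  have "r (single a s) \<le> r (emb a) * r (delta s)" using a s R.p_mult by (simp add: single_emb_delta)
  also have "\<dots> \<le> r (emb a) * 1" using u a R.p_nonneg by (intro mult_left_mono) auto
  finally show ?thesis using e by simp
qed

sublocale BB: bounded_star_algebra B
proof
  fix f assume "f \<in> carrier B"
  then show "\<exists>C. \<forall>r. cstar_seminorm B r \<longrightarrow> r f \<le> C"
  proof (induction f rule: B_induct)
    case zero
    have "r \<zero>\<^bsub>B\<^esub> \<le> 0" if r: "cstar_seminorm B r" for r
    proof -
      interpret R: cstar_seminormed B r by unfold_locales (rule r)
      show ?thesis by simp
    qed
    then show ?case by blast
  next
    case (single a s)
    then show ?case using seminorm_single by blast
  next
    case (add f g)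
    then obtain C D where CD: "\<And>r. cstar_seminorm B r \<Longrightarrow> r f \<le> C" "\<And>r. cstar_seminorm B r \<Longrightarrow> r g \<le> D"
      by blast
    have "r (f \<oplus>\<^bsub>B\<^esub> g) \<le> C + D" if r: "cstar_seminorm B r" for r
    proof -
      interpret R: cstar_seminormed B r by unfold_locales (rule r)
      show ?thesis using R.p_triangle[OF add(1,2)] CD[OF r] by linarith
    qed
    then show ?case by blast
  qed
qed

text \<open>The elements with bounded left multiplication form a subalgebra. By
  \<open>lbounded_complement\<close> it contains the group elements and the selfadjoint elements of
  A of norm at most 1/2, and these generate everything.\<close>

lemma all_lbounded:
  assumes \<Psi>: "positive_functional B \<Psi>" and b: "b \<in> carrier B"
  shows "positive_functional.lbounded B \<Psi> b"
proof -
  interpret P: positive_functional B \<Psi> by (rule \<Psi>)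
  have half: "P.lbounded (emb h)" if h: "h \<in> carrier A" "star A h = h" "cnorm A h \<le> 1/2" for h
  proof -
    obtain w where w: "w \<in> carrier A" "star A w = w" "w \<otimes> h = h \<otimes> w" "h \<otimes> h \<oplus> w \<otimes> w = \<one>"
      using sqrt_one_minus_square[OF h] .
    have "star B (emb h) \<otimes>\<^bsub>B\<^esub> emb h \<oplus>\<^bsub>B\<^esub> star B (emb w) \<otimes>\<^bsub>B\<^esub> emb w = emb (h \<otimes> h \<oplus> w \<otimes> w)"
      using h w(1,2) emb_simps(4)[of h] emb_simps(4)[of w] by (simp add: emb_simps(1,2))
    then show ?thesis using P.lbounded_complement[of "emb h" "emb w"] h w(1) by (simp add: w(4) emb_simps(5))
  qed
  have sa: "P.lbounded (emb h)" if h: "h \<in> carrier A" "star A h = h" for h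
  proof -
    \<comment> \<open>The summand 1 keeps the denominator positive when h = 0.\<close>
    define c where "c = complex_of_real (1 / (2 * (cnorm A h + 1)))"
    have n: "0 \<le> cnorm A h" using h CN.p_nonneg by simp
    have cm: "cmod c = 1 / (2 * (cnorm A h + 1))" unfolding c_def norm_of_real using n by simp
    have c0: "c \<noteq> 0" using cm n by auto
    have "P.lbounded (emb (c \<odot> h))"
    proof (rule half)
      show "star A (c \<odot> h) = c \<odot> h" using h by (simp add: star_smult c_def)
      show "cnorm A (c \<odot> h) \<le> 1/2" using h n by (simp add: CN.p_smult cm field_simps)
    qed (use h in simp)
    then have "P.lbounded ((1 / c) \<odot>\<^bsub>B\<^esub> emb (c \<odot> h))" using h by (intro P.lbounded_smult) auto
    then show ?thesis using h c0 by (simp flip: emb_simps(3))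
  qed
  have e: "P.lbounded (emb a)" if a: "a \<in> carrier A" for a
  proof -
    define h where "h = (1/2) \<odot> (a \<oplus> star A a)"
    define k where "k = (- \<i> / 2) \<odot> (a \<oplus> (-1) \<odot> star A a)"
    have h: "h \<in> carrier A" "star A h = h" using a by (auto simp: h_def star_smult star_add a_comm)
    have k: "k \<in> carrier A" "star A k = k"
      using a by (auto simp: k_def star_smult star_add s_add a_comm)
    have "h \<oplus> \<i> \<odot> k = ((1/2) \<odot> a \<oplus> (1/2) \<odot> star A a) \<oplus> ((1/2) \<odot> a \<oplus> (- (1/2)) \<odot> star A a)"
      using a by (simp add: h_def k_def s_add)
    also have "\<dots> = ((1/2) \<odot> a \<oplus> (1/2) \<odot> a) \<oplus> ((1/2) \<odot> star A a \<oplus> (- (1/2)) \<odot> star A a)"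
      using a by (intro a_4) auto
    also have "\<dots> = a" using a s_plus[of a "1/2" "1/2", symmetric] s_plus[of "star A a" "1/2" "-(1/2)", symmetric] by simp
    finally have "emb a = emb h \<oplus>\<^bsub>B\<^esub> \<i> \<odot>\<^bsub>B\<^esub> emb k" using h k by (simp flip: emb_simps)
    moreover have "P.lbounded (emb h \<oplus>\<^bsub>B\<^esub> \<i> \<odot>\<^bsub>B\<^esub> emb k)"
      using h k sa by (intro P.lbounded_add P.lbounded_smult) auto
    ultimately show ?thesis by simp
  qed
  have u: "P.lbounded (delta s)" if s: "s \<in> carrier G" for s
    using P.lbounded_complement[of "delta s" "\<zero>\<^bsub>B\<^esub>"] s by (simp add: delta_star_delta)
  show ?thesis using b
  proof (induction b rule: B_induct)
    case zero
    show ?case using e[of \<zero>] by (simp add: emb_simps)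
  next
    case (single a s)
    then show ?case using e u by (auto simp: single_emb_delta intro!: P.lbounded_mult)
  next
    case (add f g)
    then show ?case by (intro P.lbounded_add)
  qed
qed

lemma gns_B: "positive_functional B \<Psi> \<Longrightarrow> gns B \<Psi>"
  using all_lbounded by (intro gns.intro gns_axioms.intro BB.bounded_star_algebra_axioms)

end

section \<open>The group algebra\<close>

text \<open>The complex numbers as a C*-algebra: with the trivial action their algebra of finitely
  supported functions is the group algebra (\<open>group_alg_cc_alg\<close>), so the general results
  apply to it.\<close>

definition CC :: "complex cstar_alg" where
  "CC = \<lparr>carrier = UNIV, mult = (*), one = 1, zero = 0, add = (+), smult = (*), star = cnj, cnorm = cmod\<rparr>"

lemma CC_simps [simp]:
  "carrier CC = UNIV" "x \<otimes>\<^bsub>CC\<^esub> y = x * y" "\<one>\<^bsub>CC\<^esub> = 1" "\<zero>\<^bsub>CC\<^esub> = 0" "x \<oplus>\<^bsub>CC\<^esub> y = x + y"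
  "x \<odot>\<^bsub>CC\<^esub> y = x * y" "star CC = cnj" "cnorm CC = cmod"
  by (simp_all add: CC_def)

lemma CC_cring: "cring CC"
  by (intro cringI abelian_groupI comm_monoidI)
     (auto simp: algebra_simps intro: exI[of _ "- _"] add.left_inverse)

lemma CC_cstar_algebra: "unital_cstar_algebra CC"
proof -
  interpret cring CC by (rule CC_cring)
  have m: "Module.module complex_ring CC"
    by (rule moduleI[OF complex_ring_cring]) (auto simp: algebra_simps is_abelian_group)
  have minus: "x \<ominus>\<^bsub>CC\<^esub> y = x - y" for x y
    using minus_equality[of "- y" y] by (simp add: a_minus_def)
  have s: "unital_star_algebra CC"
    by (intro unital_star_algebra.intro m ring_axioms unital_star_algebra_axioms.intro) auto
  moreover have "cstar_seminorm CC (cnorm CC)"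
    unfolding cstar_seminorm_def by (auto simp: norm_triangle_ineq norm_mult power2_eq_square)
  moreover have "seq_complete CC (cnorm CC)"
    unfolding seq_complete_def
  proof
    fix X assume "X \<in> cauchy_seqs CC (cnorm CC)"
    then have "Cauchy X" by (auto simp: cauchy_seqs_def Cauchy_def dist_norm minus)
    then obtain x where "X \<longlonglongrightarrow> x" using Cauchy_convergent convergent_def by blast
    then have "(\<lambda>n. norm (X n - x)) \<longlonglongrightarrow> 0" by (simp add: LIM_zero tendsto_norm_zero)
    then show "\<exists>x\<in>carrier CC. (\<lambda>n. cnorm CC (X n \<ominus>\<^bsub>CC\<^esub> x)) \<longlonglongrightarrow> 0" by (auto simp: minus)
  qed
  ultimately show ?thesis
    by (intro unital_cstar_algebra.intro unital_cstar_algebra_axioms.intro) auto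
qed

lemma CC_system: "group G \<Longrightarrow> cstar_system CC G (\<lambda>_ x. x)"
  by (intro cstar_system.intro star_system.intro CC_cstar_algebra star_system_axioms.intro
      unital_cstar_algebra.axioms(1)[OF CC_cstar_algebra]) auto

lemma CC_finsum: "finsum CC f S = sum f S"
proof -
  interpret cring CC by (rule CC_cring)
  show ?thesis
  proof (cases "finite S")
    case True
    then show ?thesis by (induction S rule: finite_induct) auto
  qed (simp add: finsum_infinite)
qed

lemma group_alg_cc_alg: "cc_alg CC G (\<lambda>_ x. x) = group_alg G"
  by (simp add: cc_alg_def group_alg_def CC_finsum fun_eq_iff cong: if_cong)

locale cstar_system_group = cstar_system A G \<alpha>
  for A :: "('a, 'm) cstar_alg_scheme" (structure) and G :: "('g, 'n) monoid_scheme" and \<alpha>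
begin

sublocale C: cstar_system CC G "\<lambda>_ x. x"
  by (rule CC_system) (rule G.group_axioms)

definition incl :: "('g \<Rightarrow> complex) \<Rightarrow> 'g \<Rightarrow> 'a" where
  "incl f = (\<lambda>t. f t \<odot> \<one>)"

lemma incl_single: "incl (C.single c s) = single (c \<odot> \<one>) s"
  by (auto simp: incl_def C.single_def single_def)

lemma incl_in [simp]: "f \<in> carrier C.B \<Longrightarrow> incl f \<in> carrier B"
proof -
  assume f: "f \<in> carrier C.B"
  have "supp (incl f) \<subseteq> C.supp f" by (auto simp: supp_def C.supp_def incl_def)
  then show ?thesis using f unfolding B_carrier C.B_carrier by (auto simp: incl_def intro: finite_subset)
qed

lemma incl_add: "incl (f \<oplus>\<^bsub>C.B\<^esub> g) = incl f \<oplus>\<^bsub>B\<^esub> incl g"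
  by (auto simp: incl_def C.B_ops B_ops s_plus)

lemma incl_smult: "incl (c \<odot>\<^bsub>C.B\<^esub> f) = c \<odot>\<^bsub>B\<^esub> incl f"
  by (auto simp: incl_def C.B_ops B_ops)

lemma incl_one: "incl \<one>\<^bsub>C.B\<^esub> = \<one>\<^bsub>B\<^esub>"
  by (simp add: C.B_ops(1) B_ops(1) incl_single)

lemma incl_zero: "incl \<zero>\<^bsub>C.B\<^esub> = \<zero>\<^bsub>B\<^esub>"
  by (auto simp: incl_def C.B_ops B_ops)

lemma incl_star: "f \<in> carrier C.B \<Longrightarrow> incl (star C.B f) = star B (incl f)"
  by (auto simp: incl_def C.B_ops B_ops star_smult al_smult)

lemma incl_mult:
  assumes "f \<in> carrier C.B" "g \<in> carrier C.B"
  shows "incl (f \<otimes>\<^bsub>C.B\<^esub> g) = incl f \<otimes>\<^bsub>B\<^esub> incl g"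
  using assms(1)
proof (induction f rule: C.B_induct)
  case zero
  then show ?case using assms by (simp add: incl_zero)
next
  case (single a s)
  note as = this
  show ?case using assms(2)
  proof (induction g rule: C.B_induct)
    case zero
    then show ?case using as by (simp add: incl_zero incl_single)
  next
    case (single b t)
    then show ?case using as
      by (simp add: C.single_mult incl_single single_mult al_smult smult_mult mult.commute)
  next
    case (add f g)
    then show ?case using as by (simp add: C.B_mult_add_right incl_add B_mult_add_right incl_single)
  qed
next
  case (add f g)
  then show ?case using assms by (simp add: C.B_mult_add_left incl_add B_mult_add_left)
qed

text \<open>C*-seminorms pull back along the homomorphism \<open>incl\<close>, which makes it
  contractive for the universal norms; the reverse estimate is where invariant states come
  in.\<close>

lemma seminorm_incl:
  assumes r: "cstar_seminorm B r"
  shows "cstar_seminorm C.B (\<lambda>f. r (incl f))"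
proof -
  interpret R: cstar_seminormed B r by unfold_locales (rule r)
  show ?thesis
    unfolding cstar_seminorm_def
    by (auto simp: incl_add incl_smult incl_mult incl_star R.p_nonneg R.p_triangle R.p_smult R.p_mult R.p_cstar)
qed

lemma univ_norm_incl_le: "f \<in> carrier C.B \<Longrightarrow> univ_norm B (incl f) \<le> univ_norm C.B f"
  by (rule C.BB.le_univ_norm[OF seminorm_incl[OF BB.univ_norm_seminorm]])

end

section \<open>Invariant states and injectivity of the canonical homomorphism\<close>

context positive_functional
begin

text \<open>The square of the GNS seminorm of u - 1 is 1 - 1 - 1 + 1 = 0, and by Cauchy-Schwarz
  \<psi> does not distinguish b u from b. This is the multiplicative domain argument for a unitary
  at which \<psi> takes the value 1.\<close>

lemma fixed_unitary:
  assumes u: "u \<in> carrier A" "star A u \<otimes> u = \<one>" and 1: "\<psi> \<one> = 1" "\<psi> u = 1"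
  shows "sn (u \<ominus> \<one>) = 0" "b \<in> carrier A \<Longrightarrow> \<psi> (b \<otimes> u) = \<psi> b"
    "b \<in> carrier A \<Longrightarrow> \<psi> (star A u \<otimes> b) = \<psi> b"
proof -
  have su: "\<psi> (star A u) = 1" using psi_star[OF u(1)] 1 by simp
  have "\<psi> (star A (u \<oplus> (-1) \<odot> \<one>) \<otimes> (u \<oplus> (-1) \<odot> \<one>)) = 0"
    using psi_expand[OF u(1) one_closed, of "-1"] u su 1 by simp
  then show s: "sn (u \<ominus> \<one>) = 0" using u by (simp add: sn_def diff_s)
  have r: "\<psi> (b \<otimes> u) = \<psi> b" if b: "b \<in> carrier A" for b
  proof -
    have "cmod (\<psi> (b \<otimes> (u \<ominus> \<one>))) \<le> sn (u \<ominus> \<one>) * sn (star A b)"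
      using psi_bound[of "u \<ominus> \<one>" "star A b"] u b by simp
    then have "\<psi> (b \<otimes> (u \<ominus> \<one>)) = 0" using s by simp
    then show ?thesis using u b by (simp add: diff_s r_distr smult_mult psi_add psi_smult)
  qed
  show "b \<in> carrier A \<Longrightarrow> \<psi> (b \<otimes> u) = \<psi> b" by (rule r)
  assume b: "b \<in> carrier A"
  have "\<psi> (star A u \<otimes> b) = cnj (\<psi> (star A b \<otimes> u))" using psi_herm[of b u] u b by simp
  also have "\<dots> = \<psi> b" using r[of "star A b"] psi_star[OF b] b by simp
  finally show "\<psi> (star A u \<otimes> b) = \<psi> b" .
qed

end

section \<open>Products of invariant states with functionals on the group algebra\<close>

context cstar_system_group
begin

lemma state_positive:
  assumes "\<phi> \<in> states A"
  shows "positive_functional A \<phi>"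
  by unfold_locales (use assms in \<open>auto simp: states_def\<close>)

text \<open>
  In terms of representations \<open>(\<pi>, U)\<close> and \<open>V\<close> for \<open>\<phi>\<close> and \<open>\<psi>\<close>, this is a vector functional of
  \<open>(\<pi> \<otimes> 1, U \<otimes> V)\<close>.
\<close>

definition prod_functional :: "('a \<Rightarrow> complex) \<Rightarrow> (('g \<Rightarrow> complex) \<Rightarrow> complex) \<Rightarrow> ('g \<Rightarrow> 'a) \<Rightarrow> complex" where
  "prod_functional \<phi> \<psi> = fsum (\<lambda>s a. \<phi> a * \<psi> (C.delta s))"

context
  fixes \<phi> :: "'a \<Rightarrow> complex" and \<psi> :: "('g \<Rightarrow> complex) \<Rightarrow> complex"
  assumes \<phi>: "\<phi> \<in> invariant_states A G \<alpha>" and \<psi>: "positive_functional C.B \<psi>"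
begin

interpretation PA: positive_functional A \<phi>
  using \<phi> state_positive by (simp add: invariant_states_def)

interpretation PC: positive_functional C.B \<psi>
  by (rule \<psi>)

abbreviation (input) "\<Psi> \<equiv> prod_functional \<phi> \<psi>"

lemma prod_add: "f \<in> carrier B \<Longrightarrow> g \<in> carrier B \<Longrightarrow> \<Psi> (f \<oplus>\<^bsub>B\<^esub> g) = \<Psi> f + \<Psi> g"
  unfolding prod_functional_def by (rule fsum_add) (auto simp: PA.psi_add distrib_right)

lemma prod_smult: "f \<in> carrier B \<Longrightarrow> \<Psi> (c \<odot>\<^bsub>B\<^esub> f) = c * \<Psi> f"
  unfolding prod_functional_def by (rule fsum_smult) (auto simp: PA.psi_smult)

lemma prod_single: "\<Psi> (single a s) = \<phi> a * \<psi> (C.delta s)"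
  unfolding prod_functional_def by (rule fsum_single) simp

text \<open>The adjoint of f_s u_s times f_t u_t has the group element s^-1 t and the coefficient
  obtained from \<open>star A (f s) \<otimes> f t\<close> by the automorphism of s^-1, which an
  invariant \<phi> does not see. What remains is the pointwise product of two kernels.\<close>

lemma prod_form:
  assumes f: "f \<in> carrier B"
  shows "\<Psi> (star B f \<otimes>\<^bsub>B\<^esub> f) = (\<Sum>s\<in>supp f. \<Sum>t\<in>supp f.
    \<phi> (star A (f s) \<otimes> f t) * \<psi> (star C.B (C.delta s) \<otimes>\<^bsub>C.B\<^esub> C.delta t))"
proof -
  have S: "finite (supp f)" "supp f \<subseteq> carrier G" using f by (auto simp: B_carrier)
  have c: "s \<in> supp f \<Longrightarrow> single (f s) s \<in> carrier B" for s using S f by auto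
  have "\<Psi> (star B f \<otimes>\<^bsub>B\<^esub> f) = (\<Sum>s\<in>supp f. \<Psi> (star B (single (f s) s) \<otimes>\<^bsub>B\<^esub> f))"
    by (rule additive_sum[where L = "\<lambda>h. \<Psi> (star B h \<otimes>\<^bsub>B\<^esub> f)"])
       (use f S in \<open>auto simp: prod_add B_star_add B_mult_add_left\<close>)
  also have "\<dots> = (\<Sum>s\<in>supp f. \<Sum>t\<in>supp f. \<Psi> (star B (single (f s) s) \<otimes>\<^bsub>B\<^esub> single (f t) t))"
  proof (rule sum.cong[OF refl])
    fix s assume s: "s \<in> supp f"
    show "\<Psi> (star B (single (f s) s) \<otimes>\<^bsub>B\<^esub> f) = (\<Sum>t\<in>supp f. \<Psi> (star B (single (f s) s) \<otimes>\<^bsub>B\<^esub> single (f t) t))"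
      by (rule additive_sum[where L = "\<lambda>h. \<Psi> (star B (single (f s) s) \<otimes>\<^bsub>B\<^esub> h)"])
         (use f S c[OF s] in \<open>auto simp: prod_add B_mult_add_right\<close>)
  qed
  also have "\<dots> = (\<Sum>s\<in>supp f. \<Sum>t\<in>supp f.
    \<phi> (star A (f s) \<otimes> f t) * \<psi> (star C.B (C.delta s) \<otimes>\<^bsub>C.B\<^esub> C.delta t))"
  proof (intro sum.cong refl)
    fix s t assume "s \<in> supp f" "t \<in> supp f"
    then have st: "s \<in> carrier G" "t \<in> carrier G" using S by auto
    have a: "star A (f s) \<otimes> f t \<in> carrier A" using f by simp
    have "star B (single (f s) s) \<otimes>\<^bsub>B\<^esub> single (f t) t
        = single (\<alpha> (inv\<^bsub>G\<^esub> s) (star A (f s) \<otimes> f t)) (inv\<^bsub>G\<^esub> s \<otimes>\<^bsub>G\<^esub> t)"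
      using st f by (simp add: star_single single_mult al_mult)
    moreover have "\<phi> (\<alpha> (inv\<^bsub>G\<^esub> s) (star A (f s) \<otimes> f t)) = \<phi> (star A (f s) \<otimes> f t)"
      using \<phi> a st unfolding invariant_states_def by blast
    moreover have "star C.B (C.delta s) \<otimes>\<^bsub>C.B\<^esub> C.delta t = C.delta (inv\<^bsub>G\<^esub> s \<otimes>\<^bsub>G\<^esub> t)"
      using st by (simp add: C.delta_simps)
    ultimately show "\<Psi> (star B (single (f s) s) \<otimes>\<^bsub>B\<^esub> single (f t) t)
        = \<phi> (star A (f s) \<otimes> f t) * \<psi> (star C.B (C.delta s) \<otimes>\<^bsub>C.B\<^esub> C.delta t)"
      by (simp add: prod_single)
  qed
  finally show ?thesis .
qed

lemma prod_positive: "positive_functional B \<Psi>"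
proof
  fix f assume f: "f \<in> carrier B"
  have S: "finite (supp f)" "supp f \<subseteq> carrier G" using f by (auto simp: B_carrier)
  let ?M = "\<lambda>s t. \<phi> (star A (f s) \<otimes> f t)" and ?L = "\<lambda>s t. \<psi> (star C.B (C.delta s) \<otimes>\<^bsub>C.B\<^esub> C.delta t)"
  have M: "psd_kernel (supp f) ?M" using S f by (intro PA.psi_psd_kernel) auto
  have L: "psd_kernel (supp f) ?L" using S by (intro PC.psi_psd_kernel) auto
  show "0 \<le> Re (\<Psi> (star B f \<otimes>\<^bsub>B\<^esub> f))"
    unfolding prod_form[OF f] by (rule Schur_product_nonneg[OF S(1) M L])
  \<comment> \<open>Conjugation exchanges the indices of both kernels, so the double sum equals its
    own conjugate.\<close>
  have "cnj (\<Sum>s\<in>supp f. \<Sum>t\<in>supp f. ?M s t * ?L s t) = (\<Sum>s\<in>supp f. \<Sum>t\<in>supp f. ?M t s * ?L t s)"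
    unfolding cnj_sum
  proof (intro sum.cong refl)
    fix s t assume st: "s \<in> supp f" "t \<in> supp f"
    show "cnj (?M s t * ?L s t) = ?M t s * ?L t s"
      unfolding complex_cnj_mult psd_kernel_herm[OF M st] psd_kernel_herm[OF L st] ..
  qed
  also have "\<dots> = (\<Sum>s\<in>supp f. \<Sum>t\<in>supp f. ?M s t * ?L s t)" by (rule sum.swap)
  finally have "cnj (\<Psi> (star B f \<otimes>\<^bsub>B\<^esub> f)) = \<Psi> (star B f \<otimes>\<^bsub>B\<^esub> f)" unfolding prod_form[OF f] .
  then have "- Im (\<Psi> (star B f \<otimes>\<^bsub>B\<^esub> f)) = Im (\<Psi> (star B f \<otimes>\<^bsub>B\<^esub> f))" by (metis cnj.simps(2))
  then show "Im (\<Psi> (star B f \<otimes>\<^bsub>B\<^esub> f)) = 0" by simp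
qed (auto simp: prod_add prod_smult)

text \<open>The coefficients of \<open>incl f\<close> are scalars, on which \<phi> is the identity
  because \<phi> 1 = 1.\<close>

lemma prod_incl:
  assumes f: "f \<in> carrier C.B"
  shows "\<Psi> (incl f) = \<psi> f"
  using f
proof (induction f rule: C.B_induct)
  case zero
  show ?case using prod_smult[OF B_zero_closed, of 0] by (simp add: incl_zero)
next
  case (single c s)
  have "C.single c s = c \<odot>\<^bsub>C.B\<^esub> C.delta s" by (simp add: C.delta_def C.single_smult)
  then have "\<psi> (C.single c s) = c * \<psi> (C.delta s)" using single PC.psi_smult[of "C.delta s" c] by simp
  moreover have "\<phi> \<one> = 1" using \<phi> by (simp add: invariant_states_def states_def)
  ultimately show ?case by (simp add: incl_single prod_single PA.psi_smult)
next
  case (add f g)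
  then show ?case by (simp add: incl_add prod_add PC.psi_add)
qed

end

text \<open>The trivial character of the group algebra, which sends every group element to
  1.\<close>

definition eps :: "('g \<Rightarrow> complex) \<Rightarrow> complex" where
  "eps f = C.fsum (\<lambda>s c. c) f"

lemma eps_add: "f \<in> carrier C.B \<Longrightarrow> g \<in> carrier C.B \<Longrightarrow> eps (f \<oplus>\<^bsub>C.B\<^esub> g) = eps f + eps g"
  unfolding eps_def by (rule C.fsum_add) auto

lemma eps_smult: "f \<in> carrier C.B \<Longrightarrow> eps (c \<odot>\<^bsub>C.B\<^esub> f) = c * eps f"
  unfolding eps_def by (rule C.fsum_smult) auto

lemma eps_single: "eps (C.single c s) = c"
  unfolding eps_def by (rule C.fsum_single) simp

lemma eps_zero: "eps \<zero>\<^bsub>C.B\<^esub> = 0"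
  using eps_smult[OF C.B_zero_closed, of 0] by simp

lemma eps_mult:
  assumes "f \<in> carrier C.B" "g \<in> carrier C.B"
  shows "eps (f \<otimes>\<^bsub>C.B\<^esub> g) = eps f * eps g"
  using assms(1)
proof (induction f rule: C.B_induct)
  case zero
  then show ?case using assms by (simp add: eps_zero)
next
  case (single a s)
  note as = this
  show ?case using assms(2)
  proof (induction g rule: C.B_induct)
    case zero
    then show ?case using as by (simp add: eps_zero)
  next
    case (single b t)
    then show ?case using as by (simp add: C.single_mult eps_single)
  next
    case (add f g)
    then show ?case using as by (simp add: C.B_mult_add_right eps_add distrib_left)
  qed
next
  case (add f g)
  then show ?case using assms by (simp add: C.B_mult_add_left eps_add distrib_right)
qed

lemma eps_star: "f \<in> carrier C.B \<Longrightarrow> eps (star C.B f) = cnj (eps f)"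
proof (induction f rule: C.B_induct)
  case (add f g)
  then show ?case by (simp add: C.B_star_add eps_add)
qed (simp_all add: eps_zero C.star_single eps_single)

lemma eps_one: "eps \<one>\<^bsub>C.B\<^esub> = 1"
  by (simp add: C.B_ops(1) eps_single)

lemma eps_positive: "positive_functional C.B eps"
  by unfold_locales
     (auto simp: eps_add eps_smult eps_mult eps_star)

lemma eps_seminorm: "cstar_seminorm C.B (\<lambda>f. cmod (eps f))"
  unfolding cstar_seminorm_def
  by (auto simp: eps_add eps_smult eps_mult eps_star norm_mult norm_triangle_ineq power2_eq_square)

lemma eps_le_univ_norm: "f \<in> carrier C.B \<Longrightarrow> cmod (eps f) \<le> univ_norm C.B f"
  by (rule C.BB.le_univ_norm[OF eps_seminorm])

lemma eps_rpeval:
  assumes h: "h \<in> carrier C.B" "eps h = complex_of_real t"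
  shows "eps (C.B.rpeval h P) = complex_of_real (poly P t)"
proof -
  have "eps (C.B.peval h F) = poly F (eps h)" for F
  proof (induction F)
    case (pCons a F)
    then show ?case using h(1)
      by (simp add: C.B.peval_pCons eps_add eps_smult eps_mult eps_one)
  qed (simp add: eps_zero)
  moreover have "poly (C.B.cpx P) (complex_of_real t) = complex_of_real (poly P t)" for P
    by (induction P) (simp_all add: C.B.cpx_def map_poly_pCons)
  ultimately show ?thesis using h(2) by (simp add: C.B.rpeval_def)
qed

theorem univ_norm_incl:
  assumes \<phi>: "\<phi> \<in> invariant_states A G \<alpha>" and f: "f \<in> carrier C.B"
  shows "univ_norm B (incl f) = univ_norm C.B f"
proof (rule antisym[OF univ_norm_incl_le[OF f]])
  show "univ_norm C.B f \<le> univ_norm B (incl f)"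
  proof (rule C.BB.univ_norm_least)
    fix p assume p: "cstar_seminorm C.B p"
    interpret p: cstar_seminormed C.B p by unfold_locales (rule p)
    show "p f \<le> univ_norm B (incl f)"
    proof (cases "p \<one>\<^bsub>C.B\<^esub> = 1")
      case False
      \<comment> \<open>A C*-seminorm takes the value 0 or 1 at the unit, and in the first case it
        vanishes identically.\<close>
      then have "p \<one>\<^bsub>C.B\<^esub> = 0" using p.p_one_cases by simp
      then have "p f \<le> 0" using p.p_mult[of "\<one>\<^bsub>C.B\<^esub>" f] f by simp
      then show ?thesis using BB.univ_norm_nonneg[of "incl f"] f by simp
    next
      case True
      obtain \<psi> where \<psi>: "positive_functional C.B \<psi>" "\<psi> \<one>\<^bsub>C.B\<^esub> = 1"
        "\<psi> (star C.B f \<otimes>\<^bsub>C.B\<^esub> f) = complex_of_real ((p f)\<^sup>2)"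
        using p.norming_functional[OF f True] .
      interpret Q: gns B "prod_functional \<phi> \<psi>"
        by (rule gns_B[OF prod_positive[OF \<phi> \<psi>(1)]])
      have i: "incl f \<in> carrier B" using f by simp
      have "(Q.sn (incl f))\<^sup>2 = (p f)\<^sup>2"
      proof -
        have "star B (incl f) \<otimes>\<^bsub>B\<^esub> incl f = incl (star C.B f \<otimes>\<^bsub>C.B\<^esub> f)" using f by (simp add: incl_mult incl_star)
        then have "complex_of_real ((Q.sn (incl f))\<^sup>2) = complex_of_real ((p f)\<^sup>2)"
          using Q.sn_square[OF i] prod_incl[OF \<phi> \<psi>(1), of "star C.B f \<otimes>\<^bsub>C.B\<^esub> f"] \<psi>(3) f by simp
        then show ?thesis by (simp only: of_real_eq_iff)
      qed
      then have 1: "Q.sn (incl f) = p f" using p.p_nonneg[OF f] Q.sn_nonneg[OF i] by simp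
      \<comment> \<open>The class of 1 is a unit vector which \<open>incl f\<close> maps to a vector
        of norm p f, so the universal norm of \<open>incl f\<close> is at least p f.\<close>
      have "Q.sn \<one>\<^bsub>B\<^esub> = 1"
        using prod_incl[OF \<phi> \<psi>(1), of "\<one>\<^bsub>C.B\<^esub>"] \<psi>(2) by (simp add: incl_one Q.sn_def)
      then show ?thesis using Q.sn_mult_le[OF i, of "\<one>\<^bsub>B\<^esub>"] 1 i by simp
    qed
  qed
qed

section \<open>The canonical homomorphism on Cauchy sequences\<close>

lemma canonical_cls:
  assumes X: "X \<in> C.BB.S.CS"
  shows "(\<lambda>n. incl (X n)) \<in> BB.S.CS" "canonical_hom A G \<alpha> (C.BB.S.cls X) = BB.S.cls (\<lambda>n. incl (X n))"
proof -
  have diff: "incl f \<ominus>\<^bsub>B\<^esub> incl g = incl (f \<ominus>\<^bsub>C.B\<^esub> g)" if "f \<in> carrier C.B" "g \<in> carrier C.B" for f g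
    using that by (simp add: B.diff_s C.B.diff_s incl_add incl_smult)
  have le: "univ_norm B (incl f \<ominus>\<^bsub>B\<^esub> incl g) \<le> univ_norm C.B (f \<ominus>\<^bsub>C.B\<^esub> g)"
    if "f \<in> carrier C.B" "g \<in> carrier C.B" for f g
    unfolding diff[OF that] using that by (intro univ_norm_incl_le) simp
  have cs: "(\<lambda>n. incl (Y n)) \<in> BB.S.CS" if Y: "Y \<in> C.BB.S.CS" for Y
  proof (rule BB.S.CS_I)
    show "incl (Y n) \<in> carrier B" for n using Y by simp
    fix e :: real assume "0 < e"
    from C.BB.S.CS_D[OF Y this] obtain N
      where N: "\<And>m n. N \<le> m \<Longrightarrow> N \<le> n \<Longrightarrow> univ_norm C.B (Y m \<ominus>\<^bsub>C.B\<^esub> Y n) < e" by blast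
    have "univ_norm B (incl (Y m) \<ominus>\<^bsub>B\<^esub> incl (Y n)) < e" if "N \<le> m" "N \<le> n" for m n
      using le[of "Y m" "Y n"] N[OF that] Y by simp
    then show "\<exists>N. \<forall>m\<ge>N. \<forall>n\<ge>N. univ_norm B (incl (Y m) \<ominus>\<^bsub>B\<^esub> incl (Y n)) < e" by blast
  qed
  show "(\<lambda>n. incl (X n)) \<in> BB.S.CS" by (rule cs[OF X])
  have "BB.S.cls (\<lambda>n. incl (Y n)) = BB.S.cls (\<lambda>n. incl (X n))" if r: "(X, Y) \<in> C.BB.S.rel" for Y
  proof -
    have Y: "Y \<in> C.BB.S.CS" and lim: "(\<lambda>n. univ_norm C.B (X n \<ominus>\<^bsub>C.B\<^esub> Y n)) \<longlonglongrightarrow> 0"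
      using r by (auto simp: C.BB.S.rel_def)
    have "(\<lambda>n. univ_norm B (incl (X n) \<ominus>\<^bsub>B\<^esub> incl (Y n))) \<longlonglongrightarrow> 0"
    proof (rule tendsto_sandwich[OF _ _ tendsto_const lim]; rule always_eventually, rule allI)
      fix n
      show "0 \<le> univ_norm B (incl (X n) \<ominus>\<^bsub>B\<^esub> incl (Y n))" using X Y by (intro BB.univ_norm_nonneg) simp
      show "univ_norm B (incl (X n) \<ominus>\<^bsub>B\<^esub> incl (Y n)) \<le> univ_norm C.B (X n \<ominus>\<^bsub>C.B\<^esub> Y n)"
        using X Y by (intro le) auto
    qed
    then have "((\<lambda>n. incl (X n)), (\<lambda>n. incl (Y n))) \<in> BB.S.rel" using cs[OF X] cs[OF Y] by (simp add: BB.S.rel_def)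
    from BB.S.cls_cong[OF this] show ?thesis by simp
  qed
  then have "(\<Union>Y\<in>C.BB.S.cls X. BB.S.cls (\<lambda>n. incl (Y n))) = BB.S.cls (\<lambda>n. incl (X n))"
    by (rule C.BB.S.UN_cls[OF X, where F = "\<lambda>Y. BB.S.cls (\<lambda>n. incl (Y n))"])
  then show "canonical_hom A G \<alpha> (C.BB.S.cls X) = BB.S.cls (\<lambda>n. incl (X n))"
    by (simp add: canonical_hom_def BB.completion_class_cls incl_def)
qed

lemma group_cstar_carrier: "P \<in> carrier (group_cstar G) \<longleftrightarrow> (\<exists>X\<in>C.BB.S.CS. P = C.BB.S.cls X)"
  using C.BB.completion_carrier[of P] by (simp add: group_cstar_def group_alg_cc_alg)

text \<open>By \<open>univ_norm_incl\<close> the map is isometric on each term of a difference of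
  sequences, so it reflects null sequences.\<close>

theorem state_imp_inj:
  assumes \<phi>: "\<phi> \<in> invariant_states A G \<alpha>"
  shows "inj_on (canonical_hom A G \<alpha>) (carrier (group_cstar G))"
proof (rule inj_onI)
  fix P Q assume "P \<in> carrier (group_cstar G)" "Q \<in> carrier (group_cstar G)"
    and eq: "canonical_hom A G \<alpha> P = canonical_hom A G \<alpha> Q"
  then obtain X Y where X: "X \<in> C.BB.S.CS" "P = C.BB.S.cls X" and Y: "Y \<in> C.BB.S.CS" "Q = C.BB.S.cls Y"
    unfolding group_cstar_carrier by blast
  have "BB.S.cls (\<lambda>n. incl (X n)) = BB.S.cls (\<lambda>n. incl (Y n))"
    using eq unfolding X(2) Y(2) canonical_cls(2)[OF X(1)] canonical_cls(2)[OF Y(1)] .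
  then have r: "((\<lambda>n. incl (X n)), (\<lambda>n. incl (Y n))) \<in> BB.S.rel"
    unfolding BB.S.cls_eq[OF canonical_cls(1)[OF X(1)]] .
  have "univ_norm B (incl (X n) \<ominus>\<^bsub>B\<^esub> incl (Y n)) = univ_norm C.B (X n \<ominus>\<^bsub>C.B\<^esub> Y n)" for n
  proof -
    have "incl (X n) \<ominus>\<^bsub>B\<^esub> incl (Y n) = incl (X n \<ominus>\<^bsub>C.B\<^esub> Y n)"
      using X Y by (simp add: B.diff_s C.B.diff_s incl_add incl_smult)
    then show ?thesis using univ_norm_incl[OF \<phi>, of "X n \<ominus>\<^bsub>C.B\<^esub> Y n"] X Y by simp
  qed
  then have "(X, Y) \<in> C.BB.S.rel" using r X(1) Y(1) by (simp add: BB.S.rel_def C.BB.S.rel_def)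
  from C.BB.S.cls_cong[OF this] show "P = Q" unfolding X(2) Y(2) .
qed

text \<open>
  If \<open>\<bar>\<epsilon>(f)\<bar>\<close> exceeds the norm of \<open>f\<close> in the crossed product, then with \<open>h = f\<^sup>*f\<close>, \<open>r\<close> the norm of \<open>h\<close> in the
  crossed product and \<open>g(t) = max 0 (\<bar>t\<bar> - r)\<close>, the element \<open>g(h)\<close> of the group C*-algebra is nonzero, since
  \<open>\<epsilon>(g(h)) = g(\<epsilon>(h)) > 0\<close>, but is mapped to zero.
\<close>

theorem inj_imp_eps_bounded:
  assumes inj: "inj_on (canonical_hom A G \<alpha>) (carrier (group_cstar G))" and f: "f \<in> carrier C.B"
  shows "cmod (eps f) \<le> univ_norm B (incl f)"
proof (rule ccontr)
  assume gt: "\<not> ?thesis"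
  \<comment> \<open>The norm of the crossed product, pulled back to the group algebra. The element h
    has one spectrum for p and another for the universal norm of the group algebra.\<close>
  define p where "p f = univ_norm B (incl f)" for f
  have "cstar_seminorm C.B p" unfolding p_def by (rule seminorm_incl[OF BB.univ_norm_seminorm])
  then interpret p: cstar_seminormed C.B p by unfold_locales
  define h where "h = star C.B f \<otimes>\<^bsub>C.B\<^esub> f"
  have h: "h \<in> carrier C.B" "star C.B h = h" using f by (auto simp: h_def C.B.star_mult)
  define e where "e = (cmod (eps f))\<^sup>2"
  have e: "eps h = complex_of_real e"
  proof -
    have "eps h = cnj (eps f) * eps f" using f by (simp add: h_def eps_mult eps_star)
    also have "\<dots> = complex_of_real e" unfolding e_def by (metis complex_norm_square mult.commute)
    finally show ?thesis .
  qed
  define r where "r = p h"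
  have r0: "0 \<le> r" using h p.p_nonneg by (simp add: r_def)
  have "p f < cmod (eps f)" using gt by (simp add: p_def)
  then have "(p f)\<^sup>2 < e" unfolding e_def using p.p_nonneg[OF f] by (intro power_strict_mono) auto
  then have re: "r < e" using p.p_cstar[OF f] by (simp add: r_def h_def)
  define R where "R = univ_norm C.B h"
  have eR: "e \<le> R" using eps_le_univ_norm[OF h(1)] r0 re by (simp add: e R_def)
  define g where "g t = max 0 (\<bar>t\<bar> - r)" for t :: real
  have "continuous_on {- R..R} g" unfolding g_def by (intro continuous_intros)
  \<comment> \<open>The interval [-R, R] contains both spectra of h as well as the point e, so one
    sequence of polynomials represents g in all three places.\<close>
  then have "\<exists>P. \<forall>t\<in>{- R..R}. \<bar>g t - poly P t\<bar> < inverse (real (Suc n))" for n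
    using Weierstrass_poly[of "- R" R g "inverse (real (Suc n))"] by (metis inverse_positive_iff_positive of_nat_0_less_iff zero_less_Suc)
  then obtain P where P: "\<And>n t. t \<in> {- R..R} \<Longrightarrow> \<bar>g t - poly (P n) t\<bar> < inverse (real (Suc n))" by metis
  define X where "X n = C.B.rpeval h (P n)" for n
  have X: "X n \<in> carrier C.B" for n using h by (simp add: X_def C.B.rpeval_simps)
  have XX: "univ_norm C.B (X m \<ominus>\<^bsub>C.B\<^esub> X n) \<le> inverse (real (Suc m)) + inverse (real (Suc n))" for m n
  proof -
    have eq: "X m \<ominus>\<^bsub>C.B\<^esub> X n = C.B.rpeval h (P m - P n)" using h by (simp only: X_def C.B.rpeval_simps)
    show ?thesis
      unfolding eq
    proof (rule C.BB.U.sp_bound[OF h])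
      fix t assume "t \<in> C.BB.U.sp h"
      then have "\<bar>t\<bar> \<le> R" using C.BB.U.sp_abs_le[OF h] by (simp add: R_def)
      then have "t \<in> {- R..R}" by auto
      from P[OF this, of m] P[OF this, of n]
      show "\<bar>poly (P m - P n) t\<bar> \<le> inverse (real (Suc m)) + inverse (real (Suc n))"
        by (simp del: of_nat_Suc)
    qed simp
  qed
  have XCS: "X \<in> C.BB.S.CS"
  proof (rule C.BB.S.CS_I[OF X])
    fix d :: real assume "0 < d"
    then obtain N where N: "inverse (real (Suc N)) < d / 2" using reals_Archimedean[of "d / 2"] by auto
    have "univ_norm C.B (X m \<ominus>\<^bsub>C.B\<^esub> X n) < d" if mn: "N \<le> m" "N \<le> n" for m n
    proof -
      have "inverse (real (Suc m)) \<le> inverse (real (Suc N))" "inverse (real (Suc n)) \<le> inverse (real (Suc N))"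
        using mn by (simp_all add: le_imp_inverse_le)
      then show ?thesis using XX[of m n] N by linarith
    qed
    then show "\<exists>N. \<forall>m\<ge>N. \<forall>n\<ge>N. univ_norm C.B (X m \<ominus>\<^bsub>C.B\<^esub> X n) < d" by blast
  qed
  have rR: "r \<le> R" using re eR by simp
  have pX: "univ_norm B (incl (X n)) \<le> inverse (real (Suc n))" for n
  proof -
    have "p (C.B.rpeval h (P n)) \<le> inverse (real (Suc n))"
    proof (rule p.sp_bound[OF h])
      fix t assume "t \<in> p.sp h"
      then have t: "\<bar>t\<bar> \<le> r" using p.sp_abs_le[OF h] by (simp add: r_def)
      then have "t \<in> {- R..R}" "g t = 0" using rR by (auto simp: g_def)
      then show "\<bar>poly (P n) t\<bar> \<le> inverse (real (Suc n))" using P[of t n] by simp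
    qed simp
    then show ?thesis by (simp add: p_def X_def)
  qed
  have Z: "(\<lambda>n. \<zero>\<^bsub>C.B\<^esub>) \<in> C.BB.S.CS" by (rule C.BB.S.CS_const) simp
  have "(\<lambda>n. univ_norm B (incl (X n) \<ominus>\<^bsub>B\<^esub> incl \<zero>\<^bsub>C.B\<^esub>)) \<longlonglongrightarrow> 0"
  proof (rule tendsto_sandwich[OF _ _ tendsto_const LIMSEQ_inverse_real_of_nat]; rule always_eventually, rule allI)
    fix n
    have d: "incl (X n) \<ominus>\<^bsub>B\<^esub> incl \<zero>\<^bsub>C.B\<^esub> = incl (X n)" unfolding incl_zero using X by (intro BB.S.diff_zero) simp
    show "0 \<le> univ_norm B (incl (X n) \<ominus>\<^bsub>B\<^esub> incl \<zero>\<^bsub>C.B\<^esub>)" unfolding d using X by (intro BB.univ_norm_nonneg) simp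
    show "univ_norm B (incl (X n) \<ominus>\<^bsub>B\<^esub> incl \<zero>\<^bsub>C.B\<^esub>) \<le> inverse (real (Suc n))" unfolding d by (rule pX)
  qed
  then have "((\<lambda>n. incl (X n)), (\<lambda>n. incl \<zero>\<^bsub>C.B\<^esub>)) \<in> BB.S.rel"
    using canonical_cls(1)[OF XCS] canonical_cls(1)[OF Z] by (simp add: BB.S.rel_def)
  from BB.S.cls_cong[OF this]
  have "canonical_hom A G \<alpha> (C.BB.S.cls X) = canonical_hom A G \<alpha> (C.BB.S.cls (\<lambda>n. \<zero>\<^bsub>C.B\<^esub>))"
    unfolding canonical_cls(2)[OF XCS] canonical_cls(2)[OF Z] .
  moreover have "C.BB.S.cls X \<in> carrier (group_cstar G)" "C.BB.S.cls (\<lambda>n. \<zero>\<^bsub>C.B\<^esub>) \<in> carrier (group_cstar G)"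
    unfolding group_cstar_carrier using XCS Z by blast+
  ultimately have "C.BB.S.cls X = C.BB.S.cls (\<lambda>n. \<zero>\<^bsub>C.B\<^esub>)" using inj by (meson inj_onD)
  then have "(X, \<lambda>n. \<zero>\<^bsub>C.B\<^esub>) \<in> C.BB.S.rel" unfolding C.BB.S.cls_eq[OF XCS] .
  then have lim: "(\<lambda>n. univ_norm C.B (X n \<ominus>\<^bsub>C.B\<^esub> \<zero>\<^bsub>C.B\<^esub>)) \<longlonglongrightarrow> 0" by (simp add: C.BB.S.rel_def)
  \<comment> \<open>The character turns polynomials in h into their values at e and is bounded by
    the universal norm. As g e = e - r > 0, the sequence X is not a null sequence in the group
    C*-algebra.\<close>
  have le: "e - r \<le> univ_norm C.B (X n \<ominus>\<^bsub>C.B\<^esub> \<zero>\<^bsub>C.B\<^esub>) + inverse (real (Suc n))" for n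
  proof -
    have "e \<in> {- R..R}" "g e = e - r" using eR re r0 by (auto simp: g_def)
    then have "e - r \<le> \<bar>poly (P n) e\<bar> + inverse (real (Suc n))" using P[of e n] by linarith
    also have "\<bar>poly (P n) e\<bar> = cmod (eps (X n))" by (simp add: X_def eps_rpeval[OF h(1) e])
    also have "\<dots> \<le> univ_norm C.B (X n)" by (rule eps_le_univ_norm[OF X])
    also have "X n = X n \<ominus>\<^bsub>C.B\<^esub> \<zero>\<^bsub>C.B\<^esub>" using X by (simp add: C.BB.S.diff_zero)
    finally show ?thesis by simp
  qed
  have "e - r \<le> 0 + 0"
    by (rule LIMSEQ_le_const[OF tendsto_add[OF lim LIMSEQ_inverse_real_of_nat]]) (use le in blast)
  then show False using re by simp
qed

end

section \<open>Covariant representations\<close>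

text \<open>No group structure is established for \<open>unitary_group H\<close> itself. Its
  inverses are identified from \<open>m_inv_def\<close>, computing in the ambient group
  \<open>BijGroup (carrier H)\<close>.\<close>

lemma unitary_group_hom:
  assumes G: "group G" and U: "U \<in> hom G (unitary_group H)"
  shows "s \<in> carrier G \<Longrightarrow> U s \<in> Bij (carrier H) \<inter> isometries H H"
    and "s \<in> carrier G \<Longrightarrow> t \<in> carrier G \<Longrightarrow> U (s \<otimes>\<^bsub>G\<^esub> t) = compose (carrier H) (U s) (U t)"
    and "U \<one>\<^bsub>G\<^esub> = (\<lambda>x\<in>carrier H. x)"
    and "s \<in> carrier G \<Longrightarrow> inv\<^bsub>unitary_group H\<^esub> (U s) = U (inv\<^bsub>G\<^esub> s)"
proof -
  interpret G: group G by (rule G)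
  interpret BG: group "BijGroup (carrier H)" by (rule group_BijGroup)
  have c: "U s \<in> Bij (carrier H) \<inter> isometries H H" if "s \<in> carrier G" for s
    using hom_in_carrier[OF U that] by (simp add: unitary_group_def)
  then show "s \<in> carrier G \<Longrightarrow> U s \<in> Bij (carrier H) \<inter> isometries H H" .
  have b: "U s \<in> carrier (BijGroup (carrier H))" if "s \<in> carrier G" for s
    using c[OF that] by (simp add: BijGroup_def)
  have m: "U (s \<otimes>\<^bsub>G\<^esub> t) = U s \<otimes>\<^bsub>BijGroup (carrier H)\<^esub> U t" if "s \<in> carrier G" "t \<in> carrier G" for s t
    using hom_mult[OF U that] by (simp add: unitary_group_def)
  show "U (s \<otimes>\<^bsub>G\<^esub> t) = compose (carrier H) (U s) (U t)" if "s \<in> carrier G" "t \<in> carrier G"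
    using m[OF that] c that by (simp add: BijGroup_def)
  have one: "U \<one>\<^bsub>G\<^esub> = \<one>\<^bsub>BijGroup (carrier H)\<^esub>"
    using m[of "\<one>\<^bsub>G\<^esub>" "\<one>\<^bsub>G\<^esub>"] b[of "\<one>\<^bsub>G\<^esub>"] by (metis BG.l_cancel_one' G.l_one G.one_closed)
  then show "U \<one>\<^bsub>G\<^esub> = (\<lambda>x\<in>carrier H. x)" by (simp add: BijGroup_def)
  assume s: "s \<in> carrier G"
  show "inv\<^bsub>unitary_group H\<^esub> (U s) = U (inv\<^bsub>G\<^esub> s)"
    unfolding m_inv_def[of "unitary_group H"]
  proof (rule the_equality)
    have "U s \<otimes>\<^bsub>BijGroup (carrier H)\<^esub> U (inv\<^bsub>G\<^esub> s) = \<one>\<^bsub>BijGroup (carrier H)\<^esub>"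
      "U (inv\<^bsub>G\<^esub> s) \<otimes>\<^bsub>BijGroup (carrier H)\<^esub> U s = \<one>\<^bsub>BijGroup (carrier H)\<^esub>"
      using m[of s "inv\<^bsub>G\<^esub> s"] m[of "inv\<^bsub>G\<^esub> s" s] s one by simp_all
    note inv = this
    then show "U (inv\<^bsub>G\<^esub> s) \<in> carrier (unitary_group H)
      \<and> U s \<otimes>\<^bsub>unitary_group H\<^esub> U (inv\<^bsub>G\<^esub> s) = \<one>\<^bsub>unitary_group H\<^esub>
      \<and> U (inv\<^bsub>G\<^esub> s) \<otimes>\<^bsub>unitary_group H\<^esub> U s = \<one>\<^bsub>unitary_group H\<^esub>"
      using c[of "inv\<^bsub>G\<^esub> s"] s by (simp add: unitary_group_def)
    fix V assume "V \<in> carrier (unitary_group H) \<and> U s \<otimes>\<^bsub>unitary_group H\<^esub> V = \<one>\<^bsub>unitary_group H\<^esub>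
      \<and> V \<otimes>\<^bsub>unitary_group H\<^esub> U s = \<one>\<^bsub>unitary_group H\<^esub>"
    then have V: "V \<in> carrier (BijGroup (carrier H))"
      "V \<otimes>\<^bsub>BijGroup (carrier H)\<^esub> U s = \<one>\<^bsub>BijGroup (carrier H)\<^esub>"
      by (auto simp: unitary_group_def BijGroup_def)
    have "V = V \<otimes>\<^bsub>BijGroup (carrier H)\<^esub> (U s \<otimes>\<^bsub>BijGroup (carrier H)\<^esub> U (inv\<^bsub>G\<^esub> s))"
      unfolding inv(1) using V(1) by simp
    also have "\<dots> = U (inv\<^bsub>G\<^esub> s)" using V b s by (simp flip: BG.m_assoc)
    finally show "V = U (inv\<^bsub>G\<^esub> s)" .
  qed
qed

lemma representation_comp:
  assumes h: "h \<in> unital_star_hom A B" and \<pi>: "\<pi> \<in> representations B H"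
  shows "(\<lambda>a. \<pi> (h a)) \<in> representations A H"
proof -
  have h1: "h \<in> ring_hom A B" "\<And>c x. x \<in> carrier A \<Longrightarrow> h (c \<odot>\<^bsub>A\<^esub> x) = c \<odot>\<^bsub>B\<^esub> h x"
    "\<And>x. x \<in> carrier A \<Longrightarrow> h (star A x) = star B (h x)"
    using h by (auto simp: unital_star_hom_def unital_alg_hom_def)
  have p1: "\<pi> \<in> ring_hom B (bounded_operators H)"
    "\<And>c x. x \<in> carrier B \<Longrightarrow> \<pi> (c \<odot>\<^bsub>B\<^esub> x) = c \<odot>\<^bsub>bounded_operators H\<^esub> \<pi> x"
    "\<And>x. x \<in> carrier B \<Longrightarrow> is_adjoint H (\<pi> x) (\<pi> (star B x))"
    using \<pi> by (auto simp: representations_def unital_alg_hom_def)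
  note hc = ring_hom_closed[OF h1(1)]
  have "(\<lambda>a. \<pi> (h a)) \<in> ring_hom A (bounded_operators H)"
    by (rule ring_hom_memI)
       (simp_all add: hc ring_hom_closed[OF p1(1)] ring_hom_mult[OF h1(1)] ring_hom_mult[OF p1(1)]
         ring_hom_add[OF h1(1)] ring_hom_add[OF p1(1)] ring_hom_one[OF h1(1)] ring_hom_one[OF p1(1)])
  then show ?thesis
    unfolding representations_def unital_alg_hom_def using h1(2,3) p1(2,3) hc by simp
qed

section \<open>Rules of calculation for a representation\<close>

locale star_representation = complex_hilbert_space H + B: unital_star_algebra B
  for B :: "('b, 'm) star_alg_scheme" and H :: "('h, 'k) inner_space_scheme" +
  fixes \<pi>
  assumes representation: "\<pi> \<in> representations B H"
begin

lemma pi_hom: "\<pi> \<in> ring_hom B (bounded_operators H)"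
  using representation by (simp add: representations_def unital_alg_hom_def)

lemma pi_linear: "b \<in> carrier B \<Longrightarrow> \<pi> b \<in> linear_maps H H"
  using ring_hom_closed[OF pi_hom] by (auto simp: bounded_operators_def)

lemma pi_closed [simp]: "b \<in> carrier B \<Longrightarrow> x \<in> carrier H \<Longrightarrow> \<pi> b x \<in> carrier H"
  using pi_linear unfolding linear_maps_def by blast

lemma pi_ext: "b \<in> carrier B \<Longrightarrow> \<pi> b \<in> extensional (carrier H)"
  using pi_linear unfolding linear_maps_def by (auto simp: PiE_def)

lemma pi_compose: "b \<in> carrier B \<Longrightarrow> c \<in> carrier B \<Longrightarrow> \<pi> (b \<otimes>\<^bsub>B\<^esub> c) = compose (carrier H) (\<pi> b) (\<pi> c)"
  using ring_hom_mult[OF pi_hom] by (simp add: bounded_operators_def)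

lemma pi_mult: "b \<in> carrier B \<Longrightarrow> c \<in> carrier B \<Longrightarrow> x \<in> carrier H \<Longrightarrow> \<pi> (b \<otimes>\<^bsub>B\<^esub> c) x = \<pi> b (\<pi> c x)"
  by (simp add: pi_compose compose_def)

lemma pi_one: "x \<in> carrier H \<Longrightarrow> \<pi> \<one>\<^bsub>B\<^esub> x = x"
  using ring_hom_one[OF pi_hom] by (simp add: bounded_operators_def)

lemma pi_add: "b \<in> carrier B \<Longrightarrow> c \<in> carrier B \<Longrightarrow> x \<in> carrier H \<Longrightarrow> \<pi> (b \<oplus>\<^bsub>B\<^esub> c) x = \<pi> b x \<oplus>\<^bsub>H\<^esub> \<pi> c x"
  using ring_hom_add[OF pi_hom] by (simp add: bounded_operators_def)

lemma pi_smult: "b \<in> carrier B \<Longrightarrow> x \<in> carrier H \<Longrightarrow> \<pi> (c \<odot>\<^bsub>B\<^esub> b) x = c \<odot>\<^bsub>H\<^esub> \<pi> b x"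
  using representation by (simp add: representations_def unital_alg_hom_def bounded_operators_def)

lemma pi_adjoint:
  "b \<in> carrier B \<Longrightarrow> x \<in> carrier H \<Longrightarrow> y \<in> carrier H \<Longrightarrow> cinner H (\<pi> b x) y = cinner H x (\<pi> (star B b) y)"
  using representation by (simp add: representations_def is_adjoint_def)

lemma pi_unitary:
  assumes u: "u \<in> carrier B" "star B u \<otimes>\<^bsub>B\<^esub> u = \<one>\<^bsub>B\<^esub>" "u \<otimes>\<^bsub>B\<^esub> star B u = \<one>\<^bsub>B\<^esub>"
  shows "\<pi> u \<in> Bij (carrier H) \<inter> isometries H H"
proof -
  have "bij_betw (\<pi> u) (carrier H) (carrier H)"
  proof (rule bij_betw_byWitness[where f' = "\<pi> (star B u)"])
    show "\<forall>x\<in>carrier H. \<pi> (star B u) (\<pi> u x) = x" "\<forall>x\<in>carrier H. \<pi> u (\<pi> (star B u) x) = x"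
      using u by (simp_all add: pi_one flip: pi_mult)
  qed (use u in auto)
  moreover have "cinner H (\<pi> u x) (\<pi> u y) = cinner H x y" if "x \<in> carrier H" "y \<in> carrier H" for x y
    using that u by (simp add: pi_adjoint pi_one flip: pi_mult)
  ultimately show ?thesis using pi_ext[OF u(1)] pi_linear[OF u(1)] by (simp add: Bij_def isometries_def)
qed

lemma pi_zero:
  assumes "b \<in> carrier B"
  shows "\<pi> b \<zero>\<^bsub>H\<^esub> = \<zero>\<^bsub>H\<^esub>"
proof -
  have "\<pi> b (0 \<odot>\<^bsub>H\<^esub> \<zero>\<^bsub>H\<^esub>) = 0 \<odot>\<^bsub>H\<^esub> \<pi> b \<zero>\<^bsub>H\<^esub>"
    using pi_linear[OF assms] M.zero_closed unfolding linear_maps_def by blast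
  moreover have "0 \<odot>\<^bsub>H\<^esub> x = \<zero>\<^bsub>H\<^esub>" if "x \<in> carrier H" for x
    using smult_l_null[OF that] by simp
  ultimately show ?thesis using assms by simp
qed

end

context complex_hilbert_space
begin

lemma cinner_self_real: "x \<in> carrier H \<Longrightarrow> cinner H x x = complex_of_real (Re (cinner H x x))"
proof -
  assume x: "x \<in> carrier H"
  have "Im (cinner H x x) = - Im (cinner H x x)" using cinner_commute[OF x x] by (metis cnj.simps(2))
  then show ?thesis by (simp add: complex_eq_iff)
qed

lemma cinner_smult_right:
  assumes "x \<in> carrier H" "y \<in> carrier H"
  shows "cinner H x (c \<odot>\<^bsub>H\<^esub> y) = cnj c * cinner H x y"
proof -
  have cy: "c \<odot>\<^bsub>H\<^esub> y \<in> carrier H" using assms smult_closed[of c y] by simp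
  have "cinner H x (c \<odot>\<^bsub>H\<^esub> y) = cnj (cinner H (c \<odot>\<^bsub>H\<^esub> y) x)" by (rule cinner_commute[OF cy assms(1)])
  also have "\<dots> = cnj c * cnj (cinner H y x)" using assms by (simp add: cinner_smult_left)
  also have "cnj (cinner H y x) = cinner H x y" by (rule cinner_commute[OF assms(2,1), symmetric])
  finally show ?thesis .
qed

text \<open>The intertwining isometry sends 1 to the fixed vector x divided by its norm.\<close>

lemma contains_trivial:
  assumes x: "x \<in> carrier H" "x \<noteq> \<zero>" and U: "\<And>s. s \<in> carrier G \<Longrightarrow> U s \<in> linear_maps H H"
    and fix_x: "\<And>s. s \<in> carrier G \<Longrightarrow> U s x = x"
  shows "contains_rep G H U complex_line trivial_rep"
proof -
  define n where "n = sqrt (Re (cinner H x x))"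
  have "cinner H x x \<noteq> 0" using cinner_definite x by blast
  then have "Re (cinner H x x) \<noteq> 0" using cinner_self_real[OF x(1)] by auto
  then have pos: "0 < Re (cinner H x x)" using cinner_nonneg[OF x(1)] by simp
  then have n: "0 < n" "n * n = Re (cinner H x x)" by (simp_all add: n_def)
  define W where "W z = (z / complex_of_real n) \<odot>\<^bsub>H\<^esub> x" for z
  have closed: "c \<odot>\<^bsub>H\<^esub> x \<in> carrier H" for c using smult_closed[of c x] x by simp
  have "W \<in> isometries complex_line H"
    unfolding isometries_def linear_maps_def
  proof (intro CollectI conjI ballI allI)
    show "W \<in> carrier complex_line \<rightarrow>\<^sub>E carrier H" using closed by (auto simp: W_def complex_line_def)
    fix z w c
    show "W (z \<oplus>\<^bsub>complex_line\<^esub> w) = W z \<oplus>\<^bsub>H\<^esub> W w"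
      using smult_l_distr[of "z / complex_of_real n" "w / complex_of_real n" x] x
      by (simp add: W_def complex_line_def add_divide_distrib)
    show "W (c \<odot>\<^bsub>complex_line\<^esub> z) = c \<odot>\<^bsub>H\<^esub> W z"
      using smult_assoc1[of c "z / complex_of_real n" x] x by (simp add: W_def complex_line_def)
    have "cinner H (W z) (W w) = (z / complex_of_real n) * (cnj (w / complex_of_real n) * cinner H x x)"
      using x closed by (simp only: W_def cinner_smult_left cinner_smult_right) (rule mult.left_commute)
    also have "cinner H x x = complex_of_real n * complex_of_real n"
      using cinner_self_real[OF x(1)] n(2) by (metis of_real_mult)
    finally show "cinner H (W z) (W w) = cinner complex_line z w"
      using n(1) by (simp add: complex_line_def)
  qed
  moreover have "W (trivial_rep s z) = U s (W z)" if "s \<in> carrier G" for s z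
    using U[OF that] fix_x[OF that] x unfolding linear_maps_def by (simp add: W_def trivial_rep_def)
  ultimately show ?thesis unfolding contains_rep_def by blast
qed

end

section \<open>Passing between invariant states and representations\<close>

context cstar_system_group
begin

lemma emb_hom: "emb \<in> unital_star_hom A B"
  unfolding unital_star_hom_def unital_alg_hom_def ring_hom_def by (auto simp: emb_simps)

lemma crossed_unitary_embed: "crossed_unitary A G \<alpha> s = completion_embed B (delta s)"
  by (simp add: crossed_unitary_def delta_def single_def[abs_def])

theorem state_imp_rep:
  assumes \<phi>: "\<phi> \<in> invariant_states A G \<alpha>"
  shows "has_rep_fixing_vector TYPE((nat \<Rightarrow> 'g \<Rightarrow> 'a) set) A G \<alpha>"
proof -
  interpret Q: gns B "prod_functional \<phi> eps"
    by (rule gns_B[OF prod_positive[OF \<phi> eps_positive]])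
  have \<phi>1: "\<phi> \<one> = 1" using \<phi> by (simp add: invariant_states_def states_def)
  have u: "prod_functional \<phi> eps (delta s) = 1" for s
    using prod_single[OF \<phi> eps_positive, of \<one> s] \<phi>1 by (simp add: delta_def C.delta_def eps_single)
  have one: "prod_functional \<phi> eps \<one>\<^bsub>B\<^esub> = 1" using u[of "\<one>\<^bsub>G\<^esub>"] by (simp add: delta_simps)
  have "Q.rep (crossed_unitary A G \<alpha> s) Q.cyc = Q.cyc" if s: "s \<in> carrier G" for s
    unfolding crossed_unitary_embed
    using Q.fixed_unitary(1)[of "delta s"] u one s by (intro Q.rep_fixes_cyc) (auto simp: delta_star_delta)
  then have "Q.cyc \<in> fixed_vectors A G \<alpha> Q.Hsp Q.rep"
    using Q.cyc_in by (simp add: fixed_vectors_def)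
  moreover have "Q.cyc \<noteq> \<zero>\<^bsub>Q.Hsp\<^esub>" using Q.cyc_nonzero one by simp
  ultimately have "fixed_vectors A G \<alpha> Q.Hsp Q.rep \<noteq> {\<zero>\<^bsub>Q.Hsp\<^esub>}" by blast
  then show ?thesis
    unfolding has_rep_fixing_vector_def crossed_product_def
    using Q.H_hilbert Q.rep_representation by blast
qed

text \<open>The representation is restricted to the images of A and of the group. Covariance already
  holds among finitely supported functions, by \<open>delta_emb_delta\<close>.\<close>

theorem rep_imp_covariant:
  assumes "has_rep_fixing_vector TYPE('h) A G \<alpha>"
  shows "has_covariant_rep_containing_trivial TYPE('h) A G \<alpha>"
proof -
  obtain H :: "'h inner_space" and \<pi> where H: "complex_hilbert_space H"
    and \<pi>: "\<pi> \<in> representations (univ_completion B) H" and fv: "fixed_vectors A G \<alpha> H \<pi> \<noteq> {\<zero>\<^bsub>H\<^esub>}"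
    using assms unfolding has_rep_fixing_vector_def crossed_product_def by blast
  define \<rho> where "\<rho> b = \<pi> (completion_embed B b)" for b
  have \<rho>: "\<rho> \<in> representations B H"
    unfolding \<rho>_def[abs_def] by (rule representation_comp[OF BB.embed_hom \<pi>])
  interpret R: star_representation B H \<rho>
    by (intro star_representation.intro star_representation_axioms.intro H B_star_algebra \<rho>)
  have delta: "\<rho> (delta s) \<in> Bij (carrier H) \<inter> isometries H H" if "s \<in> carrier G" for s
    using that by (intro R.pi_unitary) (auto simp: delta_simps)
  define U where "U s = \<rho> (delta s)" for s
  have U: "U \<in> hom G (unitary_group H)"
  proof (rule homI)
    show "U s \<in> carrier (unitary_group H)" if "s \<in> carrier G" for s
      using delta[OF that] by (simp add: unitary_group_def U_def)
    show "U (s \<otimes>\<^bsub>G\<^esub> t) = U s \<otimes>\<^bsub>unitary_group H\<^esub> U t" if "s \<in> carrier G" "t \<in> carrier G" for s t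
      using delta[OF that(1)] delta[OF that(2)] that
      by (simp add: unitary_group_def BijGroup_def U_def R.pi_compose flip: delta_simps(1))
  qed
  define \<pi>A where "\<pi>A a = \<rho> (emb a)" for a
  have \<pi>A: "\<pi>A \<in> representations A H"
    unfolding \<pi>A_def[abs_def] by (rule representation_comp[OF emb_hom \<rho>])
  have cov: "\<pi>A (\<alpha> s a) = U s \<otimes>\<^bsub>bounded_operators H\<^esub> \<pi>A a \<otimes>\<^bsub>bounded_operators H\<^esub> inv\<^bsub>unitary_group H\<^esub> (U s)"
    if s: "s \<in> carrier G" and a: "a \<in> carrier A" for s a
  proof -
    have "\<pi>A (\<alpha> s a) = \<rho> (delta s \<otimes>\<^bsub>B\<^esub> emb a \<otimes>\<^bsub>B\<^esub> delta (inv\<^bsub>G\<^esub> s))"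
      using s a by (simp add: \<pi>A_def delta_emb_delta)
    also have "\<dots> = compose (carrier H) (compose (carrier H) (U s) (\<pi>A a)) (U (inv\<^bsub>G\<^esub> s))"
      using s a by (simp add: R.pi_compose U_def \<pi>A_def)
    finally show ?thesis
      unfolding unitary_group_hom(4)[OF G.group_axioms U s] by (simp add: bounded_operators_def)
  qed
  have fixed: "x \<in> fixed_vectors A G \<alpha> H \<pi> \<longleftrightarrow> x \<in> carrier H \<and> (\<forall>s\<in>carrier G. U s x = x)" for x
    by (auto simp: fixed_vectors_def crossed_unitary_embed U_def \<rho>_def)
  \<comment> \<open>The zero vector is always fixed, so a fixed space different from {0} contains a
    nonzero vector.\<close>
  have "\<zero>\<^bsub>H\<^esub> \<in> fixed_vectors A G \<alpha> H \<pi>"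
    unfolding fixed U_def using R.pi_zero R.M.zero_closed by simp
  then obtain x where x: "x \<in> fixed_vectors A G \<alpha> H \<pi>" "x \<noteq> \<zero>\<^bsub>H\<^esub>" using fv by blast
  have "contains_rep G H U complex_line trivial_rep"
    by (rule R.contains_trivial[of x]) (use x fixed R.pi_linear in \<open>auto simp: U_def\<close>)
  then show ?thesis
    unfolding has_covariant_rep_containing_trivial_def covariant_representation_def
    using H U \<pi>A cov by blast
qed

theorem covariant_imp_state:
  assumes "has_covariant_rep_containing_trivial TYPE('h) A G \<alpha>"
  shows "invariant_states A G \<alpha> \<noteq> {}"
proof -
  obtain H :: "'h inner_space" and \<pi> U where c: "covariant_representation A G \<alpha> H \<pi> U"
    and t: "contains_rep G H U complex_line trivial_rep"
    using assms unfolding has_covariant_rep_containing_trivial_def by blast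
  have H: "complex_hilbert_space H" and \<pi>: "\<pi> \<in> representations A H" and U: "U \<in> hom G (unitary_group H)"
    using c by (auto simp: covariant_representation_def)
  have cov: "\<pi> (\<alpha> s a) = U s \<otimes>\<^bsub>bounded_operators H\<^esub> \<pi> a \<otimes>\<^bsub>bounded_operators H\<^esub> inv\<^bsub>unitary_group H\<^esub> (U s)"
    if "s \<in> carrier G" "a \<in> carrier A" for s a using c that by (simp add: covariant_representation_def)
  interpret R: star_representation A H \<pi>
    by (intro star_representation.intro star_representation_axioms.intro H unital_star_algebra_axioms \<pi>)
  obtain W where W: "W \<in> isometries complex_line H" "\<And>s z. s \<in> carrier G \<Longrightarrow> W z = U s (W z)"
    using t unfolding contains_rep_def trivial_rep_def by (auto simp: complex_line_def)
  define \<xi> where "\<xi> = W 1"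
  have \<xi>: "\<xi> \<in> carrier H" "cinner H \<xi> \<xi> = 1"
    using W(1) by (auto simp: \<xi>_def isometries_def linear_maps_def complex_line_def)
  have U\<xi>: "U s \<xi> = \<xi>" if "s \<in> carrier G" for s using W(2)[OF that, of 1] by (simp add: \<xi>_def)
  define \<phi> where "\<phi> = (\<lambda>a\<in>carrier A. cinner H (\<pi> a \<xi>) \<xi>)"
  have "\<phi> \<in> states A"
    unfolding states_def
  proof (intro CollectI conjI ballI allI)
    show "\<phi> \<in> extensional (carrier A)" by (simp add: \<phi>_def)
    show "\<phi> \<one> = 1" using \<xi> by (simp add: \<phi>_def R.pi_one)
    fix x assume x: "x \<in> carrier A"
    show "\<phi> (c \<odot>\<^bsub>A\<^esub> x) = c * \<phi> x" for c
      using x \<xi> by (simp add: \<phi>_def R.pi_smult R.cinner_smult_left)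
    show "\<phi> (x \<oplus> y) = \<phi> x + \<phi> y" if "y \<in> carrier A" for y
      using x that \<xi> by (simp add: \<phi>_def R.pi_add R.cinner_add_left)
    have "\<phi> (star A x \<otimes> x) = cinner H (\<pi> x \<xi>) (\<pi> x \<xi>)"
      using x \<xi> by (simp add: \<phi>_def R.pi_mult R.pi_adjoint)
    then show "Im (\<phi> (star A x \<otimes> x)) = 0" "0 \<le> Re (\<phi> (star A x \<otimes> x))"
      using R.cinner_self_real[of "\<pi> x \<xi>"] R.cinner_nonneg[of "\<pi> x \<xi>"] x \<xi> by (simp_all add: complex_eq_iff)
  qed
  moreover have "\<phi> (\<alpha> s a) = \<phi> a" if s: "s \<in> carrier G" and a: "a \<in> carrier A" for s a
  proof -
    \<comment> \<open>Covariance conjugates \<pi> a by U s. The inverse on the right fixes \<xi>,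
      and U s on the left drops out of the inner product because it is isometric and fixes \<xi> in
      the second argument.\<close>
    have "\<pi> (\<alpha> s a) \<xi> = U s (\<pi> a (U (inv\<^bsub>G\<^esub> s) \<xi>))"
      unfolding cov[OF s a] unitary_group_hom(4)[OF G.group_axioms U s]
      using \<xi>(1) U\<xi>[of "inv\<^bsub>G\<^esub> s"] s by (simp add: bounded_operators_def compose_def)
    also have "U (inv\<^bsub>G\<^esub> s) \<xi> = \<xi>" using U\<xi> s by simp
    finally have "cinner H (\<pi> (\<alpha> s a) \<xi>) \<xi> = cinner H (U s (\<pi> a \<xi>)) (U s \<xi>)" using U\<xi>[OF s] by simp
    also have "\<dots> = cinner H (\<pi> a \<xi>) \<xi>"
      using unitary_group_hom(1)[OF G.group_axioms U s] a \<xi>(1) by (simp add: isometries_def)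
    finally show ?thesis using s a by (simp add: \<phi>_def)
  qed
  ultimately show ?thesis unfolding invariant_states_def by blast
qed

text \<open>Only the real part of the character is extended, which the real Hahn-Banach theorem
  allows; \<open>positive_functional_of_real\<close> then restores a complex positive functional,
  known to match the character on selfadjoint elements.\<close>

theorem eps_bounded_imp_state:
  assumes le: "\<And>f. f \<in> carrier C.B \<Longrightarrow> cmod (eps f) \<le> univ_norm B (incl f)"
  shows "invariant_states A G \<alpha> \<noteq> {}"
proof -
  define E where "E = incl ` carrier C.B"
  \<comment> \<open>A preimage is chosen because \<open>incl\<close> is not known to be injective.
    The bound on \<open>eps\<close> makes the value independent of the choice: a difference of two
    preimages maps to 0.\<close>
  define g where "g x = Re (eps (SOME f. f \<in> carrier C.B \<and> incl f = x))" for x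
  have g: "g (incl f) = Re (eps f)" if f: "f \<in> carrier C.B" for f
  proof -
    define f' where "f' = (SOME f'. f' \<in> carrier C.B \<and> incl f' = incl f)"
    have f': "f' \<in> carrier C.B \<and> incl f' = incl f" unfolding f'_def by (rule someI[of _ f]) (use f in simp)
    have "incl (f' \<ominus>\<^bsub>C.B\<^esub> f) = \<zero>\<^bsub>B\<^esub>"
      using f f' by (simp add: C.B.diff_s incl_add incl_smult flip: B.diff_s)
    then have "cmod (eps (f' \<ominus>\<^bsub>C.B\<^esub> f)) \<le> 0" using le[of "f' \<ominus>\<^bsub>C.B\<^esub> f"] f f' by simp
    then have "eps f' = eps f" using f f' by (simp add: C.B.diff_s eps_add eps_smult)
    then show ?thesis by (simp add: g_def f'_def)
  qed
  have "\<exists>\<rho>. BB.U.RS.linear_on (carrier B) \<rho> \<and> (\<forall>x\<in>carrier B. \<rho> x \<le> univ_norm B x) \<and> (\<forall>x\<in>E. \<rho> x = g x)"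
  proof (rule BB.U.RS.Hahn_Banach_extension[OF BB.U.p_sublinear])
    show "E \<subseteq> carrier B" by (auto simp: E_def)
    show "\<zero>\<^bsub>B\<^esub> \<in> E" unfolding E_def by (rule image_eqI[of _ _ "\<zero>\<^bsub>C.B\<^esub>"]) (auto simp: incl_zero)
    show "x \<oplus>\<^bsub>B\<^esub> y \<in> E" if "x \<in> E" "y \<in> E" for x y
      using that unfolding E_def by (auto simp flip: incl_add)
    show "complex_of_real r \<odot>\<^bsub>B\<^esub> x \<in> E" if "x \<in> E" for x r
      using that unfolding E_def by (auto simp flip: incl_smult)
    show "BB.U.RS.linear_on E g"
      unfolding BB.U.RS.linear_on_def E_def
      by (auto simp: g eps_add eps_smult simp flip: incl_add incl_smult)
    show "g x \<le> univ_norm B x" if "x \<in> E" for x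
      using that le complex_Re_le_cmod order_trans unfolding E_def by (auto simp: g) blast
  qed
  then obtain \<rho> where \<rho>: "BB.U.RS.linear_on (carrier B) \<rho>" "\<And>x. x \<in> carrier B \<Longrightarrow> \<rho> x \<le> univ_norm B x"
    and \<rho>incl: "\<And>f. f \<in> carrier C.B \<Longrightarrow> \<rho> (incl f) = Re (eps f)"
    unfolding E_def using g by auto
  have one: "\<rho> \<one>\<^bsub>B\<^esub> = 1" using \<rho>incl[of "\<one>\<^bsub>C.B\<^esub>"] by (simp add: incl_one eps_one)
  obtain \<psi> where \<psi>: "positive_functional B \<psi>"
    and \<psi>h: "\<And>h. h \<in> carrier B \<Longrightarrow> star B h = h \<Longrightarrow> \<psi> h = complex_of_real (\<rho> h)"
    using BB.U.positive_functional_of_real[OF \<rho> one] by blast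
  interpret P: positive_functional B \<psi> by (rule \<psi>)
  have \<psi>1: "\<psi> \<one>\<^bsub>B\<^esub> = 1" using \<psi>h[of "\<one>\<^bsub>B\<^esub>"] one by simp
  have \<psi>incl: "\<psi> (incl f) = complex_of_real (Re (eps f))" if "f \<in> carrier C.B" "star C.B f = f" for f
    using \<psi>h[of "incl f"] \<rho>incl[OF that(1)] that by (simp flip: incl_star)
  have incl_delta: "incl (C.delta s) = delta s" for s by (simp add: C.delta_def delta_def incl_single)
  have \<psi>u: "\<psi> (delta s) = 1" if s: "s \<in> carrier G" for s
  proof -
    let ?v = "C.delta s" and ?w = "C.delta (inv\<^bsub>G\<^esub> s)"
    have vw: "?v \<in> carrier C.B" "?w \<in> carrier C.B" "star C.B ?v = ?w" "star C.B ?w = ?v"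
      using s by (auto simp: C.delta_simps)
    have ev: "eps (C.delta t) = 1" for t by (simp add: C.delta_def eps_single)
    \<comment> \<open>The values of \<psi> are known on selfadjoint elements of the group algebra.
      The sum of u_s and its inverse, and i times their difference, give two linear equations for
      the two values of \<psi>.\<close>
    have "\<psi> (incl (?v \<oplus>\<^bsub>C.B\<^esub> ?w)) = 2"
      using \<psi>incl[of "?v \<oplus>\<^bsub>C.B\<^esub> ?w"] vw by (simp add: C.B.star_add C.B.a_comm eps_add ev)
    then have 1: "\<psi> (delta s) + \<psi> (delta (inv\<^bsub>G\<^esub> s)) = 2" using s by (simp add: incl_add incl_delta P.psi_add)
    have "\<psi> (incl (\<i> \<odot>\<^bsub>C.B\<^esub> ?v \<oplus>\<^bsub>C.B\<^esub> (- \<i>) \<odot>\<^bsub>C.B\<^esub> ?w)) = 0"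
      using \<psi>incl[of "\<i> \<odot>\<^bsub>C.B\<^esub> ?v \<oplus>\<^bsub>C.B\<^esub> (- \<i>) \<odot>\<^bsub>C.B\<^esub> ?w"] vw
      by (simp add: C.B.star_add C.B.star_smult C.B.a_comm eps_add eps_smult ev)
    then have 2: "\<i> * \<psi> (delta s) - \<i> * \<psi> (delta (inv\<^bsub>G\<^esub> s)) = 0"
      using s by (simp add: incl_add incl_smult incl_delta P.psi_add P.psi_smult)
    show ?thesis using 1 2 by (simp add: right_diff_distrib[symmetric])
  qed
  define \<phi> where "\<phi> = (\<lambda>a\<in>carrier A. \<psi> (emb a))"
  have "\<phi> \<in> states A"
    unfolding states_def
  proof (intro CollectI conjI ballI allI)
    show "\<phi> \<in> extensional (carrier A)" by (simp add: \<phi>_def)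
    show "\<phi> \<one> = 1" using \<psi>1 by (simp add: \<phi>_def emb_simps)
    fix x assume x: "x \<in> carrier A"
    show "\<phi> (c \<odot>\<^bsub>A\<^esub> x) = c * \<phi> x" for c using x by (simp add: \<phi>_def emb_simps P.psi_smult)
    show "\<phi> (x \<oplus> y) = \<phi> x + \<phi> y" if "y \<in> carrier A" for y
      using x that by (simp add: \<phi>_def emb_simps P.psi_add)
    show "Im (\<phi> (star A x \<otimes> x)) = 0" "0 \<le> Re (\<phi> (star A x \<otimes> x))"
      using x P.psi_im[of "emb x"] P.psi_nonneg[of "emb x"] by (simp_all add: \<phi>_def emb_simps)
  qed
  moreover have "\<phi> (\<alpha> s a) = \<phi> a" if s: "s \<in> carrier G" and a: "a \<in> carrier A" for s a
  proof -
    have v: "delta (inv\<^bsub>G\<^esub> s) \<in> carrier B" "star B (delta (inv\<^bsub>G\<^esub> s)) \<otimes>\<^bsub>B\<^esub> delta (inv\<^bsub>G\<^esub> s) = \<one>\<^bsub>B\<^esub>"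
      "\<psi> (delta (inv\<^bsub>G\<^esub> s)) = 1" "star B (delta (inv\<^bsub>G\<^esub> s)) = delta s"
      using s \<psi>u by (auto simp: delta_simps)
    have "\<psi> (emb (\<alpha> s a)) = \<psi> (delta s \<otimes>\<^bsub>B\<^esub> emb a \<otimes>\<^bsub>B\<^esub> delta (inv\<^bsub>G\<^esub> s))" using s a by (simp add: delta_emb_delta)
    also have "\<dots> = \<psi> (delta s \<otimes>\<^bsub>B\<^esub> emb a)" using P.fixed_unitary(2)[OF v(1,2) \<psi>1 v(3)] s a by simp
    also have "\<dots> = \<psi> (emb a)" using P.fixed_unitary(3)[OF v(1,2) \<psi>1 v(3), of "emb a"] a by (simp add: v(4))
    finally show ?thesis using s a by (simp add: \<phi>_def)
  qed
  ultimately show ?thesis unfolding invariant_states_def by blast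
qed

end

lemma star_aut_system:
  assumes A: "unital_cstar_algebra A" and G: "group G" and \<alpha>: "\<alpha> \<in> hom G (star_aut_group A)"
  shows "cstar_system_group A G \<alpha>"
proof -
  interpret A: unital_cstar_algebra A by (rule A)
  interpret G: group G by (rule G)
  interpret BG: group "BijGroup (carrier A)" by (rule group_BijGroup)
  have c: "\<alpha> s \<in> Bij (carrier A)" "\<alpha> s \<in> unital_star_hom A A" if "s \<in> carrier G" for s
    using hom_in_carrier[OF \<alpha> that] by (auto simp: star_aut_group_def)
  have b: "\<alpha> s \<in> carrier (BijGroup (carrier A))" if "s \<in> carrier G" for s
    using c[OF that] by (simp add: BijGroup_def)
  have m: "\<alpha> (s \<otimes>\<^bsub>G\<^esub> t) = \<alpha> s \<otimes>\<^bsub>BijGroup (carrier A)\<^esub> \<alpha> t" if "s \<in> carrier G" "t \<in> carrier G" for s t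
    using hom_mult[OF \<alpha> that] by (simp add: star_aut_group_def)
  have "\<alpha> \<one>\<^bsub>G\<^esub> = \<one>\<^bsub>BijGroup (carrier A)\<^esub>"
    using m[of "\<one>\<^bsub>G\<^esub>" "\<one>\<^bsub>G\<^esub>"] b[of "\<one>\<^bsub>G\<^esub>"] by (metis BG.l_cancel_one' G.l_one G.one_closed)
  then have one: "\<alpha> \<one>\<^bsub>G\<^esub> a = a" if "a \<in> carrier A" for a using that by (simp add: BijGroup_def)
  have mult: "\<alpha> s (\<alpha> t a) = \<alpha> (s \<otimes>\<^bsub>G\<^esub> t) a" if "s \<in> carrier G" "t \<in> carrier G" "a \<in> carrier A" for s t a
    using m[OF that(1,2)] c that by (simp add: BijGroup_def compose_def)
  have h: "\<alpha> s \<in> ring_hom A A" "\<And>c x. x \<in> carrier A \<Longrightarrow> \<alpha> s (c \<odot>\<^bsub>A\<^esub> x) = c \<odot>\<^bsub>A\<^esub> \<alpha> s x"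
    "\<And>x. x \<in> carrier A \<Longrightarrow> \<alpha> s (star A x) = star A (\<alpha> s x)" if "s \<in> carrier G" for s
    using c(2)[OF that] by (auto simp: unital_star_hom_def unital_alg_hom_def)
  show ?thesis
    by (intro cstar_system_group.intro cstar_system.intro star_system.intro star_system_axioms.intro
        A G A.unital_star_algebra_axioms)
       (simp_all add: one mult h ring_hom_closed[OF h(1)] ring_hom_add[OF h(1)] ring_hom_mult[OF h(1)] ring_hom_one[OF h(1)])
qed

theorem proposition3p5:
  fixes A :: "'a cstar_alg" and G :: "'g monoid" and \<alpha> :: "'g \<Rightarrow> 'a \<Rightarrow> 'a"
  assumes "unital_cstar_algebra A"
    and "group G"
    and "\<alpha> \<in> hom G (star_aut_group A)"
  shows
    "(invariant_states A G \<alpha> \<noteq> {} \<longleftrightarrow>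
        inj_on (canonical_hom A G \<alpha>) (carrier (group_cstar G)))
     \<and> (invariant_states A G \<alpha> \<noteq> {} \<longleftrightarrow>
        has_rep_fixing_vector TYPE((nat \<Rightarrow> 'g \<Rightarrow> 'a) set) A G \<alpha>)
     \<and> (has_rep_fixing_vector TYPE((nat \<Rightarrow> 'g \<Rightarrow> 'a) set) A G \<alpha> \<longleftrightarrow>
        has_covariant_rep_containing_trivial TYPE((nat \<Rightarrow> 'g \<Rightarrow> 'a) set) A G \<alpha>)
     \<and> (has_rep_fixing_vector TYPE('h) A G \<alpha> \<longrightarrow>
        has_rep_fixing_vector TYPE((nat \<Rightarrow> 'g \<Rightarrow> 'a) set) A G \<alpha>)
     \<and> (has_covariant_rep_containing_trivial TYPE('h) A G \<alpha> \<longrightarrow>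
        has_covariant_rep_containing_trivial TYPE((nat \<Rightarrow> 'g \<Rightarrow> 'a) set) A G \<alpha>)"
proof -
  interpret cstar_system_group A G \<alpha> by (rule star_aut_system[OF assms])
  let ?S = "invariant_states A G \<alpha> \<noteq> {}"
  let ?R = "has_rep_fixing_vector TYPE((nat \<Rightarrow> 'g \<Rightarrow> 'a) set) A G \<alpha>"
  let ?C = "has_covariant_rep_containing_trivial TYPE((nat \<Rightarrow> 'g \<Rightarrow> 'a) set) A G \<alpha>"
  let ?J = "inj_on (canonical_hom A G \<alpha>) (carrier (group_cstar G))"
  have "?S \<Longrightarrow> ?J" using state_imp_inj by blast
  moreover have "?J \<Longrightarrow> ?S" using inj_imp_eps_bounded eps_bounded_imp_state by blast
  moreover have SR: "?S \<Longrightarrow> ?R" using state_imp_rep by blast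
  moreover have RC: "?R \<Longrightarrow> ?C" by (rule rep_imp_covariant)
  moreover have CS: "?C \<Longrightarrow> ?S" by (rule covariant_imp_state)
  \<comment> \<open>From a representation on an arbitrary type one passes to an invariant state on
    A, whose GNS construction lives on the type of the crossed product.\<close>
  moreover have "has_rep_fixing_vector TYPE('h) A G \<alpha> \<Longrightarrow> ?R"
    using SR covariant_imp_state[OF rep_imp_covariant] by blast
  moreover have "has_covariant_rep_containing_trivial TYPE('h) A G \<alpha> \<Longrightarrow> ?C"
    using SR RC covariant_imp_state by blast
  ultimately show ?thesis by blast
qed

end
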